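(* For every choice of constants $0 < b_2 < b_1 < 1$, the $(b_1, b_2)$-approximate similarity search problem under Braun-Blanquet similarity can be solved by a data structure with query time $O(|\mathbf{q}|\, n^{\rho} \log n)$ and space usage $O\big(n^{1+\rho}\log n + \sum_{\mathbf{x} \in P}|\mathbf{x}|\big)$, where $n = |P|$ and $\rho = \log(1/b_1) / \log(1/b_2)$.
   Context: Vectors $\mathbf{x} \in \{0,1\}^d$ are identified with subsets $\{i \in \{1,\dots,d\} : \mathbf{x}_i = 1\}$, and $|\mathbf{x}|$ denotes the Hamming weight (set size). The Braun-Blanquet similarity is $B(\mathbf{x},\mathbf{y}) = |\mathbf{x}\cap\mathbf{y}|/\max(|\mathbf{x}|,|\mathbf{y}|)$. The $(b_1,b_2)$-approximate similarity search problem under $B$: given a set $P \subseteq \{0,1\}^d$ of $n$ vectors, preprocess $P$ into a data structure supporting the query: on input $\mathbf{q} \in \{0,1\}^d$ for which there exists $\mathbf{x} \in P$ with $B(\mathbf{x},\mathbf{q}) \geq b_1$, return some $\mathbf{x}' \in P$ with $B(\mathbf{x}',\mathbf{q}) > b_2$. Data structures may be randomized; a query is required to succeed with probability at least $1/2$. The model of computation is the word RAM with word size $\Theta(\log n)$, augmented with an instruction that produces a uniformly random machine word in constant time. *)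

theory Defs
  imports "HOL-Probability.Probability"
begin

section \<open>A randomised word RAM\<close>

text \<open>
  Machine words of size \<open>w\<close> are the natural numbers below \<open>2 ^ w\<close>. The memory is an array of
  words addressed by words; a program uses finitely many registers. A program is a list of
  commands, with structured branching and loops instead of jumps. Every instruction, every test of
  a branch and every test of a loop takes one step. The word size is a parameter of the semantics
  and not of the programs, so one and the same finite program runs on machines of all word sizes.
\<close>

datatype binop = Add | Sub | Mul | Div | Mod | BitAnd | BitOr | BitXor | Shl | Shr | Less | Equal

text \<open>
  In \<open>Load r a\<close> and \<open>Store a r\<close>, the address is the content of the register \<open>a\<close>. A register
  counts as true in \<open>IfNZ\<close> and \<open>WhileNZ\<close> if it is nonzero.
\<close>

datatype cmd =
    Const nat nat
  | Op binop nat nat nat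
  | Load nat nat
  | Store nat nat
  | Rand nat
  | IfNZ nat "cmd list" "cmd list"
  | WhileNZ nat "cmd list"

fun binop_val :: "nat \<Rightarrow> binop \<Rightarrow> nat \<Rightarrow> nat \<Rightarrow> nat" where
  "binop_val w Add x y = (x + y) mod 2 ^ w"
| "binop_val w Sub x y = nat ((int x - int y) mod 2 ^ w)"
| "binop_val w Mul x y = (x * y) mod 2 ^ w"
| "binop_val w Div x y = (x div y) mod 2 ^ w"
| "binop_val w Mod x y = (x mod y) mod 2 ^ w"
| "binop_val w BitAnd x y = (semiring_bit_operations_class.and x y) mod 2 ^ w"
| "binop_val w BitOr x y = (semiring_bit_operations_class.or x y) mod 2 ^ w"
| "binop_val w BitXor x y = (semiring_bit_operations_class.xor x y) mod 2 ^ w"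
| "binop_val w Shl x y = (x * 2 ^ y) mod 2 ^ w"
| "binop_val w Shr x y = (x div 2 ^ y) mod 2 ^ w"
| "binop_val w Less x y = of_bool (x < y) mod 2 ^ w"
| "binop_val w Equal x y = of_bool (x = y) mod 2 ^ w"

text \<open>The component \<open>todo\<close> is the list of commands still to be executed.\<close>

record config =
  todo :: "cmd list"
  reg :: "nat \<Rightarrow> nat"
  mem :: "nat \<Rightarrow> nat"

definition halted :: "config \<Rightarrow> bool" where
  "halted c \<longleftrightarrow> todo c = []"

fun exec_cmd :: "nat \<Rightarrow> cmd \<Rightarrow> config \<Rightarrow> config pmf" where
  "exec_cmd w (Const r k) c = return_pmf (c\<lparr>reg := (reg c)(r := k mod 2 ^ w)\<rparr>)"
| "exec_cmd w (Op f r x y) c =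
     return_pmf (c\<lparr>reg := (reg c)(r := binop_val w f (reg c x) (reg c y))\<rparr>)"
| "exec_cmd w (Load r a) c = return_pmf (c\<lparr>reg := (reg c)(r := mem c (reg c a))\<rparr>)"
| "exec_cmd w (Store a r) c = return_pmf (c\<lparr>mem := (mem c)(reg c a := reg c r)\<rparr>)"
| "exec_cmd w (Rand r) c =
     map_pmf (\<lambda>v. c\<lparr>reg := (reg c)(r := v)\<rparr>) (pmf_of_set {..<2 ^ w})"
| "exec_cmd w (IfNZ r ps qs) c =
     return_pmf (c\<lparr>todo := (if reg c r \<noteq> 0 then ps else qs) @ todo c\<rparr>)"
| "exec_cmd w (WhileNZ r ps) c =
     return_pmf (c\<lparr>todo := (if reg c r \<noteq> 0 then ps @ WhileNZ r ps # todo c else todo c)\<rparr>)"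

definition step :: "nat \<Rightarrow> config \<Rightarrow> config pmf" where
  "step w c = (case todo c of
     [] \<Rightarrow> return_pmf c
   | p # ps \<Rightarrow> exec_cmd w p (c\<lparr>todo := ps\<rparr>))"

text \<open>The distribution of the configuration after \<open>t\<close> steps; halted configurations do not change.\<close>

primrec run :: "nat \<Rightarrow> nat \<Rightarrow> config \<Rightarrow> config pmf" where
  "run w 0 c = return_pmf c"
| "run w (Suc t) c = bind_pmf (step w c) (run w t)"


section \<open>Approximate similarity search under Braun-Blanquet similarity\<close>

text \<open>
  A vector in \<open>{0,1}\<^sup>d\<close> is a subset of \<open>{1..d}\<close>. (The similarity of two empty sets is 0 here.)
\<close>

definition braun_blanquet :: "nat set \<Rightarrow> nat set \<Rightarrow> real" where
  "braun_blanquet x y = real (card (x \<inter> y)) / real (max (card x) (card y))"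

text \<open>A vector is stored sparsely: its weight, followed by its elements in increasing order.\<close>

definition encode :: "nat set \<Rightarrow> nat list" where
  "encode x = card x # sorted_list_of_set x"

definition stored_at :: "(nat \<Rightarrow> nat) \<Rightarrow> nat \<Rightarrow> nat set \<Rightarrow> bool" where
  "stored_at m a x \<longleftrightarrow> map m [a..<a + length (encode x)] = encode x"

definition mem_of :: "nat list \<Rightarrow> nat \<Rightarrow> nat" where
  "mem_of ws a = (if a < length ws then ws ! a else 0)"

text \<open>
  Preprocessing starts on a memory holding \<open>n\<close>, \<open>d\<close>, the constants \<open>b1\<close> and \<open>b2\<close> and the vectors
  (listed in some order). As \<open>b1\<close> and \<open>b2\<close> are arbitrary reals, which a finite program
  cannot contain, they are given to the machine in fixed point, truncated to \<open>w\<close> bits.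
\<close>

definition preprocess_start ::
  "nat \<Rightarrow> real \<Rightarrow> real \<Rightarrow> nat \<Rightarrow> nat set list \<Rightarrow> cmd list \<Rightarrow> config" where
  "preprocess_start w b1 b2 d xs prog =
     \<lparr>todo = prog, reg = (\<lambda>_. 0),
      mem = mem_of ([length xs, d, nat \<lfloor>b1 * 2 ^ w\<rfloor>, nat \<lfloor>b2 * 2 ^ w\<rfloor>] @ concat (map encode xs))\<rparr>"

text \<open>
  When preprocessing has halted, register 0 contains the number \<open>s\<close> of words of the data
  structure, which consists of the memory cells \<open>0, \<dots>, s - 1\<close>. Nothing else is passed on to the
  queries: a query starts on a memory that holds these cells, then the encoding of the query
  vector, and is zero elsewhere; register 0 contains the address \<open>s\<close> of the query vector.
\<close>

definition ds_size :: "config \<Rightarrow> nat" where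
  "ds_size c = reg c 0"

definition query_start :: "config \<Rightarrow> nat set \<Rightarrow> cmd list \<Rightarrow> config" where
  "query_start c q prog =
     \<lparr>todo = prog, reg = (\<lambda>_. 0)(0 := ds_size c),
      mem = mem_of (map (mem c) [0..<ds_size c] @ encode q)\<rparr>"

text \<open>
  A query answers by leaving in register 0 the address of the vector that it returns.
\<close>

definition correct_answer :: "real \<Rightarrow> nat set set \<Rightarrow> nat set \<Rightarrow> config \<Rightarrow> bool" where
  "correct_answer b2 P q c \<longleftrightarrow>
     (\<exists>x\<in>P. stored_at (mem c) (reg c 0) x \<and> braun_blanquet x q > b2)"

text \<open>
  The programs \<open>pre\<close> and \<open>qry\<close> solve the \<open>(b1,b2)\<close>-approximate similarity search problem for \<open>P\<close>
  on a machine with word size \<open>w\<close>, with a data structure of at most \<open>size_bound\<close> words and with at most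
  \<open>time_bound q\<close> steps for a query \<open>q\<close>. Both bounds hold for all outcomes of the random choices.
  Preprocessing has to halt, but its running time \<open>T\<close> is not otherwise restricted. Queries must
  leave the data structure intact. The success probability of each single query is over the random
  choices of both preprocessing and query.
\<close>

definition solves_similarity_search ::
  "real \<Rightarrow> real \<Rightarrow> nat \<Rightarrow> nat \<Rightarrow> nat set set \<Rightarrow> cmd list \<Rightarrow> cmd list \<Rightarrow> real \<Rightarrow> (nat set \<Rightarrow> real) \<Rightarrow> bool"
where
  "solves_similarity_search b1 b2 w d P pre qry size_bound time_bound \<longleftrightarrow>
     (\<forall>xs. distinct xs \<and> set xs = P \<longrightarrow>
       (\<exists>T. let D = run w T (preprocess_start w b1 b2 d xs pre) in
          (\<forall>c\<in>set_pmf D. halted c \<and> real (ds_size c) \<le> size_bound) \<and>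
          (\<forall>q. q \<subseteq> {1..d} \<longrightarrow>
            (let answer = (\<lambda>c. run w (nat \<lfloor>time_bound q\<rfloor>) (query_start c q qry)) in
              (\<forall>c\<in>set_pmf D. \<forall>c'\<in>set_pmf (answer c).
                 halted c' \<and> (\<forall>a<ds_size c. mem c' a = mem c a)) \<and>
              ((\<exists>x\<in>P. braun_blanquet x q \<ge> b1) \<longrightarrow>
                 measure_pmf.prob (bind_pmf D answer) {c'. correct_answer b2 P q c'} \<ge> 1 / 2)))))"

end

theory Submission
  imports Defs "HOL-Real_Asymp.Real_Asymp"
begin

text \<open>
  A set is hashed to the nodes of a forest of \<open>L\<close> random trees of height \<open>k\<close> (Chosen Path): a node
  is a path of coordinates, and \<open>x\<close> extends a path by the coordinate \<open>j \<in> x\<close> if a fresh random value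
  is below \<open>1 / (b\<^sub>1 |x|)\<close>. For a single set the branching factor is then \<open>1 / b\<^sub>1\<close>; for two sets
  of similarity \<open>b\<^sub>1\<close> the joint branching factor is at least 1, so a second moment argument gives a
  common leaf in one of \<open>16 (k + 1)\<close> trees; for two sets of similarity at most \<open>b\<^sub>2\<close> it is at most
  \<open>b\<^sub>2 / b\<^sub>1\<close>, so with \<open>b\<^sub>2 ^ k = 1 / n\<close> few candidates at the leaves are false. The random values are
  drawn during preprocessing and stored with the nodes that occur in some data point; a query walks the
  stored forest by looking up its own coordinates in a multiply-shift hash table. Deterministic time and
  space bounds come from capping the number of nodes and the number of steps of a query, both of which
  exceed their expectation by a large factor with small probability.
\<close>

text \<open>All tests are on integers: \<open>b1\<close> and \<open>b2\<close> enter at the scale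
  \<open>S = 2 ^ (w div 8)\<close> as \<open>B\<close> (rounded down) and \<open>G\<close> (rounded
  strictly above \<open>b2 * S\<close>, yet at most \<open>b1 * S\<close>), so acceptance is sound
  and no pair of similarity \<open>b1\<close> is lost. The danger is that rounding spoils the
  exponent: each branching factor is off by a factor of at most \<open>1 + 1 / w\<close>, and over
  \<open>O(w)\<close> levels this costs only a constant. The lower bound on \<open>w\<close> makes
  \<open>S\<close> polynomially larger than \<open>n\<close> and \<open>d\<close>, while
  \<open>S ^ 8 \<le> 2 ^ w\<close>. The forest is grown breadth-first from one stream of random
  values, value \<open>v * d + j\<close> deciding whether node \<open>v\<close> gets a child for
  coordinate \<open>j + 1\<close>. Hence the moments need no conditional independence of subtrees:
  they follow from functions of the stream position and the forest that do not grow on average.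
  Failure splits into a forest beyond the cap \<open>X\<close> (1/8, Markov), no common leaf (1/16,
  Chebyshev) and a query beyond its budget (1/8, Markov). A rejected candidate costs
  \<open>O(|q|)\<close>, as sets too large to be similar are refused by their weight alone.\<close>

section \<open>A program logic on a fixed random tape\<close>

type_synonym assn = "(nat \<Rightarrow> nat) \<Rightarrow> (nat \<Rightarrow> nat) \<Rightarrow> nat list \<Rightarrow> nat \<Rightarrow> bool"

text \<open>Randomness is removed by reading random words off a tape \<open>rs\<close>;
  \<open>t\<close> counts the steps made so far. As a least fixed point the predicate includes
  termination, so a derivation gives total correctness together with the exact step count and the
  unread rest of the tape.\<close>

inductive wp :: "nat \<Rightarrow> assn \<Rightarrow> cmd list \<Rightarrow> assn" for w :: nat and Q :: assn where
  wp_Nil: "Q R M rs t \<Longrightarrow> wp w Q [] R M rs t"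
| wp_Const: "wp w Q ps (R(r := k mod 2 ^ w)) M rs (Suc t) \<Longrightarrow> wp w Q (Const r k # ps) R M rs t"
| wp_Op: "wp w Q ps (R(r := binop_val w f (R x) (R y))) M rs (Suc t) \<Longrightarrow>
    wp w Q (Op f r x y # ps) R M rs t"
| wp_Load: "wp w Q ps (R(r := M (R a))) M rs (Suc t) \<Longrightarrow> wp w Q (Load r a # ps) R M rs t"
| wp_Store: "wp w Q ps R (M(R a := R r)) rs (Suc t) \<Longrightarrow> wp w Q (Store a r # ps) R M rs t"
| wp_Rand: "wp w Q ps (R(r := v)) M rs (Suc t) \<Longrightarrow> wp w Q (Rand r # ps) R M (v # rs) t"
| wp_IfNZ: "wp w Q ((if R r \<noteq> 0 then ps else qs) @ cs) R M rs (Suc t) \<Longrightarrow>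
    wp w Q (IfNZ r ps qs # cs) R M rs t"
| wp_WhileNZ: "wp w Q (if R r \<noteq> 0 then ps @ WhileNZ r ps # cs else cs) R M rs (Suc t) \<Longrightarrow>
    wp w Q (WhileNZ r ps # cs) R M rs t"

\<comment> \<open>With these rules the simplifier executes straight-line code.
  \<open>WhileNZ\<close> is left out because as a rewrite rule it would unfold without end; loops go
  through \<open>wp_while\<close> and \<open>wp_for\<close>.\<close>
inductive_simps wp_simps [simp]:
  "wp w Q [] R M rs t"
  "wp w Q (Const r k # ps) R M rs t"
  "wp w Q (Op f r x y # ps) R M rs t"
  "wp w Q (Load r a # ps) R M rs t"
  "wp w Q (Store a r # ps) R M rs t"
  "wp w Q (Rand r # ps) R M (v # rs) t"
  "wp w Q (IfNZ r ps qs # cs) R M rs t"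

lemma wp_append:
  "wp w (wp w Q qs) ps R M rs t \<Longrightarrow> wp w Q (ps @ qs) R M rs t"
proof (induction ps R M rs t rule: wp.induct)
  case (wp_IfNZ R r ps qs' cs M rs t)
  then show ?case by (auto simp: append_assoc)
next
  case (wp_WhileNZ R r ps cs M rs t)
  then show ?case by (auto intro!: wp.wp_WhileNZ split: if_splits)
qed (simp_all add: fun_upd_def)

lemma wp_mono:
  assumes "wp w Q p R M rs t" "\<And>R M rs t. Q R M rs t \<Longrightarrow> Q' R M rs t"
  shows "wp w Q' p R M rs t"
  using assms by (induction p R M rs t rule: wp.induct) (auto intro: wp.intros)

lemma wp_seq:
  assumes "wp w P ps R M rs t" "\<And>R M rs t. P R M rs t \<Longrightarrow> wp w Q qs R M rs t"
  shows "wp w Q (ps @ qs) R M rs t"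
  using wp_append wp_mono[OF assms(1)] assms(2) by metis

lemma wp_while:
  assumes "I R M rs t"
    and "\<And>R M rs t. I R M rs t \<Longrightarrow> R r \<noteq> 0 \<Longrightarrow>
      wp w (\<lambda>R' M' rs' t'. I R' M' rs' t' \<and> m R' < (m R :: nat)) body R M rs (Suc t)"
    and "\<And>R M rs t. I R M rs t \<Longrightarrow> R r = 0 \<Longrightarrow> wp w Q ps R M rs (Suc t)"
  shows "wp w Q (WhileNZ r body # ps) R M rs t"
  using assms(1)
proof (induction "m R" arbitrary: R M rs t rule: less_induct)
  case less
  show ?case
  proof (cases "R r = 0")
    case True
    then show ?thesis using assms(3)[OF less.prems] by (auto intro: wp_WhileNZ)
  next
    case False
    have "wp w Q (body @ WhileNZ r body # ps) R M rs (Suc t)"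
      by (rule wp_seq[OF assms(2)[OF less.prems False]]) (use less.hyps in blast)
    then show ?thesis using False by (auto intro: wp_WhileNZ)
  qed
qed

text \<open>For loops with a known number \<open>N\<close> of iterations. The indexed invariant
  decides the guard, so no measure on registers is needed, and a step bound depending on
  \<open>i\<close> can be made part of \<open>I i\<close>.\<close>

lemma wp_for:
  fixes I :: "nat \<Rightarrow> assn"
  assumes "I 0 R M rs t"
    and "\<And>i R M rs t. i \<le> N \<Longrightarrow> I i R M rs t \<Longrightarrow> R r \<noteq> 0 \<longleftrightarrow> i < N"
    and "\<And>i R M rs t. i < N \<Longrightarrow> I i R M rs t \<Longrightarrow> wp w (I (Suc i)) body R M rs (Suc t)"
    and "\<And>R M rs t. I N R M rs t \<Longrightarrow> wp w Q ps R M rs (Suc t)"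
  shows "wp w Q (WhileNZ r body # ps) R M rs t"
proof -
  have "wp w Q (WhileNZ r body # ps) R M rs t" if "i \<le> N" "I i R M rs t" for i R M rs t
    using that
  proof (induction "N - i" arbitrary: i R M rs t)
    case 0
    then have "i = N" by simp
    then show ?case using 0 assms(2)[of N R M rs t] assms(4)[of R M rs t] by (auto intro: wp_WhileNZ)
  next
    case (Suc k)
    then have "i < N" by simp
    have "wp w Q (body @ WhileNZ r body # ps) R M rs (Suc t)"
      by (rule wp_seq[OF assms(3)[OF \<open>i < N\<close> Suc.prems(2)]]) (use Suc.hyps(2) \<open>i < N\<close> in \<open>auto intro!: Suc.hyps(1)[of "Suc i"]\<close>)
    then show ?case using assms(2)[of i R M rs t] Suc.prems \<open>i < N\<close> by (auto intro: wp_WhileNZ)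
  qed
  from this[of 0] assms(1) show ?thesis by simp
qed

section \<open>From tapes to the distribution of runs\<close>

abbreviation cf :: "cmd list \<Rightarrow> (nat \<Rightarrow> nat) \<Rightarrow> (nat \<Rightarrow> nat) \<Rightarrow> config" where
  "cf ps R M \<equiv> \<lparr>todo = ps, reg = R, mem = M\<rparr>"

text \<open>The tape execution in terms of the given \<open>step\<close>: apart from
  \<open>Rand\<close>, every command has a point distribution. Unread tape may remain when the
  program halts, so programs need not consume the tape exactly.\<close>

inductive texec :: "nat \<Rightarrow> config \<Rightarrow> nat list \<Rightarrow> nat \<Rightarrow> config \<Rightarrow> bool" for w where
  texec_halted: "halted c \<Longrightarrow> texec w c rs 0 c"
| texec_Rand: "texec w (cf ps (R(r := v)) M) rs t c' \<Longrightarrow>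
    texec w (cf (Rand r # ps) R M) (v # rs) (Suc t) c'"
| texec_det: "\<not> halted c \<Longrightarrow> (\<And>r. hd (todo c) \<noteq> Rand r) \<Longrightarrow> step w c = return_pmf c1 \<Longrightarrow>
    texec w c1 rs t c' \<Longrightarrow> texec w c rs (Suc t) c'"

lemma texec_step:
  assumes "\<exists>T R' M' rs'. texec w c1 rs T (cf [] R' M') \<and> Q R' M' rs' (Suc t + T)"
    and "step w (cf (p # ps) R M) = return_pmf c1" and "\<And>r. p \<noteq> Rand r"
  shows "\<exists>T R' M' rs'. texec w (cf (p # ps) R M) rs T (cf [] R' M') \<and> Q R' M' rs' (t + T)"
proof -
  obtain T R' M' rs' where "texec w c1 rs T (cf [] R' M')" "Q R' M' rs' (Suc t + T)"
    using assms(1) by blast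
  then have "texec w (cf (p # ps) R M) rs (Suc T) (cf [] R' M')" "Q R' M' rs' (t + Suc T)"
    using assms(2,3) by (auto intro!: texec_det simp: halted_def)
  then show ?thesis by blast
qed

lemma wp_texec:
  assumes "wp w Q p R M rs t"
  shows "\<exists>T R' M' rs'. texec w (cf p R M) rs T (cf [] R' M') \<and> Q R' M' rs' (t + T)"
  using assms
proof (induction p R M rs t rule: wp.induct)
  case (wp_Nil R M rs t)
  then show ?case by (intro exI[of _ 0] exI) (auto intro!: texec_halted simp: halted_def)
next
  case (wp_Rand ps R r v M rs t)
  then obtain T R' M' rs' where "texec w (cf ps (R(r := v)) M) rs T (cf [] R' M')"
    "Q R' M' rs' (Suc t + T)" by blast
  then show ?case by (intro exI[of _ "Suc T"] exI) (auto intro!: texec_Rand)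
qed (erule texec_step, simp add: step_def fun_upd_def, simp)+

lemma run_halted: "halted c \<Longrightarrow> run w T c = return_pmf c"
  by (induction T) (auto simp: halted_def step_def bind_return_pmf)

lemma texec_halted_cases: "texec w c rs t c' \<Longrightarrow> halted c \<Longrightarrow> c' = c"
  by (erule texec.cases) (auto simp: halted_def)

lemma texec_0_cases: "texec w c rs 0 c' \<Longrightarrow> c' = c"
  by (erule texec.cases) auto

lemma texec_Rand_cases:
  "texec w (cf (Rand r # ps) R M) rs t c' \<Longrightarrow>
    \<exists>v rs' t'. rs = v # rs' \<and> t = Suc t' \<and> texec w (cf ps (R(r := v)) M) rs' t' c'"
  by (erule texec.cases) (fastforce simp: halted_def)+

definition tape :: "nat \<Rightarrow> nat \<Rightarrow> nat list pmf" where
  "tape w m = replicate_pmf m (pmf_of_set {..<2 ^ w})"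

lemma set_tape: "rs \<in> set_pmf (tape w m) \<longleftrightarrow> length rs = m \<and> set rs \<subseteq> {..<2 ^ w}"
proof -
  have "set_pmf (pmf_of_set {..<2 ^ w::nat}) = {..<2 ^ w}"
    by (rule set_pmf_of_set) (auto simp: lessThan_empty_iff)
  then show ?thesis by (auto simp: tape_def set_replicate_pmf)
qed

lemma tape_0: "tape w 0 = return_pmf []"
  by (simp add: tape_def)

lemma tape_Suc: "tape w (Suc m) = bind_pmf (pmf_of_set {..<2 ^ w}) (\<lambda>v. map_pmf ((#) v) (tape w m))"
  by (simp add: tape_def map_pmf_def)

text \<open>Induction on the number of steps: a \<open>Rand\<close> consumes the first word of a
  uniform tape, whose rest is again uniform, and any other command leaves the tape alone. Words that
  are never read do not matter, since the final configuration is then constant in them.\<close>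

lemma run_tape:
  assumes "\<And>rs. rs \<in> set_pmf (tape w m) \<Longrightarrow> \<exists>t\<le>T. texec w c rs t (g rs)"
  shows "run w T c = map_pmf g (tape w m)"
  using assms
proof (induction T arbitrary: c m g)
  case 0
  have "g rs = c" if "rs \<in> set_pmf (tape w m)" for rs
    using 0[OF that] texec_0_cases by auto
  then have "map_pmf g (tape w m) = map_pmf (\<lambda>_. c) (tape w m)" by (intro map_pmf_cong) auto
  then show ?case by simp
next
  case (Suc T)
  show ?case
  proof (cases "halted c")
    case True
    have "g rs = c" if "rs \<in> set_pmf (tape w m)" for rs
      using Suc.prems[OF that] True texec_halted_cases by blast
    then have "map_pmf g (tape w m) = map_pmf (\<lambda>_. c) (tape w m)" by (intro map_pmf_cong) auto
    then show ?thesis using run_halted[OF True, of w "Suc T"] by simp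
  next
    case False
    then obtain p ps R M where c: "c = cf (p # ps) R M"
      by (cases c) (auto simp: halted_def neq_Nil_conv)
    show ?thesis
    proof (cases "\<exists>r. p = Rand r")
      case True
      then obtain r where p: "p = Rand r" by blast
      \<comment> \<open>Some tape exists, and an empty one could not feed a \<open>Rand\<close>;
        hence \<open>m\<close> is positive.\<close>
      obtain rs0 where rs0: "rs0 \<in> set_pmf (tape w m)" using set_pmf_not_empty by fast
      from Suc.prems[OF rs0] obtain t where "texec w c rs0 t (g rs0)" by blast
      then have "rs0 \<noteq> []" unfolding c p using texec_Rand_cases by blast
      then obtain m' where m: "m = Suc m'" using rs0 by (cases m) (auto simp: set_tape)
      have IH: "run w T (cf ps (R(r := v)) M) = map_pmf (\<lambda>rs. g (v # rs)) (tape w m')"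
        if "v < 2 ^ w" for v
      proof (rule Suc.IH)
        fix rs assume "rs \<in> set_pmf (tape w m')"
        then have "v # rs \<in> set_pmf (tape w m)" using that by (auto simp: set_tape m)
        from Suc.prems[OF this] obtain t where "t \<le> Suc T" "texec w c (v # rs) t (g (v # rs))" by blast
        then show "\<exists>t\<le>T. texec w (cf ps (R(r := v)) M) rs t (g (v # rs))"
          unfolding c p using texec_Rand_cases by fastforce
      qed
      have "run w (Suc T) c = bind_pmf (pmf_of_set {..<2 ^ w}) (\<lambda>v. run w T (cf ps (R(r := v)) M))"
        by (simp add: c p step_def bind_map_pmf)
      also have "\<dots> = bind_pmf (pmf_of_set {..<2 ^ w}) (\<lambda>v. map_pmf (\<lambda>rs. g (v # rs)) (tape w m'))"
        by (intro bind_pmf_cong refl IH) (auto simp: set_pmf_of_set lessThan_empty_iff)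
      also have "\<dots> = map_pmf g (tape w m)"
        by (simp add: m tape_Suc map_bind_pmf pmf.map_comp o_def)
      finally show ?thesis .
    next
      case nr: False
      obtain c1 where c1: "step w c = return_pmf c1"
        using nr by (cases p) (auto simp: c step_def)
      have "run w T c1 = map_pmf g (tape w m)"
      proof (rule Suc.IH)
        fix rs assume "rs \<in> set_pmf (tape w m)"
        from Suc.prems[OF this] obtain t where "t \<le> Suc T" "texec w c rs t (g rs)" by blast
        from this(2,1) show "\<exists>t\<le>T. texec w c1 rs t (g rs)"
        proof cases
          case texec_halted then show ?thesis using False by simp
        next
          case (texec_Rand ps' R' r' v' M' rs' t') then show ?thesis using nr c by auto
        next
          case (texec_det c1' t')
          then have "c1' = c1" using c1 by simp
          then show ?thesis using texec_det \<open>t \<le> Suc T\<close> by auto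
        qed
      qed
      then show ?thesis by (simp add: c1 bind_return_pmf)
    qed
  qed
qed

lemma run_det:
  assumes "texec w c [] t c'" "t \<le> T"
  shows "run w T c = return_pmf c'"
proof -
  have "run w T c = map_pmf (\<lambda>_. c') (tape w 0)"
    by (rule run_tape) (use assms in \<open>auto simp: tape_0\<close>)
  then show ?thesis by simp
qed

section \<open>Expectation over a uniform tape\<close>

text \<open>Expectation as an iterated finite average: it unfolds along the tape just as the forest
  growth does, and no integrability conditions arise.\<close>

primrec ev :: "nat \<Rightarrow> nat \<Rightarrow> (nat list \<Rightarrow> real) \<Rightarrow> real" where
  "ev w 0 g = g []"
| "ev w (Suc m) g = (\<Sum>r<2 ^ w. ev w m (\<lambda>rs. g (r # rs))) / 2 ^ w"

lemma ev_tape: "measure_pmf.expectation (tape w m) g = ev w m g"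
proof (induction m arbitrary: g)
  case 0
  then show ?case by (simp add: tape_0)
next
  case (Suc m)
  have fin: "finite (set_pmf (map_pmf ((#) v) (tape w m)))" for v
  proof -
    have "set_pmf (tape w m) \<subseteq> {xs. set xs \<subseteq> {..<2 ^ w} \<and> length xs = m}"
      using set_tape by auto
    then have "finite (set_pmf (tape w m))"
      using finite_lists_length_eq[of "{..<2 ^ w::nat}" m] finite_subset by blast
    then show ?thesis by simp
  qed
  have "measure_pmf.expectation (tape w (Suc m)) g =
      (\<Sum>a<2 ^ w. measure_pmf.expectation (map_pmf ((#) a) (tape w m)) g /\<^sub>R real (card {..<2 ^ w::nat}))"
    unfolding tape_Suc by (rule pmf_expectation_bind_pmf_of_set) (use fin in \<open>auto simp: lessThan_empty_iff\<close>)
  also have "\<dots> = (\<Sum>a<2 ^ w. ev w m (\<lambda>rs. g (a # rs)) / 2 ^ w)"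
    by (simp add: Suc.IH divide_inverse mult.commute)
  finally show ?case by (simp add: sum_divide_distrib)
qed

lemma prob_tape: "measure_pmf.prob (tape w m) {rs. Q rs} = ev w m (\<lambda>rs. of_bool (Q rs))"
proof -
  have "measure_pmf.prob (tape w m) {rs. Q rs} =
      measure_pmf.expectation (tape w m) (indicator {rs. Q rs})" by simp
  also have "\<dots> = measure_pmf.expectation (tape w m) (\<lambda>rs. of_bool (Q rs))"
    by (intro arg_cong[where f = "measure_pmf.expectation (tape w m)"] ext) (simp add: indicator_def)
  finally show ?thesis by (simp only: ev_tape)
qed

lemma ev_mono:
  assumes "\<And>rs. length rs = m \<Longrightarrow> set rs \<subseteq> {..<2 ^ w} \<Longrightarrow> g rs \<le> h rs"
  shows "ev w m g \<le> ev w m h"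
  using assms by (induction m arbitrary: g h) (auto intro!: divide_right_mono sum_mono)

lemma ev_add: "ev w m (\<lambda>rs. g rs + h rs) = ev w m g + ev w m h"
  by (induction m arbitrary: g h) (auto simp: sum.distrib add_divide_distrib)

lemma ev_cmult: "ev w m (\<lambda>rs. c * g rs) = c * ev w m g"
  by (induction m arbitrary: g) (auto simp: sum_distrib_left)

lemma ev_const: "ev w m (\<lambda>rs. c) = c"
  by (induction m) auto

lemma ev_sum: "finite A \<Longrightarrow> ev w m (\<lambda>rs. \<Sum>x\<in>A. g x rs) = (\<Sum>x\<in>A. ev w m (g x))"
  by (induction A rule: finite_induct) (auto simp: ev_add ev_const)

lemma markov:
  assumes "\<And>rs. length rs = m \<Longrightarrow> set rs \<subseteq> {..<2 ^ w} \<Longrightarrow> 0 \<le> g rs" and "0 < c"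
  shows "ev w m (\<lambda>rs. of_bool (c \<le> g rs)) \<le> ev w m g / c"
proof -
  have "ev w m (\<lambda>rs. of_bool (c \<le> g rs)) \<le> ev w m (\<lambda>rs. (1 / c) * g rs)"
    by (rule ev_mono) (use assms in \<open>auto simp: field_simps\<close>)
  then show ?thesis by (simp only: ev_cmult) simp
qed

text \<open>Cut the range into \<open>Z\<close> blocks of length \<open>S\<close>. This makes a
  random word reduced modulo \<open>S\<close> exactly uniform when \<open>S\<close> divides
  \<open>2 ^ w\<close>; the hashing bound uses it again for residues modulo a power of 2.\<close>

lemma sum_mod:
  fixes h :: "nat \<Rightarrow> 'a :: comm_semiring_1"
  shows "(\<Sum>r<Z * S. h (r mod S)) = of_nat Z * (\<Sum>r<S. h r)"
proof -
  have "(\<Sum>r\<in>{m * S..<m * S + S}. h (r mod S)) = (\<Sum>r<S. h r)" for m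
  proof -
    have "(\<Sum>r\<in>{0 + m * S..<S + m * S}. h (r mod S)) = (\<Sum>r\<in>{0..<S}. h ((r + m * S) mod S))"
      by (rule sum.shift_bounds_nat_ivl)
    then show ?thesis by (auto simp: lessThan_atLeast0 add.commute intro!: sum.cong)
  qed
  then have "(\<Sum>m<Z. \<Sum>r\<in>{m * S..<m * S + S}. h (r mod S)) = of_nat Z * (\<Sum>r<S. h r)"
    by simp
  then show ?thesis by (simp add: sum.nat_group)
qed

section \<open>The random forest and its potential functions\<close>

text \<open>Nodes in order of creation. Each holds the index of its parent and its path, newest edge
  first; an edge is a coordinate with the random value drawn for it. Roots have the empty path and
  are recognised by their index being below \<open>L\<close>.\<close>

type_synonym nodes = "(nat \<times> (nat \<times> nat) list) list"

locale chosen_path =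
  fixes S B d k L :: nat and P :: "nat set set"
  assumes S_pos: "0 < S" and B_pos: "0 < B" and d_pos: "0 < d" and finite_P: "finite P"
    and P_sub: "x \<in> P \<Longrightarrow> x \<subseteq> {1..d}"
begin

text \<open>This is \<open>r / S < 1 / ((B / S) * card x)\<close> without denominators, where
  \<open>r / S\<close> is uniform and \<open>B / S\<close> is close to \<open>b1\<close>. The test
  becomes harder as \<open>card x\<close> grows, so for two sets it is decided by the larger weight,
  which is the denominator of the Braun-Blanquet similarity.\<close>

definition edge_ok :: "nat set \<Rightarrow> nat \<times> nat \<Rightarrow> bool" where
  "edge_ok x e \<longleftrightarrow> fst e \<in> x \<and> snd e * B * card x < S * S"

text \<open>The node list doubles as the queue of a breadth-first search: position \<open>i\<close>
  of the random stream belongs to node \<open>i div d\<close> and coordinate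
  \<open>i mod d + 1\<close>. Only paths accepted by some data point are kept.\<close>

definition grow_step :: "nat \<Rightarrow> nat \<Rightarrow> nodes \<Rightarrow> nodes" where
  "grow_step i r \<tau> = (let v = i div d; p = (i mod d + 1, r) # snd (\<tau> ! v) in
     if v < length \<tau> \<and> length p \<le> k \<and> (\<exists>x\<in>P. list_all (edge_ok x) p) then \<tau> @ [(v, p)] else \<tau>)"

primrec grow :: "nat list \<Rightarrow> nat \<Rightarrow> nodes \<Rightarrow> nodes" where
  "grow [] i \<tau> = \<tau>"
| "grow (r # rs) i \<tau> = grow rs (Suc i) (grow_step i (r mod S) \<tau>)"

definition roots :: nodes where
  "roots = replicate L (0, [])"

text \<open>The supermartingale principle for the growth process: a function of stream position and
  forest that does not increase on average in one step does not increase in expectation over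
  \<open>m\<close> steps.\<close>

lemma ev_grow:
  fixes \<Phi> :: "nat \<Rightarrow> nodes \<Rightarrow> real"
  assumes "S dvd 2 ^ w" and "\<And>i \<tau>. (\<Sum>r<S. \<Phi> (Suc i) (grow_step i r \<tau>)) \<le> S * \<Phi> i \<tau>"
  shows "ev w m (\<lambda>rs. \<Phi> (i + m) (grow rs i \<tau>)) \<le> \<Phi> i \<tau>"
proof (induction m arbitrary: i \<tau>)
  case (Suc m)
  obtain Z where Z: "2 ^ w = Z * S" using assms(1) by (metis dvd_def mult.commute)
  then have Zpos: "0 < Z" by (metis gr0I mult_0 power_not_zero zero_neq_numeral)
  have "ev w (Suc m) (\<lambda>rs. \<Phi> (i + Suc m) (grow rs i \<tau>)) =
      (\<Sum>r<2 ^ w. ev w m (\<lambda>rs. \<Phi> (Suc i + m) (grow rs (Suc i) (grow_step i (r mod S) \<tau>)))) / 2 ^ w"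
    by simp
  also have "\<dots> \<le> (\<Sum>r<2 ^ w. \<Phi> (Suc i) (grow_step i (r mod S) \<tau>)) / 2 ^ w"
    using Suc.IH[of "Suc i"] by (intro divide_right_mono sum_mono) (auto simp: add_Suc[symmetric] simp del: add_Suc)
  also have "\<dots> = Z * (\<Sum>r<S. \<Phi> (Suc i) (grow_step i r \<tau>)) / 2 ^ w"
    unfolding Z sum_mod[where h = "\<lambda>r. \<Phi> (Suc i) (grow_step i r \<tau>)"] ..
  also have "\<dots> \<le> Z * (S * \<Phi> i \<tau>) / 2 ^ w"
    by (intro divide_right_mono mult_left_mono assms(2)) simp_all
  also have "\<dots> = \<Phi> i \<tau>"
  proof -
    have "(2::real) ^ w = Z * S" using arg_cong[OF Z, of real] by simp
    then show ?thesis using Zpos S_pos by simp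
  qed
  finally show ?case .
qed simp

definition pe :: "(nat \<times> nat \<Rightarrow> bool) \<Rightarrow> nat \<Rightarrow> real" where
  "pe f j = card {r. r < S \<and> f (j, r)} / S"

definition mu :: "(nat \<times> nat \<Rightarrow> bool) \<Rightarrow> real" where
  "mu f = (\<Sum>j<d. pe f (j + 1))"

definition remaining :: "(nat \<times> nat \<Rightarrow> bool) \<Rightarrow> nat \<Rightarrow> nat \<Rightarrow> real" where
  "remaining f i u = (\<Sum>j<d. if i \<le> u * d + j then pe f (j + 1) else 0)"

text \<open>The value already collected at nodes whose path satisfies \<open>f\<close>, plus a
  forecast: \<open>remaining\<close> is the mean number of children that a node may still get, and
  \<open>D l\<close> stands for the mean value of the whole subtree of a child of a
  level-\<open>l\<close> node.\<close>

definition pot :: "(nat \<times> nat \<Rightarrow> bool) \<Rightarrow> (nat \<Rightarrow> real) \<Rightarrow> (nat \<Rightarrow> real) \<Rightarrow> nat \<Rightarrow> nodes \<Rightarrow> real" where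
  "pot f val D i \<tau> = (\<Sum>u<length \<tau>. if list_all f (snd (\<tau> ! u))
     then val (length (snd (\<tau> ! u))) + remaining f i u * D (length (snd (\<tau> ! u))) else 0)"

lemma pe_nonneg: "0 \<le> pe f j"
  by (simp add: pe_def)

lemma remaining_nonneg: "0 \<le> remaining f i u"
  by (simp add: remaining_def pe_nonneg sum_nonneg)

lemma remaining_new: "i \<le> u * d \<Longrightarrow> remaining f i u = mu f"
  by (auto simp: remaining_def mu_def intro!: sum.cong)

lemma remaining_done: "Suc u * d \<le> i \<Longrightarrow> remaining f i u = 0"
  by (auto simp: remaining_def intro!: sum.neutral)

lemma remaining_Suc:
  "remaining f (Suc i) u = remaining f i u - (if i div d = u then pe f (i mod d + 1) else 0)"
proof -
  have "remaining f i u - remaining f (Suc i) u = (\<Sum>j<d. if i = u * d + j then pe f (j + 1) else 0)"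
    unfolding remaining_def sum_subtractf[symmetric] by (rule sum.cong) auto
  also have "\<dots> = (if i div d = u then pe f (i mod d + 1) else 0)"
  proof (cases "i div d = u")
    case True
    have "i = u * d + i mod d" using True by (metis div_mult_mod_eq)
    then have "i = u * d + j \<longleftrightarrow> j = i mod d" for j by linarith
    then have "(\<Sum>j<d. if i = u * d + j then pe f (j + 1) else 0) =
        (\<Sum>j<d. if j = i mod d then pe f (j + 1) else 0)"
      by simp
    also have "\<dots> = pe f (i mod d + 1)" using d_pos by simp
    finally show ?thesis using True by simp
  next
    case False
    then have "i \<noteq> u * d + j" if "j < d" for j using that by auto
    then show ?thesis using False by (auto intro!: sum.neutral)
  qed
  finally show ?thesis by simp
qed

lemma pot_append:
  "pot f val D i (\<tau> @ [(v, p)]) = pot f val D i \<tau> +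
    (if list_all f p then val (length p) + remaining f i (length \<tau>) * D (length p) else 0)"
  by (auto simp: pot_def nth_append intro!: sum.cong)

lemma pot_Suc:
  "pot f val D (Suc i) \<tau> = pot f val D i \<tau> -
    (if i div d < length \<tau> \<and> list_all f (snd (\<tau> ! (i div d)))
     then pe f (i mod d + 1) * D (length (snd (\<tau> ! (i div d)))) else 0)"
proof -
  have "pot f val D i \<tau> - pot f val D (Suc i) \<tau> = (\<Sum>u<length \<tau>. if i div d = u then
     (if list_all f (snd (\<tau> ! u)) then pe f (i mod d + 1) * D (length (snd (\<tau> ! u))) else 0) else 0)"
    unfolding pot_def sum_subtractf[symmetric]
    by (rule sum.cong) (auto simp: remaining_Suc algebra_simps)
  then show ?thesis by (auto simp: algebra_simps)
qed

text \<open>A single step replaces the forecast for one undecided coordinate,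
  \<open>pe f j * D\<close>, by its outcome: a new node with its own forecast, or nothing.\<close>

lemma pot_step:
  fixes \<tau> :: nodes and i r :: nat
  defines "v \<equiv> i div d" and "j \<equiv> i mod d + 1"
  defines "p \<equiv> snd (\<tau> ! v)"
  shows "pot f val D (Suc i) (grow_step i r \<tau>) = pot f val D i \<tau> +
    (if v < length \<tau> \<and> list_all f p then
      of_bool (length p < k \<and> f (j, r) \<and> (\<exists>x\<in>P. list_all (edge_ok x) ((j, r) # p))) *
        (val (Suc (length p)) + mu f * D (Suc (length p))) - pe f j * D (length p) else 0)"
proof -
  \<comment> \<open>The new node has index \<open>length \<tau>\<close>, and position
    \<open>i\<close> belongs to an earlier node, so all \<open>d\<close> positions of the new node
    are still to come.\<close>
  have new: "remaining f (Suc i) (length \<tau>) = mu f" if "v < length \<tau>"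
  proof (rule remaining_new)
    have "i < Suc v * d" unfolding v_def using d_pos dividend_less_div_times[of d i] by simp
    also have "\<dots> \<le> length \<tau> * d" using that by (intro mult_le_mono1) simp
    finally show "Suc i \<le> length \<tau> * d" by simp
  qed
  have pS: "pot f val D (Suc i) \<tau> = pot f val D i \<tau> -
      (if v < length \<tau> \<and> list_all f p then pe f j * D (length p) else 0)"
    unfolding v_def p_def j_def by (rule pot_Suc)
  have step: "grow_step i r \<tau> = (if v < length \<tau> \<and> length p < k \<and>
      (\<exists>x\<in>P. list_all (edge_ok x) ((j, r) # p)) then \<tau> @ [(v, (j, r) # p)] else \<tau>)"
    unfolding grow_step_def Let_def v_def p_def j_def by (simp add: Suc_le_eq)
  show ?thesis
    unfolding step by (auto simp: pot_append pS new)
qed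

lemma card_filter_sum: "real (card {r. r < S \<and> Q r}) = (\<Sum>r<S. of_bool (Q r))"
proof -
  have "{r. r < S \<and> Q r} = {r \<in> {..<S}. Q r}" by auto
  then show ?thesis by (simp add: sum.If_cases of_bool_def Int_def)
qed

text \<open>On average the outcome equals the forecast, except that a child may be missing because
  the height limit is reached or no data point accepts its path. Both only lower the potential, as
  values and forecasts are nonnegative.\<close>

lemma pot_supermartingale:
  assumes "\<And>l. l < k \<Longrightarrow> val (Suc l) + mu f * D (Suc l) \<le> D l" "\<And>l. 0 \<le> D l" "\<And>l. 0 \<le> val l"
  shows "(\<Sum>r<S. pot f val D (Suc i) (grow_step i r \<tau>)) \<le> S * pot f val D i \<tau>"
proof -
  define v j where "v = i div d" and "j = i mod d + 1"
  define p where "p = snd (\<tau> ! v)"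
  have mu: "0 \<le> mu f" by (simp add: mu_def pe_nonneg sum_nonneg)
  have "(\<Sum>r<S. pot f val D (Suc i) (grow_step i r \<tau>)) \<le>
     (\<Sum>r<S. pot f val D i \<tau> + (if v < length \<tau> \<and> list_all f p then
      of_bool (f (j, r)) * D (length p) - pe f j * D (length p) else 0))"
  proof (rule sum_mono)
    fix r
    have "of_bool (length p < k \<and> f (j, r) \<and> (\<exists>x\<in>P. list_all (edge_ok x) ((j, r) # p))) *
        (val (Suc (length p)) + mu f * D (Suc (length p))) \<le> of_bool (f (j, r)) * D (length p)"
      using assms(1)[of "length p"] assms(2) by auto
    then show "pot f val D (Suc i) (grow_step i r \<tau>) \<le> pot f val D i \<tau> +
      (if v < length \<tau> \<and> list_all f p then
      of_bool (f (j, r)) * D (length p) - pe f j * D (length p) else 0)"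
      unfolding pot_step v_def[symmetric] j_def[symmetric] p_def[symmetric] by auto
  qed
  also have "\<dots> = S * pot f val D i \<tau> + (if v < length \<tau> \<and> list_all f p then
      (\<Sum>r<S. of_bool (f (j, r))) * D (length p) - S * pe f j * D (length p) else 0)"
    by (cases "v < length \<tau> \<and> list_all f p") (auto simp: sum.distrib sum_subtractf sum_distrib_right)
  also have "\<dots> = S * pot f val D i \<tau>"
    using S_pos card_filter_sum[of "\<lambda>r. f (j, r)"] by (simp add: pe_def)
  finally show ?thesis .
qed

text \<open>When \<open>f\<close> implies acceptance by a data point, \<open>pot f val D\<close> is
  a martingale. Its squared distance from any constant grows by the conditional variance of each
  step, and \<open>E\<close> is the forecast of all variance still to come, so that the sum of both
  does not grow.\<close>

lemma pot_second_moment: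
  fixes \<Phi> :: "nat \<Rightarrow> nodes \<Rightarrow> real" and c :: real
  assumes D: "\<And>l. l < k \<Longrightarrow> val (Suc l) + mu f * D (Suc l) = D l" "\<And>l. k \<le> l \<Longrightarrow> D l = 0"
    and E: "\<And>l. l < k \<Longrightarrow> mu f * E (Suc l) + (D l)\<^sup>2 = E l" "\<And>l. k \<le> l \<Longrightarrow> E l = 0"
    and x: "x \<in> P" "\<And>e. f e \<Longrightarrow> edge_ok x e"
  defines "\<Phi> \<equiv> \<lambda>i \<tau>. (pot f val D i \<tau> - c)\<^sup>2 + pot f (\<lambda>_. 0) E i \<tau>"
  shows "(\<Sum>r<S. \<Phi> (Suc i) (grow_step i r \<tau>)) \<le> S * \<Phi> i \<tau>"
proof -
  define v j where "v = i div d" and "j = i mod d + 1"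
  define p where "p = snd (\<tau> ! v)"
  define l where "l = length p"
  show ?thesis
  proof (cases "v < length \<tau> \<and> list_all f p \<and> l < k")
    case True
    \<comment> \<open>No child passing \<open>f\<close> is suppressed, because \<open>x\<close>
      itself keeps it; this is what turns the supermartingale into a martingale.\<close>
    have ex: "(\<exists>x\<in>P. list_all (edge_ok x) ((j, r) # p))" if "f (j, r)" for r
      using x that True by (auto intro!: bexI[of _ x] simp: list_all_iff)
    define a where "a = pot f val D i \<tau> - c"
    define b where "b r = (of_bool (f (j, r)) :: real)" for r
    define q where "q = pe f j"
    \<comment> \<open>Idempotence makes the square affine in \<open>b r\<close>, so averaging over
      \<open>r\<close> needs only the mean \<open>q\<close>.\<close>
    have bb: "b r * b r = b r" for r by (simp add: b_def)
    have st: "\<Phi> (Suc i) (grow_step i r \<tau>) =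
        (a + (b r - q) * D l)\<^sup>2 + pot f (\<lambda>_. 0) E i \<tau> + b r * (mu f * E (Suc l)) - q * E l" for r
      unfolding \<Phi>_def pot_step v_def[symmetric] j_def[symmetric] p_def[symmetric] l_def[symmetric]
      using True ex[of r] D(1)[of l] by (auto simp: b_def q_def a_def algebra_simps)
    have eq: "\<Phi> (Suc i) (grow_step i r \<tau>) =
        (\<Phi> i \<tau> + (q\<^sup>2 * (D l)\<^sup>2 - 2 * a * q * D l - q * E l)) +
         b r * (2 * a * D l + (D l)\<^sup>2 - 2 * q * (D l)\<^sup>2 + mu f * E (Suc l))" for r
    proof -
      have "(a + (b r - q) * D l)\<^sup>2 = a\<^sup>2 + 2 * a * D l * b r - 2 * a * q * D l
         + b r * b r * (D l)\<^sup>2 - 2 * q * b r * (D l)\<^sup>2 + q\<^sup>2 * (D l)\<^sup>2"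
        by (simp add: power2_eq_square algebra_simps)
      then show ?thesis unfolding st bb by (simp add: \<Phi>_def a_def[symmetric] algebra_simps)
    qed
    have sb: "(\<Sum>r<S. b r) = S * q"
      using S_pos card_filter_sum[of "\<lambda>r. f (j, r)"] by (simp add: pe_def q_def b_def)
    have "(\<Sum>r<S. \<Phi> (Suc i) (grow_step i r \<tau>)) =
        S * (\<Phi> i \<tau> + (q\<^sup>2 * (D l)\<^sup>2 - 2 * a * q * D l - q * E l)) +
         S * q * (2 * a * D l + (D l)\<^sup>2 - 2 * q * (D l)\<^sup>2 + mu f * E (Suc l))"
      unfolding eq sum.distrib sum_distrib_right[symmetric] sb by (simp add: algebra_simps)
    \<comment> \<open>The step has variance \<open>q * (1 - q) * (D l)^2\<close>, whereas the
      \<open>E\<close> part pays \<open>q * (D l)^2\<close>; the surplus is the subtracted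
      square.\<close>
    also have "\<dots> = S * \<Phi> i \<tau> - S * (q * D l)\<^sup>2"
    proof -
      have "E l = mu f * E (Suc l) + (D l)\<^sup>2" using E(1)[of l] True by simp
      then show ?thesis by (simp add: power2_eq_square algebra_simps)
    qed
    finally show ?thesis by simp
  next
    case False
    then have "\<Phi> (Suc i) (grow_step i r \<tau>) = \<Phi> i \<tau>" for r
      unfolding \<Phi>_def pot_step v_def[symmetric] j_def[symmetric] p_def[symmetric] l_def[symmetric]
      using D(2)[of l] E(2)[of l] by auto
    then show ?thesis by simp
  qed
qed

end

section \<open>First and second moments of node counts\<close>

context chosen_path
begin

definition count :: "(nat \<times> nat \<Rightarrow> bool) \<Rightarrow> (nat \<Rightarrow> real) \<Rightarrow> nodes \<Rightarrow> real" where
  "count f val \<tau> = (\<Sum>u<length \<tau>. if list_all f (snd (\<tau> ! u)) then val (length (snd (\<tau> ! u))) else 0)"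

lemma count_nonneg: "(\<And>l. 0 \<le> val l) \<Longrightarrow> 0 \<le> count f val \<tau>"
  by (auto simp: count_def intro!: sum_nonneg)

lemma mu_nonneg: "0 \<le> mu f"
  by (simp add: mu_def pe_nonneg sum_nonneg)

lemma pot_roots: "pot f val D 0 roots = L * (val 0 + mu f * D 0)"
  by (simp add: pot_def roots_def remaining_new)

text \<open>With branching factor at most \<open>m\<close>, a tree has on average at most
  \<open>m ^ i\<close> nodes of level \<open>i\<close> whose path satisfies \<open>f\<close>;
  \<open>val\<close> weights the levels, which covers counting all nodes as well as only the
  leaves.\<close>

lemma expected_count:
  fixes m :: real and val :: "nat \<Rightarrow> real"
  assumes "S dvd 2 ^ w" "\<And>l. 0 \<le> val l" "mu f \<le> m"
  shows "ev w M (\<lambda>rs. count f val (grow rs 0 roots)) \<le> L * (\<Sum>i\<le>k. m ^ i * val i)"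
proof -
  \<comment> \<open>The solution of \<open>D l = val (Suc l) + m * D (Suc l)\<close> that vanishes
    at level \<open>k\<close>.\<close>
  define D where "D l = (\<Sum>i\<in>{Suc l..k}. m ^ (i - Suc l) * val i)" for l
  have m: "0 \<le> m" using assms(3) mu_nonneg order_trans by blast
  have D0: "0 \<le> D l" for l unfolding D_def using m assms(2) by (intro sum_nonneg) auto
  have split: "val l + m * D l = (\<Sum>i\<in>{l..k}. m ^ (i - l) * val i)" if "l \<le> k" for l
  proof -
    have "{l..k} = insert l {Suc l..k}" using that by auto
    then have "(\<Sum>i\<in>{l..k}. m ^ (i - l) * val i) = val l + (\<Sum>i\<in>{Suc l..k}. m ^ (i - l) * val i)"
      by simp
    also have "(\<Sum>i\<in>{Suc l..k}. m ^ (i - l) * val i) = m * D l"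
      unfolding D_def sum_distrib_left
      by (rule sum.cong) (auto simp: Suc_diff_Suc mult.assoc[symmetric] simp flip: power_Suc)
    finally show ?thesis by simp
  qed
  have "ev w M (\<lambda>rs. count f val (grow rs 0 roots)) \<le> ev w M (\<lambda>rs. pot f val D (0 + M) (grow rs 0 roots))"
    unfolding count_def pot_def using D0 remaining_nonneg
    by (intro ev_mono sum_mono) auto
  also have "\<dots> \<le> pot f val D 0 roots"
  proof (rule ev_grow[OF assms(1)])
    fix i \<tau>
    show "(\<Sum>r<S. pot f val D (Suc i) (grow_step i r \<tau>)) \<le> S * pot f val D i \<tau>"
    proof (rule pot_supermartingale)
      fix l assume "l < k"
      have "val (Suc l) + mu f * D (Suc l) \<le> val (Suc l) + m * D (Suc l)"
        using assms(3) D0 by (simp add: mult_right_mono)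
      also have "\<dots> = D l" using split[of "Suc l"] \<open>l < k\<close> by (simp add: D_def)
      finally show "val (Suc l) + mu f * D (Suc l) \<le> D l" .
    qed (use D0 assms(2) in auto)
  qed
  also have "\<dots> \<le> L * (val 0 + m * D 0)"
    unfolding pot_roots using assms(3) D0 by (intro mult_left_mono add_left_mono mult_right_mono) auto
  also have "val 0 + m * D 0 = (\<Sum>i\<le>k. m ^ i * val i)"
    using split[of 0] by (simp add: atMost_atLeast0)
  finally show ?thesis .
qed

text \<open>
  Chebyshev's inequality for the number of leaves that survive for both vectors: this is a
  branching process whose offspring have mean at least 1 and are uncorrelated.
\<close>

lemma prob_no_leaf:
  assumes "S dvd 2 ^ w" "x \<in> P" "\<And>e. f e \<Longrightarrow> edge_ok x e" "1 \<le> mu f" "0 < L"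
  shows "ev w (X * d) (\<lambda>rs. of_bool (length (grow rs 0 roots) \<le> X \<and>
      count f (\<lambda>l. of_bool (l = k)) (grow rs 0 roots) = 0)) \<le> k / L"
proof -
  define \<mu> where "\<mu> = mu f"
  define val where "val l = (of_bool (l = k) :: real)" for l
  define D where "D l = (if l < k then \<mu> ^ (k - Suc l) else 0)" for l
  define E where "E l = (\<Sum>i\<in>{l..<k}. \<mu> ^ (i - l) * (D i)\<^sup>2)" for l
  \<comment> \<open>The mean number of common leaves, equal to the initial potential, so the squared
    part of \<open>\<Phi>\<close> starts at 0.\<close>
  define c where "c = L * \<mu> ^ k"
  define \<Phi> where "\<Phi> i \<tau> = (pot f val D i \<tau> - c)\<^sup>2 + pot f (\<lambda>_. 0) E i \<tau>" for i \<tau>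
  have \<mu>: "1 \<le> \<mu>" using assms(4) by (simp add: \<mu>_def)
  have val0: "val 0 + \<mu> * D 0 = \<mu> ^ k"
    by (cases k) (auto simp: val_def D_def)
  have D1: "val (Suc l) + mu f * D (Suc l) = D l" if "l < k" for l
  proof (cases "Suc l = k")
    case False
    then have "k - Suc l = Suc (k - Suc (Suc l))" using that by simp
    then show ?thesis using that False by (simp add: val_def D_def \<mu>_def[symmetric])
  qed (auto simp: val_def D_def)
  have E1: "mu f * E (Suc l) + (D l)\<^sup>2 = E l" if "l < k" for l
  proof -
    have "{l..<k} = insert l {Suc l..<k}" using that by auto
    then have "E l = (D l)\<^sup>2 + (\<Sum>i\<in>{Suc l..<k}. \<mu> ^ (i - l) * (D i)\<^sup>2)" by (simp add: E_def)
    also have "(\<Sum>i\<in>{Suc l..<k}. \<mu> ^ (i - l) * (D i)\<^sup>2) = \<mu> * E (Suc l)"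
      unfolding E_def sum_distrib_left
      by (rule sum.cong) (auto simp: Suc_diff_Suc mult.assoc[symmetric] simp flip: power_Suc)
    finally show ?thesis by (simp add: \<mu>_def)
  qed
  have Enn: "0 \<le> E l" for l unfolding E_def using \<mu> by (intro sum_nonneg) auto
  have "(\<Sum>r<S. \<Phi> (Suc i) (grow_step i r \<tau>)) \<le> S * \<Phi> i \<tau>" for i \<tau>
    unfolding \<Phi>_def by (rule pot_second_moment[where x = x]) (use D1 E1 assms(2,3) in \<open>auto simp: D_def E_def\<close>)
  from ev_grow[OF assms(1) this]
  have le: "ev w (X * d) (\<lambda>rs. \<Phi> (0 + X * d) (grow rs 0 roots)) \<le> \<Phi> 0 roots" .
  have "\<mu> * E 0 = (\<Sum>i<k. \<mu> ^ (2 * k - Suc i))"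
  proof -
    have "\<mu> * (\<mu> ^ i * (D i)\<^sup>2) = \<mu> ^ (2 * k - Suc i)" if "i < k" for i
    proof -
      have "Suc (i + (k - Suc i) * 2) = 2 * k - Suc i" using that by simp
      then show ?thesis using that by (simp add: D_def flip: power_mult power_add power_Suc)
    qed
    then show ?thesis by (simp add: E_def sum_distrib_left lessThan_atLeast0)
  qed
  \<comment> \<open>As \<open>\<mu>\<close> is at least 1, each of the \<open>k\<close> levels
    contributes at most the squared mean of one tree. The variance is thus at most
    \<open>k / L\<close> times \<open>c^2\<close>.\<close>
  also have "\<dots> \<le> (\<Sum>i<k. \<mu> ^ (2 * k))"
    using \<mu> by (intro sum_mono power_increasing) auto
  finally have E0: "\<mu> * E 0 \<le> k * \<mu> ^ (2 * k)" by simp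
  have "\<Phi> 0 roots = L * (\<mu> * E 0)"
    unfolding \<Phi>_def pot_roots \<mu>_def[symmetric] val0 by (simp add: c_def)
  also have "\<dots> \<le> L * (k * \<mu> ^ (2 * k))" using E0 by (intro mult_left_mono) auto
  finally have \<Phi>0: "\<Phi> 0 roots \<le> L * (k * \<mu> ^ (2 * k))" .
  have c2: "c\<^sup>2 = L\<^sup>2 * \<mu> ^ (2 * k)" by (simp add: c_def power_mult_distrib mult.commute flip: power_mult)
  have cpos: "0 < c\<^sup>2" using assms(5) \<mu> by (simp add: c_def)
  have \<Phi>nn: "0 \<le> pot f (\<lambda>_. 0) E i \<tau>" for i \<tau>
    unfolding pot_def using Enn remaining_nonneg by (intro sum_nonneg) auto
  have "ev w (X * d) (\<lambda>rs. of_bool (length (grow rs 0 roots) \<le> X \<and>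
      count f (\<lambda>l. of_bool (l = k)) (grow rs 0 roots) = 0)) \<le>
    ev w (X * d) (\<lambda>rs. of_bool (c\<^sup>2 \<le> \<Phi> (X * d) (grow rs 0 roots)))"
  proof (rule ev_mono)
    fix rs
    define \<tau> where "\<tau> = grow rs 0 roots"
    have "c\<^sup>2 \<le> \<Phi> (X * d) \<tau>" if "length \<tau> \<le> X" "count f (\<lambda>l. of_bool (l = k)) \<tau> = 0"
    proof -
      \<comment> \<open>After \<open>X * d\<close> positions every coordinate of the first
        \<open>X\<close> nodes is decided, so in a forest of at most \<open>X\<close> nodes nothing
        is forecast and the potential is the leaf count.\<close>
      have "remaining f (X * d) u = 0" if "u < length \<tau>" for u
        using that \<open>length \<tau> \<le> X\<close> by (intro remaining_done mult_le_mono1) simp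
      then have "pot f val D (X * d) \<tau> = count f val \<tau>"
        unfolding pot_def count_def by (intro sum.cong) auto
      also have "\<dots> = 0" using that(2) by (simp add: val_def[abs_def])
      finally show ?thesis using \<Phi>nn by (simp add: \<Phi>_def)
    qed
    then show "(of_bool (length (grow rs 0 roots) \<le> X \<and>
        count f (\<lambda>l. of_bool (l = k)) (grow rs 0 roots) = 0) :: real)
      \<le> of_bool (c\<^sup>2 \<le> \<Phi> (X * d) (grow rs 0 roots))" by (simp add: \<tau>_def)
  qed
  also have "\<dots> \<le> ev w (X * d) (\<lambda>rs. \<Phi> (X * d) (grow rs 0 roots)) / c\<^sup>2"
    by (rule markov) (use cpos \<Phi>nn in \<open>auto simp: \<Phi>_def\<close>)
  also have "\<dots> \<le> L * (k * \<mu> ^ (2 * k)) / c\<^sup>2"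
    using le \<Phi>0 by (intro divide_right_mono) auto
  also have "\<dots> = k / L" unfolding c2 using \<mu> assms(5) by (simp add: power2_eq_square)
  finally show ?thesis .
qed

lemma mu_alt: "mu f = (\<Sum>j\<in>{1..d}. pe f j)"
  unfolding mu_def by (simp add: sum.atLeast1_atMost_eq)

text \<open>At most \<open>S * S div (B * t) + 1\<close> values \<open>r\<close> meet the threshold;
  the extra one is the rounding error and adds \<open>1 / S\<close> to the probability of each
  coordinate.\<close>

lemma mu_le:
  assumes "A \<subseteq> {1..d}" "0 < t" "\<And>j r. f (j, r) \<Longrightarrow> j \<in> A \<and> r * B * t < S * S"
  shows "mu f \<le> card A * (S / (B * t) + 1 / S)"
proof -
  have Bt: "0 < B * t" using B_pos assms(2) by simp
  have pe: "pe f j \<le> (if j \<in> A then S / (B * t) + 1 / S else 0)" for j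
  proof (cases "j \<in> A")
    case True
    have "{r. r < S \<and> f (j, r)} \<subseteq> {..< S * S div (B * t) + 1}"
    proof
      fix r assume "r \<in> {r. r < S \<and> f (j, r)}"
      then have "r * (B * t) < S * S" using assms(3)[of j r] by (simp add: mult.assoc)
      then have "r \<le> S * S div (B * t)" using Bt by (simp add: less_eq_div_iff_mult_less_eq)
      then show "r \<in> {..< S * S div (B * t) + 1}" by simp
    qed
    then have "card {r. r < S \<and> f (j, r)} \<le> S * S div (B * t) + 1"
      using card_mono[of "{..< S * S div (B * t) + 1}"] by fastforce
    then have "real (card {r. r < S \<and> f (j, r)}) \<le> real (S * S div (B * t)) + 1" by linarith
    also have "\<dots> \<le> real (S * S) / real (B * t) + 1" using of_nat_div_le_of_nat by (intro add_mono order_refl)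
    finally have "pe f j \<le> (real (S * S) / real (B * t) + 1) / S"
      unfolding pe_def by (simp add: divide_right_mono)
    also have "\<dots> = S / (B * t) + 1 / S" using S_pos by (simp add: field_simps)
    finally show ?thesis using True by simp
  next
    case False
    then have "{r. r < S \<and> f (j, r)} = {}" using assms(3) by auto
    then have "card {r. r < S \<and> f (j, r)} = 0" by (simp only: card.empty)
    then have "pe f j = 0" by (simp add: pe_def)
    then show ?thesis using False by simp
  qed
  have "mu f \<le> (\<Sum>j\<in>{1..d}. if j \<in> A then S / (B * t) + 1 / S else 0)"
    unfolding mu_alt by (intro sum_mono pe)
  also have "\<dots> = (\<Sum>j\<in>A. S / (B * t) + 1 / S)"
    using assms(1) by (simp add: sum.If_cases Int_absorb1)
  finally show ?thesis by simp
qed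

text \<open>The number of admissible \<open>r\<close> is the threshold rounded up, so the integer
  test loses nothing here, except that a probability cannot exceed 1.\<close>

lemma mu_ge:
  assumes "A \<subseteq> {1..d}" "0 < t" "\<And>j r. j \<in> A \<Longrightarrow> r * B * t < S * S \<Longrightarrow> f (j, r)"
  shows "card A * min 1 (S / (B * t)) \<le> mu f"
proof -
  have Bt: "0 < B * t" using B_pos assms(2) by simp
  define y where "y = real (S * S) / real (B * t)"
  have pe: "(if j \<in> A then min 1 (S / (B * t)) else 0) \<le> pe f j" for j
  proof (cases "j \<in> A")
    case True
    have "{..<min S (nat \<lceil>y\<rceil>)} \<subseteq> {r. r < S \<and> f (j, r)}"
    proof
      fix r assume "r \<in> {..<min S (nat \<lceil>y\<rceil>)}"
      then have r: "r < S" "int r < \<lceil>y\<rceil>" by auto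
      then have "real r < y" by (simp add: less_ceiling_iff)
      then have "real r * real (B * t) < real (S * S)" using Bt by (simp add: y_def field_simps)
      then have "real (r * B * t) < real (S * S)" by (simp add: mult.assoc)
      then have "r * B * t < S * S" by (simp only: of_nat_less_iff)
      then show "r \<in> {r. r < S \<and> f (j, r)}" using r assms(3)[OF True] by auto
    qed
    then have "min S (nat \<lceil>y\<rceil>) \<le> card {r. r < S \<and> f (j, r)}"
      using card_mono[of "{r. r < S \<and> f (j, r)}" "{..<min S (nat \<lceil>y\<rceil>)}"] by simp
    moreover have "min (real S) y \<le> real (min S (nat \<lceil>y\<rceil>))" by (auto simp: min_def) linarith+
    ultimately have "min (real S) y / S \<le> pe f j" unfolding pe_def by (intro divide_right_mono) linarith+
    also have "min (real S) y / S = min 1 (S / (B * t))"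
      using S_pos by (simp add: min_divide_distrib_right y_def)
    finally show ?thesis using True by simp
  qed (simp add: pe_nonneg)
  have "card A * min 1 (S / (B * t)) = (\<Sum>j\<in>A. min 1 (S / (B * t)))" by simp
  also have "\<dots> = (\<Sum>j\<in>{1..d}. if j \<in> A then min 1 (S / (B * t)) else 0)"
    using assms(1) by (simp add: sum.If_cases Int_absorb1)
  also have "\<dots> \<le> mu f" unfolding mu_alt by (intro sum_mono pe)
  finally show ?thesis .
qed


section \<open>The capped forest and its invariants\<close>

text \<open>The version that the program runs: it stops adding nodes at \<open>X\<close> but goes on
  drawing random values.\<close>

primrec tgrow :: "nat \<Rightarrow> nat list \<Rightarrow> nat \<Rightarrow> nodes \<Rightarrow> nodes" where
  "tgrow X [] i \<tau> = \<tau>"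
| "tgrow X (r # rs) i \<tau> =
    tgrow X rs (Suc i) (if length \<tau> < X then grow_step i (r mod S) \<tau> else \<tau>)"

lemma tgrow_append: "tgrow X (as @ bs) i \<tau> = tgrow X bs (i + length as) (tgrow X as i \<tau>)"
  by (induction as arbitrary: i \<tau>) auto

lemma grow_step_cases:
  obtains "grow_step i r \<tau> = \<tau>" | v p where "grow_step i r \<tau> = \<tau> @ [(v, p)]"
proof -
  have "grow_step i r \<tau> = \<tau> \<or> (\<exists>v p. grow_step i r \<tau> = \<tau> @ [(v, p)])"
    unfolding grow_step_def Let_def by simp
  then show ?thesis using that by blast
qed

text \<open>Steps below position \<open>X * d\<close> concern only the first \<open>X\<close> nodes,
  and whether such a node gets a child does not depend on later nodes. So moments are computed for
  \<open>grow\<close>, and the stored forest is a prefix of it.\<close>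

lemma tgrow_take:
  "i + length rs \<le> X * d \<Longrightarrow> tgrow X rs i (take X \<tau>) = take X (grow rs i \<tau>)"
proof (induction rs arbitrary: i \<tau>)
  case (Cons r rs)
  have "(if length (take X \<tau>) < X then grow_step i (r mod S) (take X \<tau>) else take X \<tau>) =
      take X (grow_step i (r mod S) \<tau>)"
    by (cases i "r mod S" \<tau> rule: grow_step_cases) (auto simp: not_less)
  then show ?case using Cons.IH[of "Suc i"] Cons.prems by simp
qed simp

text \<open>The bound \<open>v * d + j \<le> i\<close> records that children were created at earlier
  positions. The injectivity clause says that a node has at most one child per coordinate; it later
  limits the genuine matches of a table lookup.\<close>

definition tree_ok :: "nat \<Rightarrow> nodes \<Rightarrow> bool" where
  "tree_ok i \<tau> \<longleftrightarrow> L \<le> length \<tau> \<and> (\<forall>u<L. \<tau> ! u = (0, [])) \<and>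
    (\<forall>u. L \<le> u \<and> u < length \<tau> \<longrightarrow> (\<exists>v j r. \<tau> ! u = (v, (j, r) # snd (\<tau> ! v)) \<and>
      v < u \<and> 1 \<le> j \<and> j \<le> d \<and> r < S \<and> v * d + j \<le> i \<and>
      length (snd (\<tau> ! u)) \<le> k \<and> (\<exists>x\<in>P. list_all (edge_ok x) (snd (\<tau> ! u))))) \<and>
    inj_on (\<lambda>u. (fst (\<tau> ! u), fst (hd (snd (\<tau> ! u))))) {L..<length \<tau>}"

lemma tree_ok_roots: "tree_ok i roots"
  by (simp add: tree_ok_def roots_def)

lemma tree_ok_step:
  assumes "tree_ok i \<tau>" "r < S"
  shows "tree_ok (Suc i) (grow_step i r \<tau>)"
proof -
  define v where "v = i div d"
  define p where "p = (i mod d + 1, r) # snd (\<tau> ! v)"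
  have i: "i = v * d + i mod d" by (simp add: v_def)
  have md: "i mod d < d" using d_pos by simp
  have L: "L \<le> length \<tau>" and root: "\<And>u. u < L \<Longrightarrow> \<tau> ! u = (0, [])"
    and nodes: "\<And>u. L \<le> u \<Longrightarrow> u < length \<tau> \<Longrightarrow> \<exists>v j r. \<tau> ! u = (v, (j, r) # snd (\<tau> ! v)) \<and>
      v < u \<and> 1 \<le> j \<and> j \<le> d \<and> r < S \<and> v * d + j \<le> i \<and>
      length (snd (\<tau> ! u)) \<le> k \<and> (\<exists>x\<in>P. list_all (edge_ok x) (snd (\<tau> ! u)))"
    and inj: "inj_on (\<lambda>u. (fst (\<tau> ! u), fst (hd (snd (\<tau> ! u))))) {L..<length \<tau>}"
    using assms(1) unfolding tree_ok_def by blast+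
  show ?thesis
  proof (cases "v < length \<tau> \<and> length p \<le> k \<and> (\<exists>x\<in>P. list_all (edge_ok x) p)")
    case False
    then have g: "grow_step i r \<tau> = \<tau>" unfolding grow_step_def Let_def v_def[symmetric] p_def[symmetric] by simp
    have "\<exists>v j r. \<tau> ! u = (v, (j, r) # snd (\<tau> ! v)) \<and>
      v < u \<and> 1 \<le> j \<and> j \<le> d \<and> r < S \<and> v * d + j \<le> Suc i \<and>
      length (snd (\<tau> ! u)) \<le> k \<and> (\<exists>x\<in>P. list_all (edge_ok x) (snd (\<tau> ! u)))"
      if "L \<le> u" "u < length \<tau>" for u using nodes[OF that] le_SucI by meson
    then show ?thesis unfolding g tree_ok_def using L root inj by blast
  next
    case True
    define \<sigma> where "\<sigma> = \<tau> @ [(v, p)]"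
    have g: "grow_step i r \<tau> = \<sigma>"
      using True unfolding \<sigma>_def grow_step_def Let_def v_def[symmetric] p_def[symmetric] by simp
    have old: "\<sigma> ! u = \<tau> ! u" if "u < length \<tau>" for u using that by (simp add: \<sigma>_def nth_append)
    have new: "\<sigma> ! length \<tau> = (v, p)" by (simp add: \<sigma>_def)
    have "\<exists>v j r. \<sigma> ! u = (v, (j, r) # snd (\<sigma> ! v)) \<and>
      v < u \<and> 1 \<le> j \<and> j \<le> d \<and> r < S \<and> v * d + j \<le> Suc i \<and>
      length (snd (\<sigma> ! u)) \<le> k \<and> (\<exists>x\<in>P. list_all (edge_ok x) (snd (\<sigma> ! u)))"
      if u: "L \<le> u" "u < length \<sigma>" for u
    proof (cases "u = length \<tau>")
      case eq: True
      have "\<sigma> ! u = (v, (i mod d + 1, r) # snd (\<sigma> ! v))"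
        using eq new True old[of v] by (simp add: p_def)
      moreover have "v * d + (i mod d + 1) \<le> Suc i" using i by simp
      ultimately show ?thesis using True eq new md assms(2) by (intro exI[of _ v] exI[of _ "i mod d + 1"] exI[of _ r]) auto
    next
      case False
      then have ul: "u < length \<tau>" using u by (simp add: \<sigma>_def)
      from nodes[OF u(1) ul] obtain v' j' r' where "\<tau> ! u = (v', (j', r') # snd (\<tau> ! v')) \<and>
        v' < u \<and> 1 \<le> j' \<and> j' \<le> d \<and> r' < S \<and> v' * d + j' \<le> i \<and>
        length (snd (\<tau> ! u)) \<le> k \<and> (\<exists>x\<in>P. list_all (edge_ok x) (snd (\<tau> ! u)))" by blast
      then show ?thesis using ul old[of u] old[of v'] by (intro exI[of _ v'] exI[of _ j'] exI[of _ r']) auto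
    qed
    moreover have "inj_on (\<lambda>u. (fst (\<sigma> ! u), fst (hd (snd (\<sigma> ! u))))) {L..<length \<sigma>}"
    proof -
      have "{L..<length \<sigma>} = insert (length \<tau>) {L..<length \<tau>}" using L by (auto simp: \<sigma>_def)
      moreover have "inj_on (\<lambda>u. (fst (\<sigma> ! u), fst (hd (snd (\<sigma> ! u))))) {L..<length \<tau>}"
        using inj old by (auto simp: inj_on_def)
      \<comment> \<open>The new pair corresponds to stream position \<open>i + 1\<close> in the
        bound of the invariant, but all earlier pairs satisfy
        \<open>v' * d + j' \<le> i\<close>.\<close>
      moreover have "(v, i mod d + 1) \<notin> (\<lambda>u. (fst (\<sigma> ! u), fst (hd (snd (\<sigma> ! u))))) ` {L..<length \<tau>}"
      proof
        assume "(v, i mod d + 1) \<in> (\<lambda>u. (fst (\<sigma> ! u), fst (hd (snd (\<sigma> ! u))))) ` {L..<length \<tau>}"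
        then obtain u where u: "L \<le> u" "u < length \<tau>" "v = fst (\<sigma> ! u)" "i mod d + 1 = fst (hd (snd (\<sigma> ! u)))"
          by auto
        from nodes[OF u(1,2)] obtain v' j' r' where "\<tau> ! u = (v', (j', r') # snd (\<tau> ! v'))"
          "v' * d + j' \<le> i" by auto
        then show False using old[of u] u i by auto
      qed
      moreover have "(fst (\<sigma> ! length \<tau>), fst (hd (snd (\<sigma> ! length \<tau>)))) = (v, i mod d + 1)"
        using new by (simp add: p_def)
      moreover have "{L..<length \<tau>} - {length \<tau>} = {L..<length \<tau>}" by auto
      ultimately show ?thesis by (simp only: inj_on_insert) simp
    qed
    ultimately show ?thesis unfolding g tree_ok_def using L root old by (auto simp: \<sigma>_def)
  qed
qed

lemma tree_ok_mono: "tree_ok i \<tau> \<Longrightarrow> i \<le> j \<Longrightarrow> tree_ok j \<tau>"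
  unfolding tree_ok_def using order_trans by meson

lemma tree_ok_tgrow: "tree_ok i \<tau> \<Longrightarrow> tree_ok (i + length rs) (tgrow X rs i \<tau>)"
proof (induction rs arbitrary: i \<tau>)
  case (Cons r rs)
  have "tree_ok (Suc i) (if length \<tau> < X then grow_step i (r mod S) \<tau> else \<tau>)"
    using tree_ok_step[OF Cons.prems, of "r mod S"] tree_ok_mono[OF Cons.prems] S_pos by simp
  from Cons.IH[OF this] show ?case by simp
qed simp

lemma tree_ok_grow: "tree_ok i \<tau> \<Longrightarrow> tree_ok (i + length rs) (grow rs i \<tau>)"
proof (induction rs arbitrary: i \<tau>)
  case (Cons r rs)
  have "tree_ok (Suc i) (grow_step i (r mod S) \<tau>)"
    using tree_ok_step[OF Cons.prems, of "r mod S"] S_pos by simp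
  from Cons.IH[OF this] show ?case by simp
qed simp

lemma length_tgrow: "length \<tau> \<le> X \<Longrightarrow> length (tgrow X rs i \<tau>) \<le> X"
  by (induction rs arbitrary: i \<tau>) (auto simp: grow_step_def Let_def)

lemma count_take:
  assumes "\<And>l. 0 \<le> val l"
  shows "count f val (take X \<tau>) \<le> count f val \<tau>"
proof -
  have "count f val (take X \<tau>) = (\<Sum>u<length (take X \<tau>). if list_all f (snd (\<tau> ! u)) then val (length (snd (\<tau> ! u))) else 0)"
    unfolding count_def by (rule sum.cong) auto
  also have "\<dots> \<le> count f val \<tau>"
    unfolding count_def using assms by (intro sum_mono2) auto
  finally show ?thesis .
qed

end

section \<open>Multiply-shift hashing\<close>

lemma same_div_less:
  fixes a b Z :: nat
  assumes "a div Z = b div Z" "a \<le> b" "0 < Z"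
  shows "b - a < Z"
proof -
  have "b = a div Z * Z + b mod Z" "a = a div Z * Z + a mod Z"
    using assms(1) by (metis div_mult_mod_eq)+
  moreover have "b mod Z < Z" using assms(3) by simp
  ultimately show ?thesis by linarith
qed

lemma odd_part:
  assumes "0 < (z::nat)" obtains s q where "z = 2 ^ s * q" "odd q"
proof -
  have "\<exists>s q. z = 2 ^ s * q \<and> odd q" using assms
  proof (induction z rule: less_induct)
    case (less z)
    show ?case
    proof (cases "odd z")
      case True
      then show ?thesis by (intro exI[of _ 0] exI[of _ z]) simp
    next
      case False
      then obtain y where y: "z = 2 * y" by blast
      with less.prems obtain s q where "y = 2 ^ s * q" "odd q" using less.IH[of y] by auto
      then show ?thesis using y by (intro exI[of _ "Suc s"] exI[of _ q]) simp
    qed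
  qed
  then show ?thesis using that by blast
qed

text \<open>
  If two keys \<open>y < x\<close> share a bucket, then \<open>a * (x - y) mod 2 ^ w\<close> is within \<open>2 ^ (w - l)\<close> of a
  multiple of \<open>2 ^ w\<close>. Splitting \<open>x - y\<close> into an odd part and a power of 2, multiplication by the odd
  part permutes the residues.
\<close>

lemma multiply_shift_less:
  fixes x y w l :: nat
  defines "N \<equiv> 2 ^ w" and "Z \<equiv> 2 ^ (w - l)"
  assumes "l \<le> w" "y < x" "x < Z"
  shows "(\<Sum>a<N. of_bool (a * x mod N div Z = a * y mod N div Z)) \<le> 2 * Z"
proof -
  define z where "z = x - y"
  have x: "x = y + z" and z: "0 < z" "z < Z" using assms by (auto simp: z_def)
  obtain s q where q: "z = 2 ^ s * q" "odd q" using odd_part[OF z(1)] .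
  have Npos: "0 < N" and Zpos: "0 < Z" by (simp_all add: N_def Z_def)
  have sl: "s < w - l"
  proof (rule ccontr)
    assume "\<not> s < w - l"
    then have "Z \<le> 2 ^ s" unfolding Z_def by (intro power_increasing) auto
    moreover have "2 ^ s \<le> z" using q z(1) by (cases q) auto
    ultimately show False using z by simp
  qed
  \<comment> \<open>The factor \<open>2 ^ s\<close> of the key difference divides both
    \<open>N\<close> and \<open>Z\<close>; \<open>T\<close> and \<open>Y\<close> are what remains,
    and \<open>a * z mod N\<close> is \<open>2 ^ s\<close> times a residue modulo
    \<open>T\<close>.\<close>
  define T where "T = (2::nat) ^ (w - s)"
  define Y where "Y = (2::nat) ^ (w - l - s)"
  have N: "N = 2 ^ s * T" using sl by (simp add: N_def T_def flip: power_add)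
  have Z: "Z = 2 ^ s * Y" using sl by (simp add: Z_def Y_def flip: power_add)
  have YT: "Y \<le> T" unfolding Y_def T_def by (intro power_increasing) auto
  \<comment> \<open>Within \<open>Z\<close> of a multiple of \<open>N\<close>, from above or, after
    a wrap-around in the addition, from below.\<close>
  define near where "near b \<longleftrightarrow> b < Z \<or> N - b < Z" for b
  have near: "near (a * z mod N)" if "a * x mod N div Z = a * y mod N div Z" for a
  proof -
    define \<alpha> \<beta> where "\<alpha> = a * y mod N" and "\<beta> = a * z mod N"
    have ab: "\<alpha> < N" "\<beta> < N" using Npos by (auto simp: \<alpha>_def \<beta>_def)
    have ax: "a * x mod N = (\<alpha> + \<beta>) mod N"
      unfolding \<alpha>_def \<beta>_def x by (simp add: mod_add_eq distrib_left)
    show ?thesis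
    proof (cases "\<alpha> + \<beta> < N")
      case True
      then have "\<alpha> div Z = (\<alpha> + \<beta>) div Z" using that ax by (simp add: \<alpha>_def)
      from same_div_less[OF this _ Zpos] show ?thesis by (simp add: near_def \<beta>_def)
    next
      case False
      then have e: "a * x mod N = \<alpha> + \<beta> - N" using ax ab by (simp add: mod_if)
      then have "(\<alpha> + \<beta> - N) div Z = \<alpha> div Z" using that by (simp add: \<alpha>_def)
      from same_div_less[OF this _ Zpos] ab False show ?thesis
        by (simp add: near_def \<beta>_def[symmetric])
    qed
  qed
  have bij: "bij_betw (\<lambda>a. a * q mod N) {..<N} {..<N}"
  proof -
    have "coprime q N" using q(2) by (simp add: N_def)
    then have "a = b" if ab: "a * q mod N = b * q mod N" "a < N" "b \<le> a" for a b
    proof -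
      have "N dvd a * q - b * q" using mod_eq_dvd_iff_nat[of "b * q" "a * q" N] ab by simp
      then have "N dvd (a - b) * q" by (simp add: diff_mult_distrib)
      then have "N dvd a - b" using \<open>coprime q N\<close>
        by (simp add: coprime_dvd_mult_left_iff coprime_commute)
      moreover have "a - b < N" using ab by simp
      ultimately have "a - b = 0" using nat_dvd_not_less by blast
      then show ?thesis using ab by simp
    qed
    then have "inj_on (\<lambda>a. a * q mod N) {..<N}"
      by (intro inj_onI) (metis lessThan_iff nat_le_linear)
    moreover have "(\<lambda>a. a * q mod N) ` {..<N} \<subseteq> {..<N}" using Npos by auto
    ultimately show ?thesis
      by (simp add: bij_betw_def endo_inj_surj)
  qed
  have "(\<Sum>a<N. of_bool (a * x mod N div Z = a * y mod N div Z)) \<le> (\<Sum>a<N. of_bool (near (a * z mod N)) :: nat)"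
    using near by (intro sum_mono) auto
  also have "\<dots> = (\<Sum>a<N. of_bool (near (2 ^ s * (a * q mod N mod T))))"
  proof (rule sum.cong[OF refl])
    fix a
    have "a * z mod N = 2 ^ s * (a * q mod T)"
      unfolding q(1) N by (simp only: mult_mod_right) (simp add: mult.left_commute)
    also have "a * q mod T = a * q mod N mod T" unfolding N by (simp add: mod_mod_cancel)
    finally show "of_bool (near (a * z mod N)) = (of_bool (near (2 ^ s * (a * q mod N mod T))) :: nat)" by simp
  qed
  also have "\<dots> = (\<Sum>u<N. of_bool (near (2 ^ s * (u mod T))))"
    by (rule sum.reindex_bij_betw[OF bij])
  also have "\<dots> = 2 ^ s * (\<Sum>u<T. of_bool (near (2 ^ s * u)))"
    unfolding N using sum_mod[where Z = "2 ^ s" and S = T and h = "\<lambda>u. of_bool (near (2 ^ s * u)) :: nat"] by simp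
  \<comment> \<open>Scaled down by \<open>2 ^ s\<close>, the near residues are those below
    \<open>Y\<close> and those above \<open>T - Y\<close>, fewer than \<open>2 * Y\<close> in
    all.\<close>
  also have "(\<Sum>u<T. of_bool (near (2 ^ s * u)) :: nat) \<le> (\<Sum>u<T. of_bool (u < Y) + of_bool (T - Y < u))"
  proof (rule sum_mono)
    fix u assume "u \<in> {..<T}"
    have "2 ^ s * u < Z \<longleftrightarrow> u < Y" unfolding Z by simp
    moreover have "N - 2 ^ s * u < Z \<longleftrightarrow> T - u < Y" unfolding Z N by (simp flip: diff_mult_distrib2)
    ultimately show "(of_bool (near (2 ^ s * u)) :: nat) \<le> of_bool (u < Y) + of_bool (T - Y < u)"
      using \<open>u \<in> {..<T}\<close> by (auto simp: near_def)
  qed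
  also have "\<dots> \<le> 2 * Y"
  proof -
    have "{..<T} \<inter> {u. u < Y} = {..<Y}" "{..<T} \<inter> {u. T - Y < u} = {T - Y<..<T}" using YT by auto
    then have "(\<Sum>u<T. of_bool (u < Y) :: nat) = Y" "(\<Sum>u<T. of_bool (T - Y < u) :: nat) = T - (T - Y) - 1"
      by (simp_all add: sum_of_bool_eq)
    then show ?thesis by (simp add: sum.distrib)
  qed
  finally show ?thesis unfolding Z by simp
qed

lemma multiply_shift:
  fixes x y w l :: nat
  assumes "l \<le> w" "x \<noteq> y" "x < 2 ^ (w - l)" "y < 2 ^ (w - l)"
  shows "(\<Sum>a<2 ^ w. of_bool (a * x mod 2 ^ w div 2 ^ (w - l) = a * y mod 2 ^ w div 2 ^ (w - l)))
    \<le> (2 * 2 ^ (w - l) :: nat)"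
proof (cases "y < x")
  case True
  then show ?thesis using multiply_shift_less[of l w y x] assms by simp
next
  case False
  then show ?thesis using multiply_shift_less[of l w x y] assms by (simp add: eq_commute)
qed

section \<open>Fixed-point powers and the choice of parameters\<close>

text \<open>The power \<open>(G / S) ^ i\<close> at scale \<open>S\<close>, rounded down after each
  multiplication, as the preprocessing loop computes it.\<close>

primrec zval :: "nat \<Rightarrow> nat \<Rightarrow> nat \<Rightarrow> nat" where
  "zval S G 0 = S"
| "zval S G (Suc i) = zval S G i * G div S"

text \<open>An integer upper bound for \<open>(A / S) ^ i\<close>; adding 1 in every round
  compensates the division.\<close>

primrec yval :: "nat \<Rightarrow> nat \<Rightarrow> nat \<Rightarrow> nat" where
  "yval S A 0 = 1"
| "yval S A (Suc i) = yval S A i * A div S + 1"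

lemma zval_le:
  assumes "0 < S" shows "real (zval S G i) \<le> (G / S) ^ i * S"
proof (induction i)
  case (Suc i)
  have "real (zval S G (Suc i)) \<le> zval S G i * G / S"
    using of_nat_div_le_of_nat[of "zval S G i * G" S] by simp
  also have "\<dots> \<le> ((G / S) ^ i * S) * G / S"
    unfolding of_nat_mult by (intro divide_right_mono mult_right_mono Suc) auto
  finally show ?case by (simp add: mult_ac)
qed simp

lemma nat_div_ge: "real a / real b - 1 \<le> real (a div b)"
proof (cases "b = 0")
  case False
  have "a = b * (a div b) + a mod b" by simp
  then have "real a = real b * real (a div b) + real (a mod b)" by (metis of_nat_add of_nat_mult)
  moreover have "real (a mod b) \<le> real b" using False by (simp add: less_imp_le)
  ultimately have "real a \<le> real b * (real (a div b) + 1)" by (simp add: distrib_left)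
  then show ?thesis using False by (simp add: field_simps)
qed simp

text \<open>Each rounding loses at most 1, and earlier losses shrink by the factor
  \<open>G / S\<close>; the total loss is a geometric series.\<close>

lemma zval_ge:
  assumes "0 < S" "G < S" shows "(G / S) ^ i * S - 1 / (1 - G / S) \<le> real (zval S G i)"
proof (induction i)
  case 0 then show ?case using assms by simp
next
  case (Suc i)
  define \<gamma> where "\<gamma> = G / S"
  have \<gamma>: "0 \<le> \<gamma>" "\<gamma> < 1" using assms by (auto simp: \<gamma>_def)
  have "\<gamma> ^ Suc i * S - 1 / (1 - \<gamma>) = \<gamma> * (\<gamma> ^ i * S - 1 / (1 - \<gamma>)) - 1"
    using \<gamma> by (simp add: field_simps)
  also have "\<dots> \<le> \<gamma> * zval S G i - 1" using mult_left_mono[OF Suc \<gamma>(1)] by (simp add: \<gamma>_def)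
  also have "\<dots> = real (zval S G i * G) / S - 1" by (simp add: \<gamma>_def)
  also have "\<dots> \<le> real (zval S G (Suc i))" using nat_div_ge[of "zval S G i * G" S] by simp
  finally show ?case by (simp add: \<gamma>_def)
qed

lemma yval_ge:
  assumes "0 < S" shows "(A / S) ^ i \<le> real (yval S A i)"
proof (induction i)
  case (Suc i)
  have "(A / S) ^ Suc i \<le> A / S * yval S A i" using mult_left_mono[OF Suc, of "A / S"] by simp
  also have "\<dots> \<le> real (yval S A i * A div S) + 1"
    using nat_div_ge[of "yval S A i * A" S] by (simp add: mult.commute)
  finally show ?case by simp
qed simp

text \<open>Each round adds at most 1, later amplified by \<open>A / S\<close>. Relative to the
  power this is again a geometric series, which is why the bound has a constant factor and no factor
  \<open>i\<close>.\<close>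

lemma yval_le:
  assumes "0 < S" "S < A" shows "real (yval S A i) \<le> (A / S) ^ i * (1 + 1 / (A / S - 1))"
proof -
  define \<alpha> where "\<alpha> = A / S"
  have \<alpha>: "1 < \<alpha>" using assms by (simp add: \<alpha>_def)
  have "real (yval S A i) + 1 / (\<alpha> - 1) \<le> \<alpha> ^ i * (1 + 1 / (\<alpha> - 1))"
  proof (induction i)
    case (Suc i)
    have "real (yval S A (Suc i)) \<le> \<alpha> * yval S A i + 1"
      using of_nat_div_le_of_nat[of "yval S A i * A" S] by (simp add: \<alpha>_def mult.commute)
    moreover have "\<alpha> * (1 / (\<alpha> - 1)) = 1 + 1 / (\<alpha> - 1)" using \<alpha> by (simp add: field_simps)
    ultimately have "real (yval S A (Suc i)) + 1 / (\<alpha> - 1) \<le> \<alpha> * (yval S A i + 1 / (\<alpha> - 1))"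
      unfolding distrib_left by linarith
    also have "\<dots> \<le> \<alpha> * (\<alpha> ^ i * (1 + 1 / (\<alpha> - 1)))" using Suc \<alpha> by (intro mult_left_mono) auto
    finally show ?case by (simp add: mult_ac)
  qed simp
  then show ?thesis using \<alpha> by (simp add: \<alpha>_def) (smt (verit) divide_nonneg_nonneg)
qed

text \<open>The height of the trees: the least exponent at which the fixed-point power of
  \<open>b2\<close> reaches \<open>1 / n\<close>.\<close>

definition levels :: "nat \<Rightarrow> nat \<Rightarrow> nat \<Rightarrow> nat" where
  "levels S G n = (LEAST i. zval S G i * n \<le> S)"

text \<open>An eighth of the word length, so that addresses and products of several numbers of size
  \<open>S\<close> stay below \<open>2 ^ w\<close>.\<close>

definition scale :: "nat \<Rightarrow> nat" where
  "scale w = 2 ^ (w div 8)"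

definition fixpt :: "real \<Rightarrow> nat \<Rightarrow> nat" where
  "fixpt b w = nat \<lfloor>b * real (scale w)\<rfloor>"

text \<open>At scale \<open>S\<close>, an upper bound for the branching factor of a single set:
  \<open>S / B\<close> plus \<open>1 / S\<close> for each of up to \<open>d\<close> coordinates, the
  rounding error of the edge test.\<close>

definition growth :: "nat \<Rightarrow> nat \<Rightarrow> nat \<Rightarrow> nat" where
  "growth S B d = S * S div B + d + 1"

text \<open>Taking the floor commutes with division by a positive integer, so truncating the
  \<open>w\<close>-bit input again gives the directly truncated constant.\<close>

lemma fixpt_shift: "0 \<le> b \<Longrightarrow> nat \<lfloor>b * 2 ^ w\<rfloor> div 2 ^ (w - w div 8) = fixpt b w"
proof -
  assume "0 \<le> b"
  have "(2::real) ^ w = scale w * 2 ^ (w - w div 8)"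
    by (simp add: scale_def flip: power_add)
  then have "b * real (scale w) = b * 2 ^ w / 2 ^ (w - w div 8)" by simp
  then have "\<lfloor>b * real (scale w)\<rfloor> = \<lfloor>b * 2 ^ w\<rfloor> div 2 ^ (w - w div 8)"
    using floor_divide_real_eq_div[of "2 ^ (w - w div 8)" "b * 2 ^ w"] by simp
  then show ?thesis using \<open>0 \<le> b\<close> by (simp add: fixpt_def nat_div_distrib nat_power_eq)
qed

lemma scale_power: "scale w ^ 8 \<le> 2 ^ w"
  unfolding scale_def by (simp flip: power_mult)

lemma scale_ge: "2 powr (w / 8 - 1) \<le> real (scale w)"
proof -
  have "real w / 8 - 1 \<le> real (w div 8)" by linarith
  then have "2 powr (w / 8 - 1) \<le> 2 powr real (w div 8)" by (intro powr_mono) auto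
  then show ?thesis by (simp add: scale_def powr_realpow)
qed

text \<open>Minimality of \<open>k\<close> gives \<open>1 < n * \<gamma> ^ (k - 1)\<close>, from
  which both \<open>k = O(log n)\<close> and the exponent \<open>\<rho>\<close> are derived. The
  last claim says that \<open>\<gamma> ^ k\<close> is at most \<open>1 / n\<close> up to accumulated
  rounding.\<close>

lemma levels_bounds:
  fixes \<gamma> :: real
  assumes "0 < S" "G < S" "0 < G" "2 \<le> n"
  defines "k \<equiv> levels S G n" and "\<gamma> \<equiv> G / S"
  shows "zval S G k * n \<le> S" "\<And>i. i < k \<Longrightarrow> S < zval S G i * n" "0 < k" "1 < n * \<gamma> ^ (k - 1)"
    "(\<gamma> ^ k - 1 / (S * (1 - \<gamma>))) * n \<le> 1"
proof -
  have \<gamma>: "0 < \<gamma>" "\<gamma> < 1" using assms by (auto simp: \<gamma>_def)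
  have "\<exists>i. zval S G i * n \<le> S"
  proof -
    have "0 < 1 / real n" using assms by simp
    then obtain i where "\<gamma> ^ i < 1 / real n" using real_arch_pow_inv[OF _ \<gamma>(2)] by blast
    then have "\<gamma> ^ i * S * n \<le> S" using assms by (simp add: field_simps)
    then have "real (zval S G i) * n \<le> S"
      using zval_le[OF assms(1), of G i] by (smt (verit) \<gamma>_def mult_right_mono of_nat_0_le_iff)
    then have "zval S G i * n \<le> S" by (simp only: of_nat_mult[symmetric] of_nat_le_iff)
    then show ?thesis ..
  qed
  then show k: "zval S G k * n \<le> S" unfolding k_def levels_def by (rule LeastI_ex)
  show least: "S < zval S G i * n" if "i < k" for i
    using not_less_Least[of i "\<lambda>i. zval S G i * n \<le> S"] that by (auto simp: k_def levels_def)
  show "0 < k"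
  proof (rule ccontr)
    assume "\<not> 0 < k" then show False using k assms by simp
  qed
  then have "real S < real (zval S G (k - 1) * n)" using least[of "k - 1"] by linarith
  also have "\<dots> \<le> \<gamma> ^ (k - 1) * S * n"
    unfolding of_nat_mult \<gamma>_def using zval_le[OF assms(1)] by (intro mult_right_mono) auto
  finally show "1 < n * \<gamma> ^ (k - 1)" using assms(1) by (simp add: mult_ac)
  have "(\<gamma> ^ k * S - 1 / (1 - \<gamma>)) * n \<le> zval S G k * n"
    unfolding \<gamma>_def of_nat_mult using zval_ge[OF assms(1,2)] by (intro mult_right_mono) auto
  also have "\<dots> \<le> S" using k by (simp only: of_nat_mult[symmetric] of_nat_le_iff)
  finally have "(\<gamma> ^ k * S - 1 / (1 - \<gamma>)) * n / S \<le> 1" using assms(1) by simp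
  moreover have "(\<gamma> ^ k * S - 1 / (1 - \<gamma>)) * n / S = (\<gamma> ^ k - 1 / (S * (1 - \<gamma>))) * n"
    using assms(1) \<gamma> by (simp add: field_simps)
  ultimately show "(\<gamma> ^ k - 1 / (S * (1 - \<gamma>))) * n \<le> 1" by simp
qed


text \<open>\<open>2 powr (w / 8 - 1)\<close> is a lower bound for the scale, and
  \<open>2 powr (w / 64)\<close> will bound \<open>n\<close> and \<open>d\<close>. Everything holds
  eventually because 1/8 exceeds 2/64.\<close>

lemma eventually_word_size:
  fixes b1 b2 K :: real
  assumes "0 < b2" "b2 < b1" "b1 < 1"
  shows "\<forall>\<^sub>F w :: nat in sequentially. 2 \<le> b1 * 2 powr (w / 8 - 1) \<and> 1 \<le> (b1 - b2) * 2 powr (w / 8 - 1) \<and>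
    2 \<le> (1 - b2) * 2 powr (w / 8 - 1) \<and> w * (2 / b1 + 2 powr (w / 64) + 2) \<le> 2 powr (w / 8 - 1) \<and>
    w \<le> b2 * 2 powr (w / 8 - 1) \<and> 2 powr (w / 64) * (2 / (1 - b2)) \<le> 2 powr (w / 8 - 1) \<and>
    K * w * 2 powr (w / 64) * 2 powr (w / 64) \<le> 2 powr (w / 8 - 1) \<and> 256 \<le> w"
proof (intro eventually_conj)
  show "\<forall>\<^sub>F w :: nat in sequentially. 2 \<le> b1 * 2 powr (w / 8 - 1)" using assms by real_asymp
  show "\<forall>\<^sub>F w :: nat in sequentially. 1 \<le> (b1 - b2) * 2 powr (w / 8 - 1)"
  proof -
    have "0 < b1 - b2" using assms by simp
    then show ?thesis by real_asymp
  qed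
  show "\<forall>\<^sub>F w :: nat in sequentially. 2 \<le> (1 - b2) * 2 powr (w / 8 - 1)"
  proof -
    have "0 < 1 - b2" using assms by simp
    then show ?thesis by real_asymp
  qed
  show "\<forall>\<^sub>F w :: nat in sequentially. w * (2 / b1 + 2 powr (w / 64) + 2) \<le> 2 powr (w / 8 - 1)" by real_asymp
  show "\<forall>\<^sub>F w :: nat in sequentially. w \<le> b2 * 2 powr (w / 8 - 1)" using assms(1) by real_asymp
  show "\<forall>\<^sub>F w :: nat in sequentially. 2 powr (w / 64) * (2 / (1 - b2)) \<le> 2 powr (w / 8 - 1)" by real_asymp
  show "\<forall>\<^sub>F w :: nat in sequentially. K * w * 2 powr (w / 64) * 2 powr (w / 64) \<le> 2 powr (w / 8 - 1)" by real_asymp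
  show "\<forall>\<^sub>F w :: nat in sequentially. 256 \<le> real w" by real_asymp
qed

text \<open>The constants \<open>c0\<close> and \<open>C\<close> do not depend on \<open>w\<close>,
  \<open>n\<close> or \<open>d\<close>. The crux is that rounding errors, amplified over
  \<open>k\<close> levels, remain within a constant factor of \<open>n powr \<rho>\<close>.\<close>

lemma parameters:
  fixes b1 b2 \<rho> :: real and K :: nat
  assumes "0 < b2" and "b2 < b1" and "b1 < 1" and \<rho>: "\<rho> = ln (1 / b1) / ln (1 / b2)"
  shows "\<exists>c0>0. \<exists>C>0. \<forall>w n d. 2 \<le> n \<and> c0 * log 2 (real (max n d)) \<le> real w \<longrightarrow>
    (let S = scale w; B = fixpt b1 w; G = fixpt b2 w + 1; k = levels S G n; A = growth S B d; y = yval S A k in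
      256 \<le> w \<and> 0 < B \<and> real B \<le> b1 * S \<and> real G \<le> b1 * S \<and> G < S \<and> b2 * S < G \<and>
      n + d + 2 \<le> S \<and> (G / S) ^ k * n \<le> 2 \<and> real y \<le> C * n powr \<rho> \<and> k + 1 \<le> C * log 2 n \<and>
      K * n * (16 * (k + 1)) * y \<le> S)"
proof -
  \<comment> \<open>The midpoint between \<open>b2\<close> and 1 bounds the rounded
    \<open>\<gamma>\<close> independently of \<open>w\<close>, which gives a first, crude bound on
    the height.\<close>
  define g where "g = (1 + b2) / 2"
  have g: "0 < g" "g < 1" "b2 < g" using assms by (auto simp: g_def)
  define \<eta> where "\<eta> = ln (1 / g)"
  have \<eta>: "0 < \<eta>" using g by (simp add: \<eta>_def)
  \<comment> \<open>Chosen such that \<open>k \<le> \<kappa> * w\<close>; then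
    \<open>(1 + 1 / w) ^ k \<le> exp \<kappa> = ce\<close>.\<close>
  define \<kappa> where "\<kappa> = 1 + 1 / \<eta>"
  define ce where "ce = exp \<kappa>"
  define C1 where "C1 = ce / b1 * ce powr \<rho>"
  define C2 where "C2 = C1 / (1 - b1)"
  define K' where "K' = K * (16 * (\<kappa> + 1)) * C2"
  have \<kappa>: "1 < \<kappa>" using \<eta> by (simp add: \<kappa>_def)
  have ce: "1 < ce" using \<kappa> by (simp add: ce_def)
  have C1: "0 < C1" using ce assms by (simp add: C1_def)
  have C2: "0 < C2" using C1 assms by (simp add: C2_def)
  have \<rho>01: "0 < \<rho>" "\<rho> < 1"
    using assms(1-3) unfolding \<rho> by (auto simp: ln_div divide_simps)
  define Q where "Q w \<longleftrightarrow> 2 \<le> b1 * 2 powr (w / 8 - 1) \<and> 1 \<le> (b1 - b2) * 2 powr (w / 8 - 1) \<and>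
    2 \<le> (1 - b2) * 2 powr (w / 8 - 1) \<and> w * (2 / b1 + 2 powr (w / 64) + 2) \<le> 2 powr (w / 8 - 1) \<and>
    w \<le> b2 * 2 powr (w / 8 - 1) \<and> 2 powr (w / 64) * (2 / (1 - b2)) \<le> 2 powr (w / 8 - 1) \<and>
    K' * w * 2 powr (w / 64) * 2 powr (w / 64) \<le> 2 powr (w / 8 - 1) \<and> 256 \<le> real w" for w :: nat
  have "eventually Q sequentially"
    unfolding Q_def using eventually_word_size[OF assms(1-3), of K'] .
  then obtain W where W: "\<And>w. W \<le> w \<Longrightarrow> Q w" unfolding eventually_sequentially by blast
  \<comment> \<open>The logarithm is at least 1, so \<open>W\<close> makes \<open>w\<close> large
    enough for all asymptotic conditions, and 64 yields
    \<open>max n d \<le> 2 powr (w / 64)\<close>.\<close>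
  define c0 where "c0 = real W + 64"
  define C where "C = max C2 (\<kappa> + 1 + 1 / \<eta>)"
  show ?thesis
  proof (rule exI[of _ c0], intro conjI exI[of _ C] allI impI)
    show "0 < c0" by (simp add: c0_def)
    show "0 < C" using C2 by (simp add: C_def)
    fix w n d :: nat
    assume asm: "2 \<le> n \<and> c0 * log 2 (real (max n d)) \<le> real w"
    define S B G where "S = scale w" and "B = fixpt b1 w" and "G = fixpt b2 w + 1"
    define k where "k = levels S G n"
    define A where "A = growth S B d"
    define y where "y = yval S A k"
    define \<sigma> where "\<sigma> = 2 powr (w / 8 - 1)"
    define \<gamma> \<alpha> where "\<gamma> = G / S" and "\<alpha> = A / S"
    have n2: "2 \<le> n" using asm by simp
    have m2: "2 \<le> max n d" using n2 by simp
    have lg: "1 \<le> log 2 (real (max n d))" using m2 by simp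
    have "c0 * 1 \<le> c0 * log 2 (real (max n d))" using lg by (intro mult_left_mono) (auto simp: c0_def)
    then have "c0 \<le> w" using asm by simp
    then have "W \<le> w" by (simp add: c0_def)
    note w' = W[OF this, unfolded Q_def, folded \<sigma>_def]
    have w: "2 \<le> b1 * \<sigma>" "1 \<le> (b1 - b2) * \<sigma>" "2 \<le> (1 - b2) * \<sigma>"
      "w * (2 / b1 + 2 powr (w / 64) + 2) \<le> \<sigma>" "w \<le> b2 * \<sigma>" "2 powr (w / 64) * (2 / (1 - b2)) \<le> \<sigma>"
      "K' * w * 2 powr (w / 64) * 2 powr (w / 64) \<le> \<sigma>" "256 \<le> w"
      by (insert w', elim conjE, assumption, elim conjE, assumption, elim conjE, assumption,
        elim conjE, assumption, elim conjE, assumption, elim conjE, assumption,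
        elim conjE, assumption, elim conjE, linarith)
    have \<sigma>S: "\<sigma> \<le> S" unfolding \<sigma>_def S_def by (rule scale_ge)
    have \<sigma>0: "0 < \<sigma>" by (simp add: \<sigma>_def)
    then have Spos: "0 < S" using \<sigma>S by (simp add: S_def scale_def)
    have nd: "real (max n d) \<le> 2 powr (w / 64)"
    proof -
      have "64 * log 2 (real (max n d)) \<le> c0 * log 2 (real (max n d))"
        using lg by (intro mult_right_mono) (auto simp: c0_def)
      then have "log 2 (real (max n d)) \<le> w / 64" using asm by simp
      then have "2 powr log 2 (real (max n d)) \<le> 2 powr (w / 64)" by (intro powr_mono) auto
      then show ?thesis using m2 by simp
    qed
    then have nN: "real n \<le> 2 powr (w / 64)" and dN: "real d \<le> 2 powr (w / 64)" by auto
    have mS: "c * \<sigma> \<le> c * S" if "0 \<le> c" for c using that \<sigma>S by (rule mult_left_mono[rotated])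
    have wS: "2 \<le> b1 * S" "1 \<le> (b1 - b2) * S" "2 \<le> (1 - b2) * S" "w \<le> b2 * S"
      by (rule order_trans[OF _ mS]; use w(1,2,3,5) assms(1-3) in simp)+
    have B: "real B \<le> b1 * S" "b1 * S - 1 \<le> B"
      using wS(1) unfolding B_def fixpt_def S_def[symmetric] by linarith+
    have Bpos: "0 < B" using B wS(1) by linarith
    have B2: "b1 * S / 2 \<le> B" using B wS(1) by linarith
    have G: "b2 * S < G" "real G \<le> b2 * S + 1"
    proof -
      have "0 \<le> b2 * S" using assms by simp
      then show "b2 * S < G" "real G \<le> b2 * S + 1" unfolding G_def fixpt_def S_def[symmetric] by linarith+
    qed
    have Gb1: "real G \<le> b1 * S" using G(2) wS(2) by (simp add: left_diff_distrib)
    have "b1 * S < S" using assms Spos by simp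
    then have GS: "G < S" using Gb1 by linarith
    have \<gamma>: "b2 < \<gamma>" "\<gamma> \<le> b2 + 1 / S" using G Spos by (auto simp: \<gamma>_def field_simps)
    have \<gamma>g: "\<gamma> \<le> g"
    proof -
      have "1 / S \<le> (1 - b2) / 2" using wS(3) Spos by (simp add: field_simps)
      then show ?thesis using \<gamma>(2) by (simp add: g_def field_simps)
    qed
    have \<gamma>0: "0 < \<gamma>" "\<gamma> < 1" using \<gamma>(1) \<gamma>g g assms by auto
    have Gpos: "0 < G" by (simp add: G_def)
    note lb = levels_bounds[OF Spos GS Gpos n2, folded k_def \<gamma>_def]
    \<comment> \<open>Bounds the accumulated rounding error in \<open>levels_bounds\<close> by 1,
      whence \<open>\<gamma> ^ k * n \<le> 2\<close>.\<close>
    have nS1: "n \<le> S * (1 - \<gamma>)"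
    proof -
      have "real n * (2 / (1 - b2)) \<le> 2 powr (w / 64) * (2 / (1 - b2))" using nN assms by (intro mult_right_mono) auto
      also have "\<dots> \<le> S" using w(6) \<sigma>S by simp
      finally have "real n \<le> S * ((1 - b2) / 2)" using assms by (simp add: field_simps)
      also have "\<dots> \<le> S * (1 - \<gamma>)" using \<gamma>g by (intro mult_left_mono) (auto simp: g_def field_simps)
      finally show ?thesis .
    qed
    have \<gamma>k: "\<gamma> ^ k * n \<le> 2"
    proof -
      have "\<gamma> ^ k * n \<le> 1 + n / (S * (1 - \<gamma>))" using lb(5) by (simp add: field_simps)
      also have "n / (S * (1 - \<gamma>)) \<le> 1" using nS1 n2 by (subst divide_le_eq_1) auto
      finally show ?thesis by simp
    qed
    \<comment> \<open>Here \<open>\<gamma>\<close> is replaced by \<open>g\<close>, so the constant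
      in \<open>k = O(log n)\<close> does not depend on \<open>w\<close>.\<close>
    have kln: "(k - 1) * \<eta> \<le> ln n"
    proof -
      have "1 < n * g ^ (k - 1)"
      proof -
        have "\<gamma> ^ (k - 1) \<le> g ^ (k - 1)" using \<gamma>0 \<gamma>g by (intro power_mono) auto
        then have "n * \<gamma> ^ (k - 1) \<le> n * g ^ (k - 1)" by (intro mult_left_mono) auto
        then show ?thesis using lb(4) by linarith
      qed
      then have "0 < ln (n * g ^ (k - 1))" by (rule ln_gt_zero)
      also have "ln (n * g ^ (k - 1)) = ln n + (k - 1) * ln g"
        using n2 g by (simp add: ln_mult ln_realpow)
      finally show ?thesis using g by (simp add: \<eta>_def ln_div)
    qed
    then have k1: "k \<le> 1 + ln n / \<eta>" using \<eta> lb(3) by (simp add: field_simps of_nat_diff)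
    have lnw: "ln n \<le> w"
    proof -
      have "ln n \<le> ln (2 powr (w / 64))" using nN n2 by (subst ln_le_cancel_iff) auto
      also have "\<dots> = w / 64 * ln 2" by (simp add: ln_powr)
      also have "\<dots> \<le> w / 64 * 1" using ln_2_less_1 by (intro mult_left_mono) auto
      also have "\<dots> \<le> w" by simp
      finally show ?thesis .
    qed
    have kw: "k \<le> \<kappa> * w"
    proof -
      have "ln n / \<eta> \<le> w / \<eta>" using lnw \<eta> by (intro divide_right_mono) auto
      then have "k \<le> 1 + w / \<eta>" using k1 by linarith
      also have "\<dots> \<le> w + w / \<eta>" using w(8) by simp
      finally show ?thesis by (simp add: \<kappa>_def distrib_right)
    qed
    have pow: "(1 + 1 / w) ^ i \<le> ce" if "i \<le> k" for i
    proof -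
      have "(1 + 1 / w) ^ i \<le> exp (1 / w) ^ i" by (intro power_mono) auto
      also have "\<dots> = exp (i * (1 / w))" by (simp only: exp_of_nat_mult)
      also have "\<dots> \<le> exp \<kappa>" using that kw w(8) by (simp add: field_simps)
      finally show ?thesis by (simp add: ce_def)
    qed
    \<comment> \<open>Now the sharp comparison \<open>\<gamma> \<le> b2 * (1 + 1 / w)\<close> is
      used instead of \<open>g\<close>: the exponent needs the true base \<open>b2\<close>, up to
      the constant \<open>ce\<close>.\<close>
    have b2k: "(1 / b2) ^ (k - 1) \<le> ce * n"
    proof -
      have "1 / S \<le> b2 / w" using wS(4) Spos w(8) by (simp add: field_simps)
      then have "\<gamma> \<le> b2 * (1 + 1 / w)" using \<gamma>(2) by (simp add: distrib_left)
      then have "\<gamma> ^ (k - 1) \<le> (b2 * (1 + 1 / w)) ^ (k - 1)" using \<gamma>0 by (intro power_mono) auto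
      also have "\<dots> \<le> b2 ^ (k - 1) * ce"
        unfolding power_mult_distrib using assms pow[of "k - 1"] by (intro mult_left_mono) auto
      finally have "n * \<gamma> ^ (k - 1) \<le> n * (b2 ^ (k - 1) * ce)" by (intro mult_left_mono) auto
      then have "1 \<le> n * (b2 ^ (k - 1) * ce)" using lb(4) by linarith
      then show ?thesis using assms(1) by (simp add: power_one_over field_simps)
    qed
    \<comment> \<open>This is where \<open>\<rho>\<close> enters:
      \<open>(1 / b2) powr \<rho> = 1 / b1\<close>, so raising the previous bound to the power
      \<open>\<rho>\<close> changes the base.\<close>
    have b1k: "(1 / b1) ^ (k - 1) \<le> ce powr \<rho> * n powr \<rho>"
    proof -
      have "ln (1 / b1) = \<rho> * ln (1 / b2)" using assms(1-3) unfolding \<rho> by simp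
      then have "exp (\<rho> * ln (1 / b2)) = 1 / b1" using assms(1,2) by (metis exp_ln divide_pos_pos less_trans zero_less_one)
      then have pb: "(1 / b2) powr \<rho> = 1 / b1" using assms(1) by (simp add: powr_def)
      have pos: "0 < 1 / b2" using assms(1) by simp
      have "((1 / b2) ^ (k - 1)) powr \<rho> = (1 / b2) powr (real (k - 1) * \<rho>)"
        unfolding powr_realpow[OF pos, symmetric] by (rule powr_powr)
      also have "\<dots> = ((1 / b2) powr \<rho>) powr real (k - 1)" by (simp add: powr_powr mult.commute)
      also have "\<dots> = (1 / b1) ^ (k - 1)" unfolding pb using assms(1,2) by (intro powr_realpow) auto
      finally have "(1 / b1) ^ (k - 1) = ((1 / b2) ^ (k - 1)) powr \<rho>" ..
      also have "\<dots> \<le> (ce * n) powr \<rho>" using b2k \<rho>01 assms(1) by (intro powr_mono2) auto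
      also have "\<dots> = ce powr \<rho> * n powr \<rho>" using ce by (simp add: powr_mult)
      finally show ?thesis .
    qed
    have A1: "S / B \<le> \<alpha>"
    proof -
      have "real (S * S) / B \<le> A" using nat_div_ge[of "S * S" B] by (simp add: A_def growth_def)
      then have "real (S * S) / B / S \<le> \<alpha>" unfolding \<alpha>_def by (intro divide_right_mono) auto
      then show ?thesis using Spos by simp
    qed
    have \<alpha>1: "1 / b1 \<le> \<alpha>"
    proof -
      have "1 / b1 \<le> S / B" using B Bpos assms by (simp add: field_simps)
      then show ?thesis using A1 by simp
    qed
    have b1i: "1 < 1 / b1" using assms by simp
    then have \<alpha>gt: "1 < \<alpha>" using \<alpha>1 by linarith
    then have AS: "S < A" using Spos by (simp add: \<alpha>_def)
    \<comment> \<open>Two errors are collected, the truncation of \<open>b1\<close> to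
      \<open>B\<close> and the slack \<open>d + 1\<close> in \<open>growth\<close>. Both are of
      order \<open>1 / S\<close> relative to \<open>2 / b1 + d + 1\<close>, hence at most
      \<open>1 / w\<close> in total.\<close>
    have \<alpha>2: "\<alpha> * b1 \<le> 1 + 1 / w"
    proof -
      have "real A \<le> real (S * S) / B + d + 1"
        using of_nat_div_le_of_nat[of "S * S" B] by (simp add: A_def growth_def)
      then have "\<alpha> \<le> (real (S * S) / B + d + 1) / S" unfolding \<alpha>_def by (intro divide_right_mono) auto
      also have "\<dots> = S / B + (d + 1) / S" using Spos by (simp add: field_simps)
      finally have "\<alpha> * b1 \<le> (S / B + (d + 1) / S) * b1" using assms by (intro mult_right_mono) auto
      also have "\<dots> = b1 * S / B + b1 * ((d + 1) / S)" by (simp add: field_simps)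
      also have "b1 * S / B \<le> 1 + 2 / (b1 * S)"
      proof -
        have "b1 * S / B \<le> (B + 1) / B" using B by (intro divide_right_mono) auto
        also have "\<dots> = 1 + 1 / B" using Bpos by (simp add: field_simps)
        also have "1 / B \<le> 1 / (b1 * S / 2)" using B2 Bpos wS(1) by (intro divide_left_mono) auto
        finally show ?thesis by simp
      qed
      also have "b1 * ((d + 1) / S) \<le> (d + 1) / S" using assms by (intro mult_left_le_one_le) auto
      finally have "\<alpha> * b1 \<le> 1 + (2 / b1 + (d + 1)) / S" by (simp add: add_divide_distrib algebra_simps)
      also have "(2 / b1 + (d + 1)) / S \<le> 1 / w"
      proof -
        have "w * (2 / b1 + (d + 1)) \<le> w * (2 / b1 + 2 powr (w / 64) + 2)"
          using dN by (intro mult_left_mono) auto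
        also have "\<dots> \<le> S" using w(4) \<sigma>S by simp
        finally show ?thesis using Spos w(8) by (simp add: field_simps)
      qed
      finally show ?thesis by simp
    qed
    have \<alpha>k: "\<alpha> ^ k \<le> C1 * n powr \<rho>"
    proof -
      have "(\<alpha> * b1) ^ k \<le> (1 + 1 / w) ^ k" using \<alpha>2 \<alpha>gt assms by (intro power_mono) auto
      then have "(\<alpha> * b1) ^ k \<le> ce" using pow[of k] by linarith
      then have "\<alpha> ^ k \<le> ce * (1 / b1) ^ k"
        using assms by (simp add: power_mult_distrib power_one_over field_simps)
      also have "(1 / b1) ^ k = 1 / b1 * (1 / b1) ^ (k - 1)" using lb(3) by (cases k) auto
      also have "ce * (1 / b1 * (1 / b1) ^ (k - 1)) \<le> ce * (1 / b1 * (ce powr \<rho> * n powr \<rho>))"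
        using b1k ce assms by (intro mult_left_mono) auto
      finally show ?thesis by (simp add: C1_def)
    qed
    have y: "y \<le> C2 * n powr \<rho>"
    proof -
      have "y \<le> \<alpha> ^ k * (1 + 1 / (\<alpha> - 1))" unfolding y_def \<alpha>_def by (rule yval_le[OF Spos AS])
      \<comment> \<open>The geometric factor of \<open>yval_le\<close> is bounded through
        \<open>\<alpha> \<ge> 1 / b1\<close>.\<close>
      also have "1 + 1 / (\<alpha> - 1) \<le> 1 / (1 - b1)"
      proof -
        have "1 / (\<alpha> - 1) \<le> 1 / (1 / b1 - 1)" using \<alpha>1 b1i \<alpha>gt by (intro divide_left_mono) auto
        also have "\<dots> = 1 / (1 - b1) - 1" using assms by (simp add: field_simps)
        finally show ?thesis by simp
      qed
      also have "\<alpha> ^ k * (1 / (1 - b1)) \<le> C1 * n powr \<rho> * (1 / (1 - b1))"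
        using \<alpha>k assms by (intro mult_right_mono) auto
      finally show ?thesis using \<alpha>gt by (simp add: C2_def mult_left_mono)
    qed
    have nX: "real (K * n * (16 * (k + 1)) * y) \<le> S"
    proof -
      \<comment> \<open>To make \<open>X\<close> fit below \<open>S\<close>, the crude estimate
        \<open>\<rho> < 1\<close> suffices.\<close>
      have "n powr \<rho> \<le> n powr 1" using \<rho>01 n2 by (intro powr_mono) auto
      then have "y \<le> C2 * n" using y C2 n2 by (smt (verit) mult_left_mono powr_one_gt_zero_iff powr_one of_nat_0_le_iff)
      also have "\<dots> \<le> C2 * 2 powr (w / 64)" using nN C2 by (intro mult_left_mono) auto
      finally have y': "y \<le> C2 * 2 powr (w / 64)" .
      have k': "k + 1 \<le> (\<kappa> + 1) * w" using kw w(8) by (simp add: distrib_right)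
      have "real (K * n * (16 * (k + 1)) * y) = K * (16 * real (k + 1)) * n * y" by simp
      also have "\<dots> \<le> K * (16 * ((\<kappa> + 1) * w)) * 2 powr (w / 64) * (C2 * 2 powr (w / 64))"
        using k' nN y' \<kappa> by (intro mult_mono) auto
      also have "\<dots> = K' * w * 2 powr (w / 64) * 2 powr (w / 64)" by (simp add: K'_def)
      also have "\<dots> \<le> S" using w(7) \<sigma>S by simp
      finally show ?thesis .
    qed
    then have nX': "K * n * (16 * (k + 1)) * y \<le> S" by (simp only: of_nat_le_iff)
    have nd2: "n + d + 2 \<le> S"
    proof -
      have "256 * (2 / b1 + 2 powr (w / 64) + 2) \<le> w * (2 / b1 + 2 powr (w / 64) + 2)"
        using w(8) assms by (intro mult_right_mono add_nonneg_nonneg) auto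
      then have "256 * (2 / b1) + 256 * 2 powr (w / 64) + 512 \<le> S" using w(4) \<sigma>S by simp
      moreover have "0 \<le> 256 * (2 / b1)" using assms by simp
      ultimately show ?thesis using nN dN by linarith
    qed
    have klog: "k + 1 \<le> C * log 2 n"
    proof -
      have l1: "1 \<le> log 2 n" using n2 by simp
      have "ln n \<le> log 2 n"
      proof -
        have "ln n = log 2 n * ln 2" by (simp add: log_def)
        also have "\<dots> \<le> log 2 n * 1" using l1 ln_2_less_1 by (intro mult_left_mono) auto
        finally show ?thesis by simp
      qed
      then have "ln n / \<eta> \<le> log 2 n / \<eta>" using \<eta> by (intro divide_right_mono) auto
      then have "k + 1 \<le> 2 * log 2 n + log 2 n / \<eta>" using k1 l1 by linarith
      also have "\<dots> = (\<kappa> + 1) * log 2 n" by (simp add: \<kappa>_def distrib_right)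
      also have "\<dots> \<le> C * log 2 n" using l1 \<eta> by (intro mult_right_mono) (auto simp: C_def le_max_iff_disj)
      finally show ?thesis .
    qed
    have "C2 * n powr \<rho> \<le> C * n powr \<rho>" by (intro mult_right_mono) (auto simp: C_def)
    then have yC: "y \<le> C * n powr \<rho>" using y by linarith
    show "let S = scale w; B = fixpt b1 w; G = fixpt b2 w + 1; k = levels S G n; A = growth S B d; y = yval S A k in
      256 \<le> w \<and> 0 < B \<and> real B \<le> b1 * S \<and> real G \<le> b1 * S \<and> G < S \<and> b2 * S < G \<and>
      n + d + 2 \<le> S \<and> (G / S) ^ k * n \<le> 2 \<and> real y \<le> C * n powr \<rho> \<and> k + 1 \<le> C * log 2 n \<and>
      K * n * (16 * (k + 1)) * y \<le> S"
      unfolding Let_def S_def[symmetric] B_def[symmetric] G_def[symmetric] k_def[symmetric]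
        A_def[symmetric] y_def[symmetric]
      using w(8) Bpos B(1) Gb1 GS G(1) nd2 \<gamma>k yC klog nX'
      by (auto simp: \<gamma>_def simp flip: of_nat_le_iff)
  qed
qed

section \<open>One problem instance: memory layout and overflow-free arithmetic\<close>

text \<open>\<open>L\<close> trees have about \<open>L * y\<close> nodes per data point, so
  \<open>X\<close> allows \<open>K\<close> times the order of the expected total size;
  \<open>Kf\<close> plays the same role for the step budget of a query.\<close>

locale search_inst =
  fixes b1 b2 :: real and K Kf w d :: nat and xs :: "nat set list" and n S B G k A y L X :: nat
  defines "n \<equiv> length xs" and "S \<equiv> scale w" and "B \<equiv> fixpt b1 w" and "G \<equiv> fixpt b2 w + 1"
    and "k \<equiv> levels S G n" and "A \<equiv> growth S B d" and "y \<equiv> yval S A k"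
    and "L \<equiv> 16 * (k + 1)" and "X \<equiv> K * n * L * y"
  assumes distinct_xs: "distinct xs" and xs_sub: "x \<in> set xs \<Longrightarrow> x \<subseteq> {1..d}" and n2: "2 \<le> n"
    and b: "0 < b2" "b2 < b1" "b1 < 1"
    and w256: "256 \<le> w" and B_pos': "0 < B" and B_le: "real B \<le> b1 * S" and G_le: "real G \<le> b1 * S"
    and G_less: "G < S" and G_gt: "b2 * S < G" and nd: "n + d + 2 \<le> S"
    and Gk: "(G / S) ^ k * n \<le> 2" and X_le: "X \<le> S" and unit_le: "Kf * L * y \<le> S"
    and K1: "1 \<le> K"
begin

lemma S_ge: "2 ^ 32 \<le> S"
proof -
  have "32 \<le> w div 8" using w256 by simp
  then show ?thesis unfolding S_def scale_def by (intro power_increasing) auto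
qed

lemma S_big: "1000 \<le> S" using S_ge by simp

lemma d1: "1 \<le> d"
proof (rule ccontr)
  assume "\<not> 1 \<le> d"
  then have "set xs \<subseteq> {{}}" using xs_sub by fastforce
  then have "card (set xs) \<le> 1" using card_mono[of "{{}}" "set xs"] by simp
  then show False using n2 distinct_card[OF distinct_xs] by (simp add: n_def)
qed

sublocale chosen_path S B d k L "set xs"
  using S_ge B_pos' d1 xs_sub by unfold_locales auto

lemma y1: "1 \<le> y"
proof -
  have "1 \<le> yval S A i" for i by (cases i) auto
  then show ?thesis by (simp add: y_def)
qed

lemma L1: "1 \<le> L" by (simp add: L_def)

lemma L_le_X: "L \<le> X"
proof -
  have "0 < K * n * y" using K1 n2 y1 by simp
  then have "1 * L \<le> K * n * y * L" by (intro mult_le_mono1) simp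
  then show ?thesis by (simp add: X_def mult_ac)
qed

lemma dvd_S: "S dvd 2 ^ w"
  unfolding S_def scale_def by (rule le_imp_power_dvd) simp

text \<open>The number of buckets is the least power of 2 that is at least \<open>X\<close>, so that
  a bucket index is a right shift.\<close>

definition lgM :: nat where "lgM = (LEAST l. X \<le> 2 ^ l)"
definition M :: nat where "M = 2 ^ lgM"

lemma X_le_M: "X \<le> M"
  unfolding M_def lgM_def by (rule LeastI[of _ X]) (simp add: less_imp_le)

lemma lgM_less: "i < lgM \<Longrightarrow> 2 ^ i < X"
  unfolding lgM_def using not_less_Least by (meson not_le)

lemma M_le: "M \<le> 2 * X"
proof (cases lgM)
  case 0
  then show ?thesis using L1 L_le_X by (simp add: M_def)
next
  case (Suc l)
  then show ?thesis using lgM_less[of l] by (simp add: M_def)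
qed

lemma S8: "S ^ 8 \<le> 2 ^ w" unfolding S_def by (rule scale_power)

lemma S_pow: "i \<le> 8 \<Longrightarrow> S ^ i \<le> 2 ^ w"
  using S8 S_big power_increasing[of i 8 S] by linarith

lemma lgM_le: "lgM \<le> w"
proof -
  have "S ^ 2 \<le> 2 ^ w" using S_pow[of 2] by simp
  then have "S * S \<le> 2 ^ w" by (simp add: power2_eq_square)
  moreover have "2 * S \<le> S * S" using S_big by simp
  ultimately have "M \<le> 2 ^ w" using M_le X_le by linarith
  then show ?thesis unfolding M_def by (simp add: power_le_imp_le_exp)
qed

text \<open>The input stays in place and is part of the data structure, so the answer can be an
  address into it. The offset 4 skips the cells of \<open>n\<close>, \<open>d\<close> and the two
  constants.\<close>

definition adr :: "nat \<Rightarrow> nat" where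
  "adr i = 4 + (\<Sum>j<i. Suc (card (xs ! j)))"

text \<open>The data structure consists of the input, 16 cells of parameters at \<open>Iv\<close>,
  the bucket heads at \<open>H0\<close>, and \<open>X\<close> records of 5 cells at
  \<open>E0\<close>; it ends at \<open>sz\<close>.\<close>

definition Iv :: nat where "Iv = adr n"
definition H0 :: nat where "H0 = Iv + 16"
definition E0 :: nat where "E0 = H0 + M"
definition sz :: nat where "sz = E0 + 5 * X"
text \<open>Scratch arrays of preprocessing start at multiples of \<open>Z\<close>, far beyond
  \<open>sz\<close> and far enough apart for arrays of size \<open>S * S\<close>.\<close>

definition Z :: nat where "Z = S * S * S"

lemma xs_card: "i < n \<Longrightarrow> card (xs ! i) \<le> d"
  using xs_sub[of "xs ! i"] card_mono[of "{1..d}" "xs ! i"] by (simp add: n_def)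

lemma adr_mono: "i \<le> j \<Longrightarrow> adr i \<le> adr j"
  unfolding adr_def by (intro add_left_mono sum_mono2) auto

lemma adr_Suc: "adr (Suc i) = adr i + Suc (card (xs ! i))"
  by (simp add: adr_def)

lemma adr_ge: "4 \<le> adr i" by (simp add: adr_def)

lemma Iv_le: "Iv \<le> 4 + n * (d + 1)"
proof -
  have "(\<Sum>j<n. Suc (card (xs ! j))) \<le> (\<Sum>j<n. d + 1)" by (intro sum_mono) (use xs_card in auto)
  then show ?thesis by (simp add: Iv_def adr_def)
qed

lemma SS_big: "1000 * S \<le> S * S" "1000 * (S * S) \<le> Z" "1000 * Z \<le> 2 ^ w"
proof -
  show "1000 * S \<le> S * S" "1000 * (S * S) \<le> Z" using S_big by (auto simp: Z_def)
  have "1000 * Z \<le> S * Z" using S_big by simp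
  also have "\<dots> = S ^ 4" by (simp add: Z_def eval_nat_numeral)
  also have "\<dots> \<le> 2 ^ w" by (rule S_pow) simp
  finally show "1000 * Z \<le> 2 ^ w" .
qed

lemma prod_le_SS: "a \<le> S \<Longrightarrow> b \<le> S \<Longrightarrow> a * b \<le> S * S"
  by (rule mult_le_mono)

lemma sz_le: "sz \<le> 2 * (S * S)"
proof -
  have "n * (d + 1) \<le> S * S" using nd by (intro prod_le_SS) auto
  then show ?thesis
    using Iv_le M_le X_le SS_big S_big unfolding sz_def E0_def H0_def by linarith
qed

text \<open>Memory as one function per region, so that a store becomes an update of a single
  component. From \<open>Z\<close> on these are: incidence matrix of data and coordinates, addresses
  of the data points, levels of nodes, and the matrix of which data point accepts which
  node.\<close>

definition mk :: "(nat \<Rightarrow> nat) \<Rightarrow> (nat \<Rightarrow> nat) \<Rightarrow> (nat \<Rightarrow> nat) \<Rightarrow> (nat \<Rightarrow> nat \<Rightarrow> nat) \<Rightarrow>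
    (nat \<Rightarrow> nat) \<Rightarrow> (nat \<Rightarrow> nat) \<Rightarrow> (nat \<Rightarrow> nat) \<Rightarrow> (nat \<Rightarrow> nat) \<Rightarrow> nat \<Rightarrow> nat" where
  "mk low ifo hds en inc ad lev mb a =
    (if a < Iv then low a else if a < H0 then ifo (a - Iv) else if a < E0 then hds (a - H0)
     else if a < Z then en ((a - E0) div 5) ((a - E0) mod 5) else if a < 2 * Z then inc (a - Z)
     else if a < 3 * Z then ad (a - 2 * Z) else if a < 4 * Z then lev (a - 3 * Z) else mb (a - 4 * Z))"

lemma E0_less: "E0 < Z" "Iv \<le> H0" "H0 \<le> E0" "sz \<le> Z" "E0 \<le> sz" "4 \<le> Iv"
  using sz_le SS_big S_big adr_ge[of n] by (auto simp: sz_def E0_def H0_def Iv_def)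

lemma H0_E0: "H0 = Iv + 16" "E0 = H0 + M"
  by (simp_all add: H0_def E0_def)

lemma mk_read:
  "a < Iv \<Longrightarrow> mk low ifo hds en inc ad lev mb a = low a"
  "i < 16 \<Longrightarrow> mk low ifo hds en inc ad lev mb (Iv + i) = ifo i"
  "i < M \<Longrightarrow> mk low ifo hds en inc ad lev mb (H0 + i) = hds i"
  "u < X \<Longrightarrow> f < 5 \<Longrightarrow> mk low ifo hds en inc ad lev mb (E0 + (5 * u + f)) = en u f"
  "i < Z \<Longrightarrow> mk low ifo hds en inc ad lev mb (Z + i) = inc i"
  "i < Z \<Longrightarrow> mk low ifo hds en inc ad lev mb (2 * Z + i) = ad i"
  "i < Z \<Longrightarrow> mk low ifo hds en inc ad lev mb (3 * Z + i) = lev i"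
  "mk low ifo hds en inc ad lev mb (4 * Z + i) = mb i"
  using E0_less by (auto simp: mk_def H0_def E0_def sz_def)

lemma mk_write:
  "a < Iv \<Longrightarrow> (mk low ifo hds en inc ad lev mb)(a := v) = mk (low(a := v)) ifo hds en inc ad lev mb"
  "i < 16 \<Longrightarrow> (mk low ifo hds en inc ad lev mb)(Iv + i := v) = mk low (ifo(i := v)) hds en inc ad lev mb"
  "i < M \<Longrightarrow> (mk low ifo hds en inc ad lev mb)(H0 + i := v) = mk low ifo (hds(i := v)) en inc ad lev mb"
  "u < X \<Longrightarrow> f < 5 \<Longrightarrow> (mk low ifo hds en inc ad lev mb)(E0 + (5 * u + f) := v) =
     mk low ifo hds (en(u := (en u)(f := v))) inc ad lev mb"
  "i < Z \<Longrightarrow> (mk low ifo hds en inc ad lev mb)(Z + i := v) = mk low ifo hds en (inc(i := v)) ad lev mb"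
  "i < Z \<Longrightarrow> (mk low ifo hds en inc ad lev mb)(2 * Z + i := v) = mk low ifo hds en inc (ad(i := v)) lev mb"
  "i < Z \<Longrightarrow> (mk low ifo hds en inc ad lev mb)(3 * Z + i := v) = mk low ifo hds en inc ad (lev(i := v)) mb"
  "(mk low ifo hds en inc ad lev mb)(4 * Z + i := v) = mk low ifo hds en inc ad lev (mb(i := v))"
proof -
  show "u < X \<Longrightarrow> f < 5 \<Longrightarrow> (mk low ifo hds en inc ad lev mb)(E0 + (5 * u + f) := v) =
     mk low ifo hds (en(u := (en u)(f := v))) inc ad lev mb"
  proof (rule ext)
    fix a assume uf: "u < X" "f < 5"
    show "((mk low ifo hds en inc ad lev mb)(E0 + (5 * u + f) := v)) a =
       mk low ifo hds (en(u := (en u)(f := v))) inc ad lev mb a"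
    proof (cases "E0 \<le> a")
      case True
      then obtain c where a: "a = E0 + c" using le_Suc_ex by blast
      have c: "c = 5 * u + f \<longleftrightarrow> c div 5 = u \<and> c mod 5 = f" using uf by auto
      show ?thesis using uf E0_less a c by (auto simp: mk_def sz_def)
    next
      case False
      then show ?thesis using E0_less by (auto simp: mk_def)
    qed
  qed
  show "a < Iv \<Longrightarrow> (mk low ifo hds en inc ad lev mb)(a := v) = mk (low(a := v)) ifo hds en inc ad lev mb"
  proof (rule ext)
    fix a'
    assume "a < Iv"
    show "((mk low ifo hds en inc ad lev mb)(a := v)) a' = (mk (low(a := v)) ifo hds en inc ad lev mb) a'"
      using \<open>a < Iv\<close> E0_less H0_E0 by (cases "a' = a") (simp_all add: mk_def, (linarith | simp)?)
  qed
  show "i < 16 \<Longrightarrow> (mk low ifo hds en inc ad lev mb)(Iv + i := v) = mk low (ifo(i := v)) hds en inc ad lev mb"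
  proof (rule ext)
    fix a'
    assume "i < 16"
    show "((mk low ifo hds en inc ad lev mb)(Iv + i := v)) a' = (mk low (ifo(i := v)) hds en inc ad lev mb) a'"
      using \<open>i < 16\<close> E0_less H0_E0 by (cases "a' = Iv + i") (simp_all add: mk_def, (linarith | simp)?)
  qed
  show "i < M \<Longrightarrow> (mk low ifo hds en inc ad lev mb)(H0 + i := v) = mk low ifo (hds(i := v)) en inc ad lev mb"
  proof (rule ext)
    fix a'
    assume "i < M"
    show "((mk low ifo hds en inc ad lev mb)(H0 + i := v)) a' = (mk low ifo (hds(i := v)) en inc ad lev mb) a'"
      using \<open>i < M\<close> E0_less H0_E0 by (cases "a' = H0 + i") (simp_all add: mk_def, (linarith | simp)?)
  qed
  show "i < Z \<Longrightarrow> (mk low ifo hds en inc ad lev mb)(Z + i := v) = mk low ifo hds en (inc(i := v)) ad lev mb"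
  proof (rule ext)
    fix a'
    assume "i < Z"
    show "((mk low ifo hds en inc ad lev mb)(Z + i := v)) a' = (mk low ifo hds en (inc(i := v)) ad lev mb) a'"
      using \<open>i < Z\<close> E0_less H0_E0 by (cases "a' = Z + i") (simp_all add: mk_def, (linarith | simp)?)
  qed
  show "i < Z \<Longrightarrow> (mk low ifo hds en inc ad lev mb)(2 * Z + i := v) = mk low ifo hds en inc (ad(i := v)) lev mb"
  proof (rule ext)
    fix a'
    assume "i < Z"
    show "((mk low ifo hds en inc ad lev mb)(2 * Z + i := v)) a' = (mk low ifo hds en inc (ad(i := v)) lev mb) a'"
      using \<open>i < Z\<close> E0_less H0_E0 by (cases "a' = 2 * Z + i") (simp_all add: mk_def, (linarith | simp)?)
  qed
  show "i < Z \<Longrightarrow> (mk low ifo hds en inc ad lev mb)(3 * Z + i := v) = mk low ifo hds en inc ad (lev(i := v)) mb"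
  proof (rule ext)
    fix a'
    assume "i < Z"
    show "((mk low ifo hds en inc ad lev mb)(3 * Z + i := v)) a' = (mk low ifo hds en inc ad (lev(i := v)) mb) a'"
      using \<open>i < Z\<close> E0_less H0_E0 by (cases "a' = 3 * Z + i") (simp_all add: mk_def, (linarith | simp)?)
  qed
  show "(mk low ifo hds en inc ad lev mb)(4 * Z + i := v) = mk low ifo hds en inc ad lev (mb(i := v))"
  proof (rule ext)
    fix a'
    show "((mk low ifo hds en inc ad lev mb)(4 * Z + i := v)) a' = (mk low ifo hds en inc ad lev (mb(i := v))) a'"
      using E0_less by (cases "a' = 4 * Z + i") (simp_all add: mk_def, (linarith | simp)?)
  qed
qed

lemma binops:
  "x + z < 2 ^ w \<Longrightarrow> binop_val w Add x z = x + z"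
  "x * z < 2 ^ w \<Longrightarrow> binop_val w Mul x z = x * z"
  "z \<le> x \<Longrightarrow> x < 2 ^ w \<Longrightarrow> binop_val w Sub x z = x - z"
  "x < 2 ^ w \<Longrightarrow> binop_val w Div x z = x div z"
  "x < 2 ^ w \<Longrightarrow> binop_val w Mod x z = x mod z"
  "x < 2 ^ w \<Longrightarrow> binop_val w Shr x z = x div 2 ^ z"
  "x * 2 ^ z < 2 ^ w \<Longrightarrow> binop_val w Shl x z = x * 2 ^ z"
  "binop_val w Less x z = of_bool (x < z)"
  "binop_val w Equal x z = of_bool (x = z)"
proof -
  have w1: "1 < (2::nat) ^ w" using w256 by (intro one_less_power) auto
  show "x + z < 2 ^ w \<Longrightarrow> binop_val w Add x z = x + z" "x * z < 2 ^ w \<Longrightarrow> binop_val w Mul x z = x * z"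
    "x * 2 ^ z < 2 ^ w \<Longrightarrow> binop_val w Shl x z = x * 2 ^ z" by simp_all
  show "binop_val w Less x z = of_bool (x < z)" "binop_val w Equal x z = of_bool (x = z)" using w1 by simp_all
  have "x div c \<le> x" "x mod c \<le> x" for c by simp_all
  then show "x < 2 ^ w \<Longrightarrow> binop_val w Div x z = x div z" "x < 2 ^ w \<Longrightarrow> binop_val w Mod x z = x mod z"
    "x < 2 ^ w \<Longrightarrow> binop_val w Shr x z = x div 2 ^ z"
    by (simp_all, meson le_less_trans mod_less)+
  show "z \<le> x \<Longrightarrow> x < 2 ^ w \<Longrightarrow> binop_val w Sub x z = x - z"
  proof -
    assume "z \<le> x" "x < 2 ^ w"
    then have "int x - int z = int (x - z)" by simp
    then have "(int x - int z) mod 2 ^ w = int ((x - z) mod 2 ^ w)" by (simp only: of_nat_mod of_nat_power of_nat_numeral)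
    also have "(x - z) mod 2 ^ w = x - z" using \<open>x < 2 ^ w\<close> by simp
    finally have "(int x - int z) mod 2 ^ w = int (x - z)" .
    then show ?thesis by simp
  qed
qed

end

section \<open>Preprocessing: constants and parameters\<close>

text \<open>The word size is not part of the input: doubling 1 overflows to 0 after exactly
  \<open>w\<close> rounds.\<close>

definition pre1 :: "cmd list" where
  "pre1 = [Const 1 1, Const 24 1, Const 25 0, WhileNZ 24 [Op Add 24 24 24, Op Add 25 25 1]]"

text \<open>Shifting the \<open>w\<close>-bit constants right by \<open>w - w div 8\<close> brings
  them to scale \<open>S\<close>; the second one is incremented so that \<open>G\<close> lies
  strictly above \<open>b2 * S\<close>.\<close>

definition pre2 :: "cmd list" where
  "pre2 = [Const 26 8, Op Div 26 25 26, Op Shl 4 1 26, Op Sub 26 25 26, Const 27 2, Load 5 27,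
    Op Shr 5 5 26, Const 27 3, Load 6 27, Op Shr 6 6 26, Op Add 6 6 1, Const 27 0, Load 2 27, Load 3 1,
    Op Add 23 3 1, Op Mul 21 4 4, Op Div 39 21 5, Op Add 39 39 23, Op Mul 16 21 4, Op Add 17 16 16,
    Op Add 18 17 16, Op Add 19 18 16]"

text \<open>One loop finds \<open>levels\<close> by stepping through \<open>zval\<close> and
  computes \<open>yval\<close> alongside, so no logarithm is evaluated.\<close>

definition pre3 :: "cmd list" where
  "pre3 = [Const 7 0, Const 8 1, Op Add 27 4 40, Op Mul 28 27 2, Op Less 28 4 28,
    WhileNZ 28 [Op Mul 27 27 6, Op Div 27 27 4, Op Mul 8 8 39, Op Div 8 8 4, Op Add 8 8 1,
      Op Add 7 7 1, Op Mul 28 27 2, Op Less 28 4 28]]"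

definition pre4 :: "nat \<Rightarrow> cmd list" where
  "pre4 K = [Op Add 9 7 1, Const 26 16, Op Mul 9 9 26, Const 26 K, Op Mul 10 26 2, Op Mul 10 10 9,
    Op Mul 10 10 8, Const 11 1, Op Add 12 25 40, Op Less 28 11 10,
    WhileNZ 28 [Op Add 11 11 11, Op Sub 12 12 1, Op Less 28 11 10]]"

declare binop_val.simps [simp del]

context search_inst
begin

definition input :: "nat list" where
  "input = [n, d, nat \<lfloor>b1 * 2 ^ w\<rfloor>, nat \<lfloor>b2 * 2 ^ w\<rfloor>] @ concat (map encode xs)"

definition low0 :: "nat \<Rightarrow> nat" where "low0 = mem_of input"

definition mem0 :: "nat \<Rightarrow> nat" where
  "mem0 = mk low0 (\<lambda>_. 0) (\<lambda>_. 0) (\<lambda>_ _. 0) (\<lambda>_. 0) (\<lambda>_. 0) (\<lambda>_. 0) (\<lambda>_. 0)"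

lemma finite_xs: "i < n \<Longrightarrow> finite (xs ! i)"
  using xs_sub[of "xs ! i"] finite_subset by (auto simp: n_def)

lemma length_encode: "i < n \<Longrightarrow> length (encode (xs ! i)) = Suc (card (xs ! i))"
  using finite_xs by (simp add: encode_def)

lemma length_concat_take:
  "i \<le> n \<Longrightarrow> 4 + length (concat (map encode (take i xs))) = adr i"
proof (induction i)
  case (Suc i)
  then have "take (Suc i) xs = take i xs @ [xs ! i]" by (intro take_Suc_conv_app_nth) (simp add: n_def)
  then show ?case using Suc length_encode[of i] by (simp add: adr_Suc)
qed (simp add: adr_def)

lemma length_input: "length input = Iv"
  using length_concat_take[of n] by (simp add: input_def Iv_def n_def)

lemma input_nth:
  assumes "i < n" "e \<le> card (xs ! i)"
  shows "input ! (adr i + e) = encode (xs ! i) ! e"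
proof -
  have "xs = take i xs @ xs ! i # drop (Suc i) xs"
    using assms by (intro id_take_nth_drop) (simp add: n_def)
  then have "concat (map encode xs) =
      concat (map encode (take i xs)) @ encode (xs ! i) @ concat (map encode (drop (Suc i) xs))"
    by (metis concat.simps(2) concat_append list.simps(9) map_append)
  then have inp: "input = ([n, d, nat \<lfloor>b1 * 2 ^ w\<rfloor>, nat \<lfloor>b2 * 2 ^ w\<rfloor>] @ concat (map encode (take i xs))) @
      encode (xs ! i) @ concat (map encode (drop (Suc i) xs))" by (simp add: input_def)
  have "length ([n, d, nat \<lfloor>b1 * 2 ^ w\<rfloor>, nat \<lfloor>b2 * 2 ^ w\<rfloor>] @ concat (map encode (take i xs))) = adr i"
    using length_concat_take[of i] assms by simp
  then show ?thesis
    unfolding inp using assms length_encode[of i]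
    by (metis nth_append_left nth_append_length_plus le_imp_less_Suc)
qed

lemma adr_less: "i < n \<Longrightarrow> e \<le> card (xs ! i) \<Longrightarrow> adr i + e < Iv"
  using adr_mono[of "Suc i" n] by (simp add: adr_Suc Iv_def)

lemma low0: "low0 0 = n" "low0 (Suc 0) = d" "low0 2 = nat \<lfloor>b1 * 2 ^ w\<rfloor>" "low0 3 = nat \<lfloor>b2 * 2 ^ w\<rfloor>"
  "i < n \<Longrightarrow> low0 (adr i) = card (xs ! i)"
  "i < n \<Longrightarrow> e < card (xs ! i) \<Longrightarrow> low0 (adr i + Suc e) = sorted_list_of_set (xs ! i) ! e"
proof -
  have "4 \<le> length input" using length_input E0_less by simp
  then show "low0 0 = n" "low0 (Suc 0) = d" "low0 2 = nat \<lfloor>b1 * 2 ^ w\<rfloor>" "low0 3 = nat \<lfloor>b2 * 2 ^ w\<rfloor>"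
    by (simp_all add: low0_def mem_of_def) (simp_all add: input_def eval_nat_numeral)
  show "low0 (adr i) = card (xs ! i)" if "i < n"
    using that input_nth[of i 0] adr_less[of i 0] by (simp add: low0_def mem_of_def length_input encode_def)
  show "low0 (adr i + Suc e) = sorted_list_of_set (xs ! i) ! e" if "i < n" "e < card (xs ! i)"
    using that input_nth[of i "Suc e"] adr_less[of i "Suc e"]
    by (simp add: low0_def mem_of_def length_input encode_def)
qed

lemma start_mem: "preprocess_start w b1 b2 d xs prog = cf prog (\<lambda>_. 0) mem0"
proof -
  have "mem_of input = mem0"
  proof (rule ext)
    fix a
    show "mem_of input a = mem0 a"
      by (cases "a < Iv") (simp_all add: mem0_def mk_def low0_def mem_of_def length_input)
  qed
  then show ?thesis by (simp add: preprocess_start_def input_def n_def)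
qed

lemma basic_bounds: "n < S" "d + 1 < S" "S < S * S" "1000 * S \<le> S * S" "1000 * (S * S) \<le> Z"
  "1000 * Z \<le> 2 ^ w" "1000 \<le> S" "B \<le> S" "L \<le> X" "X \<le> S" "1 \<le> L" "G < S" "1000 * S \<le> Z" "1000 \<le> Z" "X \<le> Z"
proof -
  have "b1 * real S \<le> 1 * real S" using b by (intro mult_right_mono) auto
  then show "B \<le> S" using B_le by linarith
  have "1 * 1000 \<le> 1000 * S" using S_big by linarith
  then show "1000 * S \<le> Z" "1000 \<le> Z" "X \<le> Z" using SS_big S_big X_le by linarith+
qed (use nd SS_big S_big L_le_X X_le L1 G_less in auto)

lemma pre1:
  assumes "\<And>R t. R 1 = 1 \<Longrightarrow> R 25 = w \<Longrightarrow> R 40 = 0 \<Longrightarrow> Q R M' rs t"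
    and "R 40 = 0"
  shows "wp w Q pre1 R M' rs t"
proof -
  have w2: "w < 2 ^ w" by (rule less_exp)
  have w0: "0 < w" using w256 by simp
  have Sw: "Suc i mod 2 ^ w = Suc i" if "i < w" for i using that w2 by (intro mod_less) linarith
  show ?thesis
    unfolding pre1_def
    apply (simp add: w0)
    apply (rule wp_for[where N = w and I = "\<lambda>i R M'' rs' t. R 1 = 1 \<and> R 24 = 2 ^ i mod 2 ^ w \<and> R 25 = i
        \<and> R 40 = 0 \<and> M'' = M' \<and> rs' = rs"])
    subgoal using assms(2) w256 by simp
    subgoal for i by (cases "i < w") auto
    subgoal for i by (auto simp: binop_val.simps mod_simps mult_2 Sw)
    subgoal using assms(1) by auto
    done
qed

definition dd :: nat where "dd = d + 1"

text \<open>The register conventions of all later phases. Register 40 is never written: it serves as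
  the constant 0 in copies and as the address of cell 0.\<close>

definition base :: "(nat \<Rightarrow> nat) \<Rightarrow> bool" where
  "base R \<longleftrightarrow> R 1 = 1 \<and> R 2 = n \<and> R 3 = d \<and> R 4 = S \<and> R 5 = B \<and> R 6 = G \<and> R 23 = dd \<and>
    R 21 = S * S \<and> R 39 = A \<and> R 16 = Z \<and> R 17 = 2 * Z \<and> R 18 = 3 * Z \<and> R 19 = 4 * Z \<and> R 40 = 0 \<and> R 25 = w"

lemma pre2:
  assumes "\<And>R t. base R \<Longrightarrow> Q R mem0 rs t"
    and "R 1 = 1" "R 25 = w" "R 40 = 0"
  shows "wp w Q pre2 R mem0 rs t"
proof -
  have w2: "w < 2 ^ w" by (rule less_exp)
  have sh: "nat \<lfloor>b1 * 2 ^ w\<rfloor> div 2 ^ (w - w div 8) = B" "nat \<lfloor>b2 * 2 ^ w\<rfloor> div 2 ^ (w - w div 8) = G - 1"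
    using fixpt_shift[of b1 w] fixpt_shift[of b2 w] b by (auto simp: B_def G_def)
  have lt: "nat \<lfloor>b * 2 ^ w\<rfloor> < 2 ^ w" if "0 < b" "b < 1" for b :: real
  proof -
    have "b * 2 ^ w < 1 * 2 ^ w" using that by (intro mult_strict_right_mono) auto
    then have "\<lfloor>b * 2 ^ w\<rfloor> < 2 ^ w" by (simp add: floor_less_iff)
    then show ?thesis by (simp add: nat_less_iff)
  qed
  have rd: "mem0 0 = n" "mem0 (Suc 0) = d" "mem0 2 = nat \<lfloor>b1 * 2 ^ w\<rfloor>" "mem0 3 = nat \<lfloor>b2 * 2 ^ w\<rfloor>"
    using E0_less low0 by (simp_all add: mem0_def mk_read)
  have eight: "8 < (2::nat) ^ w" using w256 w2 by linarith
  have Sw: "2 ^ (w div 8) = S" by (simp add: S_def scale_def)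
  have G1: "Suc (G - Suc 0) = G" by (simp add: G_def)
  have A: "A = S * S div B + (d + 1)" by (simp add: A_def growth_def)
  have lts: "0 < w" "w div 8 \<le> w" "S < 2 ^ w" "G < 2 ^ w" "Suc d < 2 ^ w" "S * S < 2 ^ w"
    "Suc (S * S div B + d) < 2 ^ w" "Z < 2 ^ w" "2 * Z < 2 ^ w" "3 * Z < 2 ^ w" "4 * Z < 2 ^ w"
    "\<lfloor>b1 * 2 ^ w\<rfloor> < 2 ^ w" "\<lfloor>b2 * 2 ^ w\<rfloor> < 2 ^ w" "2 < (2::nat) ^ w" "3 < (2::nat) ^ w"
  proof -
    have "S * S div B \<le> S * S" by simp
    then show "Suc (S * S div B + d) < 2 ^ w" using basic_bounds by linarith
    show "S < 2 ^ w" "G < 2 ^ w" "Suc d < 2 ^ w" "S * S < 2 ^ w" using basic_bounds by linarith+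
  qed (use basic_bounds w256 eight lt b in \<open>auto simp: Z_def[symmetric]\<close>)
  have ZZ: "binop_val w Add Z Z = 2 * Z" "binop_val w Add (2 * Z) Z = 3 * Z" "binop_val w Add (3 * Z) Z = 4 * Z"
    using lts by (subst binops; simp)+
  show ?thesis
    unfolding pre2_def
    using assms(2-4)
    apply (simp add: eight rd lts w2 ZZ binops sh Sw G1 Z_def[symmetric])
    apply (rule assms(1))
    apply (simp add: base_def A G1 dd_def)
    done
qed

text \<open>The common overflow argument: addresses and products stay below a few multiples of
  \<open>Z = S ^ 3\<close>, while \<open>1000 * Z\<close> is at most \<open>S ^ 4\<close> and thus
  at most \<open>2 ^ w\<close>.\<close>

lemma lt_w: "a \<le> 900 * Z \<Longrightarrow> a < 2 ^ w"
  using basic_bounds by linarith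

lemma k_spec: "zval S G k * n \<le> S" "i < k \<Longrightarrow> S < zval S G i * n"
  using levels_bounds(1,2)[of S G n] S_pos G_less n2 by (auto simp: k_def G_def)

lemma zval_le_S: "zval S G i \<le> S"
proof (induction i)
  case (Suc i)
  have "zval S G i * G div S \<le> zval S G i * S div S" using G_less by (intro div_le_mono mult_le_mono2) simp
  then show ?case using Suc S_pos by simp
qed simp

lemma A_ge: "S \<le> A"
proof -
  have "S * S div S \<le> S * S div B" using basic_bounds B_pos by (intro div_le_mono2) auto
  then show ?thesis using S_pos by (simp add: A_def growth_def)
qed

lemma A_le: "A \<le> 2 * (S * S)"
proof -
  have "S * S div B \<le> S * S" by simp
  then show ?thesis using basic_bounds unfolding A_def growth_def by linarith
qed

lemma yval_mono: "i \<le> j \<Longrightarrow> yval S A i \<le> yval S A j"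
proof (induction j rule: dec_induct)
  case (step j)
  have "yval S A j * S div S \<le> yval S A j * A div S" using A_ge by (intro div_le_mono mult_le_mono2)
  then show ?case using step S_pos by simp
qed simp

text \<open>Intermediate products in the order in which the program multiplies; each is bounded by
  \<open>X\<close>, hence none overflows.\<close>

lemma X_parts: "K \<le> X" "K * n \<le> X" "K * n * L \<le> X" "y \<le> X" "n * L * y \<le> X" "L * y \<le> X"
proof -
  have *: "a \<le> a * b" if "1 \<le> b" for a b :: nat using that by simp
  have n1: "1 \<le> n" using n2 by simp
  show 1: "K * n * L \<le> X" unfolding X_def by (rule *[OF y1])
  show 2: "K * n \<le> X" using *[OF L1, of "K * n"] 1 by linarith
  show "K \<le> X" using *[OF n1, of K] 2 by linarith
  have kn: "1 \<le> K * n * L" using K1 n1 L1 by simp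
  show "y \<le> X" using *[OF kn, of y] by (simp add: X_def mult.commute)
  show 3: "n * L * y \<le> X" using *[OF K1, of "n * L * y"] by (simp add: X_def mult_ac)
  have "n * L * y = L * y * n" by (simp only: mult_ac)
  then show "L * y \<le> X" using *[OF n1, of "L * y"] 3 by linarith
qed

lemma pre3:
  assumes "\<And>R t. base R \<Longrightarrow> R 7 = k \<Longrightarrow> R 8 = y \<Longrightarrow> Q R mem0 rs t" and "base R"
  shows "wp w Q pre3 R mem0 rs t"
proof -
  have y: "yval S A i \<le> S" if "i \<le> k" for i
    using yval_mono[OF that] X_parts X_le by (simp add: y_def)
  have zn: "zval S G i * n < 2 ^ w" for i
    using prod_le_SS[OF zval_le_S, of n i] basic_bounds by (intro lt_w) linarith
  have zG: "zval S G i * G < 2 ^ w" for i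
    using prod_le_SS[OF zval_le_S, of G i] basic_bounds by (intro lt_w) linarith
  have yA: "yval S A i * A < 2 ^ w" if "i \<le> k" for i
  proof -
    have "yval S A i * A \<le> S * (2 * (S * S))" by (rule mult_le_mono[OF y[OF that] A_le])
    then show ?thesis using basic_bounds by (intro lt_w) (simp add: Z_def)
  qed
  have y1: "Suc (yval S A i * A div S) < 2 ^ w" if "i < k" for i
    using y[of "Suc i"] that basic_bounds by (intro lt_w) simp
  have kS: "i < k \<Longrightarrow> Suc i < 2 ^ w" for i
    using basic_bounds by (intro lt_w) (simp add: L_def)
  have lts: "0 < w" "S < 2 ^ w" "0 < S" "Suc 0 < n"
    using w256 basic_bounds n2 S_pos by (auto intro!: lt_w)
  show ?thesis
    unfolding pre3_def
    using assms(2)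
    apply (simp add: binops base_def lts zn[of 0, simplified])
    apply (rule wp_for[where N = k and I = "\<lambda>i R M'' rs' t. base R \<and> R 7 = i \<and> R 8 = yval S A i \<and>
        R 27 = zval S G i \<and> R 28 = of_bool (S < zval S G i * n) \<and> M'' = mem0 \<and> rs' = rs"])
    subgoal using lts by (simp add: base_def)
    subgoal for i using k_spec(1) k_spec(2)[of i] by (cases "i < k") auto
    subgoal for i using zn[of "Suc i"] by (auto simp: base_def binops zG yA y1 kS zn)
    subgoal using assms(1) by (auto simp: y_def)
    done
qed

definition base2 :: "(nat \<Rightarrow> nat) \<Rightarrow> bool" where
  "base2 R \<longleftrightarrow> base R \<and> R 7 = k \<and> R 8 = y \<and> R 9 = L \<and> R 10 = X \<and> R 11 = M \<and> R 12 = w - lgM"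

lemma pre4:
  assumes "\<And>R t. base2 R \<Longrightarrow> Q R mem0 rs t" and "base R" "R 7 = k" "R 8 = y"
  shows "wp w Q (pre4 K) R mem0 rs t"
proof -
  have lts: "0 < w" "w < 2 ^ w" "Suc k < 2 ^ w" "16 < (2::nat) ^ w" "L < 2 ^ w" "K < 2 ^ w" "K * n < 2 ^ w"
     "K * n * L < 2 ^ w" "X < 2 ^ w"
    using w256 basic_bounds X_parts by (auto intro!: lt_w simp: L_def)
  have L': "binop_val w Mul (Suc k) 16 = L" using lts by (subst binops) (simp_all add: L_def)
  have X': "binop_val w Mul (K * n * L) y = X" using lts by (subst binops) (simp_all add: X_def)
  have X1: "Suc 0 < X" using basic_bounds(9) by (simp add: L_def)
  have w': "binop_val w Sub (w - i) (Suc 0) = w - Suc i" if "i < lgM" for i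
    using lgM_le lts(2) that by (subst binops) (auto simp: less_imp_diff_less)
  have p: "2 ^ i + 2 ^ i < (2 :: nat) ^ w" if "i < lgM" for i
    using lgM_less[OF that] basic_bounds by (intro lt_w) linarith
  show ?thesis
    unfolding pre4_def
    using assms(2-4)
    apply (simp add: binops base_def lts L' X' X1)
    apply (rule wp_for[where N = lgM and I = "\<lambda>i R M'' rs' t. base R \<and> R 7 = k \<and> R 8 = y \<and> R 9 = L \<and> R 10 = X \<and>
        R 11 = 2 ^ i \<and> R 12 = w - i \<and> R 28 = of_bool (2 ^ i < X) \<and> M'' = mem0 \<and> rs' = rs"])
    subgoal using X1 by (simp add: base_def)
    subgoal for i using X_le_M lgM_less[of i] by (cases "i < lgM") (auto simp: M_def)
    subgoal for i using p[of i] by (auto simp: base_def binops w')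
    subgoal using assms(1) by (auto simp: base2_def M_def)
    done
qed

end

section \<open>Preprocessing: growing the stored forest\<close>

text \<open>Builds the incidence matrix, rows of length \<open>d + 1\<close>, and the address table,
  so that later tests of \<open>j \<in> xs ! x\<close> are single loads.\<close>

definition pre5 :: "cmd list" where
  "pre5 = [Const 13 4, Const 24 0, Op Less 28 24 2,
    WhileNZ 28 [Op Add 26 17 24, Store 26 13, Load 27 13, Op Mul 29 24 23, Op Add 29 16 29, Const 30 0,
      Op Less 31 30 27,
      WhileNZ 31 [Op Add 13 13 1, Load 32 13, Op Add 32 29 32, Store 32 1, Op Add 30 30 1, Op Less 31 30 27],
      Op Add 13 13 1, Op Add 24 24 1, Op Less 28 24 2]]"

text \<open>Cell 0 receives the address of the parameter block, the hash multiplier is drawn as the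
  first random word, and the acceptance bits of the roots are set to 1, the empty path being
  accepted by everybody.\<close>

definition pre6 :: "cmd list" where
  "pre6 = [Store 40 13, Const 26 16, Op Add 14 13 26, Op Add 15 14 11, Rand 20, Op Add 22 9 40,
    Op Mul 26 9 2, Const 24 0, Op Less 28 24 26,
    WhileNZ 28 [Op Add 27 19 24, Store 27 1, Op Add 24 24 1, Op Less 28 24 26]]"

definition pre7_in :: "cmd list" where
  "pre7_in = [Const 34 0, Const 35 0, Op Mul 36 29 2, Op Add 36 19 36, Op Mul 37 22 2, Op Add 37 19 37,
        Op Mul 38 27 5, Op Less 33 35 2,
        WhileNZ 33 [Op Add 41 36 35, Load 41 41, Op Mul 42 35 23, Op Add 42 16 42, Op Add 42 42 30, Load 42 42,
          Op Mul 41 41 42, Op Add 42 17 35, Load 42 42, Load 42 42, Op Mul 42 38 42, Op Less 42 42 21,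
          Op Mul 41 41 42, Op Add 42 37 35, Store 42 41, Op Add 34 34 41, Op Add 35 35 1, Op Less 33 35 2]]"

text \<open>A random word is drawn in each of the \<open>X * d\<close> rounds, whether it is used or
  not; so the tape has a fixed length and its words match the positions of
  \<open>tgrow\<close>.\<close>

definition pre7 :: "cmd list" where
  "pre7 = [Op Mul 26 10 3, Const 24 0, Op Less 28 24 26,
    WhileNZ 28 [Rand 27, Op Mod 27 27 4, Op Div 29 24 3, Op Mod 30 24 3, Op Add 30 30 1,
      Op Add 31 18 29, Load 31 31, Op Less 32 31 7, Op Less 33 29 22, Op Mul 32 32 33, Op Less 33 22 10,
      Op Mul 32 32 33,
      IfNZ 32 (pre7_in @ [IfNZ 34 [Const 41 5, Op Mul 41 41 22, Op Add 41 15 41, Store 41 29, Op Add 41 41 1, Store 41 30,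
          Op Add 41 41 1, Store 41 27, Op Add 31 31 1, Op Add 41 18 22, Store 41 31, Op Add 22 22 1] []]) [],
      Op Add 24 24 1, Op Less 28 24 26]]"

text \<open>A copy of \<^const>\<open>of_bool\<close> on which the simplifier does not split cases.\<close>

definition bt :: "bool \<Rightarrow> nat" where "bt b = of_bool b"

lemma bt_simps [simp]: "bt True = Suc 0" "bt False = 0" "(bt b = 0) = (\<not> b)" "(0 < bt b) = b"
  by (simp_all add: bt_def)

lemma bt_mult: "bt a * bt b = bt (a \<and> b)"
  by (simp add: bt_def)

context search_inst
begin

lemma cmp_bt: "binop_val w Less x z = bt (x < z)" "binop_val w Equal x z = bt (x = z)"
  by (simp_all add: binops bt_def)

lemma base2D:
  assumes "base2 R"
  shows "R (Suc 0) = Suc 0" "R 2 = n" "R 3 = d" "R 4 = S" "R 5 = B" "R 6 = G" "R 7 = k" "R 8 = y" "R 9 = L"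
    "R 10 = X" "R 11 = M" "R 12 = w - lgM" "R 16 = Z" "R 17 = 2 * Z" "R 18 = 3 * Z" "R 19 = 4 * Z"
    "R 21 = S * S" "R 23 = dd" "R 25 = w" "R 39 = A" "R 40 = 0"
  using assms by (simp_all add: base2_def base_def)

lemma base2_upd:
  "r \<notin> {Suc 0, 2, 3, 4, 5, 6, 7, 8, 9, 10, 11, 12, 16, 17, 18, 19, 21, 23, 25, 39, 40} \<Longrightarrow>
    base2 (R(r := v)) = base2 R"
  unfolding base2_def base_def by auto

definition mkA :: "(nat \<Rightarrow> nat) \<Rightarrow> (nat \<Rightarrow> nat) \<Rightarrow> nat \<Rightarrow> nat" where
  "mkA inc ad = mk low0 (\<lambda>_. 0) (\<lambda>_. 0) (\<lambda>_ _. 0) inc ad (\<lambda>_. 0) (\<lambda>_. 0)"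

text \<open>Pairs of data point and coordinate coded as positions in the matrix;
  \<open>inc_set_iff\<close> shows that the coding is unambiguous for coordinates up to
  \<open>d\<close>.\<close>

definition inc_set :: "nat \<Rightarrow> nat set" where
  "inc_set i = {i' * dd + j | i' j. i' < i \<and> j \<in> xs ! i'}"

definition ind :: "nat set \<Rightarrow> nat \<Rightarrow> nat" where
  "ind C c = bt (c \<in> C)"

definition adf :: "nat \<Rightarrow> nat \<Rightarrow> nat" where
  "adf i c = (if c < i then adr c else 0)"

abbreviation sl :: "nat \<Rightarrow> nat list" where "sl i \<equiv> sorted_list_of_set (xs ! i)"

lemma mem0_mkA: "mem0 = mkA (ind (inc_set 0)) (adf 0)"
  by (simp add: mem0_def mkA_def ind_def[abs_def] inc_set_def adf_def[abs_def])

lemma inc_set_Suc: "inc_set (Suc i) = inc_set i \<union> (\<lambda>j. i * dd + j) ` (xs ! i)"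
  by (auto simp: inc_set_def less_Suc_eq)

lemma ind_insert: "(ind C)(c := Suc 0) = ind (insert c C)"
  by (auto simp: ind_def)

lemma adf_Suc: "(adf i)(i := adr i) = adf (Suc i)"
  by (auto simp: adf_def fun_eq_iff)

lemma ndd: "n * dd \<le> S * S"
  using nd by (intro prod_le_SS) (auto simp: dd_def)

lemma i_dd: "i < n \<Longrightarrow> j \<le> d \<Longrightarrow> i * dd + j < n * dd"
proof -
  assume "i < n" "j \<le> d"
  then have "i * dd + j < Suc i * dd" by (simp add: dd_def)
  also have "\<dots> \<le> n * dd" using \<open>i < n\<close> by (intro mult_le_mono1) simp
  finally show ?thesis .
qed

lemma sl_props: "i < n \<Longrightarrow> length (sl i) = card (xs ! i)" "i < n \<Longrightarrow> set (sl i) = xs ! i"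
  "i < n \<Longrightarrow> e < card (xs ! i) \<Longrightarrow> sl i ! e \<in> xs ! i" "i < n \<Longrightarrow> j \<in> xs ! i \<Longrightarrow> 1 \<le> j \<and> j \<le> d"
proof -
  show "i < n \<Longrightarrow> length (sl i) = card (xs ! i)" "i < n \<Longrightarrow> set (sl i) = xs ! i"
    using finite_xs by auto
  then show "i < n \<Longrightarrow> e < card (xs ! i) \<Longrightarrow> sl i ! e \<in> xs ! i" by (metis nth_mem)
  show "i < n \<Longrightarrow> j \<in> xs ! i \<Longrightarrow> 1 \<le> j \<and> j \<le> d" using xs_sub[of "xs ! i"] by (auto simp: n_def)
qed

lemma Iv_Z: "Iv < Z" "sz \<le> Z" "n < Z" "dd < Z" "n * dd < Z"
  using E0_less basic_bounds ndd by (auto simp: dd_def)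

lemma add_eq: "x + z \<le> 900 * Z \<Longrightarrow> binop_val w Add x z = x + z"
  by (intro binops lt_w)

lemma add1_eq: "Suc x \<le> 900 * Z \<Longrightarrow> binop_val w Add x (Suc 0) = Suc x"
  by (subst binops) (auto intro: lt_w)

lemma mul_eq: "x * z \<le> 900 * Z \<Longrightarrow> binop_val w Mul x z = x * z"
  by (intro binops lt_w)

lemma divmod_eq: "x \<le> 900 * Z \<Longrightarrow> binop_val w Div x z = x div z" "x \<le> 900 * Z \<Longrightarrow> binop_val w Mod x z = x mod z"
  by (simp_all add: binops(4,5) lt_w)

lemmas arith_eqs = add_eq add1_eq mul_eq divmod_eq

lemma pre5:
  assumes "\<And>R t. base2 R \<Longrightarrow> R 13 = Iv \<Longrightarrow> Q R (mkA (ind (inc_set n)) (adf n)) rs t" and "base2 R"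
  shows "wp w Q pre5 R mem0 rs t"
proof -
  have lts: "0 < w" "4 < (2::nat) ^ w" "0 < n" using w256 n2 basic_bounds by (auto intro!: lt_w)
  have e1: "binop_val w Add (2 * Z) i = 2 * Z + i" "binop_val w Mul i dd = i * dd"
    "binop_val w Add Z (i * dd) = Z + i * dd" "binop_val w Add i (Suc 0) = Suc i" if "i < n" for i
  proof -
    have "i * dd < n * dd" using i_dd[OF that, of 0] by simp
    then show "binop_val w Add (2 * Z) i = 2 * Z + i" "binop_val w Mul i dd = i * dd"
      "binop_val w Add Z (i * dd) = Z + i * dd" "binop_val w Add i (Suc 0) = Suc i"
      using that Iv_Z by (intro arith_eqs; linarith)+
  qed
  have e2: "binop_val w Add (adr i + e) (Suc 0) = Suc (adr i + e)" "binop_val w Add e (Suc 0) = Suc e"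
    "mkA a b (Suc (adr i + e)) = sl i ! e" "binop_val w Add (Z + i * dd) (sl i ! e) = Z + (i * dd + sl i ! e)"
    "(mkA a b)(Z + (i * dd + sl i ! e) := v) = mkA (a(i * dd + sl i ! e := v)) b"
    if "i < n" "e < card (xs ! i)" for i e a b v
  proof -
    have *: "adr i + Suc e < Iv" using adr_less[of i "Suc e"] that by simp
    have "sl i ! e \<le> d" using sl_props(3,4) that by blast
    then have j: "i * dd + sl i ! e < n * dd" by (intro i_dd that)
    show "binop_val w Add (adr i + e) (Suc 0) = Suc (adr i + e)" "binop_val w Add e (Suc 0) = Suc e"
      using * Iv_Z adr_ge[of i] by (intro arith_eqs; linarith)+
    show "mkA a b (Suc (adr i + e)) = sl i ! e"
      using * low0(6)[OF that] by (simp add: mkA_def mk_read)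
    have "binop_val w Add (Z + i * dd) (sl i ! e) = Z + i * dd + sl i ! e"
      using j Iv_Z by (intro arith_eqs; linarith)
    then show "binop_val w Add (Z + i * dd) (sl i ! e) = Z + (i * dd + sl i ! e)" by simp
    show "(mkA a b)(Z + (i * dd + sl i ! e) := v) = mkA (a(i * dd + sl i ! e := v)) b"
      unfolding mkA_def using j Iv_Z by (subst mk_write) auto
  qed
  have e3: "mkA a b (adr i) = card (xs ! i)" "(mkA a b)(2 * Z + i := v) = mkA a (b(i := v))"
    "binop_val w Add (adr i + card (xs ! i)) (Suc 0) = adr (Suc i)" if "i < n" for i a b v
  proof -
    show "mkA a b (adr i) = card (xs ! i)"
      using adr_less[of i 0] that low0(5)[of i] by (simp add: mkA_def mk_read)
    show "(mkA a b)(2 * Z + i := v) = mkA a (b(i := v))"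
      unfolding mkA_def using that Iv_Z by (subst mk_write) auto
    have "adr (Suc i) \<le> Iv" using adr_mono[of "Suc i" n] that by (simp add: Iv_def)
    then have "binop_val w Add (adr i + card (xs ! i)) (Suc 0) = Suc (adr i + card (xs ! i))"
      using Iv_Z adr_Suc[of i] by (intro arith_eqs; linarith)
    then show "binop_val w Add (adr i + card (xs ! i)) (Suc 0) = adr (Suc i)" by (simp add: adr_Suc)
  qed
  have adr0: "adr 0 = 4" by (simp add: adr_def)
  show ?thesis
    unfolding pre5_def
    using assms(2)
    apply (simp add: cmp_bt base2D base2_upd lts)
    apply (rule wp_for[where N = n and I = "\<lambda>i R M' rs' t. base2 R \<and> R 13 = adr i \<and> R 24 = i \<and>
      R 28 = bt (i < n) \<and> M' = mkA (ind (inc_set i)) (adf i) \<and> rs' = rs"])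
    subgoal using lts by (simp add: base2D base2_upd adr0 mem0_mkA)
    subgoal for i by auto
    subgoal premises prems for i R M' rs' t
    proof -
      have i: "i < n" by fact
      have R: "base2 R" "R 13 = adr i" "R 24 = i" "R 28 = bt (i < n)"
        "M' = mkA (ind (inc_set i)) (adf i)" "rs' = rs" using prems(3) by blast+
      show ?thesis
        using R(1-4) i unfolding R(5,6)
        apply (simp add: base2D base2_upd e1 e3 adf_Suc cmp_bt lts)
        apply (rule wp_for[where N = "card (xs ! i)" and I = "\<lambda>e R M' rs' t. base2 R \<and> R 13 = adr i + e \<and> R 24 = i \<and>
          R 27 = card (xs ! i) \<and> R 29 = Z + i * dd \<and> R 30 = e \<and> R 31 = bt (e < card (xs ! i)) \<and>
          M' = mkA (ind (inc_set i \<union> (\<lambda>j. i * dd + j) ` set (take e (sl i)))) (adf (Suc i)) \<and> rs' = rs"])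
        subgoal by (simp add: base2D base2_upd)
        subgoal by auto
        subgoal for e R M' rs' t
          using sl_props(1)[OF i]
          by (auto simp: base2D base2_upd e2[OF i] cmp_bt ind_insert take_Suc_conv_app_nth)
        subgoal for R M' rs' t
          using sl_props(1,2)[OF i] by (auto simp: base2D base2_upd e1 e3 cmp_bt inc_set_Suc)
        done
    qed
    subgoal using assms(1) by (auto simp: Iv_def)
    done
qed

text \<open>A query knows only the address of its own vector and finds all parameters through cell
  0, which held \<open>n\<close> before.\<close>

definition lowI :: "nat \<Rightarrow> nat" where "lowI = low0(0 := Iv)"

definition mkB :: "(nat \<Rightarrow> nat \<Rightarrow> nat) \<Rightarrow> (nat \<Rightarrow> nat) \<Rightarrow> (nat \<Rightarrow> nat) \<Rightarrow> nat \<Rightarrow> nat" where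
  "mkB en lev mb = mk lowI (\<lambda>_. 0) (\<lambda>_. 0) en (ind (inc_set n)) (adf n) lev mb"

definition base3 :: "nat \<Rightarrow> (nat \<Rightarrow> nat) \<Rightarrow> bool" where
  "base3 a R \<longleftrightarrow> base2 R \<and> R 13 = Iv \<and> R 14 = H0 \<and> R 15 = E0 \<and> R 20 = a"

lemma Xn: "X * n \<le> S * S" "X * d \<le> S * S" "L * n \<le> X * n"
  using X_le nd L_le_X by (auto intro!: prod_le_SS mult_le_mono1)

lemma pre6:
  assumes "\<And>R t. base3 a R \<Longrightarrow> R 22 = L \<Longrightarrow>
      Q R (mkB (\<lambda>_ _. 0) (\<lambda>_. 0) (\<lambda>c. bt (c < L * n))) rs t" and "base2 R" "R 13 = Iv"
  shows "wp w Q pre6 R (mkA (ind (inc_set n)) (adf n)) (a # rs) t"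
proof -
  have lts: "0 < w" "16 < (2::nat) ^ w" using w256 basic_bounds by (auto intro!: lt_w)
  have e1: "binop_val w Add Iv 16 = H0" "binop_val w Add H0 M = E0" "binop_val w Mul L n = L * n"
    "binop_val w Add L 0 = L"
    using E0_less sz_le basic_bounds Xn unfolding H0_def E0_def
    by (subst arith_eqs; linarith)+
  have e2: "(mkA a b)(0 := Iv) = mkB (\<lambda>_ _. 0) (\<lambda>_. 0) (\<lambda>_. 0)" if "a = ind (inc_set n)" "b = adf n" for a b
    unfolding mkA_def mkB_def lowI_def using that E0_less by (subst mk_write) auto
  have e3: "binop_val w Add (4 * Z) i = 4 * Z + i" "binop_val w Add i (Suc 0) = Suc i" if "i < L * n" for i
    using that Xn basic_bounds by (intro arith_eqs; linarith)+
  have e4: "(mkB en lev mb)(4 * Z + i := v) = mkB en lev (mb(i := v))" for en lev mb i v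
    by (simp add: mkB_def mk_write)
  have e5: "(\<lambda>c. bt (c < i))(i := Suc 0) = (\<lambda>c. bt (c < Suc i))" for i
    by (auto simp: fun_eq_iff bt_def)
  have Ln: "0 < L" "0 < n" using L1 n2 by auto
  show ?thesis
    unfolding pre6_def
    using assms(2,3)
    apply (simp add: base2D base2_upd e1 e2 lts cmp_bt Ln)
    apply (rule wp_for[where N = "L * n" and I = "\<lambda>i R M' rs' t. base3 a R \<and> R 22 = L \<and> R 24 = i \<and> R 26 = L * n \<and>
      R 28 = bt (i < L * n) \<and> M' = mkB (\<lambda>_ _. 0) (\<lambda>_. 0) (\<lambda>c. bt (c < i)) \<and> rs' = rs"])
    subgoal using Ln by (simp add: base3_def base2D base2_upd)
    subgoal for i by auto
    subgoal for i by (simp add: base3_def base2D base2_upd e3 e4 e5 cmp_bt)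
    subgoal using assms(1) by auto
    done
qed

lemma base3D:
  assumes "base3 a R"
  shows "base2 R" "R 13 = Iv" "R 14 = H0" "R 15 = E0" "R 20 = a"
  using assms by (simp_all add: base3_def)

lemma base3_upd:
  "r \<notin> {Suc 0, 2, 3, 4, 5, 6, 7, 8, 9, 10, 11, 12, 13, 14, 15, 16, 17, 18, 19, 20, 21, 23, 25, 39, 40} \<Longrightarrow>
    base3 a (R(r := v)) = base3 a R"
  unfolding base3_def by (auto simp: base2_upd)

lemmas base3R = base2D[OF base3D(1)] base3D(2-5)

definition enE :: "(nat \<times> nat \<times> nat \<times> nat) list \<Rightarrow> nat \<Rightarrow> nat \<Rightarrow> nat" where
  "enE es u f = (if u < length es then (case es ! u of (p, j, r, q) \<Rightarrow>
     if f = 0 then p else if f = 1 then j else if f = 2 then r else if f = 3 then q else 0) else 0)"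

definition node_ent :: "nat \<times> (nat \<times> nat) list \<Rightarrow> nat \<times> nat \<times> nat \<times> nat" where
  "node_ent vp = (case vp of (v, p) \<Rightarrow> case p of [] \<Rightarrow> (v, 0, 0, 0) | (j, r) # _ \<Rightarrow> (v, j, r, 0))"

definition levf :: "nodes \<Rightarrow> nat \<Rightarrow> nat" where
  "levf \<tau> u = (if u < length \<tau> then length (snd (\<tau> ! u)) else 0)"

text \<open>Rows from \<open>length \<tau>\<close> on are unconstrained: the row of a tentative node
  is written before it is known whether any data point accepts it, and it is overwritten if none
  does.\<close>

definition mbok :: "nodes \<Rightarrow> (nat \<Rightarrow> nat) \<Rightarrow> bool" where
  "mbok \<tau> mb \<longleftrightarrow> (\<forall>u<length \<tau>. \<forall>x<n. mb (u * n + x) = bt (list_all (edge_ok (xs ! x)) (snd (\<tau> ! u))))"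

lemma enE_append3:
  "enE (es @ [(p, j, r, 0)]) = (enE es)(length es := (enE es (length es))(0 := p, Suc 0 := j, 2 := r))"
  by (auto simp: enE_def fun_eq_iff nth_append)

lemma levf_append: "levf (\<tau> @ [(v, p)]) = (levf \<tau>)(length \<tau> := length p)"
  by (auto simp: levf_def fun_eq_iff nth_append)

lemma un_less: "u < N \<Longrightarrow> x < n \<Longrightarrow> u * n + x < N * n"
proof -
  assume "u < N" "x < n"
  then have "u * n + x < Suc u * n" by simp
  also have "\<dots> \<le> N * n" using \<open>u < N\<close> by (intro mult_le_mono1) simp
  finally show ?thesis .
qed

lemma mkB_upd:
  "i < Z \<Longrightarrow> mkB en lev mb (3 * Z + i) = lev i" "mkB en lev mb (4 * Z + i) = mb i"
  "i < Z \<Longrightarrow> mkB en lev mb (2 * Z + i) = adf n i" "i < Z \<Longrightarrow> mkB en lev mb (Z + i) = ind (inc_set n) i"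
  "i < Z \<Longrightarrow> (mkB en lev mb)(3 * Z + i := v) = mkB en (lev(i := v)) mb"
  "(mkB en lev mb)(4 * Z + i := v) = mkB en lev (mb(i := v))"
  "u < X \<Longrightarrow> f < 5 \<Longrightarrow> (mkB en lev mb)(E0 + (5 * u + f) := v) = mkB (en(u := (en u)(f := v))) lev mb"
  "x < n \<Longrightarrow> mkB en lev mb (adr x) = card (xs ! x)"
proof -
  show "mkB en lev mb (adr x) = card (xs ! x)" if "x < n"
    using adr_less[of x 0] adr_ge[of x] low0(5)[of x] that by (simp add: mkB_def mk_read lowI_def)
qed (simp_all add: mkB_def mk_read mk_write)

lemma inc_set_iff:
  assumes "x < n" "1 \<le> j" "j \<le> d" shows "x * dd + j \<in> inc_set n \<longleftrightarrow> j \<in> xs ! x"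
proof
  assume "x * dd + j \<in> inc_set n"
  then obtain x' j' where *: "x * dd + j = x' * dd + j'" "x' < n" "j' \<in> xs ! x'" by (auto simp: inc_set_def)
  then have "j' < dd" "j < dd" using assms sl_props(4)[of x' j'] by (auto simp: dd_def)
  then have "x = (x * dd + j) div dd" "j = (x * dd + j) mod dd" "x' = (x' * dd + j') div dd" "j' = (x' * dd + j') mod dd"
    by auto
  then show "j \<in> xs ! x" using * by metis
qed (use assms in \<open>auto simp: inc_set_def\<close>)

lemma edge_ok_iff: "edge_ok x (j, r) \<longleftrightarrow> j \<in> x \<and> r * B * card x < S * S"
  by (simp add: edge_ok_def)

text \<open>The row of the tentative child is the conjunction of the parent's bit, the incidence bit
  and the threshold test. The bits are also summed, so a nonzero sum says that the path is worth
  keeping.\<close>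

lemma pre7_inner:
  fixes \<tau> :: nodes and v j r :: nat
  defines "p \<equiv> (j, r) # snd (\<tau> ! v)"
  assumes Q: "\<And>R t. base3 a R \<Longrightarrow> R 22 = length \<tau> \<Longrightarrow> R 24 = i \<Longrightarrow> R 26 = X * d \<Longrightarrow> R 27 = r \<Longrightarrow> R 29 = v \<Longrightarrow>
      R 30 = j \<Longrightarrow> R 31 = lv \<Longrightarrow> R 34 = (\<Sum>x<n. bt (list_all (edge_ok (xs ! x)) p)) \<Longrightarrow>
      wp w Q cs R (mkB en lev (\<lambda>c. if length \<tau> * n \<le> c \<and> c < length \<tau> * n + n
        then bt (list_all (edge_ok (xs ! (c - length \<tau> * n))) p) else mb c)) rs t"
    and R: "base3 a R" "R 22 = length \<tau>" "R 24 = i" "R 26 = X * d" "R 27 = r" "R 29 = v" "R 30 = j" "R 31 = lv"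
    and v: "v < length \<tau>" "length \<tau> < X" "r < S" "1 \<le> j" "j \<le> d" and mb: "mbok \<tau> mb"
  shows "wp w Q (pre7_in @ cs)
      R (mkB en lev mb) rs t"
proof -
  define N where "N = length \<tau>"
  define P where "P x = list_all (edge_ok (xs ! x)) p" for x
  define mbq where "mbq q c = (if N * n \<le> c \<and> c < N * n + q then bt (P (c - N * n)) else mb c)" for q c
  have XnS: "N * n + n \<le> S * S"
  proof -
    have "N * n + n = Suc N * n" by simp
    also have "\<dots> \<le> X * n" using v(2) by (intro mult_le_mono1) (simp add: N_def)
    finally show ?thesis using Xn by linarith
  qed
  have vn: "v * n + x < N * n" if "x < n" for x using un_less[OF v(1) that] by (simp add: N_def)
  have rB: "r * B \<le> S * S" using v(3) basic_bounds by (intro prod_le_SS) auto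
  have lts: "0 < w" "0 < n" using w256 n2 by auto
  have e0: "binop_val w Mul v n = v * n" "binop_val w Add (4 * Z) (v * n) = 4 * Z + v * n"
    "binop_val w Mul N n = N * n" "binop_val w Add (4 * Z) (N * n) = 4 * Z + N * n" "binop_val w Mul r B = r * B"
    using vn[of 0] lts XnS rB basic_bounds by (intro arith_eqs; linarith)+
  have e1: "binop_val w Add (4 * Z + v * n) x = 4 * Z + (v * n + x)"
    "binop_val w Mul x dd = x * dd" "binop_val w Add Z (x * dd) = Z + x * dd"
    "binop_val w Add (Z + x * dd) j = Z + (x * dd + j)" "binop_val w Add (2 * Z) x = 2 * Z + x"
    "binop_val w Mul (r * B) (card (xs ! x)) = r * B * card (xs ! x)"
    "binop_val w Add (4 * Z + N * n) x = 4 * Z + (N * n + x)" "binop_val w Add x (Suc 0) = Suc x"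
    if "x < n" for x
  proof -
    have xd: "x * dd + j < Z" using i_dd[OF that v(5)] Iv_Z by linarith
    have "r * B * card (xs ! x) \<le> (S * S) * S"
      using xs_card[OF that] nd by (intro mult_le_mono[OF rB]) auto
    then have rBc: "r * B * card (xs ! x) \<le> Z" by (simp add: Z_def)
    show "binop_val w Mul x dd = x * dd" "binop_val w Add Z (x * dd) = Z + x * dd"
      "binop_val w Add (2 * Z) x = 2 * Z + x"
      "binop_val w Mul (r * B) (card (xs ! x)) = r * B * card (xs ! x)" "binop_val w Add x (Suc 0) = Suc x"
      using xd rBc that Iv_Z by (intro arith_eqs; linarith)+
    have "binop_val w Add (4 * Z + v * n) x = 4 * Z + v * n + x" "binop_val w Add (Z + x * dd) j = Z + x * dd + j"
      "binop_val w Add (4 * Z + N * n) x = 4 * Z + N * n + x"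
      using vn[OF that] xd that Iv_Z XnS basic_bounds by (intro arith_eqs; linarith)+
    then show "binop_val w Add (4 * Z + v * n) x = 4 * Z + (v * n + x)"
      "binop_val w Add (Z + x * dd) j = Z + (x * dd + j)" "binop_val w Add (4 * Z + N * n) x = 4 * Z + (N * n + x)"
      by simp_all
  qed
  have e2: "mkB en lev (mbq q) (4 * Z + (v * n + x)) = bt (list_all (edge_ok (xs ! x)) (snd (\<tau> ! v)))"
    "mkB en lev (mbq q) (Z + (x * dd + j)) = bt (j \<in> xs ! x)"
    "mkB en lev (mbq q) (2 * Z + x) = adr x"
    "mkB en lev (mbq q) (adr x) = card (xs ! x)" if "x < n" for x q
  proof -
    have xd: "x * dd + j < Z" using i_dd[OF that v(5)] Iv_Z by linarith
    show "mkB en lev (mbq q) (4 * Z + (v * n + x)) = bt (list_all (edge_ok (xs ! x)) (snd (\<tau> ! v)))"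
      using vn[OF that] mb v(1) that by (simp add: mkB_upd mbq_def mbok_def)
    show "mkB en lev (mbq q) (Z + (x * dd + j)) = bt (j \<in> xs ! x)"
      using xd inc_set_iff[OF that v(4,5)] by (simp add: mkB_upd ind_def)
    show "mkB en lev (mbq q) (2 * Z + x) = adr x" "mkB en lev (mbq q) (adr x) = card (xs ! x)"
      using that Iv_Z by (simp_all add: mkB_upd adf_def)
  qed
  have e3: "binop_val w Mul (bt a) (bt b) = bt (a \<and> b)" for a b
    using basic_bounds by (subst mul_eq) (auto simp: bt_mult bt_def)
  have e4: "(mkB en lev (mbq x))(4 * Z + (N * n + x) := bt (P x)) = mkB en lev (mbq (Suc x))" for x
    unfolding mkB_upd by (rule arg_cong[where f = "mkB en lev"]) (auto simp: mbq_def fun_eq_iff less_Suc_eq)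
  have e5: "binop_val w Add (\<Sum>x<q. bt (P x)) (bt (P q)) = (\<Sum>x<Suc q. bt (P x))" if "q < n" for q
  proof -
    have "(\<Sum>x<q. bt (P x)) \<le> (\<Sum>x<q. 1)" by (intro sum_mono) (simp add: bt_def)
    then have "(\<Sum>x<q. bt (P x)) + bt (P q) \<le> q + 1" by (simp add: bt_def)
    then show ?thesis using that Iv_Z basic_bounds by (subst add_eq) auto
  qed
  have P: "(list_all (edge_ok (xs ! x)) (snd (\<tau> ! v)) \<and> j \<in> xs ! x \<and> r * B * card (xs ! x) < S * S) = P x" for x
    by (auto simp: P_def p_def edge_ok_iff)
  have mb0: "mbq 0 = mb" by (auto simp: mbq_def)
  show ?thesis
    using R
    apply (simp add: pre7_in_def base3R[of a] N_def[symmetric] e0 cmp_bt lts)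
    apply (rule wp_for[where N = n and I = "\<lambda>q R M' rs' t. base3 a R \<and> R 22 = N \<and> R 24 = i \<and> R 26 = X * d \<and> R 27 = r \<and>
       R 29 = v \<and> R 30 = j \<and> R 31 = lv \<and> R 36 = 4 * Z + v * n \<and> R 37 = 4 * Z + N * n \<and> R 38 = r * B \<and> R 35 = q \<and>
       R 34 = (\<Sum>x<q. bt (P x)) \<and> R 33 = bt (q < n) \<and> M' = mkB en lev (mbq q) \<and> rs' = rs"])
    subgoal using lts by (simp add: base3_upd mb0)
    subgoal by (simp add: order_less_le)
    subgoal by (simp add: base3R[of a] base3_upd e1 e2 e3 P e4 e5 cmp_bt del: sum.lessThan_Suc)
    subgoal for R M' rs' t using Q[folded N_def P_def, of R "Suc t"] by (simp add: mbq_def[abs_def])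
    done
qed

end

section \<open>Preprocessing: leaf candidates and the hash table\<close>

text \<open>A data point at a leaf is stored as a record with label 0. As coordinates start at 1, it
  is found by the same lookup as a child, and its random value 0 always passes the edge
  test.\<close>

definition pre8 :: "cmd list" where
  "pre8 = [Op Mul 26 22 2, Const 24 0, Op Less 28 24 26,
    WhileNZ 28 [Op Div 29 24 2, Op Mod 30 24 2, Op Add 31 18 29, Load 31 31, Op Equal 32 31 7,
      Op Add 33 19 24, Load 33 33, Op Mul 32 32 33, Op Less 33 22 10, Op Mul 32 32 33,
      IfNZ 32 [Const 41 5, Op Mul 41 41 22, Op Add 41 15 41, Store 41 29, Const 42 3, Op Add 41 41 42,
        Op Add 42 17 30, Load 42 42, Store 41 42, Op Add 22 22 1] [],
      Op Add 24 24 1, Op Less 28 24 26]]"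

text \<open>Chained hashing keyed by parent and label. Heads and links hold index plus 1, with 0 as
  the end of a chain; the roots are never looked up and are not inserted.\<close>

definition pre9 :: "cmd list" where
  "pre9 = [Op Add 24 9 40, Op Less 28 24 22,
    WhileNZ 28 [Const 41 5, Op Mul 41 41 24, Op Add 41 15 41, Load 42 41, Op Mul 42 42 23,
      Op Add 43 41 1, Load 43 43, Op Add 42 42 43, Op Mul 42 20 42, Op Shr 42 42 12, Op Add 42 14 42,
      Load 43 42, Const 44 4, Op Add 41 41 44, Store 41 43, Op Add 24 24 1, Store 42 24, Op Less 28 24 22]]"

definition pre10 :: "nat \<Rightarrow> cmd list" where
  "pre10 Kf = [Const 26 2, Op Add 26 13 26, Store 26 4, Const 26 3, Op Add 26 13 26, Store 26 5,
    Const 26 4, Op Add 26 13 26, Store 26 6, Const 26 5, Op Add 26 13 26, Store 26 9,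
    Const 26 6, Op Add 26 13 26, Store 26 12, Const 26 7, Op Add 26 13 26, Store 26 20,
    Const 26 8, Op Add 26 13 26, Store 26 14, Const 26 9, Op Add 26 13 26, Store 26 15,
    Const 27 Kf, Op Mul 27 27 9, Op Mul 27 27 8, Const 26 10, Op Add 26 13 26, Store 26 27,
    Const 26 11, Op Add 26 13 26, Store 26 23, Const 26 5, Op Mul 26 26 10, Op Add 0 15 26]"

text \<open>The chains without pointers: the last index in \<open>l..<t\<close> whose hash is
  \<open>c\<close>, plus 1, or 0 if there is none. It describes both a head (\<open>t\<close> the
  number of records) and the link of record \<open>t\<close>.\<close>

primrec prv :: "(nat \<Rightarrow> nat) \<Rightarrow> nat \<Rightarrow> nat \<Rightarrow> nat \<Rightarrow> nat" where
  "prv h l c 0 = 0"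
| "prv h l c (Suc t) = (if l \<le> t \<and> h t = c then Suc t else prv h l c t)"

context search_inst
begin

lemma ent_addr:
  assumes "u < X"
  shows "binop_val w Mul 5 u = 5 * u" "binop_val w Add E0 (5 * u) = E0 + 5 * u"
    "binop_val w Add (E0 + 5 * u) (Suc 0) = E0 + (5 * u + 1)" "binop_val w Add (E0 + (5 * u + 1)) (Suc 0) = E0 + (5 * u + 2)"
    "binop_val w Add (E0 + 5 * u) 3 = E0 + (5 * u + 3)" "binop_val w Add (E0 + 5 * u) 4 = E0 + (5 * u + 4)"
    "binop_val w Add u (Suc 0) = Suc u"
proof -
  have "E0 + 5 * u + 4 < Z" using assms E0_less(4) by (simp add: sz_def)
  then show "binop_val w Mul 5 u = 5 * u" "binop_val w Add E0 (5 * u) = E0 + 5 * u"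
    "binop_val w Add (E0 + 5 * u) (Suc 0) = E0 + (5 * u + 1)" "binop_val w Add (E0 + (5 * u + 1)) (Suc 0) = E0 + (5 * u + 2)"
    "binop_val w Add (E0 + 5 * u) 3 = E0 + (5 * u + 3)" "binop_val w Add (E0 + 5 * u) 4 = E0 + (5 * u + 4)"
    "binop_val w Add u (Suc 0) = Suc u"
    by (subst arith_eqs; linarith)+
qed

lemma mkB_ent:
  assumes "u < X"
  shows "(mkB en lev mb)(E0 + 5 * u := v) = mkB (en(u := (en u)(0 := v))) lev mb"
    "(mkB en lev mb)(E0 + (5 * u + 1) := v) = mkB (en(u := (en u)(Suc 0 := v))) lev mb"
    "(mkB en lev mb)(E0 + (5 * u + 2) := v) = mkB (en(u := (en u)(2 := v))) lev mb"
    "(mkB en lev mb)(E0 + (5 * u + 3) := v) = mkB (en(u := (en u)(3 := v))) lev mb"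
  using mkB_upd(7)[OF assms, of 0] mkB_upd(7)[OF assms, of 1] mkB_upd(7)[OF assms, of 2] mkB_upd(7)[OF assms, of 3]
  by simp_all

lemma pre7:
  assumes len: "length rs = X * d"
    and Q: "\<And>R t lev mb \<tau>. \<tau> = tgrow X rs 0 roots \<Longrightarrow> base3 a R \<Longrightarrow> R 22 = length \<tau> \<Longrightarrow> mbok \<tau> mb \<Longrightarrow>
      Q R (mkB (enE (map node_ent \<tau>)) (levf \<tau>) mb) [] t"
    and R: "base3 a R" "R 22 = L"
  shows "wp w Q pre7 R (mkB (\<lambda>_ _. 0) (\<lambda>_. 0) (\<lambda>c. bt (c < L * n))) rs t"
proof -
  define T where "T i = tgrow X (take i rs) 0 roots" for i
  define c where "c i = i div d" for i
  have T0: "T 0 = roots" by (simp add: T_def)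
  have TX: "length (T i) \<le> X" for i
    unfolding T_def using L_le_X by (intro length_tgrow) (simp add: roots_def)
  have TS: "T (Suc i) = (if length (T i) < X then grow_step i (rs ! i mod S) (T i) else T i)" if "i < X * d" for i
    using that len by (simp add: T_def take_Suc_conv_app_nth tgrow_append)
  have ok: "tree_ok (X * d) (T i)" if "i \<le> X * d" for i
  proof -
    have "tree_ok (0 + length (take i rs)) (T i)" unfolding T_def by (intro tree_ok_tgrow tree_ok_roots)
    moreover have "0 + length (take i rs) \<le> X * d" using that by simp
    ultimately show ?thesis by (rule tree_ok_mono)
  qed
  have Xd: "0 < X * d" using L_le_X L1 d1 by simp
  have lts: "0 < w" "5 < (2::nat) ^ w" using w256 basic_bounds by (auto intro!: lt_w)
  have e0: "binop_val w Mul X d = X * d"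
    using Xn basic_bounds by (intro arith_eqs; linarith)
  have e1: "binop_val w Div i d = i div d" "binop_val w Mod i d = i mod d" "binop_val w Add (i mod d) (Suc 0) = Suc (i mod d)"
    "binop_val w Add (3 * Z) (i div d) = 3 * Z + i div d" "i div d < Z" "binop_val w Add i (Suc 0) = Suc i"
    if "i < X * d" for i
  proof -
    have "i div d \<le> i" "i mod d \<le> i" by simp_all
    moreover have "i < Z" using that Xn basic_bounds by linarith
    ultimately show "binop_val w Div i d = i div d" "binop_val w Mod i d = i mod d"
      "binop_val w Add (i mod d) (Suc 0) = Suc (i mod d)" "i div d < Z" "binop_val w Add i (Suc 0) = Suc i"
      "binop_val w Add (3 * Z) (i div d) = 3 * Z + i div d"
      by - ((intro arith_eqs)?; linarith)+
  qed
  have e2: "binop_val w Mod r S = r mod S" for r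
  proof -
    have "r mod S < S" using S_pos by simp
    then have "r mod S < 2 ^ w" using basic_bounds by linarith
    then show ?thesis by (simp add: binop_val.simps)
  qed
  have e3: "binop_val w Mul (bt a) (bt b) = bt (a \<and> b)" for a b
    using basic_bounds by (subst mul_eq) (auto simp: bt_mult bt_def)
  have levk: "levf (T i) v \<le> k" if "i \<le> X * d" for i v
  proof (cases "v < length (T i) \<and> L \<le> v")
    case True
    then show ?thesis using ok[OF that] unfolding tree_ok_def levf_def by auto
  next
    case False
    then show ?thesis using ok[OF that] unfolding tree_ok_def levf_def by auto
  qed
  have e4: "binop_val w Add (levf (T i) v) (Suc 0) = Suc (levf (T i) v)" if "i < X * d" for i v
  proof -
    have "k \<le> X" using basic_bounds(9) by (simp add: L_def)
    then show ?thesis using levk[of i v] that basic_bounds by (intro arith_eqs) linarith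
  qed
  have e5: "binop_val w Add (3 * Z) u = 3 * Z + u" "u < Z" if "u < X" for u
    using that basic_bounds by ((intro arith_eqs)?; linarith)+
  have lev_upd: "(mkB en lev mb)(3 * Z + i := v) = mkB en (lev(i := v)) mb" if "i < X" for en lev mb i v
    using mkB_upd(5)[OF e5(2)[OF that]] .
  define rr where "rr i = rs ! i mod S" for i
  have rrS: "rr i < S" for i using S_pos by (simp add: rr_def)
  define p where "p i = (Suc (i mod d), rr i) # snd (T i ! (i div d))" for i
  define act where "act i \<longleftrightarrow> levf (T i) (i div d) < k \<and> i div d < length (T i) \<and> length (T i) < X" for i
  define cnt where "cnt i = (\<Sum>x<n. bt (list_all (edge_ok (xs ! x)) (p i)))" for i
  have cnt: "cnt i \<noteq> 0 \<longleftrightarrow> (\<exists>x\<in>set xs. list_all (edge_ok x) (p i))" for i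
  proof -
    have "cnt i = 0 \<longleftrightarrow> (\<forall>x<n. \<not> list_all (edge_ok (xs ! x)) (p i))" by (auto simp: cnt_def)
    moreover have "(\<exists>x\<in>set xs. list_all (edge_ok x) (p i)) \<longleftrightarrow> (\<exists>x<n. list_all (edge_ok (xs ! x)) (p i))"
      unfolding n_def using in_set_conv_nth[of _ xs] by (metis nth_mem)
    ultimately show ?thesis by metis
  qed
  \<comment> \<open>The level table replaces the length of the new path and the sum of acceptance
    bits replaces the existential over data points; the cap is part of \<open>act\<close>.\<close>
  have step: "T (Suc i) = (if act i \<and> cnt i \<noteq> 0 then T i @ [(i div d, p i)] else T i)" if "i < X * d" for i
    unfolding TS[OF that] act_def cnt grow_step_def Let_def p_def rr_def
    by (auto simp: levf_def Suc_le_eq)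
  define mbn where "mbn i mb c = (if length (T i) * n \<le> c \<and> c < length (T i) * n + n
        then bt (list_all (edge_ok (xs ! (c - length (T i) * n))) (p i)) else mb c)" for i mb c
  have mbn1: "mbok (T i) (mbn i mb)" if "mbok (T i) mb" for i mb
    unfolding mbok_def
  proof (intro allI impI)
    fix u x assume "u < length (T i)" "x < n"
    then show "mbn i mb (u * n + x) = bt (list_all (edge_ok (xs ! x)) (snd (T i ! u)))"
      using un_less[of u "length (T i)" x] that by (simp add: mbn_def mbok_def)
  qed
  have mbn2: "mbok (T i @ [(v, p i)]) (mbn i mb)" if "mbok (T i) mb" for i mb v
    unfolding mbok_def
  proof (intro allI impI)
    fix u x assume u: "u < length (T i @ [(v, p i)])" "x < n"
    show "mbn i mb (u * n + x) = bt (list_all (edge_ok (xs ! x)) (snd ((T i @ [(v, p i)]) ! u)))"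
    proof (cases "u < length (T i)")
      case True
      then show ?thesis using mbn1[OF that] u by (simp add: mbok_def nth_append)
    next
      case False
      then have "u = length (T i)" using u by simp
      then show ?thesis using u by (simp add: mbn_def)
    qed
  qed
  have ent: "enE (map node_ent (T i @ [(i div d, p i)])) = (enE (map node_ent (T i)))(length (T i) :=
      (enE (map node_ent (T i)) (length (T i)))(0 := i div d, Suc 0 := Suc (i mod d), 2 := rr i))" for i
    using enE_append3[of "map node_ent (T i)" "i div d" "Suc (i mod d)" "rr i"] by (simp add: node_ent_def p_def)
  have levt: "levf (T i @ [(i div d, p i)]) = (levf (T i))(length (T i) := Suc (levf (T i) (i div d)))"
    if "i div d < length (T i)" for i
    using levf_append[of "T i" "i div d" "p i"] that by (simp add: p_def levf_def)
  have init: "mbok roots (\<lambda>c. bt (c < L * n))" "enE (map node_ent roots) = (\<lambda>_ _. 0)" "levf roots = (\<lambda>_. 0)"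
    by (auto simp: mbok_def roots_def un_less enE_def node_ent_def levf_def fun_eq_iff)
  define I where "I i R M' rs' t \<longleftrightarrow> base3 a R \<and> R 22 = length (T i) \<and> R 24 = i \<and> R 26 = X * d \<and>
      R 28 = bt (i < X * d) \<and> rs' = drop i rs \<and>
      (\<exists>mb. mbok (T i) mb \<and> M' = mkB (enE (map node_ent (T i))) (levf (T i)) mb)" for i R M' rs' and t :: nat
  show ?thesis
    unfolding pre7_def
    using R
    apply (simp add: base3R[of a] e0 cmp_bt lts)
    apply (rule wp_for[where N = "X * d" and I = I])
    subgoal using init unfolding I_def T0 by (simp add: base3_upd base3R[of a] roots_def Xd) blast
    subgoal for i by (simp add: I_def order_less_le)
    subgoal premises prems for i R M' rs' t
    proof -
      have i: "i < X * d" by fact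
      from prems(4) obtain mb where R: "base3 a R" "R 22 = length (T i)" "R 24 = i" "R 26 = X * d"
        "R 28 = bt (i < X * d)" and rs': "rs' = drop i rs" and mb: "mbok (T i) mb"
        and M': "M' = mkB (enE (map node_ent (T i))) (levf (T i)) mb" unfolding I_def by blast
      have dr: "drop i rs = rs ! i # drop (Suc i) rs" using i len by (simp add: Cons_nth_drop_Suc)
      show ?thesis
      proof (cases "act i")
        case False
        have S: "T (Suc i) = T i" using step[OF i] False by simp
        show ?thesis
          using R(1-4) unfolding rs' M' dr
          apply (simp add: base3R[of a] e1[OF i] e2 e3 e5 cmp_bt mkB_upd(1) act_def[symmetric] False)
          apply (simp add: I_def base3_upd S base3R[of a])
          using mb by blast
      next
        case True
        then have act: "levf (T i) (i div d) < k" "i div d < length (T i)" "length (T i) < X" by (auto simp: act_def)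
        show ?thesis
          using R(1-4) unfolding rs' M' dr
          apply (simp add: base3R[of a] e1[OF i] e2 e3 e5 cmp_bt mkB_upd(1) act_def[symmetric] True rr_def[symmetric])
          apply (rule pre7_inner[where \<tau> = "T i" and v = "i div d" and j = "Suc (i mod d)" and r = "rr i"
                and i = i and a = a and lv = "levf (T i) (i div d)"])
          unfolding p_def[symmetric] cnt_def[symmetric] mbn_def[symmetric]
          subgoal for R t
          proof (cases "cnt i = 0")
            case c: True
            then have S: "T (Suc i) = T i" using step[OF i] by simp
            assume "base3 a R" "R 22 = length (T i)" "R 24 = i" "R 26 = X * d" "R 27 = rr i" "R 29 = i div d"
              "R 30 = Suc (i mod d)" "R 31 = levf (T i) (i div d)" "R 34 = cnt i"
            then show ?thesis
              apply (simp add: c base3R[of a] e1[OF i] cmp_bt)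
              apply (simp add: I_def base3_upd base3R[of a] S)
              using mbn1[OF mb] unfolding mbn_def[abs_def] by blast
          next
            case c: False
            then have S: "T (Suc i) = T i @ [(i div d, p i)]" using step[OF i] True by simp
            assume "base3 a R" "R 22 = length (T i)" "R 24 = i" "R 26 = X * d" "R 27 = rr i" "R 29 = i div d"
              "R 30 = Suc (i mod d)" "R 31 = levf (T i) (i div d)" "R 34 = cnt i"
            then show ?thesis
              using c
              apply (simp add: base3R[of a] e1[OF i] cmp_bt lts ent_addr[OF act(3)] ent_addr[OF act(3), simplified]
                  mkB_ent[OF act(3)] mkB_ent[OF act(3), simplified] e4[OF i] e5[OF act(3)] lev_upd[OF act(3)])
              apply (simp add: I_def base3_upd base3R[of a] S ent[simplified] levt[OF act(2)])
              using mbn2[OF mb] unfolding mbn_def[abs_def] by blast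
          qed
          using d_pos rrS mb act by (simp_all add: base3_upd base3R[of a] Suc_le_eq)
      qed
    qed
    subgoal for R M' rs' t
      using Q[of "T (X * d)" R] len unfolding I_def T_def by auto
    done
qed

end

definition preprocessing :: "nat \<Rightarrow> nat \<Rightarrow> cmd list" where
  "preprocessing K Kf = pre1 @ pre2 @ pre3 @ pre4 K @ pre5 @ pre6 @ pre7 @ pre8 @ pre9 @ pre10 Kf"

context search_inst
begin

definition leaf_ok :: "nodes \<Rightarrow> nat \<Rightarrow> nat \<Rightarrow> bool" where
  "leaf_ok \<tau> v x \<longleftrightarrow> length (snd (\<tau> ! v)) = k \<and> list_all (edge_ok (xs ! x)) (snd (\<tau> ! v))"

text \<open>Position \<open>c\<close> runs over pairs of a node \<open>c div n\<close> and a data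
  point \<open>c mod n\<close>, the order in which the program scans the acceptance matrix.\<close>

definition cands :: "nodes \<Rightarrow> nat \<Rightarrow> (nat \<times> nat \<times> nat \<times> nat) list" where
  "cands \<tau> i = map (\<lambda>c. (c div n, 0, 0, adr (c mod n))) (filter (\<lambda>c. leaf_ok \<tau> (c div n) (c mod n)) [0..<i])"

text \<open>Candidates share the cap \<open>X\<close> with the nodes; if the total stays within it,
  nothing is cut off, and this is one of the events that make a run good.\<close>

definition ents :: "nodes \<Rightarrow> nat \<Rightarrow> (nat \<times> nat \<times> nat \<times> nat) list" where
  "ents \<tau> i = take X (map node_ent \<tau> @ cands \<tau> i)"

definition entries :: "nodes \<Rightarrow> (nat \<times> nat \<times> nat \<times> nat) list" where
  "entries \<tau> = ents \<tau> (length \<tau> * n)"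

lemma ents_Suc: "ents \<tau> (Suc i) = (if leaf_ok \<tau> (i div n) (i mod n) \<and> length (ents \<tau> i) < X
    then ents \<tau> i @ [(i div n, 0, 0, adr (i mod n))] else ents \<tau> i)"
  by (auto simp: ents_def cands_def)

lemma mbn_div: "i < N * n \<Longrightarrow> i div n < N \<and> i mod n < n"
  using n2 by (simp add: less_mult_imp_div_less)

lemma pre8:
  assumes Q: "\<And>R t. base3 a R \<Longrightarrow> R 22 = length (entries \<tau>) \<Longrightarrow>
      Q R (mkB (enE (entries \<tau>)) (levf \<tau>) mb) rs t"
    and R: "base3 a R" "R 22 = length \<tau>" and mb: "mbok \<tau> mb" and \<tau>: "length \<tau> \<le> X"
  shows "wp w Q pre8 R (mkB (enE (map node_ent \<tau>)) (levf \<tau>) mb) rs t"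
proof -
  define N where "N = length \<tau> * n"
  have NX: "N \<le> X * n" using \<tau> by (simp add: N_def)
  have NS: "N \<le> S * S" using NX Xn by linarith
  have lts: "0 < w" "5 < (2::nat) ^ w" "3 < (2::nat) ^ w" using w256 basic_bounds by (auto intro!: lt_w)
  have e0: "binop_val w Mul (length \<tau>) n = N"
    using NS basic_bounds unfolding N_def by (intro arith_eqs; linarith)
  have e1: "binop_val w Div i n = i div n" "binop_val w Mod i n = i mod n"
    "binop_val w Add (3 * Z) (i div n) = 3 * Z + i div n" "i div n < Z" "binop_val w Add i (Suc 0) = Suc i"
    "binop_val w Add (4 * Z) i = 4 * Z + i" "binop_val w Add (2 * Z) (i mod n) = 2 * Z + i mod n"
    "i mod n < Z" "adf n (i mod n) = adr (i mod n)"
    if "i < N" for i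
  proof -
    have "i div n \<le> i" "i mod n \<le> i" by simp_all
    moreover have "i < Z" using that NS basic_bounds by linarith
    ultimately show "binop_val w Div i n = i div n" "binop_val w Mod i n = i mod n"
      "i div n < Z" "binop_val w Add i (Suc 0) = Suc i"
      "binop_val w Add (3 * Z) (i div n) = 3 * Z + i div n" "binop_val w Add (4 * Z) i = 4 * Z + i"
      "binop_val w Add (2 * Z) (i mod n) = 2 * Z + i mod n" "i mod n < Z"
      by - ((intro arith_eqs)?; linarith)+
    show "adf n (i mod n) = adr (i mod n)" using mbn_div[of i "length \<tau>"] that by (simp add: adf_def N_def)
  qed
  have e3: "binop_val w Mul (bt a) (bt b) = bt (a \<and> b)" for a b
    using basic_bounds by (subst mul_eq) (auto simp: bt_mult bt_def)
  have e4: "levf \<tau> (i div n) = length (snd (\<tau> ! (i div n)))"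
      "mb i = bt (list_all (edge_ok (xs ! (i mod n))) (snd (\<tau> ! (i div n))))" if "i < N" for i
  proof -
    have *: "i div n < length \<tau>" "i mod n < n" using mbn_div[of i "length \<tau>"] that by (auto simp: N_def)
    then have "mb (i div n * n + i mod n) = bt (list_all (edge_ok (xs ! (i mod n))) (snd (\<tau> ! (i div n))))"
      using mb unfolding mbok_def by blast
    then show "levf \<tau> (i div n) = length (snd (\<tau> ! (i div n)))"
      "mb i = bt (list_all (edge_ok (xs ! (i mod n))) (snd (\<tau> ! (i div n))))"
      using * by (simp_all add: levf_def)
  qed
  have es0: "ents \<tau> 0 = map node_ent \<tau>" using \<tau> by (simp add: ents_def cands_def)
  have esX: "length (ents \<tau> i) \<le> X" for i by (simp add: ents_def)
  have app: "enE (es @ [(v, 0, 0, q)]) = (enE es)(length es := (enE es (length es))(0 := v, 3 := q))" for es v q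
    by (auto simp: enE_def fun_eq_iff nth_append)
  define I where "I i R M' rs' t \<longleftrightarrow> base3 a R \<and> R 22 = length (ents \<tau> i) \<and> R 24 = i \<and> R 26 = N \<and>
      R 28 = bt (i < N) \<and> rs' = rs \<and> M' = mkB (enE (ents \<tau> i)) (levf \<tau>) mb" for i R M' rs' and t :: nat
  show ?thesis
    unfolding pre8_def
    using R
    apply (simp add: base3R[of a] e0 cmp_bt lts)
    apply (rule wp_for[where N = N and I = I])
    subgoal unfolding I_def es0 by (simp add: base3_upd)
    subgoal for i by (simp add: I_def order_less_le)
    subgoal premises prems for i R M' rs' t
    proof -
      have i: "i < N" by fact
      from prems(4) have R: "base3 a R" "R 22 = length (ents \<tau> i)" "R 24 = i" "R 26 = N"
        "R 28 = bt (i < N)" and rs': "rs' = rs" and M': "M' = mkB (enE (ents \<tau> i)) (levf \<tau>) mb"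
        unfolding I_def by blast+
      define act where "act \<longleftrightarrow> length (snd (\<tau> ! (i div n))) = k \<and>
        list_all (edge_ok (xs ! (i mod n))) (snd (\<tau> ! (i div n))) \<and> length (ents \<tau> i) < X"
      show ?thesis
      proof (cases act)
        case False
        then have S: "ents \<tau> (Suc i) = ents \<tau> i" by (auto simp: ents_Suc act_def leaf_ok_def)
        show ?thesis
          using R(1-4) unfolding rs' M'
          apply (simp add: base3R[of a] e1[OF i] e3 e4[OF i] cmp_bt mkB_upd(1,2) act_def[symmetric] False)
          apply (simp add: I_def base3_upd S base3R[of a])
          done
      next
        case True
        then have S: "ents \<tau> (Suc i) = ents \<tau> i @ [(i div n, 0, 0, adr (i mod n))]"
          and lX: "length (ents \<tau> i) < X" by (auto simp: ents_Suc act_def leaf_ok_def)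
        show ?thesis
          using R(1-4) unfolding rs' M'
          apply (simp add: base3R[of a] e1[OF i] e3 e4[OF i] cmp_bt mkB_upd(1,2) act_def[symmetric] True
              lts ent_addr[OF lX] mkB_ent[OF lX] mkB_upd(3))
          apply (simp add: I_def base3_upd S base3R[of a] app)
          done
      qed
    qed
    subgoal for R M' rs' t
      using Q[of R "Suc t"] unfolding I_def entries_def N_def by simp
    done
qed

definition hsh :: "nat \<Rightarrow> nat \<Rightarrow> nat" where
  "hsh a key = a * key mod 2 ^ w div 2 ^ (w - lgM)"

definition ekey :: "nat \<times> nat \<times> nat \<times> nat \<Rightarrow> nat" where
  "ekey e = fst e * dd + fst (snd e)"

lemma hsh_less: "hsh a key < M"
proof -
  have "(2::nat) ^ w = 2 ^ lgM * 2 ^ (w - lgM)" using lgM_le by (simp flip: power_add)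
  then have "a * key mod 2 ^ w < M * 2 ^ (w - lgM)" by (simp add: M_def)
  then show ?thesis unfolding hsh_def by (rule less_mult_imp_div_less)
qed

definition mkC :: "(nat \<Rightarrow> nat) \<Rightarrow> (nat \<Rightarrow> nat) \<Rightarrow> (nat \<Rightarrow> nat \<Rightarrow> nat) \<Rightarrow> (nat \<Rightarrow> nat) \<Rightarrow> (nat \<Rightarrow> nat) \<Rightarrow> nat \<Rightarrow> nat" where
  "mkC ifo hds en lev mb = mk lowI ifo hds en (ind (inc_set n)) (adf n) lev mb"

text \<open>Only field 4, the link, changes while the table is built; the records from
  \<open>t\<close> on are not yet linked.\<close>

definition enH :: "nat \<Rightarrow> (nat \<times> nat \<times> nat \<times> nat) list \<Rightarrow> nat \<Rightarrow> nat \<Rightarrow> nat \<Rightarrow> nat" where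
  "enH a es t u f = (if f = 4 then (if L \<le> u \<and> u < t then prv (\<lambda>u. hsh a (ekey (es ! u))) L (hsh a (ekey (es ! u))) u else 0)
     else enE es u f)"

definition ifo_fin :: "nat \<Rightarrow> nat \<Rightarrow> nat" where
  "ifo_fin a = (\<lambda>_. 0)(2 := S, 3 := B, 4 := G, 5 := L, 6 := w - lgM, 7 := a, 8 := H0, 9 := E0, 10 := Kf * L * y, 11 := dd)"

lemma prv_init: "t \<le> l \<Longrightarrow> prv h l c t = 0"
  by (induction t) auto

lemma enE_4: "enE es u 4 = 0"
  by (auto simp: enE_def split: prod.splits)

lemma mkC_en:
  assumes "u < X"
  shows "mkC ifo hds en lev mb (E0 + 5 * u) = en u 0" "mkC ifo hds en lev mb (E0 + (5 * u + 1)) = en u (Suc 0)"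
    "(mkC ifo hds en lev mb)(E0 + (5 * u + 4) := v) = mkC ifo hds (en(u := (en u)(4 := v))) lev mb"
  using mk_read(4)[OF assms, of 0] mk_read(4)[OF assms, of 1] mk_write(4)[OF assms, of 4]
  by (simp_all add: mkC_def)

lemma pre9:
  assumes Q: "\<And>R t. base3 a R \<Longrightarrow>
      Q R (mkC (\<lambda>_. 0) (\<lambda>c. prv (\<lambda>u. hsh a (ekey (es ! u))) L c (length es)) (enH a es (length es)) lev mb) rs t"
    and R: "base3 a R" "R 22 = length es" and es: "length es \<le> X" "L \<le> length es"
    and ent: "\<And>u. u < length es \<Longrightarrow> fst (es ! u) < X \<and> fst (snd (es ! u)) \<le> d"
  shows "wp w Q pre9 R (mkB (enE es) lev mb) rs t"
proof -
  define h where "h u = hsh a (ekey (es ! u))" for u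
  have lts: "0 < w" "5 < (2::nat) ^ w" "4 < (2::nat) ^ w" using w256 basic_bounds by (auto intro!: lt_w)
  have e0: "binop_val w Add L 0 = L" using basic_bounds by (subst add_eq; linarith)
  have enE: "enE es u 0 = fst (es ! u)" "enE es u (Suc 0) = fst (snd (es ! u))" if "u < length es" for u
    using that by (auto simp: enE_def split: prod.splits)
  have enH: "enH a es t u 0 = fst (es ! u)" "enH a es t u (Suc 0) = fst (snd (es ! u))" if "u < length es" for u t
    using enE[OF that] by (simp_all add: enH_def)
  have e1: "binop_val w Mul (fst (es ! u)) dd = fst (es ! u) * dd"
    "binop_val w Add (fst (es ! u) * dd) (fst (snd (es ! u))) = ekey (es ! u)"
    "binop_val w Shr (binop_val w Mul a (ekey (es ! u))) (w - lgM) = h u"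
    "binop_val w Add H0 (h u) = H0 + h u" "h u < M" if "u < length es" for u
  proof -
    have le: "fst (es ! u) * dd \<le> S * S" using ent[OF that] X_le nd by (intro prod_le_SS) (auto simp: dd_def)
    then show "binop_val w Mul (fst (es ! u)) dd = fst (es ! u) * dd"
      using basic_bounds by (intro mul_eq; linarith)
    show "binop_val w Add (fst (es ! u) * dd) (fst (snd (es ! u))) = ekey (es ! u)"
      unfolding ekey_def using le ent[OF that] basic_bounds by (intro add_eq; linarith)
    have "a * ekey (es ! u) mod 2 ^ w < 2 ^ w" by simp
    then show "binop_val w Shr (binop_val w Mul a (ekey (es ! u))) (w - lgM) = h u"
      by (simp add: binops(6) binop_val.simps(3) h_def hsh_def)
    show hM: "h u < M" unfolding h_def by (rule hsh_less)
    have "H0 + M \<le> Z" using E0_less by (simp add: E0_def)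
    then show "binop_val w Add H0 (h u) = H0 + h u" using hM basic_bounds by (intro add_eq; linarith)
  qed
  have e2: "mkC ifo hds en lev mb (H0 + c) = hds c" "(mkC ifo hds en lev mb)(H0 + c := v) = mkC ifo (hds(c := v)) en lev mb"
    if "c < M" for ifo hds en lev mb c v using that by (simp_all add: mkC_def mk_read mk_write)
  have hd0: "mkB (enE es) lev mb = mkC (\<lambda>_. 0) (\<lambda>c. prv h L c L) (enH a es L) lev mb"
  proof -
    have "enH a es L = enE es" by (auto simp: enH_def fun_eq_iff enE_4)
    then show ?thesis by (simp add: mkB_def mkC_def prv_init)
  qed
  have enS: "(enH a es u)(u := (enH a es u u)(4 := prv h L (h u) u)) = enH a es (Suc u)"
    if "L \<le> u" for u
    using that by (auto simp: enH_def fun_eq_iff h_def[abs_def])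
  have hdS: "(\<lambda>c. prv h L c u)(h u := Suc u) = (\<lambda>c. prv h L c (Suc u))" if "L \<le> u" for u
    using that by (auto simp: fun_eq_iff)
  define I where "I i R M' rs' t \<longleftrightarrow> base3 a R \<and> R 22 = length es \<and> R 24 = L + i \<and>
      R 28 = bt (L + i < length es) \<and> rs' = rs \<and> M' = mkC (\<lambda>_. 0) (\<lambda>c. prv h L c (L + i)) (enH a es (L + i)) lev mb"
    for i R M' rs' and t :: nat
  show ?thesis
    unfolding pre9_def
    using R
    apply (simp add: base3R[of a] e0 cmp_bt lts)
    apply (rule wp_for[where N = "length es - L" and I = I])
    subgoal unfolding I_def hd0 by (simp add: base3_upd)
    subgoal for i using es by (auto simp: I_def)
    subgoal premises prems for i R M' rs' t
    proof -
      have i: "i < length es - L" by fact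
      define u where "u = L + i"
      have u: "u < length es" "u < X" "L \<le> u" using i es by (auto simp: u_def)
      from prems(4) have R: "base3 a R" "R 22 = length es" "R 24 = u" and rs': "rs' = rs"
        and M': "M' = mkC (\<lambda>_. 0) (\<lambda>c. prv h L c u) (enH a es u) lev mb"
        unfolding I_def u_def by blast+
      show ?thesis
        using R(1-3) unfolding rs' M'
        apply (simp add: base3R[of a] lts ent_addr[OF u(2)] ent_addr[OF u(2), simplified] mkC_en[OF u(2)]
            mkC_en[OF u(2), simplified] enH[OF u(1)] e1[OF u(1)] e2 cmp_bt enS[OF u(3)] hdS[OF u(3)]
            del: prv.simps)
        apply (simp add: I_def base3_upd base3R[of a] u_def[symmetric] del: prv.simps)
        done
    qed
    subgoal for R M' rs' t
      using Q[of R "Suc t"] es unfolding I_def h_def[abs_def] by simp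
    done
qed

lemma pre10:
  assumes Q: "\<And>R t. R 0 = sz \<Longrightarrow> Q R (mkC (ifo_fin a) hds en lev mb) rs t" and R: "base3 a R"
  shows "wp w Q (pre10 Kf) R (mkC (\<lambda>_. 0) hds en lev mb) rs t"
proof -
  have KfL: "Kf * L \<le> S" "Kf \<le> S"
  proof -
    show "Kf * L \<le> S" using unit_le mult_le_mono2[OF y1, of "Kf * L"] by linarith
    then show "Kf \<le> S" using mult_le_mono2[OF L1, of Kf] by linarith
  qed
  have lts: "0 < w" "c < (2::nat) ^ w" if "c < 16" for c using w256 basic_bounds that by (auto intro!: lt_w)
  have Kw: "Kf < 2 ^ w" using KfL basic_bounds by (intro lt_w) linarith
  have e0: "binop_val w Mul Kf L = Kf * L" "binop_val w Mul (Kf * L) y = Kf * L * y" "binop_val w Mul 5 X = 5 * X"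
    "binop_val w Add E0 (5 * X) = sz"
    using KfL unit_le basic_bounds E0_less(4) unfolding sz_def by (subst arith_eqs; linarith)+
  have e1: "binop_val w Add Iv c = Iv + c" "(mkC ifo hds en lev mb)(Iv + c := v) = mkC (ifo(c := v)) hds en lev mb"
    if "c < 16" for c ifo v
    using that E0_less H0_E0 basic_bounds by (intro arith_eqs; linarith) (simp add: mkC_def mk_write that)
  show ?thesis
    unfolding pre10_def
    using R
    apply (simp add: base3R[of a] lts Kw e0 e1 e1(2)[of 2, simplified])
    apply (rule Q[unfolded ifo_fin_def])
    apply simp
    done
qed

lemma entries_bounds:
  assumes "tree_ok (X * d) \<tau>" "length \<tau> \<le> X"
  shows "u < length (entries \<tau>) \<Longrightarrow> fst (entries \<tau> ! u) < X \<and> fst (snd (entries \<tau> ! u)) \<le> d"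
    "L \<le> length (entries \<tau>)" "length (entries \<tau>) \<le> X" "length \<tau> \<le> length (entries \<tau>)"
proof -
  have L: "L \<le> length \<tau>" using assms(1) by (simp add: tree_ok_def)
  show "L \<le> length (entries \<tau>)" "length (entries \<tau>) \<le> X" "length \<tau> \<le> length (entries \<tau>)"
    using L assms(2) L_le_X by (auto simp: entries_def ents_def)
  assume u: "u < length (entries \<tau>)"
  show "fst (entries \<tau> ! u) < X \<and> fst (snd (entries \<tau> ! u)) \<le> d"
  proof (cases "u < length \<tau>")
    case True
    then have e: "entries \<tau> ! u = node_ent (\<tau> ! u)" using assms(2) by (simp add: entries_def ents_def nth_append)
    show ?thesis
    proof (cases "u < L")
      case True
      then have "\<tau> ! u = (0, [])" using assms(1) by (simp add: tree_ok_def)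
      then show ?thesis using L1 L_le_X by (simp add: e node_ent_def)
    next
      case False
      then obtain v j r where "\<tau> ! u = (v, (j, r) # snd (\<tau> ! v))" "v < u" "j \<le> d"
        using assms(1) True unfolding tree_ok_def by (meson not_le)
      then show ?thesis using True assms(2) by (simp add: e node_ent_def)
    qed
  next
    case False
    have "entries \<tau> ! u = cands \<tau> (length \<tau> * n) ! (u - length \<tau>)"
      using u False by (simp add: entries_def ents_def nth_append)
    moreover have "u - length \<tau> < length (cands \<tau> (length \<tau> * n))" using u False by (auto simp: entries_def ents_def)
    ultimately have "entries \<tau> ! u \<in> set (cands \<tau> (length \<tau> * n))" by simp
    then obtain c where "c < length \<tau> * n" "entries \<tau> ! u = (c div n, 0, 0, adr (c mod n))"
      by (auto simp: cands_def)
    then show ?thesis using mbn_div[of c "length \<tau>"] assms(2) by auto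
  qed
qed

definition tree_of :: "nat list \<Rightarrow> nodes" where
  "tree_of rs = tgrow X rs 0 roots"

lemma tree_of:
  assumes "length rs = X * d"
  shows "tree_ok (X * d) (tree_of rs)" "length (tree_of rs) \<le> X" "tree_of rs = take X (grow rs 0 roots)"
proof -
  show "tree_ok (X * d) (tree_of rs)" unfolding tree_of_def using tree_ok_tgrow[OF tree_ok_roots, of 0 rs X] assms by simp
  show "length (tree_of rs) \<le> X" unfolding tree_of_def using L_le_X by (intro length_tgrow) (simp add: roots_def)
  have "take X roots = roots" using L_le_X by (simp add: roots_def)
  then show "tree_of rs = take X (grow rs 0 roots)"
    unfolding tree_of_def using tgrow_take[of 0 rs X roots] assms by simp
qed

text \<open>The levels and acceptance bits are hidden by existentials, since these arrays lie beyond
  \<open>sz\<close> and are not passed on to a query.\<close>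

definition data :: "nat \<Rightarrow> nat list \<Rightarrow> (nat \<Rightarrow> nat) \<Rightarrow> bool" where
  "data a rs M' \<longleftrightarrow> (let es = entries (tree_of rs) in \<exists>lev mb. M' = mkC (ifo_fin a)
     (\<lambda>c. prv (\<lambda>u. hsh a (ekey (es ! u))) L c (length es)) (enH a es (length es)) lev mb)"

theorem preprocessing:
  assumes len: "length rs = X * d"
  shows "wp w (\<lambda>R M' rs' t. R 0 = sz \<and> data a rs M') (preprocessing K Kf) (\<lambda>_. 0) mem0 (a # rs) 0"
proof -
  note eb = entries_bounds[OF tree_of(1,2)[OF len]]
  show ?thesis
    unfolding preprocessing_def
    apply (rule wp_append, rule pre1)
     apply (rule wp_append, rule pre2)
        apply (rule wp_append, rule pre3)
         apply (rule wp_append, rule pre4)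
            apply (rule wp_append, rule pre5)
             apply (rule wp_append, rule pre6[where a = a])
               apply (rule wp_append, rule pre7[OF len, where a = a])
                 apply (rule wp_append)
                 apply (simp only: tree_of_def[symmetric])
                 apply (rule pre8[where a = a])
                     apply (rule wp_append, rule pre9[where a = a])
                          apply (rule pre10[where a = a])
                           apply (simp only: data_def Let_def)
                           apply blast
    using eb tree_of(2)[OF len] by (assumption | simp)+
qed

end

section \<open>The query as an abstract search, and its total work\<close>

lemma prv_le: "prv h l c t \<le> t"
  by (induction t) auto

lemma prv_prop: "prv h l c t \<noteq> 0 \<Longrightarrow> l \<le> prv h l c t - 1 \<and> h (prv h l c t - 1) = c"
  by (induction t) auto

text \<open>A chain skips nothing: between a link target and the link there is no record of the same
  bucket.\<close>

lemma prv_between: "prv h l c t \<le> u \<Longrightarrow> u < t \<Longrightarrow> l \<le> u \<Longrightarrow> h u \<noteq> c"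
  by (induction t) (auto simp: less_Suc_eq split: if_splits)

locale query_inst = search_inst +
  fixes q :: "nat set" and a :: nat and rs :: "nat list"
  assumes q_sub: "q \<subseteq> {1..d}" and len_rs: "length rs = X * d"
begin

definition \<tau> :: nodes where "\<tau> = tree_of rs"
definition es :: "(nat \<times> nat \<times> nat \<times> nat) list" where "es = entries \<tau>"
definition N :: nat where "N = length es"
definition par :: "nat \<Rightarrow> nat" where "par u = fst (es ! u)"
definition lab :: "nat \<Rightarrow> nat" where "lab u = fst (snd (es ! u))"
definition rv :: "nat \<Rightarrow> nat" where "rv u = fst (snd (snd (es ! u)))"
definition pay :: "nat \<Rightarrow> nat" where "pay u = snd (snd (snd (es ! u)))"
definition T :: nat where "T = card q"
definition sq :: "nat list" where "sq = sorted_list_of_set q"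
text \<open>The labels to look up at a node: index 0 asks for candidates, index \<open>i > 0\<close>
  for the child at the \<open>i\<close>-th element of the query.\<close>

definition lb :: "nat \<Rightarrow> nat" where "lb i = (if i = 0 then 0 else sq ! (i - 1))"
definition hu :: "nat \<Rightarrow> nat" where "hu u = hsh a (par u * dd + lab u)"
definition hb :: "nat \<Rightarrow> nat \<Rightarrow> nat" where "hb v i = hsh a (v * dd + lb i)"
definition mt :: "nat \<Rightarrow> nat \<Rightarrow> nat \<Rightarrow> bool" where
  "mt v i u \<longleftrightarrow> par u = v \<and> lab u = lb i \<and> rv u * (B * T) < S * S"
text \<open>The payload is the address of a data point; addresses are strictly increasing, so the
  choice is unique.\<close>

definition pt :: "nat \<Rightarrow> nat set" where "pt u = xs ! (SOME x. x < n \<and> adr x = pay u)"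
definition acc :: "nat set \<Rightarrow> bool" where "acc x \<longleftrightarrow> 0 < card x \<and> max (card x) T * G \<le> card (x \<inter> q) * S"
text \<open>A set heavier than this cannot be accepted, as the intersection has at most
  \<open>T\<close> elements. Such sets are refused by weight, so it also bounds the length of a
  verification.\<close>

definition tm :: nat where "tm = T * S div G"
definition rc :: "nat \<Rightarrow> nat" where "rc u = (if card (pt u) * G \<le> T * S then card (pt u) else 0)"
text \<open>The part of a bucket still to be scanned when the chain pointer is
  \<open>c\<close>.\<close>

definition pend :: "nat \<Rightarrow> nat \<Rightarrow> nat \<Rightarrow> nat set" where
  "pend v i c = {u \<in> {L..<N}. u < c \<and> hu u = hb v i}"

lemma tau_ok: "tree_ok (X * d) \<tau>" "length \<tau> \<le> X"
  using tree_of[OF len_rs] by (auto simp: \<tau>_def)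

lemma finite_q: "finite q" using q_sub finite_subset by blast

lemma T_le: "T \<le> d" unfolding T_def using card_mono[OF _ q_sub] by simp

lemma sq_props: "length sq = T" "set sq = q" "distinct sq"
  using finite_q by (auto simp: sq_def T_def)

lemma N_le: "N \<le> X" "L \<le> N" "length \<tau> \<le> N"
  using entries_bounds[OF tau_ok] by (auto simp: N_def es_def)

lemma L_tau: "L \<le> length \<tau>" using tau_ok by (simp add: tree_ok_def)

lemma lb_q: "0 < i \<Longrightarrow> i \<le> T \<Longrightarrow> lb i \<in> q"
  using nth_mem[of "i - 1" sq] sq_props by (simp add: lb_def)

lemma lb_le: "i \<le> T \<Longrightarrow> lb i \<le> d"
  using lb_q[of i] q_sub by (cases "i = 0") (auto simp: lb_def)

lemma lb_0: "lb 0 = 0" by (simp add: lb_def)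

lemma lb_pos: "0 < i \<Longrightarrow> i \<le> T \<Longrightarrow> 1 \<le> lb i"
  using lb_q[of i] q_sub by auto

lemma lb_inj: "i \<le> T \<Longrightarrow> j \<le> T \<Longrightarrow> lb i = lb j \<Longrightarrow> i = j"
proof -
  assume *: "i \<le> T" "j \<le> T" "lb i = lb j"
  show "i = j"
  proof (cases "i = 0 \<or> j = 0")
    case True
    then show ?thesis using * lb_pos[of i] lb_pos[of j] lb_0 by (metis not_one_le_zero neq0_conv)
  next
    case False
    then have "i - 1 = j - 1" using * sq_props nth_eq_iff_index_eq[of sq "i - 1" "j - 1"] by (auto simp: lb_def)
    then show ?thesis using False by arith
  qed
qed

lemma lb_surj: "j \<in> q \<Longrightarrow> \<exists>i\<le>T. 0 < i \<and> lb i = j"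
proof -
  assume "j \<in> q"
  then obtain e where "e < T" "sq ! e = j" using sq_props by (metis in_set_conv_nth)
  then show ?thesis by (intro exI[of _ "Suc e"]) (simp add: lb_def)
qed

lemma adr_inj: "i < j \<Longrightarrow> adr i < adr j"
  using adr_mono[of "Suc i" j] by (simp add: adr_Suc)

lemma adr_eq: "adr i = adr j \<longleftrightarrow> i = j"
  using adr_inj[of i j] adr_inj[of j i] by (cases i j rule: linorder_cases) auto

lemma pt_eq: "pay u = adr x \<Longrightarrow> x < n \<Longrightarrow> pt u = xs ! x"
proof -
  assume *: "pay u = adr x" "x < n"
  have "(SOME x. x < n \<and> adr x = pay u) = x" using * adr_eq by (intro some_equality) auto
  then show ?thesis by (simp add: pt_def)
qed

lemma entry_node:
  assumes "u < length \<tau>"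
  shows "pay u = 0" "L \<le> u \<Longrightarrow> par u < u \<and> 1 \<le> lab u \<and> rv u < S \<and> snd (\<tau> ! u) = (lab u, rv u) # snd (\<tau> ! par u)"
    "u < L \<Longrightarrow> \<tau> ! u = (0, [])" "rv u < S" "par u < length \<tau>"
proof -
  have e: "es ! u = node_ent (\<tau> ! u)" using assms tau_ok(2) by (simp add: es_def entries_def ents_def nth_append)
  show "pay u = 0" unfolding pay_def e by (simp add: node_ent_def split: prod.splits list.splits)
  show root: "u < L \<Longrightarrow> \<tau> ! u = (0, [])" using tau_ok by (simp add: tree_ok_def)
  have nd: "par u < u \<and> 1 \<le> lab u \<and> rv u < S \<and> snd (\<tau> ! u) = (lab u, rv u) # snd (\<tau> ! par u)" if "L \<le> u"
  proof -
    have "L \<le> u \<and> u < length \<tau> \<longrightarrow> (\<exists>v j r. \<tau> ! u = (v, (j, r) # snd (\<tau> ! v)) \<and>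
      v < u \<and> 1 \<le> j \<and> j \<le> d \<and> r < S \<and> v * d + j \<le> X * d \<and>
      length (snd (\<tau> ! u)) \<le> k \<and> (\<exists>x\<in>set xs. list_all (edge_ok x) (snd (\<tau> ! u))))"
      using tau_ok(1) unfolding tree_ok_def by (elim conjE allE[of _ u]) assumption
    from mp[OF this conjI[OF that assms]]
    obtain v j r where v: "\<tau> ! u = (v, (j, r) # snd (\<tau> ! v))" "v < u" "1 \<le> j" "r < S"
      by (elim exE conjE)
    have "es ! u = (v, j, r, 0)" unfolding e v(1) node_ent_def by simp
    then have "par u = v" "lab u = j" "rv u = r" by (simp_all add: par_def lab_def rv_def)
    then show ?thesis using v by simp
  qed
  then show "L \<le> u \<Longrightarrow> par u < u \<and> 1 \<le> lab u \<and> rv u < S \<and> snd (\<tau> ! u) = (lab u, rv u) # snd (\<tau> ! par u)" .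
  have "es ! u = (0, 0, 0, 0)" if "u < L" using root[OF that] by (simp add: e node_ent_def)
  then show "rv u < S" "par u < length \<tau>"
    using nd S_pos assms L1 by (cases "u < L"; force simp: rv_def par_def)+
qed

lemma entry_cand:
  assumes "length \<tau> \<le> u" "u < N"
  shows "\<exists>x<n. pay u = adr x \<and> lab u = 0 \<and> rv u = 0 \<and> par u < length \<tau> \<and> leaf_ok \<tau> (par u) x"
proof -
  have "es ! u = cands \<tau> (length \<tau> * n) ! (u - length \<tau>)"
    using assms by (simp add: es_def N_def entries_def ents_def nth_append)
  moreover have "u - length \<tau> < length (cands \<tau> (length \<tau> * n))"
    using assms by (auto simp: es_def N_def entries_def ents_def)
  ultimately have "es ! u \<in> set (cands \<tau> (length \<tau> * n))" by simp
  then obtain c where "c < length \<tau> * n" "es ! u = (c div n, 0, 0, adr (c mod n))" "leaf_ok \<tau> (c div n) (c mod n)"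
    by (auto simp: cands_def)
  then show ?thesis using mbn_div[of c "length \<tau>"]
    by (intro exI[of _ "c mod n"]) (auto simp: pay_def lab_def rv_def par_def)
qed

lemma entry:
  assumes "u < N"
  shows "pay u = 0 \<longleftrightarrow> u < length \<tau>" "pay u \<noteq> 0 \<Longrightarrow> \<exists>x<n. pay u = adr x" "pay u \<noteq> 0 \<Longrightarrow> lab u = 0 \<and> rv u = 0"
    "L \<le> u \<Longrightarrow> par u < u" "par u < length \<tau>" "rv u < S"
proof -
  show p: "pay u = 0 \<longleftrightarrow> u < length \<tau>"
    using entry_node(1)[of u] entry_cand[of u] assms adr_ge by (metis not_less not_numeral_le_zero)
  show "pay u \<noteq> 0 \<Longrightarrow> \<exists>x<n. pay u = adr x" "pay u \<noteq> 0 \<Longrightarrow> lab u = 0 \<and> rv u = 0"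
    using p entry_cand[of u] assms by (auto simp: not_less)
  show "L \<le> u \<Longrightarrow> par u < u" "par u < length \<tau>" "rv u < S"
    using entry_node(2,4,5)[of u] entry_cand[of u] assms S_pos by (cases "u < length \<tau>"; force)+
qed

lemma mt_cand: "u < N \<Longrightarrow> pay u \<noteq> 0 \<Longrightarrow> mt v i u \<longleftrightarrow> par u = v \<and> lb i = 0"
  using entry(3)[of u] S_pos by (auto simp: mt_def)

lemma lb_eq_0: "i \<le> T \<Longrightarrow> lb i = 0 \<longleftrightarrow> i = 0"
  using lb_pos[of i] by (cases "i = 0") (auto simp: lb_0)

lemma mt_hash: "mt v i u \<Longrightarrow> hu u = hb v i"
  by (auto simp: mt_def hu_def hb_def)

text \<open>Loop iterations spent below node \<open>v\<close>: one to pop it, one per lookup, one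
  per scanned record, plus verifications and subtrees. An acceptable candidate counts 0, because the
  search ends there and its verification is paid from a separate reserve. The guard
  \<open>v < u\<close> gives termination and holds for every match, see
  \<open>wt_lc\<close>.\<close>

function wt :: "nat \<Rightarrow> nat" where
  "wt v = 1 + (\<Sum>i\<le>T. 1 + (\<Sum>u\<in>{u \<in> {L..<N}. hu u = hb v i}.
     if mt v i u \<and> pay u \<noteq> 0 then (if acc (pt u) then 0 else 1 + rc u)
     else 1 + (if mt v i u \<and> v < u then wt u else 0)))"
  by pat_completeness auto
termination by (relation "Wellfounded.measure (\<lambda>v. N - v)") auto

declare wt.simps [simp del]

definition ec :: "nat \<Rightarrow> nat \<Rightarrow> nat \<Rightarrow> nat" where
  "ec v i u = (if mt v i u \<and> pay u \<noteq> 0 then (if acc (pt u) then 0 else 1 + rc u)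
     else 1 + (if mt v i u then wt u else 0))"

definition lc :: "nat \<Rightarrow> nat \<Rightarrow> nat" where
  "lc v i = 1 + (\<Sum>u\<in>pend v i N. ec v i u)"

lemma wt_lc: "wt v = 1 + (\<Sum>i\<le>T. lc v i)"
proof -
  have "(\<Sum>u\<in>{u \<in> {L..<N}. hu u = hb v i}.
     if mt v i u \<and> pay u \<noteq> 0 then (if acc (pt u) then 0 else 1 + rc u)
     else 1 + (if mt v i u \<and> v < u then wt u else 0)) = (\<Sum>u\<in>pend v i N. ec v i u)" for i
  proof (rule sum.cong)
    fix u assume "u \<in> pend v i N"
    then have "mt v i u \<Longrightarrow> v < u" using entry(4)[of u] by (auto simp: mt_def pend_def)
    then show "(if mt v i u \<and> pay u \<noteq> 0 then (if acc (pt u) then 0 else 1 + rc u)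
     else 1 + (if mt v i u \<and> v < u then wt u else 0)) = ec v i u" by (auto simp: ec_def)
  qed (auto simp: pend_def)
  then show ?thesis by (subst wt.simps) (simp add: lc_def)
qed

text \<open>The same count as \<open>wt\<close> with the subtrees of matching children cut off, so
  that the total is a sum over visited nodes.\<close>

definition own :: "nat \<Rightarrow> nat" where
  "own v = 1 + (\<Sum>i\<le>T. 1 + (\<Sum>u\<in>pend v i N.
     if mt v i u \<and> pay u \<noteq> 0 then (if acc (pt u) then 0 else 1 + rc u) else 1))"

definition vis :: "nat set" where
  "vis = {u. u < length \<tau> \<and> list_all (edge_ok q) (snd (\<tau> ! u))}"

lemma finite_pend: "finite (pend v i c)" by (simp add: pend_def)

lemma finite_vis: "finite vis" by (simp add: vis_def)

lemma vis_child:
  assumes "v \<in> vis" "L \<le> u" "u < N" "mt v i u" "i \<le> T" "pay u = 0"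
  shows "u \<in> vis"
proof -
  have u: "u < length \<tau>" using entry(1)[OF assms(3)] assms(6) by simp
  have n: "1 \<le> lab u" "snd (\<tau> ! u) = (lab u, rv u) # snd (\<tau> ! par u)" using entry_node(2)[OF u assms(2)] by auto
  have "i \<noteq> 0"
  proof
    assume "i = 0"
    then have "lab u = 0" using assms(4) lb_0 by (simp add: mt_def)
    then show False using n(1) by simp
  qed
  then have "lab u \<in> q" using lb_q[of i] assms(4,5) by (auto simp: mt_def)
  moreover have "rv u * B * card q < S * S" using assms(4) by (simp add: mt_def T_def mult.assoc)
  ultimately show ?thesis
    using assms(1,4) u n by (auto simp: vis_def mt_def edge_ok_def)
qed

lemma wt_own:
  assumes "v \<in> vis"
  shows "wt v \<le> own v + (\<Sum>u\<in>{u \<in> vis. L \<le> u \<and> par u = v}. wt u)"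
proof -
  define ch where "ch = {u \<in> vis. L \<le> u \<and> par u = v}"
  define g where "g i u = (if mt v i u \<and> pay u = 0 then wt u else 0)" for i u
  have "ec v i u = (if mt v i u \<and> pay u \<noteq> 0 then (if acc (pt u) then 0 else 1 + rc u) else 1) + g i u" for i u
    by (simp add: ec_def g_def)
  then have ec: "(\<Sum>u\<in>pend v i N. ec v i u) = (\<Sum>u\<in>pend v i N.
     if mt v i u \<and> pay u \<noteq> 0 then (if acc (pt u) then 0 else 1 + rc u) else 1) + (\<Sum>u\<in>pend v i N. g i u)" for i
    by (simp only: sum.distrib)
  define P Q where "P i = 1 + (\<Sum>u\<in>pend v i N.
     if mt v i u \<and> pay u \<noteq> 0 then (if acc (pt u) then 0 else 1 + rc u) else 1)"
    and "Q i = (\<Sum>u\<in>pend v i N. g i u)" for i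
  have "lc v i = P i + Q i" for i unfolding lc_def P_def Q_def ec by (rule add.assoc[symmetric])
  then have "(\<Sum>i\<le>T. lc v i) = (\<Sum>i\<le>T. P i) + (\<Sum>i\<le>T. Q i)" by (simp only: sum.distrib)
  then have "wt v = 1 + ((\<Sum>i\<le>T. P i) + (\<Sum>i\<le>T. Q i))" unfolding wt_lc[of v] by (rule arg_cong)
  moreover have "own v = 1 + (\<Sum>i\<le>T. P i)" unfolding own_def P_def ..
  ultimately have "wt v = own v + (\<Sum>i\<le>T. Q i)" by linarith
  then have eq: "wt v = own v + (\<Sum>i\<le>T. \<Sum>u\<in>pend v i N. g i u)" unfolding Q_def .
  \<comment> \<open>Every matching child is visited and carries the label of exactly one lookup, so
    its weight is counted at most once.\<close>
  have "(\<Sum>i\<le>T. \<Sum>u\<in>pend v i N. g i u) \<le> (\<Sum>i\<le>T. \<Sum>u\<in>ch. if lab u = lb i then wt u else 0)"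
  proof (rule sum_mono)
    fix i assume i: "i \<in> {..T}"
    have "(\<Sum>u\<in>pend v i N. g i u) = (\<Sum>u\<in>{u \<in> pend v i N. mt v i u \<and> pay u = 0}. wt u)"
      unfolding g_def by (rule sum.inter_filter[OF finite_pend, symmetric])
    also have "\<dots> \<le> (\<Sum>u\<in>{u \<in> ch. lab u = lb i}. wt u)"
    proof (rule sum_mono2)
      show "{u \<in> pend v i N. mt v i u \<and> pay u = 0} \<subseteq> {u \<in> ch. lab u = lb i}"
      proof
        fix u assume "u \<in> {u \<in> pend v i N. mt v i u \<and> pay u = 0}"
        then have u: "L \<le> u" "u < N" "mt v i u" "pay u = 0" by (simp_all add: pend_def)
        moreover have "u \<in> vis" using vis_child[OF assms u(1-3)] u(4) i by simp
        moreover have "par u = v" "lab u = lb i" using u(3) by (simp_all add: mt_def)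
        ultimately show "u \<in> {u \<in> ch. lab u = lb i}" by (simp add: ch_def)
      qed
    qed (auto simp: ch_def finite_vis)
    also have "\<dots> = (\<Sum>u\<in>ch. if lab u = lb i then wt u else 0)"
      using finite_vis by (intro sum.inter_filter) (simp add: ch_def)
    finally show "(\<Sum>u\<in>pend v i N. g i u) \<le> (\<Sum>u\<in>ch. if lab u = lb i then wt u else 0)" .
  qed
  also have "\<dots> = (\<Sum>u\<in>ch. \<Sum>i\<le>T. if lab u = lb i then wt u else 0)" by (rule sum.swap)
  also have "\<dots> \<le> (\<Sum>u\<in>ch. wt u)"
  proof (rule sum_mono)
    fix u
    show "(\<Sum>i\<le>T. if lab u = lb i then wt u else 0) \<le> wt u"
    proof (cases "\<exists>i\<le>T. lab u = lb i")
      case True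
      then obtain i0 where i0: "i0 \<le> T" "lab u = lb i0" by blast
      have "lab u = lb i \<longleftrightarrow> i = i0" if "i \<in> {..T}" for i
      proof
        assume "lab u = lb i"
        then have "lb i = lb i0" using i0(2) by simp
        then show "i = i0" using lb_inj[of i i0] i0(1) that by simp
      qed (use i0 in simp)
      then have "(\<Sum>i\<le>T. if lab u = lb i then wt u else 0) = (\<Sum>i\<le>T. if i = i0 then wt u else 0)"
        by (rule_tac sum.cong) simp_all
      also have "\<dots> = wt u" using i0(1) by (simp only: sum.delta finite_atMost atMost_iff if_True)
      finally show ?thesis by simp
    next
      case False
      then have "(\<Sum>i\<le>T. if lab u = lb i then wt u else 0) = (\<Sum>i\<le>T. 0)" by (intro sum.cong if_not_P refl) simp
      then show ?thesis by simp
    qed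
  qed
  finally show ?thesis unfolding ch_def[symmetric] eq by linarith
qed

lemma roots_vis: "r < L \<Longrightarrow> r \<in> vis"
  using L_tau entry_node(3)[of r] by (simp add: vis_def)

text \<open>Children have larger indices than their parents. Unrolling the recursion in index order
  therefore replaces the weight of a frontier node by its own work and the weights of its children,
  until the frontier is empty.\<close>

lemma work_le: "(\<Sum>r<L. wt r) \<le> (\<Sum>v\<in>vis. own v)"
proof -
  \<comment> \<open>The frontier at \<open>m\<close>: visited nodes from \<open>m\<close> on with a
    parent below \<open>m\<close>. \<open>Am\<close> adds its weight to the own work of the nodes
    already passed.\<close>
  define F where "F m = {u \<in> vis. m \<le> u \<and> par u < m}" for m
  define Am where "Am m = (\<Sum>v\<in>{v \<in> vis. v < m}. own v) + (\<Sum>u\<in>F m. wt u)" for m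
  have finF: "finite (F m)" for m using finite_vis by (simp add: F_def)
  have visN: "u \<in> vis \<Longrightarrow> u < N" for u using N_le by (auto simp: vis_def)
  have mono: "Am m \<le> Am (Suc m)" if m: "L \<le> m" for m
  proof (cases "m \<in> vis")
    case False
    then have "{v \<in> vis. v < Suc m} = {v \<in> vis. v < m}" by (auto simp: less_Suc_eq)
    moreover have "F m \<subseteq> F (Suc m)" using False by (auto simp: F_def Suc_le_eq le_less)
    then have "(\<Sum>u\<in>F m. wt u) \<le> (\<Sum>u\<in>F (Suc m). wt u)" using finF by (intro sum_mono2) auto
    ultimately show ?thesis by (simp add: Am_def)
  next
    case True
    define ch where "ch = {u \<in> vis. L \<le> u \<and> par u = m}"
    have pm: "par m < m" using entry(4)[OF visN[OF True] m] .
    then have Fm: "F m = insert m (F m - {m})" using True by (auto simp: F_def)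
    have ch: "u \<in> ch \<Longrightarrow> m < u" for u using entry(4)[of u] visN[of u] by (auto simp: ch_def)
    have sub: "(F m - {m}) \<union> ch \<subseteq> F (Suc m)"
    proof
      fix u assume "u \<in> (F m - {m}) \<union> ch"
      then show "u \<in> F (Suc m)" using ch[of u] unfolding F_def ch_def by (elim UnE) (simp_all add: Suc_le_eq)
    qed
    have dis: "(F m - {m}) \<inter> ch = {}" by (auto simp: F_def ch_def)
    have fch: "finite ch" using finite_vis by (simp add: ch_def)
    have "(\<Sum>u\<in>F m. wt u) = wt m + (\<Sum>u\<in>F m - {m}. wt u)"
      using Fm by (intro sum.remove finF) blast
    also have "\<dots> \<le> own m + ((\<Sum>u\<in>ch. wt u) + (\<Sum>u\<in>F m - {m}. wt u))"
      using wt_own[OF True] by (simp add: ch_def)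
    also have "(\<Sum>u\<in>ch. wt u) + (\<Sum>u\<in>F m - {m}. wt u) = (\<Sum>u\<in>(F m - {m}) \<union> ch. wt u)"
      using dis fch finF by (subst sum.union_disjoint) auto
    also have "\<dots> \<le> (\<Sum>u\<in>F (Suc m). wt u)" using sub finF by (intro sum_mono2) auto
    finally have "(\<Sum>u\<in>F m. wt u) \<le> own m + (\<Sum>u\<in>F (Suc m). wt u)" by simp
    moreover have "{v \<in> vis. v < Suc m} = insert m {v \<in> vis. v < m}" using True by auto
    ultimately show ?thesis using finite_vis by (simp add: Am_def)
  qed
  have start: "(\<Sum>r<L. wt r) \<le> Am L"
  proof -
    have "(\<Sum>r<L. wt r) \<le> (\<Sum>r<L. own r + (\<Sum>u\<in>{u \<in> vis. L \<le> u \<and> par u = r}. wt u))"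
      by (intro sum_mono wt_own roots_vis) simp
    also have "\<dots> = (\<Sum>r<L. own r) + (\<Sum>r<L. \<Sum>u\<in>{u \<in> vis. L \<le> u \<and> par u = r}. wt u)" by (simp add: sum.distrib)
    also have "(\<Sum>r<L. \<Sum>u\<in>{u \<in> vis. L \<le> u \<and> par u = r}. wt u) = (\<Sum>u\<in>(\<Union>r<L. {u \<in> vis. L \<le> u \<and> par u = r}). wt u)"
      using finite_vis by (subst sum.UNION_disjoint) auto
    also have "(\<Union>r<L. {u \<in> vis. L \<le> u \<and> par u = r}) = F L" by (auto simp: F_def)
    also have "(\<Sum>r<L. own r) = (\<Sum>v\<in>{v \<in> vis. v < L}. own v)" using roots_vis by (intro sum.cong) auto
    finally show ?thesis by (simp add: Am_def)
  qed
  have "Am L \<le> Am N" using N_le(2)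
  proof (induction rule: dec_induct)
    case (step m)
    then show ?case using mono[of m] by linarith
  qed simp
  also have "Am N = (\<Sum>v\<in>vis. own v)"
  proof -
    have "F N = {}" "{v \<in> vis. v < N} = vis" by (auto simp: F_def dest: visN)
    then show ?thesis by (simp add: Am_def)
  qed
  finally show ?thesis using start by simp
qed

section \<open>Good nodes and the invariant of the search\<close>

text \<open>Records from which the search will reach an acceptable candidate along matching
  records.\<close>

inductive gd :: "nat \<Rightarrow> bool" where
  gd_acc: "L \<le> u \<Longrightarrow> u < N \<Longrightarrow> pay u \<noteq> 0 \<Longrightarrow> acc (pt u) \<Longrightarrow> gd u"
| gd_par: "gd u \<Longrightarrow> L \<le> u \<Longrightarrow> u < N \<Longrightarrow> i \<le> T \<Longrightarrow> mt v i u \<Longrightarrow> gd v"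

lemma gd_node:
  assumes "gd v" "pay v = 0"
  shows "\<exists>i\<le>T. \<exists>u. L \<le> u \<and> u < N \<and> mt v i u \<and> gd u"
  using assms by (cases rule: gd.cases) auto

text \<open>No record has a candidate as its parent, so a candidate can only be good by being
  acceptable itself.\<close>

lemma gd_cand:
  assumes "gd u" "pay u \<noteq> 0" shows "acc (pt u)"
  using assms(1)
proof cases
  case (gd_par u' i)
  then have "u < length \<tau>" using entry(5)[of u'] by (simp add: mt_def)
  then show ?thesis using entry_node(1) assms(2) by simp
qed

text \<open>All ancestors of a visited node are visited, and the edge to the parent passes the
  query's test; goodness thus climbs to a root.\<close>

lemma gd_tree:
  assumes "v \<in> vis" "gd v" shows "\<exists>r<L. gd r"
  using assms
proof (induction v rule: less_induct)
  case (less v)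
  show ?case
  proof (cases "v < L")
    case False
    have v: "v < length \<tau>" using less.prems(1) by (simp add: vis_def)
    have n: "par v < v" "snd (\<tau> ! v) = (lab v, rv v) # snd (\<tau> ! par v)" using entry_node(2)[OF v] False by auto
    then have e: "lab v \<in> q" "rv v * B * card q < S * S" "par v \<in> vis"
      using less.prems(1) v by (auto simp: vis_def edge_ok_def)
    obtain i where i: "i \<le> T" "lb i = lab v" using lb_surj[OF e(1)] by blast
    then have "mt (par v) i v" using e(2) by (simp add: mt_def T_def mult.assoc)
    then have "gd (par v)" using gd_par[OF less.prems(2) _ _ i(1)] False v N_le by auto
    then show ?thesis using less.IH[OF n(1) e(3)] by blast
  qed (use less.prems in blast)
qed

text \<open>A common leaf of the query and an acceptable data point gives a good root, provided that
  the candidate record was not lost to the cap.\<close>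

lemma gd_leaf:
  assumes "v \<in> vis" "length (snd (\<tau> ! v)) = k" "x < n" "list_all (edge_ok (xs ! x)) (snd (\<tau> ! v))" "acc (xs ! x)"
    and full: "length \<tau> + length (cands \<tau> (length \<tau> * n)) \<le> X"
  shows "\<exists>r<L. gd r"
proof -
  have v: "v < length \<tau>" using assms(1) by (simp add: vis_def)
  have "v * n + x < length \<tau> * n" using un_less[OF v assms(3)] .
  moreover have "leaf_ok \<tau> ((v * n + x) div n) ((v * n + x) mod n)" using assms(2-4) by (simp add: leaf_ok_def)
  ultimately have "(v, 0, 0, adr x) \<in> set (cands \<tau> (length \<tau> * n))"
    unfolding cands_def set_map by (intro image_eqI[of _ _ "v * n + x"]) (use assms(3) in simp_all)
  then obtain c where c: "c < length (cands \<tau> (length \<tau> * n))" "cands \<tau> (length \<tau> * n) ! c = (v, 0, 0, adr x)"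
    by (metis in_set_conv_nth)
  define u where "u = length \<tau> + c"
  have "es = map node_ent \<tau> @ cands \<tau> (length \<tau> * n)" using full by (simp add: es_def entries_def ents_def)
  then have u: "u < N" "es ! u = (v, 0, 0, adr x)" using c by (auto simp: u_def N_def nth_append)
  have p: "pay u = adr x" "par u = v" "pay u \<noteq> 0" using u adr_ge[of x] by (auto simp: pay_def par_def)
  have Lu: "L \<le> u" using L_tau by (simp add: u_def)
  have "gd u" using gd_acc[OF Lu u(1) p(3)] pt_eq[OF p(1) assms(3)] assms(5) by simp
  moreover have "mt v 0 u" using mt_cand[OF u(1) p(3)] p(2) lb_0 by simp
  ultimately have "gd v" using gd_par[of u 0 v] Lu u(1) by auto
  then show ?thesis using gd_tree assms(1) by blast
qed

text \<open>Following the link of record \<open>u\<close> removes exactly \<open>u\<close> from the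
  records to be scanned.\<close>

lemma pend_step:
  assumes "u \<in> pend v i (Suc u)"
  defines "c' \<equiv> prv hu L (hu u) u"
  shows "pend v i (Suc u) = insert u (pend v i c')" "u \<notin> pend v i c'" "c' = 0 \<or> c' - 1 \<in> pend v i c'"
proof -
  have u: "hu u = hb v i" "u < N" "L \<le> u" using assms(1) by (auto simp: pend_def)
  have b: "t \<in> {L..<N} \<Longrightarrow> t < u \<Longrightarrow> hu t = hb v i \<Longrightarrow> t < c'" for t
    using prv_between[of hu L "hu u" u t] u(1) by (force simp: c'_def)
  have le: "c' \<le> u" unfolding c'_def by (rule prv_le)
  show "pend v i (Suc u) = insert u (pend v i c')" using b le u by (auto simp: pend_def less_Suc_eq)
  show "u \<notin> pend v i c'" using le by (auto simp: pend_def)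
  show "c' = 0 \<or> c' - 1 \<in> pend v i c'"
  proof (cases "c' = 0")
    case False
    then show ?thesis using prv_prop[of hu L "hu u" u] le u by (auto simp: pend_def c'_def)
  qed simp
qed

lemma pend_start:
  fixes v i :: nat
  defines "c' \<equiv> prv hu L (hb v i) N"
  shows "pend v i N = pend v i c'" "c' = 0 \<or> c' - 1 \<in> pend v i c'" "c' \<le> N"
proof -
  have b: "t \<in> {L..<N} \<Longrightarrow> hu t = hb v i \<Longrightarrow> t < c'" for t
    using prv_between[of hu L "hb v i" N t] by (force simp: c'_def)
  show le: "c' \<le> N" unfolding c'_def by (rule prv_le)
  show "pend v i N = pend v i c'" using b le by (auto simp: pend_def)
  show "c' = 0 \<or> c' - 1 \<in> pend v i c'"
  proof (cases "c' = 0")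
    case False
    then show ?thesis using prv_prop[of hu L "hb v i" N] le by (auto simp: pend_def c'_def)
  qed simp
qed

lemma rc_le: "rc u \<le> tm"
proof -
  have "0 < G" by (simp add: G_def)
  then show ?thesis by (auto simp: rc_def tm_def less_eq_div_iff_mult_less_eq)
qed

lemma acc_small: "acc x \<Longrightarrow> card x * G \<le> T * S \<and> card x \<le> tm"
proof -
  assume "acc x"
  then have "max (card x) T * G \<le> card (x \<inter> q) * S" by (simp add: acc_def)
  also have "\<dots> \<le> T * S" using finite_q by (intro mult_le_mono1) (simp add: T_def card_mono)
  finally have "max (card x) T * G \<le> T * S" .
  moreover have "card x * G \<le> max (card x) T * G" by simp
  ultimately have "card x * G \<le> T * S" by linarith
  moreover have "0 < G" by (simp add: G_def)
  ultimately show ?thesis by (simp add: tm_def less_eq_div_iff_mult_less_eq)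
qed

definition F :: nat where "F = Kf * L * y * (T + 1)"

definition work_ok :: bool where
  "work_ok \<longleftrightarrow> (\<exists>r<L. gd r) \<and> tm + 1 + (\<Sum>r<L. wt r) \<le> F"

text \<open>An upper bound for the iterations until success: the reserve \<open>tm + 1\<close>, the
  verification in progress, the rest of the current chain, the lookups still to be made at
  \<open>v\<close>, and the queue.\<close>

definition pot_q :: "nat \<Rightarrow> nat \<Rightarrow> nat \<Rightarrow> nat \<Rightarrow> nat \<Rightarrow> nat \<Rightarrow> (nat \<Rightarrow> nat) \<Rightarrow> nat" where
  "pot_q c jx rem v qh qt qf = tm + 1 + rem + (\<Sum>u\<in>pend v (jx - 1) c. ec v (jx - 1) u) +
     (\<Sum>i\<in>{jx..T}. lc v i) + (\<Sum>i\<in>{qh..<qt}. wt (qf i))"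

definition good_q :: "nat \<Rightarrow> nat \<Rightarrow> nat \<Rightarrow> nat \<Rightarrow> nat \<Rightarrow> (nat \<Rightarrow> nat) \<Rightarrow> bool" where
  "good_q c jx v qh qt qf \<longleftrightarrow> (\<exists>i. qh \<le> i \<and> i < qt \<and> gd (qf i)) \<or>
     (\<exists>i u. jx \<le> i \<and> i \<le> T \<and> L \<le> u \<and> u < N \<and> mt v i u \<and> gd u) \<or>
     (\<exists>u\<in>pend v (jx - 1) c. mt v (jx - 1) u \<and> gd u)"

text \<open>\<open>Ic\<close> counts the elements of the query among those already scanned, and
  \<open>rem\<close> elements are left. The comparison of \<open>Ic * S\<close> with
  \<open>mG\<close> is made after each element, so acceptance may come early.\<close>

definition verifying :: "nat \<Rightarrow> nat \<Rightarrow> nat \<Rightarrow> nat \<Rightarrow> nat \<Rightarrow> nat \<Rightarrow> bool" where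
  "verifying x rem Ic xp cand mG \<longleftrightarrow> x < n \<and> cand = adr x \<and> rem \<le> card (xs ! x) \<and>
     xp = adr x + Suc (card (xs ! x) - rem) \<and> Ic = (\<Sum>e<card (xs ! x) - rem. bt (sl x ! e \<in> q)) \<and>
     mG = max (card (xs ! x)) T * G \<and> card (xs ! x) * G \<le> T * S"

text \<open>The invariant with \<open>f\<close> iterations left. \<open>qt + f \<le> L + F\<close>
  bounds the queue, since an iteration pushes at most one node. Under \<open>work_ok\<close> either
  an acceptable candidate is being verified with enough budget, or something good is pending and the
  potential fits into the budget.\<close>

definition live :: "nat \<Rightarrow> nat \<Rightarrow> nat \<Rightarrow> nat \<Rightarrow> nat \<Rightarrow> nat \<Rightarrow> nat \<Rightarrow> nat \<Rightarrow> nat \<Rightarrow> nat \<Rightarrow> nat \<Rightarrow> nat \<Rightarrow> (nat \<Rightarrow> nat) \<Rightarrow> bool" where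
  "live f c jx rem Ic xp cand v j mG qh qt qf \<longleftrightarrow> qt + f \<le> L + F \<and> qh \<le> qt \<and>
     (\<forall>i. qh \<le> i \<and> i < qt \<longrightarrow> qf i < length \<tau>) \<and> jx \<le> T + 1 \<and> (c \<noteq> 0 \<or> jx \<le> T \<longrightarrow> v < length \<tau>) \<and>
     (c \<noteq> 0 \<longrightarrow> 1 \<le> jx \<and> c - 1 \<in> pend v (jx - 1) c \<and> j = lb (jx - 1)) \<and>
     (rem \<noteq> 0 \<longrightarrow> (\<exists>x. verifying x rem Ic xp cand mG)) \<and>
     (work_ok \<longrightarrow> (rem \<noteq> 0 \<and> (\<exists>x<n. cand = adr x \<and> acc (xs ! x)) \<and> rem \<le> f) \<or>
       ((rem \<noteq> 0 \<longrightarrow> (\<exists>x<n. cand = adr x \<and> \<not> acc (xs ! x))) \<and> good_q c jx v qh qt qf \<and>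
         pot_q c jx rem v qh qt qf \<le> f))"

text \<open>With no budget left both alternatives are absurd: the reserve makes the potential
  positive, and a verification in progress needs an iteration.\<close>

lemma live_end: "live 0 c jx rem Ic xp cand v j mG qh qt qf \<Longrightarrow> \<not> work_ok"
  by (auto simp: live_def pot_q_def)

lemma live_init: "live F 0 (T + 1) 0 Ic xp cand v j mG 0 L (\<lambda>i. if i < L then i else 0)"
  using L_tau by (auto simp: live_def work_ok_def good_q_def pot_q_def pend_def lessThan_atLeast0)

lemma count_sl:
  assumes "x < n" shows "(\<Sum>e<card (xs ! x). bt (sl x ! e \<in> q)) = card (xs ! x \<inter> q)"
proof -
  have "(\<Sum>e<card (xs ! x). bt (sl x ! e \<in> q)) = (\<Sum>j\<in>xs ! x. bt (j \<in> q))"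
  proof (rule sum.reindex_bij_betw)
    have "bij_betw ((!) (sl x)) {..<length (sl x)} (set (sl x))" by (intro bij_betw_nth) auto
    then show "bij_betw ((!) (sl x)) {..<card (xs ! x)} (xs ! x)" using sl_props(1,2)[OF assms] by simp
  qed
  also have "\<dots> = card (xs ! x \<inter> q)"
    using finite_xs[OF assms] by (simp add: bt_def sum_of_bool_eq Int_def)
  finally show ?thesis .
qed

lemma live_verify:
  assumes "live (Suc f) c jx (Suc r) Ic xp cand v j mG qh qt qf"
  shows "\<exists>x. verifying x (Suc r) Ic xp cand mG \<and>
    (if mG \<le> (Ic + bt (sl x ! (card (xs ! x) - Suc r) \<in> q)) * S then acc (xs ! x)
     else live f c jx r (Ic + bt (sl x ! (card (xs ! x) - Suc r) \<in> q)) (Suc xp) cand v j mG qh qt qf)"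
proof -
  obtain x where x: "verifying x (Suc r) Ic xp cand mG" using assms by (auto simp: live_def)
  have xn: "x < n" "cand = adr x" using x by (auto simp: verifying_def)
  define Ic' where "Ic' = Ic + bt (sl x ! (card (xs ! x) - Suc r) \<in> q)"
  have "card (xs ! x) - r = Suc (card (xs ! x) - Suc r)" using x by (auto simp: verifying_def)
  then have Ic': "Ic' = (\<Sum>e<card (xs ! x) - r. bt (sl x ! e \<in> q))"
    using x by (simp add: Ic'_def verifying_def)
  have v': "verifying x r Ic' (Suc xp) cand mG"
    using x Ic' by (auto simp: verifying_def Suc_diff_Suc)
  have le: "Ic' \<le> card (xs ! x \<inter> q)"
    unfolding Ic' count_sl[OF xn(1), symmetric] by (intro sum_mono2) auto
  show ?thesis
  proof (intro exI[of _ x] conjI)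
    show "if mG \<le> (Ic + bt (sl x ! (card (xs ! x) - Suc r) \<in> q)) * S then acc (xs ! x)
     else live f c jx r (Ic + bt (sl x ! (card (xs ! x) - Suc r) \<in> q)) (Suc xp) cand v j mG qh qt qf"
      unfolding Ic'_def[symmetric]
    proof (split if_split, intro conjI impI)
      assume "mG \<le> Ic' * S"
      also have "\<dots> \<le> card (xs ! x \<inter> q) * S" using le by (intro mult_le_mono1)
      finally show "acc (xs ! x)" using x by (auto simp: acc_def verifying_def)
    next
      assume nacc: "\<not> mG \<le> Ic' * S"
      have un: "xs ! x' = xs ! x" if "adr x' = cand" for x' using that xn adr_eq by simp
      \<comment> \<open>After the last element \<open>Ic'\<close> is the whole intersection, so an
        acceptable set would have passed the comparison; if it has not, elements are left.\<close>
      have "r \<noteq> 0" if "acc (xs ! x)"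
      proof
        assume "r = 0"
        then have "Ic' = card (xs ! x \<inter> q)" using Ic' count_sl[OF xn(1)] by simp
        then show False using nacc that x by (auto simp: acc_def verifying_def)
      qed
      moreover have "pot_q c jx (Suc r) v qh qt qf = Suc (pot_q c jx r v qh qt qf)" by (simp add: pot_q_def)
      moreover have "work_ok \<longrightarrow> ((\<exists>x<n. cand = adr x \<and> acc (xs ! x)) \<and> Suc r \<le> Suc f) \<or>
          ((\<exists>x<n. cand = adr x \<and> \<not> acc (xs ! x)) \<and> good_q c jx v qh qt qf \<and> pot_q c jx (Suc r) v qh qt qf \<le> Suc f)"
        using assms unfolding live_def by blast
      ultimately have "work_ok \<longrightarrow> (r \<noteq> 0 \<and> (\<exists>x<n. cand = adr x \<and> acc (xs ! x)) \<and> r \<le> f) \<or>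
          ((\<exists>x<n. cand = adr x \<and> \<not> acc (xs ! x)) \<and> good_q c jx v qh qt qf \<and> pot_q c jx r v qh qt qf \<le> f)"
        using un by (metis Suc_le_mono)
      moreover have "qt + f \<le> L + F \<and> qh \<le> qt \<and> (\<forall>i. qh \<le> i \<and> i < qt \<longrightarrow> qf i < length \<tau>) \<and> jx \<le> T + 1 \<and>
          (c \<noteq> 0 \<or> jx \<le> T \<longrightarrow> v < length \<tau>) \<and> (c \<noteq> 0 \<longrightarrow> 1 \<le> jx \<and> c - 1 \<in> pend v (jx - 1) c \<and> j = lb (jx - 1))"
        using assms unfolding live_def by (elim conjE) (intro conjI; (assumption | linarith))
      ultimately show "live f c jx r Ic' (Suc xp) cand v j mG qh qt qf"
        using v' unfolding live_def by blast
    qed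
  qed (rule x)
qed

text \<open>The outcomes of looking at one record: a mismatch, a child to be queued, a candidate to
  be verified, or a candidate refused by its weight. In each the potential drops by at least 1 or an
  acceptable candidate comes under verification.\<close>

lemma live_chain:
  assumes "live (Suc f) (Suc u) jx 0 Ic xp cand v j mG qh qt qf"
  defines "c' \<equiv> prv hu L (hu u) u"
  shows "u \<in> pend v (jx - 1) (Suc u)" "1 \<le> jx" "j = lb (jx - 1)" "v < length \<tau>" "qt + Suc f \<le> L + F"
    "\<not> mt v (jx - 1) u \<Longrightarrow> live f c' jx 0 Ic' xp' cand' v j mG' qh qt qf"
    "mt v (jx - 1) u \<Longrightarrow> pay u = 0 \<Longrightarrow> live f c' jx 0 Ic' xp' cand' v j mG' qh (Suc qt) (qf(qt := u))"
    "mt v (jx - 1) u \<Longrightarrow> pay u = adr x \<Longrightarrow> x < n \<Longrightarrow> card (xs ! x) * G \<le> T * S \<Longrightarrow>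
      live f c' jx (card (xs ! x)) 0 (Suc (adr x)) (adr x) v j (max (card (xs ! x)) T * G) qh qt qf"
    "mt v (jx - 1) u \<Longrightarrow> pay u = adr x \<Longrightarrow> x < n \<Longrightarrow> \<not> card (xs ! x) * G \<le> T * S \<Longrightarrow>
      live f c' jx 0 Ic' xp' cand' v j mG' qh qt qf"
proof -
  show u: "u \<in> pend v (jx - 1) (Suc u)" "1 \<le> jx" "j = lb (jx - 1)" "v < length \<tau>" "qt + Suc f \<le> L + F"
    using assms(1) by (auto simp: live_def)
  note ps = pend_step[OF u(1), folded c'_def]
  have uN: "L \<le> u" "u < N" using u(1) by (auto simp: pend_def)
  have jT: "jx \<le> T + 1" using assms(1) by (simp add: live_def)
  have P: "pot_q (Suc u) jx 0 v qh qt qf = ec v (jx - 1) u + pot_q c' jx 0 v qh qt qf"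
    unfolding pot_q_def ps(1) using ps(2) finite_pend by simp
  have gq: "good_q (Suc u) jx v qh qt qf \<longleftrightarrow> good_q c' jx v qh qt qf \<or> (mt v (jx - 1) u \<and> gd u)"
    unfolding good_q_def ps(1) by auto
  have base: "qt + Suc f \<le> L + F" "qh \<le> qt" "\<forall>i. qh \<le> i \<and> i < qt \<longrightarrow> qf i < length \<tau>"
    "work_ok \<Longrightarrow> (good_q c' jx v qh qt qf \<or> (mt v (jx - 1) u \<and> gd u)) \<and>
      ec v (jx - 1) u + pot_q c' jx 0 v qh qt qf \<le> Suc f"
    using assms(1) unfolding live_def P gq by auto
  have c': "c' \<noteq> 0 \<longrightarrow> c' - 1 \<in> pend v (jx - 1) c'" using ps(3) by blast
  show "live f c' jx 0 Ic' xp' cand' v j mG' qh qt qf" if "\<not> mt v (jx - 1) u"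
  proof -
    have "ec v (jx - 1) u = 1" using that by (simp add: ec_def)
    then show ?thesis unfolding live_def using base u c' jT that by auto
  qed
  show "live f c' jx 0 Ic' xp' cand' v j mG' qh (Suc qt) (qf(qt := u))" if "mt v (jx - 1) u" "pay u = 0"
  proof -
    have e: "ec v (jx - 1) u = 1 + wt u" using that by (simp add: ec_def)
    have "(\<Sum>i\<in>{qh..<Suc qt}. wt ((qf(qt := u)) i)) = (\<Sum>i\<in>{qh..<qt}. wt (qf i)) + wt u"
      using base(2) by (simp add: sum.atLeastLessThan_Suc)
    then have p: "pot_q c' jx 0 v qh (Suc qt) (qf(qt := u)) = pot_q c' jx 0 v qh qt qf + wt u"
      unfolding pot_q_def by simp
    have g: "good_q c' jx v qh (Suc qt) (qf(qt := u))" if "good_q c' jx v qh qt qf \<or> gd u"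
      using that base(2) unfolding good_q_def by (auto simp: less_Suc_eq)
    have ut: "u < length \<tau>" using entry(1)[OF uN(2)] that(2) by simp
    show ?thesis unfolding live_def using base u c' jT that ut p e g by (auto simp: less_Suc_eq)
  qed
  show "live f c' jx 0 Ic' xp' cand' v j mG' qh qt qf"
    if "mt v (jx - 1) u" "pay u = adr x" "x < n" "\<not> card (xs ! x) * G \<le> T * S"
  proof -
    have pt: "pt u = xs ! x" using pt_eq that by simp
    have p0: "pay u \<noteq> 0" using that(2) adr_ge[of x] by simp
    have na: "\<not> acc (xs ! x)" using acc_small that(4) by blast
    then have "\<not> gd u" using gd_cand[OF _ p0] pt by auto
    moreover have "ec v (jx - 1) u = 1" using that p0 pt na by (simp add: ec_def rc_def)
    ultimately show ?thesis unfolding live_def using base u c' jT that by auto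
  qed
  show "live f c' jx (card (xs ! x)) 0 (Suc (adr x)) (adr x) v j (max (card (xs ! x)) T * G) qh qt qf"
    if "mt v (jx - 1) u" "pay u = adr x" "x < n" "card (xs ! x) * G \<le> T * S"
  proof -
    have pt: "pt u = xs ! x" using pt_eq that by simp
    have p0: "pay u \<noteq> 0" using that(2) adr_ge[of x] by simp
    have vf: "verifying x (card (xs ! x)) 0 (Suc (adr x)) (adr x) (max (card (xs ! x)) T * G)"
      using that by (simp add: verifying_def)
    show ?thesis
    proof (cases "acc (xs ! x)")
      case True
      \<comment> \<open>This is what the reserve is for: at most \<open>tm\<close> elements have to
        be counted, and that much budget is left.\<close>
      then have "card (xs ! x) \<le> tm" "card (xs ! x) \<noteq> 0" using acc_small by (auto simp: acc_def)
      moreover have "tm \<le> f" if work_ok using base(4)[OF that] by (simp add: pot_q_def)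
      ultimately show ?thesis unfolding live_def using base(1-3) u c' jT that vf True by auto
    next
      case False
      have "\<not> gd u" using gd_cand[OF _ p0] pt False by auto
      moreover have "ec v (jx - 1) u = 1 + card (xs ! x)" using that p0 pt False by (simp add: ec_def rc_def)
      moreover have "pot_q c' jx (card (xs ! x)) v qh qt qf = pot_q c' jx 0 v qh qt qf + card (xs ! x)"
        by (simp add: pot_q_def)
      ultimately show ?thesis unfolding live_def using base u c' jT that vf False by auto
    qed
  qed
qed

lemma live_lookup:
  assumes "live (Suc f) 0 jx 0 Ic xp cand v j mG qh qt qf" "jx \<le> T"
  shows "live f (prv hu L (hb v jx) N) (Suc jx) 0 Ic' xp' cand' v (lb jx) mG' qh qt qf" "v < length \<tau>"
proof -
  note ps = pend_start[of v jx]
  have "{jx..T} = insert jx {Suc jx..T}" using assms(2) by auto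
  then have p: "pot_q 0 jx 0 v qh qt qf = 1 + pot_q (prv hu L (hb v jx) N) (Suc jx) 0 v qh qt qf"
    unfolding pot_q_def by (simp add: lc_def ps(1) pend_def[of _ _ 0])
  have g: "good_q (prv hu L (hb v jx) N) (Suc jx) v qh qt qf" if "good_q 0 jx v qh qt qf"
  proof -
    have "u \<in> pend v jx N" if "L \<le> u" "u < N" "mt v jx u" for u using that mt_hash by (simp add: pend_def)
    moreover have "pend v (jx - 1) 0 = {}" by (simp add: pend_def)
    moreover have "i = jx \<or> Suc jx \<le> i" if "jx \<le> i" for i using that by linarith
    ultimately show ?thesis using that unfolding good_q_def diff_Suc_1 ps(1)[symmetric]
      by (metis empty_iff)
  qed
  show "v < length \<tau>" using assms by (simp add: live_def)
  show "live f (prv hu L (hb v jx) N) (Suc jx) 0 Ic' xp' cand' v (lb jx) mG' qh qt qf"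
    using assms p g ps(2) unfolding live_def by auto
qed

text \<open>A popped good node is no candidate, so by \<open>gd_node\<close> its goodness comes from
  a record found by one of the lookups that now start.\<close>

lemma live_pop:
  assumes "live (Suc f) 0 (T + 1) 0 Ic xp cand v j mG qh qt qf" "qh < qt"
  shows "live f 0 0 0 Ic' xp' cand' (qf qh) j mG' (Suc qh) qt qf"
proof -
  have "{qh..<qt} = insert qh {Suc qh..<qt}" using assms(2) by auto
  then have p: "pot_q 0 (T + 1) 0 v qh qt qf = 1 + pot_q 0 0 0 (qf qh) (Suc qh) qt qf"
    unfolding pot_q_def by (simp add: wt_lc pend_def[of _ _ 0] atLeast0AtMost)
  have v: "qf qh < length \<tau>" using assms by (simp add: live_def)
  have g: "good_q 0 0 (qf qh) (Suc qh) qt qf" if good: "good_q 0 (T + 1) v qh qt qf"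
  proof -
    obtain i where i: "qh \<le> i" "i < qt" "gd (qf i)"
      using good unfolding good_q_def by (auto simp: pend_def)
    show ?thesis
    proof (cases "i = qh")
      case True
      then have "gd (qf qh)" using i by simp
      from gd_node[OF this entry_node(1)[OF v]] show ?thesis unfolding good_q_def by auto
    next
      case False
      then show ?thesis unfolding good_q_def using i by (auto simp: Suc_le_eq)
    qed
  qed
  show ?thesis using assms p g v unfolding live_def by auto
qed

text \<open>An empty queue with nothing pending contradicts goodness, so \<open>work_ok\<close>
  fails and the remaining iterations may be idle.\<close>

lemma live_idle:
  assumes "live (Suc f) 0 (T + 1) 0 Ic xp cand v j mG qh qt qf" "\<not> qh < qt"
  shows "live f 0 (T + 1) 0 Ic' xp' cand' v j mG' qh qt qf"
proof -
  have "\<not> good_q 0 (T + 1) v qh qt qf" using assms(2) by (auto simp: good_q_def pend_def)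
  then show ?thesis using assms unfolding live_def by auto
qed

end

section \<open>The query program\<close>

definition qry1 :: "cmd list" where
  "qry1 = [Const 1 1, Op Add 9 0 40, Load 2 40,
    Const 41 2, Op Add 41 2 41, Load 4 41, Const 41 3, Op Add 41 2 41, Load 5 41,
    Const 41 4, Op Add 41 2 41, Load 6 41, Const 41 5, Op Add 41 2 41, Load 7 41,
    Const 41 6, Op Add 41 2 41, Load 8 41, Const 41 7, Op Add 41 2 41, Load 12 41,
    Const 41 8, Op Add 41 2 41, Load 13 41, Const 41 9, Op Add 41 2 41, Load 14 41,
    Const 41 10, Op Add 41 2 41, Load 15 41, Const 41 11, Op Add 41 2 41, Load 16 41,
    Load 10 9, Op Add 11 9 10, Op Add 11 11 1, Op Add 3 11 16, Op Mul 17 4 4, Op Mul 18 10 4, Op Mul 19 5 10,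
    Op Add 32 10 1, Op Mul 20 15 32]"

text \<open>Marks the elements of the query in a bitmap behind the query vector, for constant-time
  membership tests; that memory starts as zero.\<close>

definition qry2 :: "cmd list" where
  "qry2 = [Const 41 0, Op Less 42 41 10,
    WhileNZ 42 [Op Add 43 9 41, Op Add 43 43 1, Load 43 43, Op Add 43 11 43, Store 43 1, Op Add 41 41 1,
      Op Less 42 41 10]]"

definition qry3 :: "cmd list" where
  "qry3 = [Const 41 0, Op Less 42 41 7,
    WhileNZ 42 [Op Add 43 3 41, Store 43 41, Op Add 41 41 1, Op Less 42 41 7]]"

definition qverify :: "cmd list" where
  "qverify = [Load 41 25, Op Add 41 11 41, Load 41 41, Op Add 24 24 41, Op Add 25 25 1, Op Sub 23 23 1,
    Op Mul 41 24 4, Op Less 41 41 29, IfNZ 41 [] [Op Add 0 26 40, Const 20 0]]"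

text \<open>The chain pointer moves on before the record is examined. A candidate is compared with
  \<open>T * S\<close> first, so heavy sets cost a single iteration.\<close>

definition qchain :: "cmd list" where
  "qchain = [Op Sub 41 21 1, Const 42 5, Op Mul 42 42 41, Op Add 42 14 42, Load 43 42,
    Op Add 44 42 1, Load 44 44, Const 45 2, Op Add 45 42 45, Load 45 45, Const 46 3, Op Add 46 42 46, Load 46 46,
    Const 47 4, Op Add 47 42 47, Load 21 47, Op Equal 43 43 27, Op Equal 44 44 28, Op Mul 43 43 44,
    Op Mul 45 45 19, Op Less 45 45 17, Op Mul 43 43 45,
    IfNZ 43
     [IfNZ 46
       [Load 43 46, Op Mul 44 43 6, Op Less 44 18 44,
        IfNZ 44 []
         [Op Add 23 43 40, Const 24 0, Op Add 25 46 1, Op Add 26 46 40, Op Less 44 43 10,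
          IfNZ 44 [Op Mul 29 10 6] [Op Mul 29 43 6]]]
       [Op Add 44 3 31, Store 44 41, Op Add 31 31 1]]
     []]"

definition qlookup :: "cmd list" where
  "qlookup = [IfNZ 22 [Op Add 28 9 22, Load 28 28] [Const 28 0], Op Mul 41 27 16, Op Add 41 41 28, Op Mul 41 12 41,
    Op Shr 41 41 8, Op Add 41 13 41, Load 21 41, Op Add 22 22 1]"

definition qpop :: "cmd list" where
  "qpop = [Op Add 41 3 30, Load 27 41, Op Add 30 30 1, Const 22 0]"

text \<open>The nested search is flattened into a state machine: one iteration makes one unit of
  progress, namely one element of a verification, one record, one lookup or one pop. A counter of
  iterations is then a budget that holds for every random outcome.\<close>

definition qstep :: "cmd list" where
  "qstep = [Op Sub 20 20 1, IfNZ 23 qverify [IfNZ 21 qchain [Op Less 41 22 32,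
     IfNZ 41 qlookup [Op Less 41 30 31, IfNZ 41 qpop []]]]]"

definition query :: "cmd list" where
  "query = qry1 @ qry2 @ qry3 @ [Const 0 0, Const 21 0, Const 23 0, Const 30 0, Op Add 22 32 40, Op Add 31 7 40,
    WhileNZ 20 qstep]"

context query_inst
begin

definition MB :: nat where "MB = sz + T + 1"
definition QB :: nat where "QB = MB + dd"

definition qm0 :: "(nat \<Rightarrow> nat) \<Rightarrow> nat \<Rightarrow> nat" where
  "qm0 m = mem_of (map m [0..<sz] @ encode q)"

definition mkQ :: "(nat \<Rightarrow> nat) \<Rightarrow> (nat \<Rightarrow> nat) \<Rightarrow> (nat \<Rightarrow> nat) \<Rightarrow> nat \<Rightarrow> nat" where
  "mkQ m mrk qf c = (if c < MB then qm0 m c else if c < QB then mrk (c - MB) else qf (c - QB))"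

lemma len_qmem: "length (map m [0..<sz] @ encode q) = MB"
  using finite_q by (simp add: encode_def MB_def T_def)

lemma qm0_init: "qm0 m = mkQ m (\<lambda>_. 0) (\<lambda>_. 0)"
  unfolding mkQ_def fun_eq_iff using len_qmem[of m] by (simp add: qm0_def mem_of_def)

lemma qm0_ds: "c < sz \<Longrightarrow> qm0 m c = m c"
  using len_qmem[of m] by (simp add: qm0_def mem_of_def MB_def nth_append)

lemma qm0_q: "qm0 m sz = T" "e < T \<Longrightarrow> qm0 m (sz + Suc e) = sq ! e"
  using len_qmem[of m] by (simp_all add: qm0_def mem_of_def MB_def nth_append encode_def T_def sq_def)

lemma mkQ_low: "c < MB \<Longrightarrow> mkQ m mrk qf c = qm0 m c"
  by (simp add: mkQ_def)

lemma mkQ_ds: "c < sz \<Longrightarrow> mkQ m mrk qf c = m c"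
  using mkQ_low[of c m mrk qf] qm0_ds[of c m] by (simp add: MB_def)

lemma mkQ_rest:
  "j < dd \<Longrightarrow> mkQ m mrk qf (MB + j) = mrk j" "mkQ m mrk qf (QB + i) = qf i"
  "j < dd \<Longrightarrow> (mkQ m mrk qf)(MB + j := v) = mkQ m (mrk(j := v)) qf"
  "(mkQ m mrk qf)(QB + i := v) = mkQ m mrk (qf(i := v))"
  by (auto simp: mkQ_def QB_def fun_eq_iff)

lemma q_bounds: "sz \<le> 2 * (S * S)" "MB \<le> 3 * (S * S)" "QB \<le> 4 * (S * S)" "T < S" "F \<le> S * S" "dd \<le> S"
  "L + F \<le> 2 * (S * S)" "T * S \<le> S * S" "B * T \<le> S * S"
proof -
  show dd: "dd \<le> S" using nd by (simp add: dd_def)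
  show sz: "sz \<le> 2 * (S * S)" by (rule sz_le)
  show T: "T < S" using T_le nd by linarith
  show "F \<le> S * S" unfolding F_def using unit_le T by (intro mult_le_mono) auto
  then show "L + F \<le> 2 * (S * S)" using basic_bounds by linarith
  show MB: "MB \<le> 3 * (S * S)" unfolding MB_def using sz T basic_bounds by linarith
  show "QB \<le> 4 * (S * S)" unfolding QB_def using MB dd basic_bounds by linarith
  show "T * S \<le> S * S" "B * T \<le> S * S" using T basic_bounds by (auto intro!: mult_le_mono)
qed

definition qbase :: "(nat \<Rightarrow> nat) \<Rightarrow> bool" where
  "qbase R \<longleftrightarrow> R 1 = 1 \<and> R 3 = QB \<and> R 4 = S \<and> R 5 = B \<and> R 6 = G \<and> R 7 = L \<and> R 8 = w - lgM \<and> R 9 = sz \<and> R 10 = T \<and>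
    R 11 = MB \<and> R 12 = a \<and> R 13 = H0 \<and> R 14 = E0 \<and> R 16 = dd \<and> R 17 = S * S \<and> R 18 = T * S \<and> R 19 = B * T \<and>
    R 32 = T + 1 \<and> R 40 = 0"

lemma qbaseD:
  assumes "qbase R"
  shows "R (Suc 0) = Suc 0" "R 3 = QB" "R 4 = S" "R 5 = B" "R 6 = G" "R 7 = L" "R 8 = w - lgM" "R 9 = sz" "R 10 = T"
    "R 11 = MB" "R 12 = a" "R 13 = H0" "R 14 = E0" "R 16 = dd" "R 17 = S * S" "R 18 = T * S" "R 19 = B * T"
    "R 32 = Suc T" "R 40 = 0"
  using assms by (simp_all add: qbase_def)

lemma qbase_upd:
  "r \<notin> {Suc 0, 3, 4, 5, 6, 7, 8, 9, 10, 11, 12, 13, 14, 16, 17, 18, 19, 32, 40} \<Longrightarrow> qbase (R(r := v)) = qbase R"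
  unfolding qbase_def by auto

context
  fixes m :: "nat \<Rightarrow> nat"
  assumes data: "data a rs m"
begin

lemma hu_eq: "(\<lambda>u. hsh a (ekey (es ! u))) = hu"
  by (simp add: hu_def ekey_def par_def lab_def fun_eq_iff)

lemma m_reads:
  "m 0 = Iv" "c < 16 \<Longrightarrow> m (Iv + c) = ifo_fin a c" "c < M \<Longrightarrow> m (H0 + c) = prv hu L c N"
  "u < N \<Longrightarrow> m (E0 + 5 * u) = par u" "u < N \<Longrightarrow> m (E0 + (5 * u + 1)) = lab u" "u < N \<Longrightarrow> m (E0 + (5 * u + 2)) = rv u"
  "u < N \<Longrightarrow> m (E0 + (5 * u + 3)) = pay u" "L \<le> u \<Longrightarrow> u < N \<Longrightarrow> m (E0 + (5 * u + 4)) = prv hu L (hu u) u"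
  "x < n \<Longrightarrow> m (adr x) = card (xs ! x)" "x < n \<Longrightarrow> e < card (xs ! x) \<Longrightarrow> m (adr x + Suc e) = sl x ! e"
proof -
  obtain lev mb where m: "m = mkC (ifo_fin a) (\<lambda>c. prv hu L c N) (enH a es N) lev mb"
    using data unfolding data_def Let_def \<tau>_def[symmetric] es_def[symmetric] N_def[symmetric] hu_eq by blast
  show "m 0 = Iv" using E0_less by (simp add: m mkC_def mk_read lowI_def)
  show "c < 16 \<Longrightarrow> m (Iv + c) = ifo_fin a c" "c < M \<Longrightarrow> m (H0 + c) = prv hu L c N"
    by (simp_all add: m mkC_def mk_read)
  have en: "u < N \<Longrightarrow> f < 5 \<Longrightarrow> m (E0 + (5 * u + f)) = enH a es N u f" for u f
    using N_le by (simp add: m mkC_def mk_read)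
  have v: "u < N \<Longrightarrow> enH a es N u 0 = par u" "u < N \<Longrightarrow> enH a es N u 1 = lab u" "u < N \<Longrightarrow> enH a es N u 2 = rv u"
    "u < N \<Longrightarrow> enH a es N u 3 = pay u" "L \<le> u \<Longrightarrow> u < N \<Longrightarrow> enH a es N u 4 = prv hu L (hu u) u" for u
    by (auto simp: enH_def enE_def par_def lab_def rv_def pay_def hu_eq hu_eq[THEN fun_cong] N_def split: prod.splits)
  show "u < N \<Longrightarrow> m (E0 + 5 * u) = par u" using en[of u 0] v by simp
  show "u < N \<Longrightarrow> m (E0 + (5 * u + 1)) = lab u" using en[of u 1] v by simp
  show "u < N \<Longrightarrow> m (E0 + (5 * u + 2)) = rv u" using en[of u 2] v by simp
  show "u < N \<Longrightarrow> m (E0 + (5 * u + 3)) = pay u" using en[of u 3] v by simp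
  show "L \<le> u \<Longrightarrow> u < N \<Longrightarrow> m (E0 + (5 * u + 4)) = prv hu L (hu u) u" using en[of u 4] v by simp
  show "x < n \<Longrightarrow> m (adr x) = card (xs ! x)"
    using adr_less[of x 0] adr_ge[of x] low0(5)[of x] by (simp add: m mkC_def mk_read lowI_def)
  show "x < n \<Longrightarrow> e < card (xs ! x) \<Longrightarrow> m (adr x + Suc e) = sl x ! e"
    using adr_less[of x "Suc e"] low0(6)[of x e] by (simp add: m mkC_def mk_read lowI_def)
qed

lemma sz_regions: "Iv + 16 \<le> sz" "H0 + M \<le> sz" "u < X \<Longrightarrow> E0 + 5 * u + 5 \<le> sz" "x < n \<Longrightarrow> adr x + card (xs ! x) < Iv" "Iv \<le> sz"
  using adr_less[of x "card (xs ! x)"] by (auto simp: sz_def E0_def H0_def)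

lemma q_reads:
  "mkQ m mrk qf 0 = Iv" "c < 16 \<Longrightarrow> mkQ m mrk qf (Iv + c) = ifo_fin a c" "c < M \<Longrightarrow> mkQ m mrk qf (H0 + c) = prv hu L c N"
  "u < N \<Longrightarrow> mkQ m mrk qf (E0 + 5 * u) = par u" "u < N \<Longrightarrow> mkQ m mrk qf (E0 + (5 * u + 1)) = lab u"
  "u < N \<Longrightarrow> mkQ m mrk qf (E0 + (5 * u + 2)) = rv u" "u < N \<Longrightarrow> mkQ m mrk qf (E0 + (5 * u + 3)) = pay u"
  "L \<le> u \<Longrightarrow> u < N \<Longrightarrow> mkQ m mrk qf (E0 + (5 * u + 4)) = prv hu L (hu u) u"
  "x < n \<Longrightarrow> mkQ m mrk qf (adr x) = card (xs ! x)" "x < n \<Longrightarrow> e < card (xs ! x) \<Longrightarrow> mkQ m mrk qf (adr x + Suc e) = sl x ! e"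
  "mkQ m mrk qf sz = T" "e < T \<Longrightarrow> mkQ m mrk qf (sz + Suc e) = sq ! e"
proof -
  have ul: "E0 + 5 * u + 5 \<le> sz" if "u < N" for u using sz_regions(3)[of u] that N_le by simp
  show "mkQ m mrk qf 0 = Iv" using sz_regions E0_less m_reads by (simp add: mkQ_ds)
  show "c < 16 \<Longrightarrow> mkQ m mrk qf (Iv + c) = ifo_fin a c" "c < M \<Longrightarrow> mkQ m mrk qf (H0 + c) = prv hu L c N"
    using sz_regions m_reads by (simp_all add: mkQ_ds)
  show "u < N \<Longrightarrow> mkQ m mrk qf (E0 + 5 * u) = par u" "u < N \<Longrightarrow> mkQ m mrk qf (E0 + (5 * u + 1)) = lab u"
    "u < N \<Longrightarrow> mkQ m mrk qf (E0 + (5 * u + 2)) = rv u" "u < N \<Longrightarrow> mkQ m mrk qf (E0 + (5 * u + 3)) = pay u"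
    "L \<le> u \<Longrightarrow> u < N \<Longrightarrow> mkQ m mrk qf (E0 + (5 * u + 4)) = prv hu L (hu u) u"
  proof -
    have e: "mkQ m mrk qf (E0 + (5 * u + f)) = m (E0 + (5 * u + f))" if "u < N" "f < 5" for f
      using ul[OF that(1)] that(2) by (intro mkQ_ds) simp
    show "u < N \<Longrightarrow> mkQ m mrk qf (E0 + 5 * u) = par u" using e[of 0] m_reads(4) by simp
    show "u < N \<Longrightarrow> mkQ m mrk qf (E0 + (5 * u + 1)) = lab u" using e[of 1] m_reads(5) by simp
    show "u < N \<Longrightarrow> mkQ m mrk qf (E0 + (5 * u + 2)) = rv u" using e[of 2] m_reads(6) by simp
    show "u < N \<Longrightarrow> mkQ m mrk qf (E0 + (5 * u + 3)) = pay u" using e[of 3] m_reads(7) by simp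
    show "L \<le> u \<Longrightarrow> u < N \<Longrightarrow> mkQ m mrk qf (E0 + (5 * u + 4)) = prv hu L (hu u) u" using e[of 4] m_reads(8) by simp
  qed
  show "x < n \<Longrightarrow> mkQ m mrk qf (adr x) = card (xs ! x)"
    using sz_regions(4)[of x] sz_regions(5) m_reads by (simp add: mkQ_ds)
  show "x < n \<Longrightarrow> e < card (xs ! x) \<Longrightarrow> mkQ m mrk qf (adr x + Suc e) = sl x ! e"
    using sz_regions(4)[of x] sz_regions(5) m_reads(10)[of x e] by (simp add: mkQ_ds)
  show "mkQ m mrk qf sz = T" "e < T \<Longrightarrow> mkQ m mrk qf (sz + Suc e) = sq ! e"
    using qm0_q by (simp_all add: mkQ_low MB_def)
qed

lemma qry1:
  assumes Q: "\<And>R t'. qbase R \<Longrightarrow> R 20 = F \<Longrightarrow> t' \<le> t + 50 \<Longrightarrow> Q R (mkQ m (\<lambda>_. 0) (\<lambda>_. 0)) [] t'"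
  shows "wp w Q qry1 ((\<lambda>_. 0)(0 := sz)) (mkQ m (\<lambda>_. 0) (\<lambda>_. 0)) [] t"
proof -
  have w0: "0 < w" using w256 by simp
  have ltw: "c < (2::nat) ^ w" if "c < 16" for c using basic_bounds that by (auto intro!: lt_w)
  note lts = w0 ltw
  have e1: "binop_val w Add Iv c = Iv + c" if "c < 16" for c
    using that E0_less H0_E0 basic_bounds by (intro arith_eqs; linarith)
  have e2: "binop_val w Add sz 0 = sz" "binop_val w Add sz T = sz + T" "binop_val w Add (sz + T) (Suc 0) = MB"
    "binop_val w Add MB dd = QB" "binop_val w Mul S S = S * S" "binop_val w Mul T S = T * S" "binop_val w Mul B T = B * T"
    "binop_val w Add T (Suc 0) = Suc T" "binop_val w Mul (Kf * L * y) (Suc T) = F"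
  proof -
    have "F = Kf * L * y * Suc T" by (simp add: F_def)
    then show "binop_val w Mul (Kf * L * y) (Suc T) = F" using q_bounds basic_bounds by (subst mul_eq; linarith)
    show "binop_val w Add MB dd = QB" using q_bounds basic_bounds unfolding QB_def by (intro arith_eqs; linarith)
    show "binop_val w Add (sz + T) (Suc 0) = MB" using q_bounds basic_bounds unfolding MB_def by (subst arith_eqs; linarith)
    show "binop_val w Add sz 0 = sz" "binop_val w Add sz T = sz + T" "binop_val w Mul S S = S * S"
      "binop_val w Mul T S = T * S" "binop_val w Mul B T = B * T" "binop_val w Add T (Suc 0) = Suc T"
      using q_bounds basic_bounds by (subst arith_eqs; linarith)+
  qed
  show ?thesis
    unfolding qry1_def
    apply (simp add: lts e1 e1[of 2, simplified] e2 q_reads(1,2,11) q_reads(2)[of 2, simplified] ifo_fin_def)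
    apply (rule Q)
      apply (simp_all add: qbase_def)
    done
qed

lemma qry2:
  assumes Q: "\<And>R t'. qbase R \<Longrightarrow> R 20 = F \<Longrightarrow> t' \<le> t + 3 + 8 * T \<Longrightarrow> Q R (mkQ m (ind q) (\<lambda>_. 0)) [] t'"
    and R: "qbase R" "R 20 = F"
  shows "wp w Q qry2 R (mkQ m (\<lambda>_. 0) (\<lambda>_. 0)) [] t"
proof -
  have lts: "0 < w" using w256 by simp
  have e1: "binop_val w Add sz e = sz + e" "binop_val w Add (sz + e) (Suc 0) = sz + Suc e" "binop_val w Add e (Suc 0) = Suc e"
    "binop_val w Add MB (sq ! e) = MB + sq ! e" "sq ! e < dd" if "e < T" for e
  proof -
    have "sq ! e \<in> q" using that sq_props nth_mem by metis
    then show s: "sq ! e < dd" using q_sub by (auto simp: dd_def)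
    have "binop_val w Add (sz + e) (Suc 0) = Suc (sz + e)" using that q_bounds basic_bounds by (intro arith_eqs; linarith)
    then show "binop_val w Add (sz + e) (Suc 0) = sz + Suc e" by simp
    show "binop_val w Add sz e = sz + e" "binop_val w Add e (Suc 0) = Suc e" "binop_val w Add MB (sq ! e) = MB + sq ! e"
      using that s q_bounds basic_bounds by (intro arith_eqs; linarith)+
  qed
  have e2: "mkQ m (ind (set (take e sq))) (\<lambda>_. 0) (Suc (sz + e)) = sq ! e" if "e < T" for e
    using q_reads(12)[OF that] by simp
  have e3: "(mkQ m (ind (set (take e sq))) (\<lambda>_. 0))(MB + sq ! e := Suc 0) = mkQ m (ind (set (take (Suc e) sq))) (\<lambda>_. 0)"
    if "e < T" for e
    using that e1(5)[OF that] sq_props(1) by (simp add: mkQ_rest ind_insert take_Suc_conv_app_nth)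
  have z: "(\<lambda>_. 0) = ind (set (take 0 sq))" by (simp add: ind_def fun_eq_iff)
  show ?thesis
    unfolding qry2_def
    using R
    apply (simp add: qbaseD cmp_bt lts)
    apply (rule wp_for[where N = T and I = "\<lambda>e R M' rs' t'. qbase R \<and> R 20 = F \<and> R 41 = e \<and> R 42 = bt (e < T) \<and>
       M' = mkQ m (ind (set (take e sq))) (\<lambda>_. 0) \<and> rs' = [] \<and> t' \<le> t + 2 + 8 * e"])
    subgoal using z by (simp add: qbase_upd)
    subgoal by (simp add: order_less_le)
    subgoal by (simp add: qbaseD qbase_upd e1 e2 e3 cmp_bt)
    subgoal for R M' rs' t' using Q[of R "Suc t'"] sq_props by simp
    done
qed

lemma qry3:
  assumes Q: "\<And>R t'. qbase R \<Longrightarrow> R 20 = F \<Longrightarrow> t' \<le> t + 3 + 5 * L \<Longrightarrow>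
      Q R (mkQ m (ind q) (\<lambda>i. if i < L then i else 0)) [] t'"
    and R: "qbase R" "R 20 = F"
  shows "wp w Q qry3 R (mkQ m (ind q) (\<lambda>_. 0)) [] t"
proof -
  have lts: "0 < w" "0 < L" using w256 L1 by auto
  have e1: "binop_val w Add QB e = QB + e" "binop_val w Add e (Suc 0) = Suc e" if "e < L" for e
    using that q_bounds basic_bounds by (intro arith_eqs; linarith)+
  have e3: "(mkQ m (ind q) (\<lambda>i. if i < e then i else 0))(QB + e := e) = mkQ m (ind q) (\<lambda>i. if i < Suc e then i else 0)" for e
    unfolding mkQ_rest by (rule arg_cong[where f = "mkQ m (ind q)"]) (auto simp: fun_eq_iff)
  show ?thesis
    unfolding qry3_def
    using R
    apply (simp add: qbaseD cmp_bt lts)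
    apply (rule wp_for[where N = L and I = "\<lambda>e R M' rs' t'. qbase R \<and> R 20 = F \<and> R 41 = e \<and> R 42 = bt (e < L) \<and>
       M' = mkQ m (ind q) (\<lambda>i. if i < e then i else 0) \<and> rs' = [] \<and> t' \<le> t + 2 + 5 * e"])
    subgoal using lts by (simp add: qbase_upd)
    subgoal by (simp add: order_less_le)
    subgoal by (simp add: qbaseD qbase_upd e1 e3 cmp_bt)
    subgoal for R M' rs' t' using Q[of R "Suc t'"] by simp
    done
qed

text \<open>Register 20 is the budget, each unit worth 50 steps. Success zeroes it and puts an
  address into register 0, where 0 means that nothing has been found, all addresses being at least
  4.\<close>

definition qinv :: "nat \<Rightarrow> assn" where
  "qinv t0 R M' rs' t \<longleftrightarrow> qbase R \<and> rs' = [] \<and> t + 50 * R 20 \<le> t0 \<and> (\<exists>qf. M' = mkQ m (ind q) qf \<and>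
     ((R 20 = 0 \<and> (\<exists>x<n. R 0 = adr x \<and> acc (xs ! x))) \<or>
      (R 0 = 0 \<and> live (R 20) (R 21) (R 22) (R 23) (R 24) (R 25) (R 26) (R 27) (R 28) (R 29) (R 30) (R 31) qf)))"

text \<open>Each branch of the state machine is matched with its \<open>live\<close> lemma, and none
  takes more than 50 steps.\<close>

lemma qstep:
  assumes I: "qinv t0 R M' rs' t" and f: "R 20 \<noteq> 0"
  shows "wp w (\<lambda>R' M' rs' t'. qinv t0 R' M' rs' t' \<and> R' 20 < R 20) qstep R M' rs' (Suc t)"
proof -
  obtain f where f': "R 20 = Suc f" using f by (cases "R 20") auto
  obtain qf where qb: "qbase R" and rs': "rs' = []" and t: "t + 50 * R 20 \<le> t0" and M': "M' = mkQ m (ind q) qf"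
    and R0: "R 0 = 0"
    and lv: "live (Suc f) (R 21) (R 22) (R 23) (R 24) (R 25) (R 26) (R 27) (R 28) (R 29) (R 30) (R 31) qf"
    using I f' unfolding qinv_def by auto
  have w0: "0 < w" using w256 by simp
  have ltw: "c < (2::nat) ^ w" if "c < 16" for c using basic_bounds that by (auto intro!: lt_w)
  note lts = w0 ltw
  have fS: "qt + Suc f \<le> L + F \<Longrightarrow> f < Z" for qt using q_bounds basic_bounds by linarith
  have fl: "R 31 + Suc f \<le> L + F" "R 30 \<le> R 31" "R 22 \<le> T + 1" using lv by (auto simp: live_def)
  have e0: "binop_val w Sub (Suc f) (Suc 0) = f"
    using fS[OF fl(1)] basic_bounds by (subst binops) (auto intro!: lt_w)
  have t': "t + 50 * f + 50 \<le> t0" using t f' by simp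
  show ?thesis
  proof (cases "R 23")
    case (Suc r)
    have lv': "live (Suc f) (R 21) (R 22) (Suc r) (R 24) (R 25) (R 26) (R 27) (R 28) (R 29) (R 30) (R 31) qf"
      using lv Suc by simp
    obtain x where x: "verifying x (Suc r) (R 24) (R 25) (R 26) (R 29)"
      and step: "if R 29 \<le> (R 24 + bt (sl x ! (card (xs ! x) - Suc r) \<in> q)) * S then acc (xs ! x)
       else live f (R 21) (R 22) r (R 24 + bt (sl x ! (card (xs ! x) - Suc r) \<in> q)) (Suc (R 25)) (R 26) (R 27) (R 28) (R 29) (R 30) (R 31) qf"
      using live_verify[OF lv'] by blast
    define e where "e = card (xs ! x) - Suc r"
    have xn: "x < n" "R 26 = adr x" "R 25 = adr x + Suc e" "e < card (xs ! x)" "r < card (xs ! x)"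
      "R 24 = (\<Sum>i<e. bt (sl x ! i \<in> q))"
      using x by (auto simp: verifying_def e_def)
    have se: "sl x ! e < dd" using sl_props(4)[OF xn(1) sl_props(3)[OF xn(1,4)]] by (simp add: dd_def)
    define Ic where "Ic = R 24 + bt (sl x ! e \<in> q)"
    have "R 24 \<le> (\<Sum>i<e. 1)" unfolding xn(6) by (intro sum_mono) (simp add: bt_def)
    then have Ic: "Ic \<le> d" using xn(4) xs_card[OF xn(1)] by (simp add: Ic_def bt_def)
    have IcS: "Ic * S \<le> S * S" using Ic nd by (intro mult_le_mono1) simp
    have ax: "adr x + Suc e < Iv" using adr_less[of x "Suc e"] xn by simp
    have ev: "binop_val w Add MB (sl x ! e) = MB + sl x ! e" "binop_val w Add (R 24) (bt (sl x ! e \<in> q)) = Ic"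
      "binop_val w Add (R 25) (Suc 0) = Suc (R 25)" "binop_val w Mul Ic S = Ic * S" "binop_val w Add (R 26) 0 = R 26"
    proof -
      show "binop_val w Add (R 24) (bt (sl x ! e \<in> q)) = Ic"
        using Ic nd basic_bounds unfolding Ic_def by (intro arith_eqs; linarith)
      show "binop_val w Add MB (sl x ! e) = MB + sl x ! e" "binop_val w Mul Ic S = Ic * S"
        using se q_bounds IcS basic_bounds by (intro arith_eqs; linarith)+
      have "R 26 \<le> Z" "R 25 < Z" using ax xn Iv_Z by linarith+
      then show "binop_val w Add (R 25) (Suc 0) = Suc (R 25)" "binop_val w Add (R 26) 0 = R 26"
        using basic_bounds by (subst arith_eqs; linarith)+
    qed
    have es: "binop_val w Sub (Suc r) (Suc 0) = r"
      using xn(5) xs_card[OF xn(1)] nd basic_bounds by (subst binops) (auto intro!: lt_w)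
    have rd: "mkQ m (ind q) qf (R 25) = sl x ! e" "mkQ m (ind q) qf (MB + sl x ! e) = bt (sl x ! e \<in> q)"
      using q_reads(10)[OF xn(1,4)] xn(3) mkQ_rest(1)[OF se] by (simp_all add: ind_def)
    show ?thesis
    proof (cases "Ic * S < R 29")
      case True
      then have lv2: "live f (R 21) (R 22) r Ic (Suc (R 25)) (R 26) (R 27) (R 28) (R 29) (R 30) (R 31) qf"
        using step unfolding e_def[symmetric] Ic_def[symmetric] by (simp add: not_le)
      show ?thesis
        unfolding qstep_def qverify_def rs' M'
        using qb f' Suc True
        apply (simp add: qbaseD e0 rd ev es cmp_bt)
        apply (simp add: qinv_def qbase_upd)
        using t' lv2 R0 by auto
    next
      case False
      then have ac: "acc (xs ! x)" using step unfolding e_def[symmetric] Ic_def[symmetric] by (simp add: not_less)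
      show ?thesis
        unfolding qstep_def qverify_def rs' M'
        using qb f' Suc False
        apply (simp add: qbaseD e0 rd ev es cmp_bt lts)
        apply (simp add: qinv_def qbase_upd)
        using t' ac xn by auto
    qed
  next
    case r0: 0
    show ?thesis
    proof (cases "R 21")
      case (Suc u)
      have lv': "live (Suc f) (Suc u) (R 22) 0 (R 24) (R 25) (R 26) (R 27) (R 28) (R 29) (R 30) (R 31) qf"
        using lv Suc r0 by simp
      note lc = live_chain[OF lv']
      define c' where "c' = prv hu L (hu u) u"
      have u: "L \<le> u" "u < N" "u < X" using lc(1) N_le by (auto simp: pend_def)
      have rB: "rv u * (B * T) \<le> S * (S * S)" using entry(6)[OF u(2)] q_bounds by (simp only: mult_le_mono less_imp_le)
      have ev: "binop_val w Sub (Suc u) (Suc 0) = u" "binop_val w Mul (rv u) (B * T) = rv u * (B * T)"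
        "binop_val w Add (E0 + 5 * u) 2 = E0 + (5 * u + 2)" "binop_val w Mul (bt p) (bt p') = bt (p \<and> p')" for p p'
      proof -
        show "binop_val w Sub (Suc u) (Suc 0) = u" using u basic_bounds by (subst binops) (auto intro!: lt_w)
        show "binop_val w Mul (rv u) (B * T) = rv u * (B * T)"
          using rB basic_bounds by (intro mul_eq) (simp add: Z_def mult.assoc)
        have "binop_val w Add (E0 + 5 * u) 2 = E0 + 5 * u + 2"
          using sz_regions(3)[OF u(3)] q_bounds basic_bounds by (intro add_eq; linarith)
        then show "binop_val w Add (E0 + 5 * u) 2 = E0 + (5 * u + 2)" by simp
        show "binop_val w Mul (bt p) (bt p') = bt (p \<and> p')"
          using basic_bounds by (subst mul_eq) (auto simp: bt_mult bt_def)
      qed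
      have m1: "binop_val w Mul (Suc 0) (Suc 0) = Suc 0" using ev(4)[of True True] by (simp only: bt_def simp_thms of_bool_eq One_nat_def)
      note rds = q_reads(4-7)[OF u(2)] q_reads(8)[OF u(1,2)]
      have mt_eq: "par u = R 27 \<and> lab u = R 28 \<and> rv u * (B * T) < S * S \<longleftrightarrow> mt (R 27) (R 22 - 1) u"
        using lc(3) by (auto simp: mt_def)
      show ?thesis
      proof (cases "mt (R 27) (R 22 - 1) u")
        case False
        show ?thesis
          unfolding qstep_def qchain_def rs' M'
          using qb f' Suc r0 False[folded mt_eq]
          apply (simp add: qbaseD e0 lts ev ent_addr[OF u(3)] ent_addr[OF u(3), simplified] rds rds[simplified] m1 cmp_bt c'_def[symmetric])
          apply (simp add: qinv_def qbase_upd)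
          using t' lc(6)[OF False] R0 unfolding c'_def[symmetric] by auto
      next
        case True
        show ?thesis
        proof (cases "pay u = 0")
          case p0: True
          have eq: "binop_val w Add QB (R 31) = QB + R 31" "binop_val w Add (R 31) (Suc 0) = Suc (R 31)"
            using fl q_bounds basic_bounds by (intro arith_eqs; linarith)+
          show ?thesis
            unfolding qstep_def qchain_def rs' M'
            using qb f' Suc r0 True[folded mt_eq] p0
            apply (simp add: qbaseD e0 lts ev ent_addr[OF u(3)] ent_addr[OF u(3), simplified] rds rds[simplified] m1 cmp_bt c'_def[symmetric]
                eq mkQ_rest(4))
            apply (simp add: qinv_def qbase_upd)
            using t' lc(7)[OF True p0] R0 unfolding c'_def[symmetric] by auto
        next
          case p1: False
          obtain x where x: "x < n" "pay u = adr x" using entry(2)[OF u(2) p1] by blast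
          have cx: "card (xs ! x) * G \<le> S * S" "max (card (xs ! x)) T * G \<le> S * S" "card (xs ! x) \<le> d"
            using xs_card[OF x(1)] T_le nd basic_bounds by (auto intro!: mult_le_mono)
          have ax: "adr x < Iv" using adr_less[of x 0] x by simp
          have eq: "binop_val w Mul (card (xs ! x)) G = card (xs ! x) * G" "binop_val w Add (card (xs ! x)) 0 = card (xs ! x)"
            "binop_val w Add (adr x) (Suc 0) = Suc (adr x)" "binop_val w Add (adr x) 0 = adr x"
            "T > card (xs ! x) \<Longrightarrow> binop_val w Mul T G = max (card (xs ! x)) T * G"
            "\<not> T > card (xs ! x) \<Longrightarrow> card (xs ! x) * G = max (card (xs ! x)) T * G"
          proof -
            show "T > card (xs ! x) \<Longrightarrow> binop_val w Mul T G = max (card (xs ! x)) T * G"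
              using cx basic_bounds by (subst mul_eq) (auto simp: max_def)
            show "\<not> T > card (xs ! x) \<Longrightarrow> card (xs ! x) * G = max (card (xs ! x)) T * G" by (simp add: max_def)
            show "binop_val w Mul (card (xs ! x)) G = card (xs ! x) * G" "binop_val w Add (card (xs ! x)) 0 = card (xs ! x)"
              "binop_val w Add (adr x) (Suc 0) = Suc (adr x)" "binop_val w Add (adr x) 0 = adr x"
              using cx ax Iv_Z nd basic_bounds by (subst arith_eqs; linarith)+
          qed
          have a0: "0 < adr x" using adr_ge[of x] by simp
          show ?thesis
          proof (cases "card (xs ! x) * G \<le> T * S")
            case False
            show ?thesis
              unfolding qstep_def qchain_def rs' M'
              using qb f' Suc r0 True[folded mt_eq] x(2) a0 False
              apply (simp add: qbaseD e0 lts ev ent_addr[OF u(3)] ent_addr[OF u(3), simplified] rds rds[simplified] m1 cmp_bt c'_def[symmetric]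
                  eq(1-4) q_reads(9)[OF x(1)] not_le)
              apply (simp add: qinv_def qbase_upd)
              using t' lc(9)[OF True x(2,1) False] R0 unfolding c'_def[symmetric] by auto
          next
            case small: True
            show ?thesis
            proof (cases "card (xs ! x) < T")
              case lt: True
              show ?thesis
                unfolding qstep_def qchain_def rs' M'
                using qb f' Suc r0 True[folded mt_eq] x(2) a0 small lt
                apply (simp add: qbaseD e0 lts ev ent_addr[OF u(3)] ent_addr[OF u(3), simplified] rds rds[simplified] m1 cmp_bt c'_def[symmetric]
                    eq(1-4) eq(5)[OF lt] q_reads(9)[OF x(1)] not_less)
                apply (simp add: qinv_def qbase_upd)
                using t' lc(8)[OF True x(2,1) small] R0 unfolding c'_def[symmetric] by auto
            next
              case lt: False
              show ?thesis
                unfolding qstep_def qchain_def rs' M'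
                using qb f' Suc r0 True[folded mt_eq] x(2) a0 small lt
                apply (simp add: qbaseD e0 lts ev ent_addr[OF u(3)] ent_addr[OF u(3), simplified] rds rds[simplified] m1 cmp_bt c'_def[symmetric]
                    eq(1-4) q_reads(9)[OF x(1)] not_less)
                apply (simp add: qinv_def qbase_upd)
                using t' lc(8)[OF True x(2,1) small] R0 unfolding c'_def[symmetric] eq(6)[OF lt, symmetric] by auto
            qed
          qed
        qed
      qed
    next
      case c0: 0
      show ?thesis
      proof (cases "R 22 \<le> T")
        case True
        have lv': "live (Suc f) 0 (R 22) 0 (R 24) (R 25) (R 26) (R 27) (R 28) (R 29) (R 30) (R 31) qf"
          using lv c0 r0 by simp
        note ll = live_lookup[OF lv' True]
        have vX: "R 27 < X" using ll(2) tau_ok(2) by linarith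
        have key: "R 27 * dd \<le> S * S" using vX X_le q_bounds by (intro mult_le_mono) auto
        have lbd: "lb (R 22) \<le> d" using lb_le[OF True] .
        have hM: "hb (R 27) (R 22) < M" unfolding hb_def by (rule hsh_less)
        have ev: "binop_val w Mul (R 27) dd = R 27 * dd" "binop_val w Add (R 27 * dd) (lb (R 22)) = R 27 * dd + lb (R 22)"
          "binop_val w Add H0 (hb (R 27) (R 22)) = H0 + hb (R 27) (R 22)" "binop_val w Add (R 22) (Suc 0) = Suc (R 22)"
          "binop_val w Add sz (R 22) = sz + R 22"
          using key lbd hM sz_regions(2) True T_le nd q_bounds basic_bounds by (intro arith_eqs; linarith)+
        have "a * (R 27 * dd + lb (R 22)) mod 2 ^ w < 2 ^ w" by simp
        then have eh: "binop_val w Shr (binop_val w Mul a (R 27 * dd + lb (R 22))) (w - lgM) = hb (R 27) (R 22)"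
          by (simp add: binops(6) binop_val.simps(3) hb_def hsh_def)
        have rl: "mkQ m (ind q) qf (sz + R 22) = lb (R 22)" if "0 < R 22"
          using q_reads(12)[of "R 22 - 1" "ind q" qf] True that by (simp add: lb_def)
        show ?thesis
        proof (cases "R 22 = 0")
          case z: True
          have "lb (R 22) = 0" using z lb_0 by simp
          then show ?thesis
            unfolding qstep_def qlookup_def rs' M'
            using qb f' c0 r0 z ev[unfolded z lb_0, simplified] eh[unfolded z lb_0, simplified] hM[unfolded z]
            apply (simp add: qbaseD e0 lts cmp_bt q_reads(3))
            apply (simp add: qinv_def qbase_upd)
            using t' ll(1) R0 z lb_0 by auto
        next
          case nz: False
          show ?thesis
            unfolding qstep_def qlookup_def rs' M'
            using qb f' c0 r0 nz True
            apply (simp add: qbaseD e0 lts cmp_bt rl ev eh q_reads(3)[OF hM] less_Suc_eq_le)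
            apply (simp add: qinv_def qbase_upd)
            using t' ll(1) R0 by auto
        qed
      next
        case False
        then have jT: "R 22 = T + 1" using fl(3) by simp
        have lv': "live (Suc f) 0 (T + 1) 0 (R 24) (R 25) (R 26) (R 27) (R 28) (R 29) (R 30) (R 31) qf"
          using lv c0 r0 jT by simp
        show ?thesis
        proof (cases "R 30 < R 31")
          case True
          have ev: "binop_val w Add QB (R 30) = QB + R 30" "binop_val w Add (R 30) (Suc 0) = Suc (R 30)"
            using fl True q_bounds basic_bounds by (intro arith_eqs; linarith)+
          show ?thesis
            unfolding qstep_def qpop_def rs' M'
            using qb f' c0 r0 jT True
            apply (simp add: qbaseD e0 lts cmp_bt ev mkQ_rest(2))
            apply (simp add: qinv_def qbase_upd)
            using t' live_pop[OF lv' True] R0 by auto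
        next
          case False
          show ?thesis
            unfolding qstep_def rs' M'
            using qb f' c0 r0 jT False
            apply (simp add: qbaseD e0 lts cmp_bt)
            apply (simp add: qinv_def qbase_upd)
            using t' live_idle[OF lv' False] R0 by auto
        qed
      qed
    qed
  qed
qed

theorem query:
  "wp w (\<lambda>R M' rs' t. t \<le> 70 + 8 * T + 5 * L + 50 * F \<and> (\<forall>c<sz. M' c = m c) \<and>
      (work_ok \<longrightarrow> (\<exists>x<n. R 0 = adr x \<and> acc (xs ! x))))
    query ((\<lambda>_. 0)(0 := sz)) (qm0 m) [] 0"
proof -
  have lts: "0 < w" using w256 by simp
  have ev: "binop_val w Add (Suc T) 0 = Suc T" "binop_val w Add L 0 = L"
    using q_bounds basic_bounds by (subst add_eq; linarith)+
  show ?thesis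
    unfolding query_def qm0_init
    apply (rule wp_append, rule qry1)
    apply (rule wp_append, rule qry2)
      apply (rule wp_append, rule qry3)
        apply (simp add: qbaseD ev)
        apply (rule wp_while[where I = "qinv (65 + 8 * T + 5 * L + 50 * F)" and m = "\<lambda>R. R 20"])
    subgoal using live_init by (auto simp: qinv_def qbase_upd)
    subgoal by (rule qstep)
    subgoal for R1 t1 R2 t2 R3 t3 R M' rs' t
      by (auto simp: qinv_def mkQ_ds dest: live_end)
    by assumption+
qed

end

end

section \<open>Bounding the work of a query by node counts and collisions\<close>

context search_inst
begin

text \<open>This and the next definitions repeat notions of \<open>query_inst\<close> with the
  random outcome as an argument, so that they can be averaged over the tape.\<close>

definition qlab :: "nat set \<Rightarrow> nat \<Rightarrow> nat" where
  "qlab q i = (if i = 0 then 0 else sorted_list_of_set q ! (i - 1))"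

definition accept :: "nat set \<Rightarrow> nat set \<Rightarrow> bool" where
  "accept q x \<longleftrightarrow> 0 < card x \<and> max (card x) (card q) * G \<le> card (x \<inter> q) * S"

definition visited :: "nat set \<Rightarrow> nodes \<Rightarrow> nat set" where
  "visited q \<tau> = {u. u < length \<tau> \<and> list_all (edge_ok q) (snd (\<tau> ! u))}"

text \<open>Records met in the buckets looked up at \<open>v\<close> although their key differs from
  the one asked for.\<close>

definition coll :: "nat set \<Rightarrow> nat \<Rightarrow> nodes \<Rightarrow> nat \<Rightarrow> nat" where
  "coll q a \<tau> v = (\<Sum>i\<le>card q. card {u \<in> {L..<length (entries \<tau>)}. ekey (entries \<tau> ! u) \<noteq> v * dd + qlab q i \<and>
     hsh a (ekey (entries \<tau> ! u)) = hsh a (v * dd + qlab q i)})"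

definition both :: "nat set \<Rightarrow> nat set \<Rightarrow> nat \<times> nat \<Rightarrow> bool" where
  "both q x e \<longleftrightarrow> edge_ok q e \<and> edge_ok x e"

definition leaf :: "nat \<Rightarrow> real" where
  "leaf l = of_bool (l = k)"

definition rejects :: "nat set \<Rightarrow> nat set set" where
  "rejects q = {x \<in> set xs. \<not> accept q x}"

text \<open>In this order: the reserve for the final verification, the fixed work per visited node,
  hash collisions, and a full verification for each rejected data point at a leaf shared with the
  query.\<close>

definition cost :: "nat set \<Rightarrow> nat \<Rightarrow> nodes \<Rightarrow> real" where
  "cost q a \<tau> = real (1 + card q * S div G) + (3 + 2 * real (card q)) * real (card (visited q \<tau>)) +
     (\<Sum>v\<in>visited q \<tau>. real (coll q a \<tau> v)) +
     real (1 + card q * S div G) * (\<Sum>x\<in>rejects q. count (both q x) leaf \<tau>)"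

lemma count_card:
  "count f (\<lambda>l. of_bool (Q l)) \<tau> = card {u. u < length \<tau> \<and> list_all f (snd (\<tau> ! u)) \<and> Q (length (snd (\<tau> ! u)))}"
proof -
  have "count f (\<lambda>l. of_bool (Q l)) \<tau> =
      (\<Sum>u<length \<tau>. of_bool (list_all f (snd (\<tau> ! u)) \<and> Q (length (snd (\<tau> ! u)))))"
    unfolding count_def by (rule sum.cong) auto
  also have "\<dots> = card {u. u < length \<tau> \<and> list_all f (snd (\<tau> ! u)) \<and> Q (length (snd (\<tau> ! u)))}"
    by (subst sum_of_bool_eq) (auto intro!: arg_cong[where f = card])
  finally show ?thesis .
qed

lemma list_all_both: "list_all (both q x) p \<longleftrightarrow> list_all (edge_ok q) p \<and> list_all (edge_ok x) p"
  by (induction p) (auto simp: both_def)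

lemma length_cands:
  "length (cands \<tau> i) = card {c. c < i \<and> leaf_ok \<tau> (c div n) (c mod n)}"
proof -
  have "length (cands \<tau> i) = card (set (filter (\<lambda>c. leaf_ok \<tau> (c div n) (c mod n)) [0..<i]))"
    unfolding cands_def by (simp only: length_map) (rule distinct_card[symmetric], simp)
  then show ?thesis by (auto intro!: arg_cong[where f = card])
qed

lemma nth_xs: "x < n \<Longrightarrow> xs ! x \<in> set xs" "x < n \<Longrightarrow> x' < n \<Longrightarrow> xs ! x = xs ! x' \<Longrightarrow> x = x'"
  using distinct_xs by (auto simp: n_def nth_eq_iff_index_eq)

lemma card_xs: "card (set xs) = n"
  using distinct_card[OF distinct_xs] by (simp add: n_def)

text \<open>Each node is charged to a data point that accepts it, and each candidate to its pair of
  data point and leaf. This reduces the total size to counts for single sets.\<close>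

lemma size_le:
  assumes "tree_ok i \<tau>"
  shows "real (length \<tau> + length (cands \<tau> (length \<tau> * n))) \<le> (\<Sum>x\<in>set xs. count (edge_ok x) (\<lambda>l. 1 + leaf l) \<tau>)"
proof -
  define U where "U x = {u. u < length \<tau> \<and> list_all (edge_ok x) (snd (\<tau> ! u))}" for x
  define V where "V x = {u. u < length \<tau> \<and> list_all (edge_ok x) (snd (\<tau> ! u)) \<and> length (snd (\<tau> ! u)) = k}" for x
  have fin: "finite (U x)" "finite (V x)" for x by (simp_all add: U_def V_def)
  have "count (edge_ok x) (\<lambda>l. 1 + leaf l) \<tau> = count (edge_ok x) (\<lambda>l. of_bool True) \<tau> + count (edge_ok x) (\<lambda>l. of_bool (l = k)) \<tau>" for x
    unfolding count_def leaf_def sum.distrib[symmetric] by (rule sum.cong) auto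
  then have c: "count (edge_ok x) (\<lambda>l. 1 + leaf l) \<tau> = real (card (U x) + card (V x))" for x
    unfolding count_card U_def V_def by simp
  have "{..<length \<tau>} \<subseteq> (\<Union>x\<in>set xs. U x)"
  proof
    fix u assume u: "u \<in> {..<length \<tau>}"
    have "\<exists>x\<in>set xs. list_all (edge_ok x) (snd (\<tau> ! u))"
    proof (cases "u < L")
      case True
      then have "\<tau> ! u = (0, [])" using assms by (simp add: tree_ok_def)
      then show ?thesis using nth_xs(1)[of 0] n2 by (intro bexI[of _ "xs ! 0"]) auto
    next
      case False
      then show ?thesis using assms u unfolding tree_ok_def by (meson lessThan_iff not_le)
    qed
    then show "u \<in> (\<Union>x\<in>set xs. U x)" using u by (auto simp: U_def)
  qed
  then have "card {..<length \<tau>} \<le> card (\<Union>x\<in>set xs. U x)" using fin by (intro card_mono) auto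
  also have "\<dots> \<le> (\<Sum>x\<in>set xs. card (U x))" by (rule card_UN_le) simp
  finally have 1: "length \<tau> \<le> (\<Sum>x\<in>set xs. card (U x))" by simp
  have "card {c. c < length \<tau> * n \<and> leaf_ok \<tau> (c div n) (c mod n)} \<le> card (SIGMA x:set xs. V x)"
  proof (rule card_inj_on_le)
    let ?f = "\<lambda>c. (xs ! (c mod n), c div n)"
    show "inj_on ?f {c. c < length \<tau> * n \<and> leaf_ok \<tau> (c div n) (c mod n)}"
    proof (rule inj_onI)
      fix c c' assume "?f c = ?f c'"
      moreover have "c mod n < n" "c' mod n < n" using n2 by simp_all
      ultimately have "c mod n = c' mod n" "c div n = c' div n" using nth_xs(2) by auto
      then show "c = c'" by (metis div_mult_mod_eq)
    qed
    show "?f ` {c. c < length \<tau> * n \<and> leaf_ok \<tau> (c div n) (c mod n)} \<subseteq> (SIGMA x:set xs. V x)"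
      using mbn_div[of _ "length \<tau>"] nth_xs(1) by (auto simp: V_def leaf_ok_def)
  qed (simp add: fin)
  also have "\<dots> = (\<Sum>x\<in>set xs. card (V x))" by (rule card_SigmaI) (simp_all add: fin)
  finally have 2: "length (cands \<tau> (length \<tau> * n)) \<le> (\<Sum>x\<in>set xs. card (V x))" unfolding length_cands .
  show ?thesis unfolding c of_nat_sum[symmetric] of_nat_le_iff sum.distrib using 1 2 by linarith
qed

text \<open>The hashing bound needs keys below \<open>2 ^ (w - lgM)\<close>; indeed \<open>M\<close>
  times a key is at most of order \<open>S ^ 3\<close>.\<close>

lemma key_less:
  assumes "v < X" "j \<le> d" shows "v * dd + j < 2 ^ (w - lgM)"
proof -
  have "v * dd \<le> S * S" using assms X_le nd by (intro mult_le_mono) (auto simp: dd_def)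
  then have le: "v * dd + j < 2 * (S * S)" using assms basic_bounds by linarith
  have "M * (2 * (S * S)) \<le> (2 * S) * (2 * (S * S))" using M_le X_le by (intro mult_le_mono1) linarith
  then have "M * (2 * (S * S)) \<le> 4 * Z" by (simp add: Z_def)
  then have "M * (2 * (S * S)) < 2 ^ w" using basic_bounds by linarith
  moreover have "(2::nat) ^ w = M * 2 ^ (w - lgM)" using lgM_le by (simp add: M_def flip: power_add)
  ultimately have "2 * (S * S) < 2 ^ (w - lgM)" by simp
  then show ?thesis using le by linarith
qed

lemma qlab_le: "q \<subseteq> {1..d} \<Longrightarrow> i \<le> card q \<Longrightarrow> qlab q i \<le> d"
proof -
  assume q: "q \<subseteq> {1..d}" "i \<le> card q"
  then have "finite q" using finite_subset by blast
  then have "i \<noteq> 0 \<Longrightarrow> sorted_list_of_set q ! (i - 1) \<in> q"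
    using nth_mem[of "i - 1" "sorted_list_of_set q"] q by simp
  then show ?thesis using q by (auto simp: qlab_def)
qed

text \<open>Over the multipliers, a given record collides with a given lookup with probability at
  most \<open>2 / M\<close>. There are at most \<open>X \<le> M\<close> records and
  \<open>card q + 1\<close> lookups.\<close>

lemma coll_sum:
  assumes \<tau>: "tree_ok (X * d) \<tau>" "length \<tau> \<le> X" and v: "v < length \<tau>" and q: "q \<subseteq> {1..d}"
  shows "(\<Sum>a<2 ^ w. coll q a \<tau> v) \<le> 2 * (card q + 1) * 2 ^ w"
proof -
  define ky where "ky u = ekey (entries \<tau> ! u)" for u
  define kq where "kq i = v * dd + qlab q i" for i
  define U where "U = {L..<length (entries \<tau>)}"
  define h :: "nat \<Rightarrow> nat \<Rightarrow> nat \<Rightarrow> nat" where "h a i u = of_bool (ky u \<noteq> kq i \<and> hsh a (ky u) = hsh a (kq i))" for a i u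
  note eb = entries_bounds[OF \<tau>]
  have c: "coll q a \<tau> v = (\<Sum>i\<le>card q. \<Sum>u\<in>U. h a i u)" for a
    unfolding coll_def ky_def[symmetric] kq_def[symmetric] U_def[symmetric] h_def
    by (subst sum_of_bool_eq) (auto simp: U_def Int_def)
  have "(\<Sum>a<2 ^ w. h a i u) \<le> 2 * 2 ^ (w - lgM)" if "u \<in> U" "i \<in> {..card q}" for u i
  proof (cases "ky u = kq i")
    case False
    have "ky u < 2 ^ (w - lgM)" "kq i < 2 ^ (w - lgM)"
      unfolding ky_def kq_def ekey_def using eb(1)[of u] that qlab_le[OF q, of i] v \<tau>(2)
      by (auto intro!: key_less simp: U_def)
    then have "(\<Sum>a<2 ^ w. of_bool (a * ky u mod 2 ^ w div 2 ^ (w - lgM) = a * kq i mod 2 ^ w div 2 ^ (w - lgM))) \<le> (2 * 2 ^ (w - lgM) :: nat)"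
      using multiply_shift[OF lgM_le False] by blast
    then show ?thesis using False by (simp add: h_def hsh_def)
  qed (simp add: h_def)
  then have "(\<Sum>i\<le>card q. \<Sum>u\<in>U. \<Sum>a<2 ^ w. h a i u) \<le> (\<Sum>i\<le>card q. \<Sum>u\<in>U. 2 * 2 ^ (w - lgM))"
    by (intro sum_mono)
  moreover have "(\<Sum>i\<le>card q. \<Sum>u\<in>U. (2 * 2 ^ (w - lgM) :: nat)) = (card q + 1) * (card U * (2 * 2 ^ (w - lgM)))" by simp
  moreover have "(card q + 1) * (card U * (2 * 2 ^ (w - lgM))) \<le> (card q + 1) * (M * (2 * 2 ^ (w - lgM)))"
    using eb(3) X_le_M by (intro mult_le_mono) (auto simp: U_def)
  moreover have "M * 2 ^ (w - lgM) = (2::nat) ^ w" using lgM_le by (simp add: M_def flip: power_add)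
  then have "(card q + 1) * (M * (2 * 2 ^ (w - lgM))) = 2 * (card q + 1) * 2 ^ w" by (simp add: algebra_simps)
  moreover have "(\<Sum>a<2 ^ w. \<Sum>i\<le>card q. \<Sum>u\<in>U. h a i u) = (\<Sum>i\<le>card q. \<Sum>u\<in>U. \<Sum>a<2 ^ w. h a i u)"
  proof -
    have "(\<Sum>a<2 ^ w. \<Sum>i\<le>card q. \<Sum>u\<in>U. h a i u) = (\<Sum>i\<le>card q. \<Sum>a<2 ^ w. \<Sum>u\<in>U. h a i u)" by (rule sum.swap)
    moreover have "(\<Sum>a<2 ^ w. \<Sum>u\<in>U. h a i u) = (\<Sum>u\<in>U. \<Sum>a<2 ^ w. h a i u)" for i by (rule sum.swap)
    ultimately show ?thesis by simp
  qed
  ultimately show ?thesis unfolding c by linarith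
qed

end

context query_inst
begin

lemma lb_eq: "lb i = qlab q i" by (simp add: lb_def qlab_def sq_def)
lemma acc_eq: "acc x = accept q x" by (simp add: acc_def accept_def T_def)
lemma vis_eq: "vis = visited q \<tau>" by (simp add: vis_def visited_def)
lemma ekey_eq: "ekey (es ! u) = par u * dd + lab u" by (simp add: ekey_def par_def lab_def)

definition rej :: "nat \<Rightarrow> nat set" where
  "rej v = {u \<in> {length \<tau>..<N}. par u = v \<and> \<not> acc (pt u)}"

lemma lab_le: "u < N \<Longrightarrow> lab u \<le> d"
  using entries_bounds(1)[OF tau_ok, of u] by (simp add: lab_def es_def N_def)

lemma same_child:
  "card {u \<in> {L..<length \<tau>}. par u = v \<and> lab u = j} \<le> 1"
proof -
  have inj: "inj_on (\<lambda>u. (fst (\<tau> ! u), fst (hd (snd (\<tau> ! u))))) {L..<length \<tau>}"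
    using tau_ok by (simp add: tree_ok_def)
  have e: "fst (\<tau> ! u) = par u" "fst (hd (snd (\<tau> ! u))) = lab u" if "u \<in> {L..<length \<tau>}" for u
  proof -
    have u: "u < length \<tau>" "L \<le> u" using that by auto
    have "es ! u = node_ent (\<tau> ! u)" using u tau_ok(2) by (simp add: es_def entries_def ents_def nth_append)
    then show "fst (\<tau> ! u) = par u" by (simp add: par_def node_ent_def split: prod.splits list.splits)
    show "fst (hd (snd (\<tau> ! u))) = lab u" using entry_node(2)[OF u] by simp
  qed
  have "u = u'" if "u \<in> {L..<length \<tau>}" "u' \<in> {L..<length \<tau>}" "par u = par u'" "lab u = lab u'" for u u'
    by (rule inj_onD[OF inj _ that(1,2)]) (use that e in simp)
  then show ?thesis unfolding One_nat_def by (subst card_le_Suc0_iff_eq) auto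
qed

text \<open>One pop and \<open>T + 1\<close> lookups, each with at most one true child, give
  \<open>3 + 2 * T\<close>. All else in the buckets is a collision or a candidate, and candidates
  with the right key occur only at label 0.\<close>

lemma own_le: "own v \<le> 3 + 2 * T + coll q a \<tau> v + (1 + tm) * card (rej v)"
proof -
  define ec' where "ec' i u = (if mt v i u \<and> pay u \<noteq> 0 then (if acc (pt u) then 0 else 1 + rc u) else 1)" for i u
  define D where "D i = {u \<in> {L..<N}. par u * dd + lab u \<noteq> v * dd + lb i \<and> hu u = hb v i}" for i
  define E where "E i = {u \<in> {L..<length \<tau>}. par u = v \<and> lab u = lb i}" for i
  have ND: "D i \<subseteq> {L..<N}" "E i \<subseteq> {L..<N}" "rej v \<subseteq> {L..<N}" for i
    using N_le L_tau by (auto simp: D_def E_def rej_def)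
  \<comment> \<open>If the keys agree, then so do parent and label, both labels being below
    \<open>dd\<close>; the record is then the unique child or a candidate.\<close>
  have pw: "ec' i u \<le> of_bool (u \<in> D i) + of_bool (u \<in> E i) + (if i = 0 then (1 + tm) * of_bool (u \<in> rej v) else 0)"
    if u: "u \<in> pend v i N" and i: "i \<le> T" for i u
  proof -
    have uN: "L \<le> u" "u < N" "hu u = hb v i" using u by (auto simp: pend_def)
    show ?thesis
    proof (cases "par u * dd + lab u = v * dd + lb i")
      case False
      then have "\<not> mt v i u" by (auto simp: mt_def)
      moreover have "u \<in> D i" using False uN by (simp add: D_def)
      ultimately show ?thesis by (simp add: ec'_def)
    next
      case True
      have l: "lab u < dd" "lb i < dd" using lab_le[OF uN(2)] lb_le[OF i] by (auto simp: dd_def)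
      have "par u = (par u * dd + lab u) div dd" "lab u = (par u * dd + lab u) mod dd" using l by auto
      then have pl: "par u = v" "lab u = lb i" using l unfolding True by auto
      show ?thesis
      proof (cases "pay u = 0")
        case True
        then have "u \<in> E i" using entry(1)[OF uN(2)] uN pl by (simp add: E_def)
        then show ?thesis using True by (simp add: ec'_def)
      next
        case False
        then have "lab u = 0" using entry(3)[OF uN(2)] by simp
        then have i0: "i = 0" using lb_eq_0[OF i] pl by simp
        have m: "mt v i u" using mt_cand[OF uN(2) False] pl \<open>lab u = 0\<close> by simp
        have "length \<tau> \<le> u" using entry(1)[OF uN(2)] False by simp
        then have "\<not> acc (pt u) \<Longrightarrow> u \<in> rej v" using uN pl by (simp add: rej_def)
        then show ?thesis using m False i0 rc_le[of u] by (simp add: ec'_def)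
      qed
    qed
  qed
  have cb: "(\<Sum>u\<in>{L..<N}. of_bool (u \<in> W)) = card W" if "W \<subseteq> {L..<N}" for W
    using that by (simp add: sum_of_bool_eq Int_absorb1)
  have row: "(\<Sum>u\<in>pend v i N. ec' i u) \<le> card (D i) + 1 + (if i = 0 then (1 + tm) * card (rej v) else 0)" if i: "i \<le> T" for i
  proof -
    define g where "g u = of_bool (u \<in> D i) + of_bool (u \<in> E i) + (if i = 0 then (1 + tm) * of_bool (u \<in> rej v) else 0)" for u
    have "(\<Sum>u\<in>pend v i N. ec' i u) \<le> (\<Sum>u\<in>pend v i N. g u)" unfolding g_def by (rule sum_mono) (rule pw[OF _ i])
    moreover have "(\<Sum>u\<in>pend v i N. g u) \<le> (\<Sum>u\<in>{L..<N}. g u)" by (rule sum_mono2) (auto simp: pend_def)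
    moreover have "(\<Sum>u\<in>{L..<N}. if i = 0 then (1 + tm) * of_bool (u \<in> rej v) else 0) = (if i = 0 then (1 + tm) * card (rej v) else 0)"
      by (cases "i = 0") (simp_all only: if_True if_False simp_thms sum_distrib_left[symmetric] cb[OF ND(3)] sum.neutral_const)
    then have "(\<Sum>u\<in>{L..<N}. g u) = card (D i) + card (E i) + (if i = 0 then (1 + tm) * card (rej v) else 0)"
      unfolding g_def sum.distrib cb[OF ND(1)] cb[OF ND(2)] by linarith
    moreover have "card (E i) \<le> 1" unfolding E_def by (rule same_child)
    ultimately show ?thesis by linarith
  qed
  have s1: "(\<Sum>i\<le>T. 1 + (\<Sum>u\<in>pend v i N. ec' i u)) \<le> (\<Sum>i\<le>T. 2 + card (D i) + (if i = 0 then (1 + tm) * card (rej v) else 0))"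
  proof (rule sum_mono)
    fix i assume "i \<in> {..T}"
    then show "1 + (\<Sum>u\<in>pend v i N. ec' i u) \<le> 2 + card (D i) + (if i = 0 then (1 + tm) * card (rej v) else 0)"
      using row[of i] by simp
  qed
  have s2: "(\<Sum>i\<le>T. 2 + card (D i) + (if i = 0 then (1 + tm) * card (rej v) else 0)) =
      2 * (T + 1) + (\<Sum>i\<le>T. card (D i)) + (1 + tm) * card (rej v)"
    unfolding sum.distrib by simp
  have gen: "o' \<le> 3 + 2 * t + c + r" if "s \<le> 2 * (t + 1) + c' + r" "c' = c" "o' = 1 + s" for s t c c' r o' :: nat
    using that unfolding distrib_left by linarith
  have "(\<Sum>i\<le>T. card (D i)) = coll q a \<tau> v"
    unfolding coll_def D_def T_def[symmetric] es_def[symmetric] N_def[symmetric] ekey_eq hu_def hb_def lb_eq ..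
  moreover have "own v = 1 + (\<Sum>i\<le>T. 1 + (\<Sum>u\<in>pend v i N. ec' i u))" unfolding own_def ec'_def ..
  ultimately show ?thesis by (rule gen[OF ord_le_eq_trans[OF s1 s2]])
qed

lemma cand_inj:
  assumes "u \<in> {length \<tau>..<N}" "u' \<in> {length \<tau>..<N}" "par u = par u'" "pt u = pt u'"
  shows "u = u'"
proof -
  have e: "es ! u = cands \<tau> (length \<tau> * n) ! (u - length \<tau>)" "u - length \<tau> < length (cands \<tau> (length \<tau> * n))"
    if "u \<in> {length \<tau>..<N}" for u
    using that by (auto simp: es_def N_def entries_def ents_def nth_append)
  have dis: "distinct (cands \<tau> (length \<tau> * n))"
    unfolding cands_def distinct_map
  proof (intro conjI inj_onI)
    fix c c' assume "(c div n, 0::nat, 0::nat, adr (c mod n)) = (c' div n, 0, 0, adr (c' mod n))"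
    then have "c div n = c' div n" "c mod n = c' mod n" by (simp_all add: adr_eq)
    then show "c = c'" by (metis div_mult_mod_eq)
  qed simp
  obtain x where x: "x < n" "pay u = adr x" "lab u = 0" "rv u = 0" using entry_cand[of u] assms(1) by auto
  obtain x' where x': "x' < n" "pay u' = adr x'" "lab u' = 0" "rv u' = 0" using entry_cand[of u'] assms(2) by auto
  have "x = x'" using nth_xs(2)[OF x(1) x'(1)] pt_eq[OF x(2,1)] pt_eq[OF x'(2,1)] assms(4) by simp
  then have "es ! u = es ! u'" using x x' assms(3) by (simp add: par_def lab_def rv_def pay_def prod_eq_iff)
  then have "u - length \<tau> = u' - length \<tau>"
    using e[OF assms(1)] e[OF assms(2)] nth_eq_iff_index_eq[OF dis] by simp
  then show ?thesis using assms(1,2) unfolding atLeastLessThan_iff by linarith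
qed

text \<open>A rejected candidate at a visited leaf is determined by data point and leaf, and this
  leaf is accepted by both the query and the data point.\<close>

lemma rej_sum: "real (\<Sum>v\<in>vis. card (rej v)) \<le> (\<Sum>x\<in>rejects q. count (both q x) leaf \<tau>)"
proof -
  define V where "V x = {u. u < length \<tau> \<and> list_all (both q x) (snd (\<tau> ! u)) \<and> length (snd (\<tau> ! u)) = k}" for x
  have fin: "finite (rejects q)" "finite (V x)" "finite (rej v)" for x v by (simp_all add: rejects_def V_def rej_def)
  have "card (SIGMA v:vis. rej v) \<le> card (SIGMA x:rejects q. V x)"
  proof (rule card_inj_on_le)
    show "inj_on (\<lambda>(v, u). (pt u, v)) (SIGMA v:vis. rej v)"
    proof (rule inj_onI)
      fix p p' assume *: "p \<in> (SIGMA v:vis. rej v)" "p' \<in> (SIGMA v:vis. rej v)"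
        "(\<lambda>(v, u). (pt u, v)) p = (\<lambda>(v, u). (pt u, v)) p'"
      obtain v u v' u' where p: "p = (v, u)" "p' = (v', u')" by fastforce
      have u: "u \<in> {length \<tau>..<N}" "u' \<in> {length \<tau>..<N}" "par u = v" "par u' = v'" "pt u = pt u'" "v = v'"
        using * unfolding p by (auto simp: rej_def)
      then show "p = p'" using cand_inj[OF u(1,2)] p by simp
    qed
    show "(\<lambda>(v, u). (pt u, v)) ` (SIGMA v:vis. rej v) \<subseteq> (SIGMA x:rejects q. V x)"
    proof clarify
      fix v u assume v: "v \<in> vis" and u: "u \<in> rej v"
      then obtain x where x: "x < n" "pay u = adr x" "leaf_ok \<tau> v x" "v < length \<tau>"
        using entry_cand[of u] by (auto simp: rej_def)
      have "pt u = xs ! x" using pt_eq x by simp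
      then show "pt u \<in> rejects q \<and> v \<in> V (pt u)"
        using x v u nth_xs(1)[OF x(1)] by (auto simp: rejects_def V_def rej_def acc_eq leaf_ok_def list_all_both vis_def)
    qed
  qed (simp add: fin)
  moreover have "card (SIGMA v:vis. rej v) = (\<Sum>v\<in>vis. card (rej v))" by (rule card_SigmaI) (simp_all add: fin finite_vis)
  moreover have "card (SIGMA x:rejects q. V x) = (\<Sum>x\<in>rejects q. card (V x))" by (rule card_SigmaI) (simp_all add: fin)
  ultimately have "(\<Sum>v\<in>vis. card (rej v)) \<le> (\<Sum>x\<in>rejects q. card (V x))" by simp
  then have "real (\<Sum>v\<in>vis. card (rej v)) \<le> real (\<Sum>x\<in>rejects q. card (V x))" by (rule of_nat_mono)
  moreover have "count (both q x) leaf \<tau> = real (card (V x))" for x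
    unfolding leaf_def[abs_def] count_card V_def ..
  ultimately show ?thesis by simp
qed

text \<open>Separates the chance events: bounded cost, no overflow of the cap and a common leaf with
  an acceptable data point together imply success.\<close>

lemma work_okI:
  assumes "x \<in> set xs" "accept q x" "cost q a \<tau> \<le> F"
    "length \<tau> + length (cands \<tau> (length \<tau> * n)) \<le> X" "count (both q x) leaf \<tau> \<noteq> 0"
  shows work_ok
proof -
  have "{u. u < length \<tau> \<and> list_all (both q x) (snd (\<tau> ! u)) \<and> length (snd (\<tau> ! u)) = k} \<noteq> {}"
    using assms(5) unfolding leaf_def[abs_def] count_card by auto
  then obtain v where v: "v < length \<tau>" "list_all (both q x) (snd (\<tau> ! v))" "length (snd (\<tau> ! v)) = k" by blast
  obtain i where i: "i < n" "xs ! i = x" using assms(1) by (auto simp: in_set_conv_nth n_def)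
  have "\<exists>r<L. gd r"
    using gd_leaf[of v i] v i assms(2,4) by (auto simp: list_all_both vis_def acc_eq)
  moreover have "tm + 1 + (\<Sum>r<L. wt r) \<le> F"
  proof -
    have "(\<Sum>v\<in>vis. own v) \<le> (\<Sum>v\<in>vis. 3 + 2 * T + coll q a \<tau> v + (1 + tm) * card (rej v))"
      by (rule sum_mono) (rule own_le)
    also have "\<dots> = (3 + 2 * T) * card vis + (\<Sum>v\<in>vis. coll q a \<tau> v) + (1 + tm) * (\<Sum>v\<in>vis. card (rej v))"
      by (simp only: sum.distrib sum_constant sum_distrib_left) (simp add: algebra_simps)
    finally have "tm + 1 + (\<Sum>r<L. wt r) \<le>
        (1 + tm) + (3 + 2 * T) * card vis + (\<Sum>v\<in>vis. coll q a \<tau> v) + (1 + tm) * (\<Sum>v\<in>vis. card (rej v))"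
      using work_le by linarith
    then have "real (tm + 1 + (\<Sum>r<L. wt r)) \<le>
        real ((1 + tm) + (3 + 2 * T) * card vis + (\<Sum>v\<in>vis. coll q a \<tau> v) + (1 + tm) * (\<Sum>v\<in>vis. card (rej v)))"
      by (rule of_nat_mono)
    also have "\<dots> = real (1 + tm) + (3 + 2 * real T) * card vis + (\<Sum>v\<in>vis. real (coll q a \<tau> v)) +
        real (1 + tm) * real (\<Sum>v\<in>vis. card (rej v))" by (simp add: algebra_simps)
    also have "\<dots> \<le> real (1 + tm) + (3 + 2 * real T) * card vis + (\<Sum>v\<in>vis. real (coll q a \<tau> v)) +
        real (1 + tm) * (\<Sum>x\<in>rejects q. count (both q x) leaf \<tau>)"
      using mult_left_mono[OF rej_sum, of "real (1 + tm)"] by simp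
    also have "\<dots> = cost q a \<tau>" by (simp add: cost_def vis_eq T_def tm_def)
    finally show ?thesis using assms(3) by linarith
  qed
  ultimately show ?thesis by (simp add: work_ok_def)
qed

end

section \<open>Expected size and cost, and the failure probability\<close>

text \<open>The first word of the tape is the hash multiplier, independent of the words that grow
  the forest; so one may average over it for a fixed forest.\<close>

lemma ev_hd: "ev w (Suc m) (\<lambda>rs. h (hd rs) (tl rs)) = ev w m (\<lambda>rs. (\<Sum>a<2 ^ w. h a rs) / 2 ^ w)"
proof -
  have "ev w m (\<lambda>rs. (\<Sum>a<2 ^ w. h a rs) / 2 ^ w) = (1 / 2 ^ w) * ev w m (\<lambda>rs. \<Sum>a<2 ^ w. h a rs)"
    using ev_cmult[of w m "1 / 2 ^ w" "\<lambda>rs. \<Sum>a<2 ^ w. h a rs"] by simp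
  also have "ev w m (\<lambda>rs. \<Sum>a<2 ^ w. h a rs) = (\<Sum>a<2 ^ w. ev w m (h a))" by (rule ev_sum) simp
  finally show ?thesis by simp
qed

lemma ev_tl: "ev w (Suc m) (\<lambda>rs. h (tl rs)) = ev w m h"
  by simp

lemma finite_set_tape: "finite (set_pmf (tape w m))"
proof -
  have "set_pmf (tape w m) \<subseteq> {xs. set xs \<subseteq> {..<2 ^ w} \<and> length xs = m}" using set_tape by auto
  then show ?thesis using finite_lists_length_eq[of "{..<2 ^ w::nat}" m] finite_subset by blast
qed

context search_inst
begin

text \<open>The bound on the branching factor of a single set that includes all rounding;
  \<open>\<alpha> ^ k \<le> y\<close> links it to the integers known to the program.\<close>

definition \<alpha> :: real where "\<alpha> = A / S"

lemma S_pos': "0 < real S" using S_pos by simp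

lemma b1_pos: "0 < b1" using b by simp

lemma alpha_ge: "t \<le> d \<Longrightarrow> S / B + t / S \<le> \<alpha>" "1 / b1 \<le> \<alpha>" "1 \<le> \<alpha>"
proof -
  have *: "S / B + t / S \<le> \<alpha>" if "t \<le> d" for t
  proof -
    have "real (S * S) / B - 1 \<le> real (S * S div B)" by (rule nat_div_ge)
    then have "real (S * S) / B + real t \<le> A" using that by (simp add: A_def growth_def)
    then have "(real (S * S) / B + real t) / S \<le> A / S" by (intro divide_right_mono) auto
    then show ?thesis using S_pos' by (simp add: \<alpha>_def add_divide_distrib)
  qed
  then show "t \<le> d \<Longrightarrow> S / B + t / S \<le> \<alpha>" .
  have "1 / b1 \<le> S / B" using B_le B_pos b1_pos by (simp add: field_simps)
  then show "1 / b1 \<le> \<alpha>" using *[of 0] by simp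
  moreover have "1 \<le> 1 / b1" using b b1_pos by simp
  ultimately show "1 \<le> \<alpha>" by linarith
qed

text \<open>A geometric sum of ratio at least \<open>1 / b1\<close> is dominated by its last term,
  so counting all levels costs only the factor \<open>1 / (1 - b1)\<close>.\<close>

lemma alpha_sum: "(\<Sum>i\<le>j. \<alpha> ^ i) \<le> \<alpha> ^ j / (1 - b1)"
proof (induction j)
  case 0
  then show ?case using b b1_pos by (simp add: field_simps)
next
  case (Suc j)
  have "1 \<le> b1 * \<alpha>" using alpha_ge(2) b1_pos by (simp add: field_simps)
  then have "1 * \<alpha> ^ j \<le> b1 * \<alpha> * \<alpha> ^ j" using alpha_ge(3) by (intro mult_right_mono) auto
  then have "\<alpha> ^ j / (1 - b1) \<le> b1 * \<alpha> ^ Suc j / (1 - b1)" using b by (intro divide_right_mono) auto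
  moreover have "b1 * \<alpha> ^ Suc j / (1 - b1) + \<alpha> ^ Suc j = \<alpha> ^ Suc j / (1 - b1)" using b by (simp add: field_simps)
  ultimately show ?case using Suc by simp
qed

lemma alpha_y: "\<alpha> ^ k \<le> y" "1 \<le> \<alpha> ^ k" "0 \<le> \<alpha> ^ k"
  using yval_ge[OF S_pos, of A k] alpha_ge(3) by (auto simp: \<alpha>_def[symmetric] y_def)

lemma mu_zero: "(\<And>j r. \<not> f (j, r)) \<Longrightarrow> mu f = 0"
  by (simp add: mu_def pe_def)

lemma card_le_d: "x \<subseteq> {1..d} \<Longrightarrow> card x \<le> d"
  using card_mono[of "{1..d}" x] by simp

lemma mu_edge:
  assumes "x \<subseteq> {1..d}" shows "mu (edge_ok x) \<le> \<alpha>"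
proof (cases "card x = 0")
  case True
  then have "x = {}" using assms finite_subset by fastforce
  then have "mu (edge_ok x) = 0" by (intro mu_zero) (simp add: edge_ok_def)
  then show ?thesis using alpha_ge by simp
next
  case False
  have "mu (edge_ok x) \<le> card x * (S / (B * card x) + 1 / S)"
    using False by (intro mu_le assms) (auto simp: edge_ok_def)
  also have "\<dots> = S / B + card x / S" using False B_pos by (simp add: field_simps)
  also have "\<dots> \<le> \<alpha>" using alpha_ge(1)[OF card_le_d[OF assms]] .
  finally show ?thesis .
qed

text \<open>The joint edge test has the threshold of the larger weight \<open>t\<close>, so the mean
  is about the intersection over \<open>t\<close> times that of a single set; rejection bounds the
  former by \<open>G / S\<close>.\<close>

lemma mu_reject:
  assumes x: "x \<in> set xs" and q: "q \<subseteq> {1..d}" and na: "\<not> accept q x"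
  shows "mu (both q x) \<le> G / S * \<alpha>"
proof -
  define t where "t = max (card x) (card q)"
  have td: "t \<le> d" using card_le_d[OF q] card_le_d[OF xs_sub[OF x]] by (simp add: t_def)
  have fin: "finite x" "finite q" using q xs_sub[OF x] finite_subset by blast+
  show ?thesis
  proof (cases "x \<inter> q = {}")
    case True
    then have "mu (both q x) = 0" by (intro mu_zero) (auto simp: both_def edge_ok_def)
    then show ?thesis using alpha_ge by simp
  next
    case False
    then have cx: "0 < card x" using fin by (auto simp: card_gt_0_iff)
    then have t0: "0 < t" by (simp add: t_def)
    have le: "mu (both q x) \<le> card (x \<inter> q) * (S / (B * t) + 1 / S)"
      using t0 xs_sub[OF x] by (intro mu_le) (auto simp: both_def edge_ok_def t_def max_def)
    have "card (x \<inter> q) * S \<le> t * G" using na cx by (simp add: accept_def t_def)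
    then have "real (card (x \<inter> q)) * real S \<le> real t * real G" by (simp only: of_nat_mult[symmetric] of_nat_le_iff)
    then have c: "real (card (x \<inter> q)) \<le> G / S * t" using S_pos' by (simp add: field_simps)
    have "card (x \<inter> q) * (S / (B * t) + 1 / S) \<le> G / S * t * (S / (B * t) + 1 / S)"
      by (rule mult_right_mono[OF c]) simp
    moreover have "t * (S / (B * t) + 1 / S) = S / B + t / S" using t0 B_pos by (simp add: field_simps)
    then have "G / S * t * (S / (B * t) + 1 / S) = G / S * (S / B + t / S)" by (simp only: mult.assoc)
    moreover have "G / S * (S / B + t / S) \<le> G / S * \<alpha>" using alpha_ge(1)[OF td] by (intro mult_left_mono) auto
    ultimately show ?thesis using le by linarith
  qed
qed

text \<open>The roundings go the right way: \<open>G \<le> b1 * S\<close> for acceptance,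
  \<open>B \<le> b1 * S\<close> for the branching factor. If the edge probability is capped at 1,
  the mean is the size of the intersection, which is at least 1.\<close>

lemma good_pair:
  assumes x: "x \<in> set xs" and q: "q \<subseteq> {1..d}" and bb: "b1 \<le> braun_blanquet x q"
  shows "accept q x" "1 \<le> mu (both q x)"
proof -
  define t where "t = max (card x) (card q)"
  have fin: "finite x" "finite q" using q xs_sub[OF x] finite_subset by blast+
  have "braun_blanquet x q \<noteq> 0" using bb b1_pos by linarith
  then have ne: "card (x \<inter> q) \<noteq> 0" "0 < t" by (auto simp: braun_blanquet_def t_def)
  then have cx: "0 < card x" using fin card_mono[of x "x \<inter> q"] by auto
  have bt: "b1 * t \<le> card (x \<inter> q)" using bb ne by (simp add: braun_blanquet_def t_def[symmetric] field_simps)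
  have "real t * real G \<le> real t * (b1 * S)" using G_le by (intro mult_left_mono) auto
  also have "\<dots> = b1 * t * S" by simp
  also have "\<dots> \<le> real (card (x \<inter> q)) * real S" using bt by (intro mult_right_mono) auto
  finally have "real (t * G) \<le> real (card (x \<inter> q) * S)" by simp
  then have "t * G \<le> card (x \<inter> q) * S" by (simp only: of_nat_le_iff)
  then show "accept q x" using cx by (simp add: accept_def t_def)
  have ge: "card (x \<inter> q) * min 1 (S / (B * t)) \<le> mu (both q x)"
  proof (rule mu_ge)
    fix j r assume *: "j \<in> x \<inter> q" "r * B * t < S * S"
    have "r * B * card q \<le> r * B * t" "r * B * card x \<le> r * B * t" by (intro mult_le_mono2; simp add: t_def)+
    then have "r * B * card q < S * S" "r * B * card x < S * S" using *(2) by linarith+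
    then show "both q x (j, r)" using * by (auto simp: both_def edge_ok_def)
  qed (use ne xs_sub[OF x] in auto)
  have "1 \<le> card (x \<inter> q) * (S / (B * t))"
  proof -
    have "real B * real t \<le> b1 * S * t" using B_le by (intro mult_right_mono) auto
    also have "\<dots> = b1 * t * S" by simp
    also have "\<dots> \<le> real (card (x \<inter> q)) * real S" using bt by (intro mult_right_mono) auto
    finally show ?thesis using ne B_pos by (simp add: field_simps)
  qed
  then show "1 \<le> mu (both q x)" using ge ne by (cases "1 \<le> S / (B * t)") (auto simp: min_def)
qed

lemma accept_sound:
  assumes "accept q x" shows "b2 < braun_blanquet x q"
proof -
  define t where "t = max (card x) (card q)"
  have t: "0 < t" "t * G \<le> card (x \<inter> q) * S" using assms by (auto simp: accept_def t_def)
  have "real (t * G) \<le> real (card (x \<inter> q) * S)" using t(2) by (rule of_nat_mono)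
  moreover have "real t * (b2 * S) < real t * G" using G_gt t by (intro mult_strict_left_mono) auto
  ultimately have "(real t * b2) * real S < real (card (x \<inter> q)) * real S" by simp
  then have "real t * b2 < real (card (x \<inter> q))" using S_pos' mult_less_cancel_right_pos by blast
  then show ?thesis using t by (simp add: braun_blanquet_def t_def[symmetric] field_simps)
qed

lemma ev_visited:
  assumes "q \<subseteq> {1..d}"
  shows "ev w m (\<lambda>rs. count (edge_ok q) (\<lambda>l. 1) (grow rs 0 roots)) \<le> L * \<alpha> ^ k / (1 - b1)"
proof -
  have "ev w m (\<lambda>rs. count (edge_ok q) (\<lambda>l. 1) (grow rs 0 roots)) \<le> L * (\<Sum>i\<le>k. \<alpha> ^ i * 1)"
    using mu_edge[OF assms] by (intro expected_count dvd_S) auto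
  also have "\<dots> \<le> L * (\<alpha> ^ k / (1 - b1))" using alpha_sum[of k] by (intro mult_left_mono) auto
  finally show ?thesis by simp
qed

lemma ev_size:
  "ev w m (\<lambda>rs. \<Sum>x\<in>set xs. count (edge_ok x) (\<lambda>l. 1 + leaf l) (grow rs 0 roots)) \<le>
    n * (L * (\<alpha> ^ k / (1 - b1) + \<alpha> ^ k))"
proof -
  have "ev w m (\<lambda>rs. count (edge_ok x) (\<lambda>l. 1 + leaf l) (grow rs 0 roots)) \<le> L * (\<alpha> ^ k / (1 - b1) + \<alpha> ^ k)"
    if "x \<in> set xs" for x
  proof -
    have "ev w m (\<lambda>rs. count (edge_ok x) (\<lambda>l. 1 + leaf l) (grow rs 0 roots)) \<le> L * (\<Sum>i\<le>k. \<alpha> ^ i * (1 + leaf i))"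
      using mu_edge[OF xs_sub[OF that]] by (intro expected_count dvd_S) (auto simp: leaf_def)
    also have "(\<Sum>i\<le>k. \<alpha> ^ i * (1 + leaf i)) = (\<Sum>i\<le>k. \<alpha> ^ i) + (\<Sum>i\<le>k. if i = k then \<alpha> ^ k else 0)"
      unfolding sum.distrib[symmetric] by (rule sum.cong) (auto simp: leaf_def)
    also have "L * \<dots> \<le> L * (\<alpha> ^ k / (1 - b1) + \<alpha> ^ k)" using alpha_sum[of k] by (intro mult_left_mono) auto
    finally show ?thesis .
  qed
  then have "(\<Sum>x\<in>set xs. ev w m (\<lambda>rs. count (edge_ok x) (\<lambda>l. 1 + leaf l) (grow rs 0 roots))) \<le>
      of_nat (card (set xs)) * (L * (\<alpha> ^ k / (1 - b1) + \<alpha> ^ k))"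
    by (intro sum_bounded_above)
  then show ?thesis by (simp add: ev_sum card_xs)
qed

text \<open>Each rejected set shares at most \<open>(G / S) ^ k\<close> of the
  \<open>L * \<alpha> ^ k\<close> leaves on average, and the height was chosen such that
  \<open>n * (G / S) ^ k \<le> 2\<close>.\<close>

lemma ev_rejects:
  assumes q: "q \<subseteq> {1..d}"
  shows "ev w m (\<lambda>rs. \<Sum>x\<in>rejects q. count (both q x) leaf (grow rs 0 roots)) \<le> 2 * (L * \<alpha> ^ k)"
proof -
  define e where "e = L * ((G / S) ^ k * \<alpha> ^ k)"
  have e0: "0 \<le> e" using alpha_y by (simp add: e_def)
  have "ev w m (\<lambda>rs. count (both q x) leaf (grow rs 0 roots)) \<le> e" if "x \<in> rejects q" for x
  proof -
    have "mu (both q x) \<le> G / S * \<alpha>" using mu_reject[OF _ q] that by (simp add: rejects_def)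
    then have "ev w m (\<lambda>rs. count (both q x) leaf (grow rs 0 roots)) \<le> L * (\<Sum>i\<le>k. (G / S * \<alpha>) ^ i * leaf i)"
      by (intro expected_count dvd_S) (auto simp: leaf_def)
    also have "(\<Sum>i\<le>k. (G / S * \<alpha>) ^ i * leaf i) = (\<Sum>i\<le>k. if i = k then (G / S * \<alpha>) ^ k else 0)"
      by (rule sum.cong) (auto simp: leaf_def)
    finally show ?thesis by (simp add: e_def power_mult_distrib power_divide)
  qed
  then have "(\<Sum>x\<in>rejects q. ev w m (\<lambda>rs. count (both q x) leaf (grow rs 0 roots))) \<le> of_nat (card (rejects q)) * e"
    by (intro sum_bounded_above)
  also have "\<dots> \<le> n * e"
    using e0 card_mono[of "set xs" "rejects q"] by (intro mult_right_mono) (auto simp: rejects_def card_xs)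
  also have "n * e = ((G / S) ^ k * n) * (L * \<alpha> ^ k)" by (simp add: e_def)
  also have "\<dots> \<le> 2 * (L * \<alpha> ^ k)" using Gk alpha_y by (intro mult_right_mono) auto
  finally show ?thesis by (simp add: ev_sum rejects_def)
qed

text \<open>The first summand pays for visited nodes, lookups and collisions, the second for the
  verifications, of length \<open>O(card q / b2)\<close> each.\<close>

definition cW :: real where "cW = 5 / (1 - b1) + 3 / b2"

lemma average_cost:
  assumes q: "q \<subseteq> {1..d}" and rs: "length rs = X * d"
  defines "t1 \<equiv> real (1 + card q * S div G)"
  shows "(\<Sum>a<2 ^ w. cost q a (tree_of rs)) / 2 ^ w \<le>
    t1 + (5 + 4 * real (card q)) * count (edge_ok q) (\<lambda>l. 1) (grow rs 0 roots) +
    t1 * (\<Sum>x\<in>rejects q. count (both q x) leaf (grow rs 0 roots))"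
proof -
  define \<tau> where "\<tau> = tree_of rs"
  define V where "V = real (card (visited q \<tau>))"
  define R where "R = (\<Sum>x\<in>rejects q. count (both q x) leaf \<tau>)"
  note tau = tree_of[OF rs, folded \<tau>_def]
  have "count (edge_ok q) (\<lambda>l. 1) \<tau> = V"
    using count_card[of "edge_ok q" "\<lambda>l. True" \<tau>] by (simp add: V_def visited_def)
  then have V: "V \<le> count (edge_ok q) (\<lambda>l. 1) (grow rs 0 roots)"
    using count_take[of "\<lambda>l. 1" "edge_ok q" X "grow rs 0 roots"] tau(3) by simp
  have R: "R \<le> (\<Sum>x\<in>rejects q. count (both q x) leaf (grow rs 0 roots))"
    unfolding R_def tau(3) by (intro sum_mono count_take) (simp add: leaf_def)
  have "(\<Sum>a<2 ^ w. \<Sum>v\<in>visited q \<tau>. real (coll q a \<tau> v)) = (\<Sum>v\<in>visited q \<tau>. \<Sum>a<2 ^ w. real (coll q a \<tau> v))"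
    by (rule sum.swap)
  moreover have "(\<Sum>v\<in>visited q \<tau>. \<Sum>a<2 ^ w. real (coll q a \<tau> v)) \<le> real (card (visited q \<tau>)) * (2 * (real (card q) + 1) * 2 ^ w)"
  proof (rule sum_bounded_above)
    fix v assume "v \<in> visited q \<tau>"
    then have "real (\<Sum>a<2 ^ w. coll q a \<tau> v) \<le> real (2 * (card q + 1) * 2 ^ w)"
      using coll_sum[OF tau(1,2) _ q, of v] by (intro of_nat_mono) (simp add: visited_def)
    then show "(\<Sum>a<2 ^ w. real (coll q a \<tau> v)) \<le> 2 * (real (card q) + 1) * 2 ^ w" by (simp add: algebra_simps)
  qed
  ultimately have c: "(\<Sum>a<2 ^ w. \<Sum>v\<in>visited q \<tau>. real (coll q a \<tau> v)) \<le> (V * (2 * (real (card q) + 1))) * 2 ^ w"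
    by (simp add: V_def mult.assoc)
  have "(\<Sum>a<2 ^ w. cost q a \<tau>) = 2 ^ w * (t1 + (3 + 2 * real (card q)) * V + t1 * R) +
      (\<Sum>a<2 ^ w. \<Sum>v\<in>visited q \<tau>. real (coll q a \<tau> v))"
    unfolding cost_def t1_def[symmetric] V_def[symmetric] R_def[symmetric] sum.distrib by (simp add: algebra_simps)
  also have "\<dots> \<le> (t1 + (5 + 4 * real (card q)) * V + t1 * R) * 2 ^ w" using c by (simp add: algebra_simps)
  finally have "(\<Sum>a<2 ^ w. cost q a \<tau>) / 2 ^ w \<le> t1 + (5 + 4 * real (card q)) * V + t1 * R"
    by (simp add: divide_le_eq)
  moreover have "(5 + 4 * real (card q)) * V \<le> (5 + 4 * real (card q)) * count (edge_ok q) (\<lambda>l. 1) (grow rs 0 roots)"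
    using V by (intro mult_left_mono) auto
  moreover have "t1 * R \<le> t1 * (\<Sum>x\<in>rejects q. count (both q x) leaf (grow rs 0 roots))"
    using R by (intro mult_left_mono) (auto simp: t1_def)
  ultimately show ?thesis unfolding \<tau>_def[symmetric] by linarith
qed

lemma ev_cost:
  assumes q: "q \<subseteq> {1..d}"
  shows "ev w (Suc (X * d)) (\<lambda>rs. cost q (hd rs) (tree_of (tl rs))) \<le> cW * (L * \<alpha> ^ k * (card q + 1))"
proof -
  define t1 where "t1 = real (1 + card q * S div G)"
  define T1 where "T1 = real (card q) + 1"
  define U where "U = L * \<alpha> ^ k"
  have U: "1 \<le> U"
    using mult_mono[of 1 "real L" 1 "\<alpha> ^ k"] L1 alpha_y by (simp add: U_def)
  have T1: "1 \<le> T1" by (simp add: T1_def)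
  have "ev w (Suc (X * d)) (\<lambda>rs. cost q (hd rs) (tree_of (tl rs))) =
      ev w (X * d) (\<lambda>rs. (\<Sum>a<2 ^ w. cost q a (tree_of rs)) / 2 ^ w)"
    by (rule ev_hd[where h = "\<lambda>a rs. cost q a (tree_of rs)"])
  also have "\<dots> \<le> ev w (X * d) (\<lambda>rs. t1 + (5 + 4 * real (card q)) * count (edge_ok q) (\<lambda>l. 1) (grow rs 0 roots) +
      t1 * (\<Sum>x\<in>rejects q. count (both q x) leaf (grow rs 0 roots)))"
    unfolding t1_def by (rule ev_mono) (rule average_cost[OF q])
  also have "\<dots> = t1 + (5 + 4 * real (card q)) * ev w (X * d) (\<lambda>rs. count (edge_ok q) (\<lambda>l. 1) (grow rs 0 roots)) +
      t1 * ev w (X * d) (\<lambda>rs. \<Sum>x\<in>rejects q. count (both q x) leaf (grow rs 0 roots))"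
    by (simp only: ev_add ev_cmult ev_const)
  also have "\<dots> \<le> t1 + (5 + 4 * real (card q)) * (U / (1 - b1)) + t1 * (2 * U)"
    unfolding U_def using ev_visited[OF q, of "X * d"] ev_rejects[OF q, of "X * d"]
    by (intro add_mono mult_left_mono) (auto simp: t1_def)
  also have "\<dots> \<le> cW * (U * T1)"
  proof -
    have G: "b2 * S < G" "0 < G" using G_gt by (auto simp: G_def)
    have "real (card q * S div G) \<le> real (card q * S) / real G" by (rule of_nat_div_le_of_nat)
    also have "\<dots> \<le> card q / b2"
    proof -
      have "real (card q) * (b2 * S) \<le> real (card q) * real G" using G by (intro mult_left_mono) auto
      then show ?thesis using b G by (simp add: field_simps)
    qed
    finally have "t1 \<le> 1 + card q / b2" by (simp add: t1_def)
    moreover have "1 \<le> 1 / b2" using b by simp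
    ultimately have t1: "t1 \<le> T1 / b2" by (simp add: T1_def add_divide_distrib)
    have t0: "0 \<le> t1" by (simp add: t1_def)
    \<comment> \<open>The reserve is absorbed into the rejected verifications, as \<open>U\<close>
      is at least 1.\<close>
    have "t1 + t1 * (2 * U) \<le> t1 * (3 * U)" using mult_left_mono[OF U t0] by (simp add: algebra_simps)
    moreover have "t1 * (3 * U) \<le> T1 / b2 * (3 * U)" using t1 U by (intro mult_right_mono) auto
    moreover have "(5 + 4 * real (card q)) * (U / (1 - b1)) \<le> 5 * T1 * (U / (1 - b1))"
      using U b by (intro mult_right_mono) (auto simp: T1_def)
    moreover have "cW * (U * T1) = T1 / b2 * (3 * U) + 5 * T1 * (U / (1 - b1))"
      by (simp add: cW_def algebra_simps)
    ultimately show ?thesis by linarith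
  qed
  finally show ?thesis by (simp add: U_def T1_def add.commute)
qed

definition good :: "nat set \<Rightarrow> nat set \<Rightarrow> nat \<Rightarrow> nat list \<Rightarrow> bool" where
  "good q x a rs \<longleftrightarrow> cost q a (tree_of rs) \<le> real (Kf * L * y * (card q + 1)) \<and>
     length (tree_of rs) + length (cands (tree_of rs) (length (tree_of rs) * n)) \<le> X \<and>
     count (both q x) leaf (tree_of rs) \<noteq> 0"

text \<open>A union bound over the three causes: size (1/8) and cost (1/8) by Markov, using that
  \<open>K\<close> and \<open>Kf\<close> are at least \<open>8 * cW\<close>, and no common leaf with
  probability at most \<open>k / L \<le> 1 / 16\<close>.\<close>

lemma prob_bad:
  assumes x: "x \<in> set xs" and q: "q \<subseteq> {1..d}" and bb: "b1 \<le> braun_blanquet x q"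
    and K: "8 * cW \<le> K" "8 * cW \<le> Kf"
  shows "ev w (Suc (X * d)) (\<lambda>rs. of_bool (\<not> good q x (hd rs) (tl rs))) \<le> 1 / 2"
proof -
  define sizes where "sizes rs = (\<Sum>x\<in>set xs. count (edge_ok x) (\<lambda>l. 1 + leaf l) (grow rs 0 roots))" for rs
  define nol where "nol rs \<longleftrightarrow> length (grow rs 0 roots) \<le> X \<and> count (both q x) leaf (grow rs 0 roots) = 0" for rs
  define FF where "FF = real (Kf * L * y * (card q + 1))"
  define U where "U = L * \<alpha> ^ k"
  have z: "1 \<le> 1 / (1 - b1)" "5 / (1 - b1) = 5 * (1 / (1 - b1))" "1 \<le> 1 / b2" "3 / b2 = 3 * (1 / b2)"
    using b by (simp_all add: field_simps)
  have cW: "1 / (1 - b1) + 1 \<le> cW" "8 \<le> cW" using z unfolding cW_def by linarith+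
  have U: "1 \<le> U" "U \<le> L * y"
    using mult_mono[of 1 "real L" 1 "\<alpha> ^ k"] L1 alpha_y by (auto simp: U_def)
  have UK: "U * K * n \<le> X"
    using mult_right_mono[OF U(2), of "real K * n"] by (simp add: X_def mult_ac)
  have UF: "U * Kf * (card q + 1) \<le> FF"
  proof -
    have "U * (real Kf * (card q + 1)) \<le> real L * y * (real Kf * (card q + 1))" by (rule mult_right_mono) (use U(2) in simp_all)
    then show ?thesis unfolding FF_def by (simp only: of_nat_mult mult_ac)
  qed
  have pos: "0 < real X" "0 < FF"
  proof -
    show "0 < real X" using L_le_X L1 by simp
    have "0 < Kf" using K cW by (intro gr0I) auto
    then have "0 < Kf * L * y * (card q + 1)" using L1 y1 by simp
    then show "0 < FF" unfolding FF_def by (simp only: of_nat_0_less_iff)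
  qed
  \<comment> \<open>If the size estimate is below \<open>X\<close>, the uncapped forest is the
    stored one. So the absence of a leaf may be judged on \<open>grow\<close>, where the second
    moment bound applies.\<close>
  have pw: "of_bool (\<not> good q x (hd rs) (tl rs)) \<le> of_bool (real X \<le> sizes (tl rs)) + (of_bool (nol (tl rs)) +
      (of_bool (FF \<le> cost q (hd rs) (tree_of (tl rs))) :: real))" if len: "length rs = Suc (X * d)" for rs
  proof (cases "real X \<le> sizes (tl rs) \<or> FF \<le> cost q (hd rs) (tree_of (tl rs))")
    case False
    define g where "g = grow (tl rs) 0 roots"
    have len': "length (tl rs) = X * d" using len by simp
    have "tree_ok (0 + length (tl rs)) g" unfolding g_def by (rule tree_ok_grow[OF tree_ok_roots])
    from size_le[OF this] have sz: "length g + length (cands g (length g * n)) < X"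
      using False by (simp add: sizes_def g_def[symmetric])
    then have tr: "tree_of (tl rs) = g" using tree_of(3)[OF len'] by (simp add: g_def)
    have c: "cost q (hd rs) g \<le> real (Kf * L * y * (card q + 1))"
      using False unfolding tr FF_def[symmetric] by linarith
    have "length g \<le> X" "length g + length (cands g (length g * n)) \<le> X" using sz by linarith+
    then have "nol (tl rs) \<or> good q x (hd rs) (tl rs)"
      unfolding good_def nol_def tr g_def[symmetric] using c by blast
    then show ?thesis by (elim disjE) simp_all
  qed auto
  have "ev w (Suc (X * d)) (\<lambda>rs. of_bool (\<not> good q x (hd rs) (tl rs))) \<le>
      ev w (Suc (X * d)) (\<lambda>rs. of_bool (real X \<le> sizes (tl rs)) + (of_bool (nol (tl rs)) +
      of_bool (FF \<le> cost q (hd rs) (tree_of (tl rs)))))"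
    by (rule ev_mono) (rule pw)
  also have "\<dots> = ev w (Suc (X * d)) (\<lambda>rs. of_bool (real X \<le> sizes (tl rs))) +
      (ev w (Suc (X * d)) (\<lambda>rs. of_bool (nol (tl rs))) +
      ev w (Suc (X * d)) (\<lambda>rs. of_bool (FF \<le> cost q (hd rs) (tree_of (tl rs)))))"
    by (simp only: ev_add)
  also have "\<dots> = ev w (X * d) (\<lambda>rs. of_bool (real X \<le> sizes rs)) + (ev w (X * d) (\<lambda>rs. of_bool (nol rs)) +
      ev w (Suc (X * d)) (\<lambda>rs. of_bool (FF \<le> cost q (hd rs) (tree_of (tl rs)))))"
    by (simp only: ev_tl[of w "X * d" "\<lambda>rs. of_bool (real X \<le> sizes rs)"] ev_tl[of w "X * d" "\<lambda>rs. of_bool (nol rs)"])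
  finally have main: "ev w (Suc (X * d)) (\<lambda>rs. of_bool (\<not> good q x (hd rs) (tl rs))) \<le> \<dots>" .
  have "ev w (X * d) (\<lambda>rs. of_bool (real X \<le> sizes rs)) \<le> ev w (X * d) sizes / X"
    by (rule markov) (use pos in \<open>auto simp: sizes_def leaf_def intro!: sum_nonneg count_nonneg\<close>)
  also have "\<dots> \<le> 1 / 8"
  proof -
    have "ev w (X * d) sizes \<le> n * (L * (\<alpha> ^ k / (1 - b1) + \<alpha> ^ k))" unfolding sizes_def by (rule ev_size)
    also have "\<dots> = (1 / (1 - b1) + 1) * (U * n)" by (simp add: U_def algebra_simps)
    also have "\<dots> \<le> (K / 8) * (U * n)" using K cW U by (intro mult_right_mono) auto
    also have "\<dots> \<le> X / 8" using UK by (simp add: mult_ac)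
    finally show ?thesis using pos by (simp add: divide_le_eq)
  qed
  finally have 1: "ev w (X * d) (\<lambda>rs. of_bool (real X \<le> sizes rs)) \<le> 1 / 8" .
  have "ev w (X * d) (\<lambda>rs. of_bool (nol rs)) \<le> k / L"
    unfolding nol_def leaf_def[abs_def]
    using good_pair(2)[OF x q bb] L1 by (intro prob_no_leaf[OF dvd_S x]) (auto simp: both_def)
  also have "\<dots> \<le> 1 / 16" by (simp add: L_def field_simps)
  finally have 2: "ev w (X * d) (\<lambda>rs. of_bool (nol rs)) \<le> 1 / 16" .
  have "ev w (Suc (X * d)) (\<lambda>rs. of_bool (FF \<le> cost q (hd rs) (tree_of (tl rs)))) \<le>
      ev w (Suc (X * d)) (\<lambda>rs. cost q (hd rs) (tree_of (tl rs))) / FF"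
    by (rule markov) (auto simp: cost_def leaf_def pos intro!: add_nonneg_nonneg mult_nonneg_nonneg sum_nonneg count_nonneg)
  also have "\<dots> \<le> 1 / 8"
  proof -
    have "ev w (Suc (X * d)) (\<lambda>rs. cost q (hd rs) (tree_of (tl rs))) \<le> cW * (U * (card q + 1))"
      unfolding U_def by (rule ev_cost[OF q])
    also have "\<dots> \<le> (Kf / 8) * (U * (card q + 1))" using K U by (intro mult_right_mono) auto
    also have "\<dots> \<le> FF / 8"
    proof -
      have gen: "r / 8 * (u * v) = u * r * v / 8" for r u v :: real by (simp add: mult_ac)
      show ?thesis unfolding gen by (rule divide_right_mono[OF UF]) simp
    qed
    finally show ?thesis unfolding pos_divide_le_eq[OF pos(2)] by linarith
  qed
  finally have 3: "ev w (Suc (X * d)) (\<lambda>rs. of_bool (FF \<le> cost q (hd rs) (tree_of (tl rs)))) \<le> 1 / 8" .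
  show ?thesis using main 1 2 3 by linarith
qed

end

section \<open>The probability statement on the machine\<close>

context query_inst
begin

lemma query_run:
  assumes data: "data a rs (mem c)" and sz: "ds_size c = sz"
  shows "\<exists>t c'. t \<le> 70 + 8 * T + 5 * L + 50 * F \<and> texec w (query_start c q query) [] t c' \<and> halted c' \<and>
    (\<forall>e<ds_size c. mem c' e = mem c e) \<and>
    (\<forall>x\<in>set xs. good q x a rs \<longrightarrow> b1 \<le> braun_blanquet x q \<longrightarrow> correct_answer b2 (set xs) q c')"
proof -
  obtain t R' M' rs' where t: "texec w (cf query ((\<lambda>_. 0)(0 := sz)) (qm0 (mem c))) [] t (cf [] R' M')"
    and post: "t \<le> 70 + 8 * T + 5 * L + 50 * F" "\<forall>e<sz. M' e = mem c e"
      "work_ok \<longrightarrow> (\<exists>x<n. R' 0 = adr x \<and> acc (xs ! x))"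
    using wp_texec[OF query[OF data]] by auto
  have start: "query_start c q query = cf query ((\<lambda>_. 0)(0 := sz)) (qm0 (mem c))"
    by (simp add: query_start_def sz qm0_def)
  have "correct_answer b2 (set xs) q (cf [] R' M')" if x: "x \<in> set xs" "good q x a rs" "b1 \<le> braun_blanquet x q" for x
  proof -
    have work_ok
      using x(2) good_pair(1)[OF x(1) q_sub x(3)] x(1) by (intro work_okI[of x]) (simp_all add: good_def \<tau>_def F_def T_def)
    then obtain i where i: "i < n" "R' 0 = adr i" "acc (xs ! i)" using post(3) by blast
    have low: "adr i + e < sz" if "e \<le> card (xs ! i)" for e
      using adr_less[OF i(1) that] E0_less(2,3,5) by linarith
    have "map M' [adr i..<adr i + length (encode (xs ! i))] = encode (xs ! i)"
    proof (rule nth_equalityI)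
      fix e assume "e < length (map M' [adr i..<adr i + length (encode (xs ! i))])"
      then have e: "e \<le> card (xs ! i)" using length_encode[OF i(1)] by simp
      have "M' (adr i + e) = encode (xs ! i) ! e"
      proof (cases e)
        case 0
        then show ?thesis using post(2) low[of 0] m_reads(9)[OF data i(1)] by (simp add: encode_def)
      next
        case (Suc e')
        then show ?thesis using post(2) low[OF e] m_reads(10)[OF data i(1), of e'] e by (simp add: encode_def)
      qed
      then show "map M' [adr i..<adr i + length (encode (xs ! i))] ! e = encode (xs ! i) ! e"
        by (subst nth_map_upt) (use e length_encode[OF i(1)] in simp_all)
    qed simp
    moreover have "b2 < braun_blanquet (xs ! i) q" using accept_sound i(3) by (simp add: acc_eq)
    ultimately show ?thesis
      unfolding correct_answer_def stored_at_def using nth_xs(1)[OF i(1)] i(2) by auto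
  qed
  then show ?thesis using t post(1,2) start
    by (intro exI[of _ t] exI[of _ "cf [] R' M'"]) (auto simp: sz halted_def)
qed

end

context search_inst
begin

lemma query_run':
  assumes "q \<subseteq> {1..d}" "length rs = X * d" "data a rs (mem c)" "ds_size c = sz"
  shows "\<exists>t c'. t \<le> 70 + 8 * card q + 5 * L + 50 * (Kf * L * y * (card q + 1)) \<and>
    texec w (query_start c q query) [] t c' \<and> halted c' \<and> (\<forall>e<ds_size c. mem c' e = mem c e) \<and>
    (\<forall>x\<in>set xs. good q x a rs \<longrightarrow> b1 \<le> braun_blanquet x q \<longrightarrow> correct_answer b2 (set xs) q c')"
proof -
  interpret query_inst b1 b2 K Kf w d xs n S B G k A y L X q a rs
    using assms unfolding X_def L_def y_def A_def k_def G_def B_def S_def n_def by unfold_locales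
  show ?thesis
    using query_run[OF assms(3,4)]
    unfolding T_def F_def X_def L_def y_def A_def k_def G_def B_def S_def n_def by (assumption | simp)
qed

lemma preprocessing_run:
  assumes "ars \<in> set_pmf (tape w (Suc (X * d)))"
  shows "\<exists>t c. texec w (preprocess_start w b1 b2 d xs (preprocessing K Kf)) ars t c \<and> halted c \<and> ds_size c = sz \<and>
    data (hd ars) (tl ars) (mem c)"
proof -
  obtain a rs where ars: "ars = a # rs" "length rs = X * d" using assms by (cases ars) (auto simp: set_tape)
  obtain t R' M' where "texec w (cf (preprocessing K Kf) (\<lambda>_. 0) mem0) ars t (cf [] R' M')" "R' 0 = sz" "data a rs M'"
    using wp_texec[OF preprocessing[OF ars(2), of a]] ars(1) by auto
  then show ?thesis unfolding start_mem using ars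
    by (intro exI[of _ t] exI[of _ "cf [] R' M'"]) (auto simp: halted_def ds_size_def)
qed

text \<open>For a fixed tape both programs are deterministic, so the two-stage distribution is an
  image of the uniform tape and the success probability is an average that \<open>prob_bad\<close>
  bounds.\<close>

theorem solves:
  fixes time_bound :: "nat set \<Rightarrow> real"
  assumes K: "8 * cW \<le> K" "8 * cW \<le> Kf" and size: "real sz \<le> size_bound"
    and time: "\<And>q. q \<subseteq> {1..d} \<Longrightarrow> real (70 + 8 * card q + 5 * L + 50 * (Kf * L * y * (card q + 1))) \<le> time_bound q"
  shows "\<exists>T. let D = run w T (preprocess_start w b1 b2 d xs (preprocessing K Kf)) in
          (\<forall>c\<in>set_pmf D. halted c \<and> real (ds_size c) \<le> size_bound) \<and>
          (\<forall>q. q \<subseteq> {1..d} \<longrightarrow>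
            (let answer = (\<lambda>c. run w (nat \<lfloor>time_bound q\<rfloor>) (query_start c q query)) in
              (\<forall>c\<in>set_pmf D. \<forall>c'\<in>set_pmf (answer c).
                 halted c' \<and> (\<forall>a<ds_size c. mem c' a = mem c a)) \<and>
              ((\<exists>x\<in>set xs. braun_blanquet x q \<ge> b1) \<longrightarrow>
                 measure_pmf.prob (bind_pmf D answer) {c'. correct_answer b2 (set xs) q c'} \<ge> 1 / 2)))"
proof -
  define tp where "tp = tape w (Suc (X * d))"
  have "\<forall>ars\<in>set_pmf tp. \<exists>p. texec w (preprocess_start w b1 b2 d xs (preprocessing K Kf)) ars (fst p) (snd p) \<and>
      halted (snd p) \<and> ds_size (snd p) = sz \<and> data (hd (ars :: nat list)) (tl ars) (mem (snd p))"
    using preprocessing_run unfolding tp_def by fastforce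
  then obtain p where p: "\<And>ars. ars \<in> set_pmf tp \<Longrightarrow> texec w (preprocess_start w b1 b2 d xs (preprocessing K Kf)) ars (fst (p ars)) (snd (p ars)) \<and>
      halted (snd (p ars)) \<and> ds_size (snd (p ars)) = sz \<and> data (hd (ars :: nat list)) (tl ars) (mem (snd (p ars)))"
    by metis
  define g where "g ars = snd (p ars)" for ars
  \<comment> \<open>There are finitely many tapes, so the longest preprocessing run bounds all of
    them.\<close>
  define T where "T = Max ((\<lambda>ars. fst (p ars)) ` set_pmf tp)"
  have "fst (p ars) \<le> T" if "ars \<in> set_pmf tp" for ars
    unfolding T_def using that finite_set_tape by (intro Max_ge) (auto simp: tp_def)
  then have D: "run w T (preprocess_start w b1 b2 d xs (preprocessing K Kf)) = map_pmf g tp"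
    unfolding tp_def by (intro run_tape) (use p in \<open>auto simp: tp_def g_def\<close>)
  show ?thesis
    unfolding Let_def
  proof (intro exI[of _ T] conjI ballI allI impI; (unfold D)?)
    fix c assume "c \<in> set_pmf (map_pmf g tp)"
    then obtain ars where "ars \<in> set_pmf tp" "c = g ars" by auto
    then show "halted c" "real (ds_size c) \<le> size_bound" using p size by (auto simp: g_def)
  next
    fix q assume q: "q \<subseteq> {1..d}"
    define answer where "answer c = run w (nat \<lfloor>time_bound q\<rfloor>) (query_start c q query)" for c
    have "\<forall>ars\<in>set_pmf tp. \<exists>c'. answer (g ars) = return_pmf c' \<and> halted c' \<and> (\<forall>e<ds_size (g ars). mem c' e = mem (g ars) e) \<and>
       (\<forall>x\<in>set xs. good q x (hd (ars :: nat list)) (tl ars) \<longrightarrow> b1 \<le> braun_blanquet x q \<longrightarrow> correct_answer b2 (set xs) q c')"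
    proof
      fix ars assume ars: "ars \<in> set_pmf tp"
      have len: "length (tl ars) = X * d" using ars by (simp add: tp_def set_tape)
      have "data (hd (ars :: nat list)) (tl ars) (mem (g ars))" "ds_size (g ars) = sz" using p[OF ars] by (auto simp: g_def)
      from query_run'[OF q len this] obtain t c' where
        t: "t \<le> 70 + 8 * card q + 5 * L + 50 * (Kf * L * y * (card q + 1))" "texec w (query_start (g ars) q query) [] t c'"
        and c': "halted c'" "\<forall>e<ds_size (g ars). mem c' e = mem (g ars) e"
        "\<forall>x\<in>set xs. good q x (hd (ars :: nat list)) (tl ars) \<longrightarrow> b1 \<le> braun_blanquet x q \<longrightarrow> correct_answer b2 (set xs) q c'"
        by blast
      have "real t \<le> time_bound q" using of_nat_mono[OF t(1)] time[OF q] by (rule order_trans)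
      then have "t \<le> nat \<lfloor>time_bound q\<rfloor>" by (rule le_nat_floor)
      from run_det[OF t(2) this] show "\<exists>c'. answer (g ars) = return_pmf c' \<and> halted c' \<and>
         (\<forall>e<ds_size (g ars). mem c' e = mem (g ars) e) \<and>
         (\<forall>x\<in>set xs. good q x (hd (ars :: nat list)) (tl ars) \<longrightarrow> b1 \<le> braun_blanquet x q \<longrightarrow> correct_answer b2 (set xs) q c')"
        unfolding answer_def using c' by blast
    qed
    then obtain h where h: "\<And>ars. ars \<in> set_pmf tp \<Longrightarrow> answer (g ars) = return_pmf (h ars) \<and> halted (h ars) \<and>
       (\<forall>e<ds_size (g ars). mem (h ars) e = mem (g ars) e) \<and>
       (\<forall>x\<in>set xs. good q x (hd (ars :: nat list)) (tl ars) \<longrightarrow> b1 \<le> braun_blanquet x q \<longrightarrow> correct_answer b2 (set xs) q (h ars))"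
      by metis
    {
      fix c c' assume "c \<in> set_pmf (map_pmf g tp)" "c' \<in> set_pmf (run w (nat \<lfloor>time_bound q\<rfloor>) (query_start c q query))"
      then obtain ars where "ars \<in> set_pmf tp" "c = g ars" "c' = h ars"
        using h unfolding answer_def[symmetric] by auto
      then show "halted c'" and "\<And>e. e < ds_size c \<Longrightarrow> mem c' e = mem c e" using h by auto
    }
    assume "\<exists>x\<in>set xs. b1 \<le> braun_blanquet x q"
    then obtain x where x: "x \<in> set xs" "b1 \<le> braun_blanquet x q" by blast
    \<comment> \<open>Queries draw no random words: the answer is a function of the preprocessing
      tape.\<close>
    have "bind_pmf (map_pmf g tp) answer = map_pmf h tp"
      unfolding bind_map_pmf map_pmf_def[of h] by (rule bind_pmf_cong) (use h in auto)
    then have "measure_pmf.prob (bind_pmf (map_pmf g tp) answer) {c'. correct_answer b2 (set xs) q c'} =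
        measure_pmf.prob tp {ars. correct_answer b2 (set xs) q (h ars)}"
      by (simp add: vimage_def)
    also have "\<dots> = ev w (Suc (X * d)) (\<lambda>ars. of_bool (correct_answer b2 (set xs) q (h ars)))"
      unfolding tp_def by (rule prob_tape)
    also have "\<dots> \<ge> ev w (Suc (X * d)) (\<lambda>ars. 1 + (- 1) * of_bool (\<not> good q x (hd (ars :: nat list)) (tl ars)))"
    proof (rule ev_mono)
      fix ars :: "nat list" assume "length ars = Suc (X * d)" "set ars \<subseteq> {..<2 ^ w}"
      then have "ars \<in> set_pmf tp" by (auto simp: tp_def set_tape)
      then show "1 + (- 1) * of_bool (\<not> good q x (hd (ars :: nat list)) (tl ars)) \<le> (of_bool (correct_answer b2 (set xs) q (h ars)) :: real)"
        using h[of ars] x by auto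
    qed
    also have "ev w (Suc (X * d)) (\<lambda>ars. 1 + (- 1) * of_bool (\<not> good q x (hd (ars :: nat list)) (tl ars))) =
        1 + (- 1) * ev w (Suc (X * d)) (\<lambda>ars. of_bool (\<not> good q x (hd (ars :: nat list)) (tl ars)))"
      by (simp only: ev_add ev_const ev_cmult)
    finally have "1 / 2 \<le> measure_pmf.prob (bind_pmf (map_pmf g tp) answer) {c'. correct_answer b2 (set xs) q c'}"
      using prob_bad[OF x(1) q x(2) K] by linarith
    then show "1 / 2 \<le> measure_pmf.prob (bind_pmf (map_pmf g tp) (\<lambda>c. run w (nat \<lfloor>time_bound q\<rfloor>) (query_start c q query)))
        {c'. correct_answer b2 (set xs) q c'}" unfolding answer_def[abs_def] .
  qed
qed

text \<open>The heads take \<open>M \<le> 2 * X\<close> cells and the records \<open>5 * X\<close>;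
  the input accounts for the weights of the data.\<close>

lemma size_bound: "real sz \<le> 20 + n + (\<Sum>x\<in>set xs. real (card x)) + 7 * real X"
proof -
  have "(\<Sum>j<n. card (xs ! j)) = (\<Sum>x\<in>set xs. card x)"
    using bij_betw_nth[OF distinct_xs refl refl] by (intro sum.reindex_bij_betw) (simp add: n_def)
  then have "Iv = 4 + n + (\<Sum>x\<in>set xs. card x)" by (simp add: Iv_def adr_def sum_Suc)
  then have "sz \<le> 20 + n + (\<Sum>x\<in>set xs. card x) + 7 * X" using M_le by (simp add: sz_def E0_def H0_def)
  then have "real sz \<le> real (20 + n + (\<Sum>x\<in>set xs. card x) + 7 * X)" by (rule of_nat_mono)
  then show ?thesis by simp
qed

end

section \<open>Choice of constants for the bounds in \<open>n\<close> and the query weight\<close>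

theorem theorem1p1:
  fixes b1 b2 \<rho> :: real
  assumes "0 < b2" and "b2 < b1" and "b1 < 1"
    and "\<rho> = ln (1 / b1) / ln (1 / b2)"
  shows "\<exists>c0>0. \<forall>c1. \<exists>pre qry. \<exists>C>0. \<forall>(w::nat) (d::nat) (P::nat set set) (n::nat).
    P \<subseteq> Pow {1..d} \<and> card P = n \<and> n \<ge> 2 \<and>
    c0 * log 2 (real (max n d)) \<le> real w \<and> real w \<le> c1 * log 2 (real n) \<longrightarrow>
    solves_similarity_search b1 b2 w d P pre qry
      (C * (real n powr (1 + \<rho>) * log 2 (real n) + (\<Sum>x\<in>P. real (card x))))
      (\<lambda>q. C * (real (max 1 (card q)) * real n powr \<rho> * log 2 (real n)))"
proof -
  \<comment> \<open>At least \<open>8 * cW\<close>, as both Markov bounds require; it depends on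
    \<open>b1\<close> and \<open>b2\<close> only, so it can be built into the program, where it
    serves as \<open>K\<close> and as \<open>Kf\<close>.\<close>
  define K where "K = nat \<lceil>8 * (5 / (1 - b1) + 3 / b2)\<rceil> + 1"
  have K: "8 * (5 / (1 - b1) + 3 / b2) \<le> K" "1 \<le> K" unfolding K_def by linarith+
  have "0 < ln (1 / b1)" "0 < ln (1 / b2)" using assms(1-3) by (simp_all add: ln_gt_zero)
  then have \<rho>: "0 < \<rho>" unfolding assms(4) by (rule divide_pos_pos)
  obtain c0 C where c0: "0 < c0" and C: "0 < C" and par: "\<And>w n d. 2 \<le> n \<and> c0 * log 2 (real (max n d)) \<le> real w \<Longrightarrow>
    (let S = scale w; B = fixpt b1 w; G = fixpt b2 w + 1; k = levels S G n; A = growth S B d; y = yval S A k in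
      256 \<le> w \<and> 0 < B \<and> real B \<le> b1 * S \<and> real G \<le> b1 * S \<and> G < S \<and> b2 * S < G \<and>
      n + d + 2 \<le> S \<and> (G / S) ^ k * n \<le> 2 \<and> real y \<le> C * n powr \<rho> \<and> k + 1 \<le> C * log 2 n \<and>
      K * n * (16 * (k + 1)) * y \<le> S)"
    using parameters[OF assms, of K] by blast
  \<comment> \<open>Large enough for \<open>21 + 112 * K * (C * C)\<close> in the size bound and
    \<open>78 + (80 + 1600 * K) * (C * C)\<close> in the time bound.\<close>
  define C' where "C' = 100 + (1800 * real K + 100) * (C * C)"
  define kc where "kc = real K * (C * C)"
  have kc: "0 \<le> kc" "0 \<le> C * C" "C' = 100 + 1800 * kc + 100 * (C * C)" "112 * real K * (C * C) = 112 * kc"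
    "(80 + 1600 * real K) * (C * C) = 80 * (C * C) + 1600 * kc"
    using C by (simp_all add: kc_def C'_def algebra_simps)
  have C': "0 < C'" "1 \<le> C'" using kc by linarith+
  show ?thesis
  proof (rule exI[of _ c0], rule conjI[OF c0], rule allI, rule exI[of _ "preprocessing K K"], rule exI[of _ query],
      rule exI[of _ C'], rule conjI[OF C'(1)], intro allI impI)
    fix c1 :: real and w d :: nat and P :: "nat set set" and n :: nat
    assume asm: "P \<subseteq> Pow {1..d} \<and> card P = n \<and> n \<ge> 2 \<and>
      c0 * log 2 (real (max n d)) \<le> real w \<and> real w \<le> c1 * log 2 (real n)"
    define lg where "lg = log 2 (real n)"
    define nr where "nr = real n powr \<rho>"
    have n2: "2 \<le> real n" using asm by simp
    have lg: "1 \<le> lg" using n2 by (simp add: lg_def le_log_iff)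
    have nr: "1 \<le> nr" using n2 \<rho> by (simp add: nr_def ge_one_powr_ge_zero)
    have nr1: "real n powr (1 + \<rho>) = n * nr" using n2 by (simp add: nr_def powr_add)
    define V where "V = nr * lg"
    have V: "1 \<le> V" using mult_mono[OF nr lg] nr by (simp add: V_def)
    show "solves_similarity_search b1 b2 w d P (preprocessing K K) query
      (C' * (real n powr (1 + \<rho>) * log 2 (real n) + (\<Sum>x\<in>P. real (card x))))
      (\<lambda>q. C' * (real (max 1 (card q)) * real n powr \<rho> * log 2 (real n)))"
      unfolding solves_similarity_search_def
    proof (intro allI impI)
      fix xs assume xs: "distinct xs \<and> set xs = P"
      have len: "length xs = n" using xs asm distinct_card by metis
      define S where "S = scale w"
      define B where "B = fixpt b1 w"
      define G where "G = fixpt b2 w + 1"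
      define k where "k = levels S G (length xs)"
      define A where "A = growth S B d"
      define y where "y = yval S A k"
      note defs = S_def B_def G_def k_def A_def y_def
      have ps: "256 \<le> w \<and> 0 < B \<and> real B \<le> b1 * S \<and> real G \<le> b1 * S \<and> G < S \<and> b2 * S < G \<and>
        length xs + d + 2 \<le> S \<and> (G / S) ^ k * length xs \<le> 2 \<and> real y \<le> C * n powr \<rho> \<and> k + 1 \<le> C * log 2 n \<and>
        K * length xs * (16 * (k + 1)) * y \<le> S"
        using par[of n d w] asm unfolding defs len by (simp add: Let_def)
      have unit: "K * (16 * (k + 1)) * y \<le> S"
      proof -
        have "1 * (K * (16 * (k + 1)) * y) \<le> length xs * (K * (16 * (k + 1)) * y)"
          using len asm by (intro mult_le_mono1) simp
        also have "\<dots> = K * length xs * (16 * (k + 1)) * y" by (simp only: mult_ac)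
        finally have "K * (16 * (k + 1)) * y \<le> K * length xs * (16 * (k + 1)) * y" by (simp only: mult_1)
        then show ?thesis using ps order_trans by blast
      qed
      have facts: "distinct xs" "\<And>x. x \<in> set xs \<Longrightarrow> x \<subseteq> {1..d}" "2 \<le> length xs" using xs asm len by auto
      interpret I: search_inst b1 b2 K K w d xs "length xs" "scale w" "fixpt b1 w" "fixpt b2 w + 1"
        "levels (scale w) (fixpt b2 w + 1) (length xs)" "growth (scale w) (fixpt b1 w) d"
        "yval (scale w) (growth (scale w) (fixpt b1 w) d) (levels (scale w) (fixpt b2 w + 1) (length xs))"
        "16 * (levels (scale w) (fixpt b2 w + 1) (length xs) + 1)"
        "K * length xs * (16 * (levels (scale w) (fixpt b2 w + 1) (length xs) + 1)) *
           yval (scale w) (growth (scale w) (fixpt b1 w) d) (levels (scale w) (fixpt b2 w + 1) (length xs))"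
        by unfold_locales (use ps[unfolded defs] unit[unfolded defs] assms(1-3) K(2) facts in blast)+
      define L where "L = 16 * (k + 1)"
      have Lr: "real L \<le> 16 * (C * lg)" "real y \<le> C * nr" "1 \<le> real y"
        using ps I.y1 by (auto simp: L_def lg_def nr_def defs)
      have Ly: "real L * y \<le> 16 * (C * C) * V"
      proof -
        have "real L * y \<le> (16 * (C * lg)) * (C * nr)" using Lr C lg by (intro mult_mono) auto
        then show ?thesis by (simp add: V_def mult_ac)
      qed
      have LLy: "real L \<le> real L * y" using mult_left_mono[OF Lr(3), of "real L"] by simp
      have CV: "0 \<le> C * C * V" using C V by simp
      have "\<exists>T. let D = run w T (preprocess_start w b1 b2 d xs (preprocessing K K)) in
          (\<forall>c\<in>set_pmf D. halted c \<and> real (ds_size c) \<le> C' * (real n powr (1 + \<rho>) * log 2 (real n) + (\<Sum>x\<in>P. real (card x)))) \<and>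
          (\<forall>q. q \<subseteq> {1..d} \<longrightarrow>
            (let answer = (\<lambda>c. run w (nat \<lfloor>C' * (real (max 1 (card q)) * real n powr \<rho> * log 2 (real n))\<rfloor>) (query_start c q query)) in
              (\<forall>c\<in>set_pmf D. \<forall>c'\<in>set_pmf (answer c).
                 halted c' \<and> (\<forall>a<ds_size c. mem c' a = mem c a)) \<and>
              ((\<exists>x\<in>set xs. braun_blanquet x q \<ge> b1) \<longrightarrow>
                 measure_pmf.prob (bind_pmf D answer) {c'. correct_answer b2 (set xs) q c'} \<ge> 1 / 2)))"
      proof (rule I.solves)
        show "8 * I.cW \<le> real K" "8 * I.cW \<le> real K" using K by (simp_all add: I.cW_def)
        have X: "real (K * length xs * L * y) \<le> 16 * K * (C * C) * (n * V)"
        proof -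
          have "real (K * length xs * L * y) = real K * n * (real L * y)" by (simp add: len)
          also have "\<dots> \<le> real K * n * (16 * (C * C) * V)" using Ly by (intro mult_left_mono) auto
          finally show ?thesis by (simp add: mult_ac)
        qed
        have nV: "1 \<le> n * V" "real n \<le> n * V" using mult_mono[of 1 "real n" 1 V] mult_left_mono[OF V, of "real n"] n2 V by auto
        have "real I.sz \<le> 20 + n + (\<Sum>x\<in>P. real (card x)) + 7 * real (K * length xs * L * y)"
          using I.size_bound xs len by (simp add: L_def defs)
        also have "\<dots> \<le> (21 + 112 * K * (C * C)) * (n * V) + (\<Sum>x\<in>P. real (card x))"
        proof -
          have "(21 + 112 * K * (C * C)) * (n * V) = 21 * (n * V) + 7 * (16 * K * (C * C) * (n * V))" by (simp add: algebra_simps)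
          then show ?thesis using X nV by linarith
        qed
        also have "\<dots> \<le> C' * (n * V) + C' * (\<Sum>x\<in>P. real (card x))"
        proof (intro add_mono mult_right_mono)
          show "21 + 112 * K * (C * C) \<le> C'" using kc by linarith
          have "1 * (\<Sum>x\<in>P. real (card x)) \<le> C' * (\<Sum>x\<in>P. real (card x))"
            by (intro mult_right_mono sum_nonneg C') auto
          then show "(\<Sum>x\<in>P. real (card x)) \<le> C' * (\<Sum>x\<in>P. real (card x))" by simp
        qed (use nV in simp)
        finally show "real I.sz \<le> C' * (real n powr (1 + \<rho>) * log 2 (real n) + (\<Sum>x\<in>P. real (card x)))"
          by (simp add: nr1 V_def lg_def algebra_simps)
      next
        fix q :: "nat set"
        define mx where "mx = real (max 1 (card q))"
        have mx: "1 \<le> mx" "real (card q) \<le> mx" by (auto simp: mx_def)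
        have mV: "1 \<le> mx * V" "real (card q) \<le> mx * V" "0 \<le> V"
          using mult_mono[OF mx(1) V] mult_mono[OF mx(2) V] mx V by auto
        have LM: "real L * y \<le> 16 * (C * C) * (mx * V)"
        proof -
          have "1 * (C * C * V) \<le> mx * (C * C * V)" using mx CV by (intro mult_right_mono)
          then show ?thesis using Ly by (simp add: mult_ac)
        qed
        have LT: "real L * y * (card q + 1) \<le> 32 * (C * C) * (mx * V)"
        proof -
          have "0 \<le> 16 * (C * C) * V" by (rule order_trans[OF _ Ly]) simp
          moreover have "real (card q + 1) \<le> 2 * mx" using mx by simp
          ultimately have "real L * y * (card q + 1) \<le> (16 * (C * C) * V) * (2 * mx)" by (intro mult_mono[OF Ly]) simp_all
          then show ?thesis by (simp add: mult_ac)
        qed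
        have "real (70 + 8 * card q + 5 * L + 50 * (K * L * y * (card q + 1))) =
            70 + 8 * real (card q) + 5 * real L + 50 * (real K * (real L * y * (card q + 1)))"
          by (simp add: algebra_simps)
        also have "\<dots> \<le> 70 * (mx * V) + 8 * (mx * V) + 5 * (16 * (C * C) * (mx * V)) + 50 * (real K * (32 * (C * C) * (mx * V)))"
        proof -
          have "real K * (real L * y * (card q + 1)) \<le> real K * (32 * (C * C) * (mx * V))" by (rule mult_left_mono[OF LT]) simp
          then show ?thesis using mV LM LLy by linarith
        qed
        also have "\<dots> = (78 + (80 + 1600 * real K) * (C * C)) * (mx * V)" by (simp add: algebra_simps)
        also have "\<dots> \<le> C' * (mx * V)" using mV kc by (intro mult_right_mono) linarith+
        finally show "real (70 + 8 * card q + 5 * (16 * (levels (scale w) (fixpt b2 w + 1) (length xs) + 1)) +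
            50 * (K * (16 * (levels (scale w) (fixpt b2 w + 1) (length xs) + 1)) *
              yval (scale w) (growth (scale w) (fixpt b1 w) d) (levels (scale w) (fixpt b2 w + 1) (length xs)) * (card q + 1)))
            \<le> C' * (real (max 1 (card q)) * real n powr \<rho> * log 2 (real n))"
          unfolding L_def defs mx_def V_def nr_def lg_def by (simp only: mult.assoc)
      qed
      then show "\<exists>T. let D = run w T (preprocess_start w b1 b2 d xs (preprocessing K K)) in
          (\<forall>c\<in>set_pmf D. halted c \<and> real (ds_size c) \<le> C' * (real n powr (1 + \<rho>) * log 2 (real n) + (\<Sum>x\<in>P. real (card x)))) \<and>
          (\<forall>q. q \<subseteq> {1..d} \<longrightarrow>
            (let answer = (\<lambda>c. run w (nat \<lfloor>C' * (real (max 1 (card q)) * real n powr \<rho> * log 2 (real n))\<rfloor>) (query_start c q query)) in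
              (\<forall>c\<in>set_pmf D. \<forall>c'\<in>set_pmf (answer c).
                 halted c' \<and> (\<forall>a<ds_size c. mem c' a = mem c a)) \<and>
              ((\<exists>x\<in>P. braun_blanquet x q \<ge> b1) \<longrightarrow>
                 measure_pmf.prob (bind_pmf D answer) {c'. correct_answer b2 P q c'} \<ge> 1 / 2)))"
        using xs by simp
    qed
  qed
qed

end
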